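(* Let $(S,\Pi_S)$ be an embedded Poisson submanifold of a Poisson manifold $(M,\Pi)$ with normal bundle $E=T_SM/TS$. There is a one-to-one correspondence between infinitesimal Poisson algebras $(C^\infty_{\mathrm{aff}}(E)\simeq C^\infty(S)\oplus\Gamma E^*,\cdot,\{,\}^{\mathrm{aff}})$ and Poisson triples $([,]_{E^*},\mathscr D,\mathscr K)$ of $S$, given by the formula $$\{f_1\oplus\eta_1,f_2\oplus\eta_2\}^{\mathrm{aff}}=\{f_1,f_2\}_S\oplus\big(\mathscr D_{\mathrm df_1}\eta_2-\mathscr D_{\mathrm df_2}\eta_1+[\eta_1,\eta_2]_{E^*}+\mathscr K(\mathrm df_1,\mathrm df_2)\big).$$
   Context: **Poisson submanifold.** $\{f,g\}_M=\Pi(\mathrm df,\mathrm dg)$; $\Pi^\natural(\alpha)=\mathbf i_\alpha\Pi$. A submanifold $S$ is Poisson if $\Pi_q\in\wedge^2T_qS$ for all $q\in S$; it then carries the restricted Poisson tensor $\Pi_S$ with bracket $\{,\}_S$. $T_SM=TM|_S$, $T^*_SM=T^*M|_S$; $TS^\circ\subset T^*_SM$ is the annihilator of $TS$. $\pi:E\to S$ is the normal bundle, $\nu:T_SM\to E$ the quotient projection; $\nu^*:E^*\to T_S^*M$ is an isomorphism onto $TS^\circ$. **Infinitesimal data.** The bracket of 1-forms on $M$ is $[\alpha,\beta]_A=\mathbf i_{\Pi^\natural(\alpha)}\mathrm d\beta-\mathbf i_{\Pi^\natural(\beta)}\mathrm d\alpha-\mathrm d\langle\alpha,\Pi^\natural(\beta)\rangle$;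 $[,]_{T^*S}$ denotes the analogous bracket of 1-forms on $(S,\Pi_S)$. The restricted Lie algebroid $A_S=(T^*_SM,[,]_{A_S},\Pi^\natural|_S)$ has the unique bracket for which the restriction map $\Gamma T^*M\to\Gamma T^*_SM$ is a Lie algebra homomorphism; $TS^\circ$ is an ideal with zero anchor. The fiberwise Lie bracket on $E^*$ is defined by $\nu^*[\eta_1,\eta_2]_{E^*}=[\nu^*\eta_1,\nu^*\eta_2]_{A_S}$; $\mathrm{ad}_\eta=[\eta,\cdot]_{E^*}$. **Affine functions.** $C^\infty_{\mathrm{aff}}(E)=\pi^*C^\infty(S)\oplus C^\infty_{\mathrm{lin}}(E)\simeq C^\infty(S)\oplus\Gamma E^*$, where $f\oplus\eta$ corresponds to $\pi^*f+\ell_\eta$, $\ell_\eta(z)=\langle\eta_{\pi(z)},z\rangle$. Its commutative product is $(f_1\oplus\eta_1)\cdot(f_2\oplus\eta_2)=f_1f_2\oplus(f_1\eta_2+f_2\eta_1)$. On $C^\infty_{\mathrm{lin}}(E)$ there is the Lie bracket $\{\ell_{\eta_1},\ell_{\eta_2}\}^{\mathrm{lin}}=\ell_{[\eta_1,\eta_2]_{E^*}}$. **Infinitesimal Poisson algebra.** A Poisson algebra $(C^\infty_{\mathrm{aff}}(E),\cdot,\{,\}^{\mathrm{aff}})$ with the commutative product $(f_1\oplus\eta_1)\cdot(f_2\oplus\eta_2)=f_1f_2\oplus(f_1\eta_2+f_2\eta_1)$ and a Lie bracket (derivation in each argument) such that (a) the natural projection $C^\infty_{\mathrm{aff}}(E)\to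 C^\infty(S)$ is a Poisson algebra homomorphism onto $(C^\infty(S),\{,\}_S)$; (b) $\{0\oplus\varphi_1,0\oplus\varphi_2\}^{\mathrm{aff}}=0\oplus\{\varphi_1,\varphi_2\}^{\mathrm{lin}}$ for all $\varphi_1,\varphi_2\in C^\infty_{\mathrm{lin}}(E)$. **Contravariant derivative.** A contravariant derivative $\mathscr D$ on $E^*$ consists of $\mathbb R$-linear operators $\mathscr D_\alpha:\Gamma E^*\to\Gamma E^*$, $C^\infty(S)$-linear in $\alpha\in\Gamma T^*S$, with $\mathscr D_\alpha(f\eta)=f\mathscr D_\alpha\eta+(\mathrm L_{\Pi_S^\natural(\alpha)}f)\eta$. Its curvature is $\mathrm{Curv}^{\mathscr D}(\alpha_1,\alpha_2)=[\mathscr D_{\alpha_1},\mathscr D_{\alpha_2}]-\mathscr D_{[\alpha_1,\alpha_2]_{T^*S}}$. **Poisson triple.** A triple $([,]_{E^*},\mathscr D,\mathscr K)$ consisting of the fiberwise Lie bracket $[,]_{E^*}$ on $E^*$ defined by $\nu^*[\eta_1,\eta_2]_{E^*}=[\nu^*\eta_1,\nu^*\eta_2]_{A_S}$, a contravariant derivative $\mathscr D$ on $E^*$, and a $C^\infty(S)$-bilinear antisymmetric map $\mathscr K:\Gamma T^*S\times\Gamma T^*S\to\Gamma E^*$, such that for all $\alpha,\beta,\gamma\in\Gamma T^*S$, $\eta\in\Gamma E^*$: $[\mathscr D_\alpha,\mathrm{ad}_\eta]=\mathrm{ad}_{\mathscr D_\alpha\eta}$; $\mathrm{Curv}^{\mathscr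 D}(\alpha,\beta)=\mathrm{ad}_{\mathscr K(\alpha,\beta)}$; and $\mathfrak S_{(\alpha,\beta,\gamma)}\big(\mathscr D_\alpha\mathscr K(\beta,\gamma)+\mathscr K(\alpha,[\beta,\gamma]_{T^*S})\big)=0$, where $\mathfrak S$ is the cyclic sum. *)

theory Defs
  imports "HOL-Analysis.Analysis" "HOL-Library.Function_Algebras"
begin

text \<open>
  Functions, tangent vectors, covectors, sections and operations are total HOL functions that are
  set to zero outside their mathematical domain. With this convention, equality of HOL functions is
  equality of the mathematical objects, and the pointwise operations on function types are the
  vector space operations on functions, on fibres and on spaces of sections.
\<close>

instantiation "fun" :: (type, real_vector) real_vector
begin

definition scaleR_fun :: "real \<Rightarrow> ('a \<Rightarrow> 'b) \<Rightarrow> 'a \<Rightarrow> 'b" where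
  "scaleR_fun c f = (\<lambda>x. c *\<^sub>R f x)"

instance
  by standard (auto simp: scaleR_fun_def plus_fun_def scaleR_add_right scaleR_add_left)

end

definition supported_on :: "'a set \<Rightarrow> ('a \<Rightarrow> 'b::zero) \<Rightarrow> bool" where
  "supported_on A f \<longleftrightarrow> (\<forall>x. x \<notin> A \<longrightarrow> f x = 0)"

definition supported_on2 :: "'a set \<Rightarrow> 'b set \<Rightarrow> ('a \<Rightarrow> 'b \<Rightarrow> 'c::zero) \<Rightarrow> bool" where
  "supported_on2 A B f \<longleftrightarrow> (\<forall>x y. x \<notin> A \<or> y \<notin> B \<longrightarrow> f x y = 0)"

definition restrict0 :: "'a set \<Rightarrow> ('a \<Rightarrow> 'b::zero) \<Rightarrow> 'a \<Rightarrow> 'b" where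
  "restrict0 A f = (\<lambda>x. if x \<in> A then f x else 0)"

definition linear_over :: "'a::real_vector set \<Rightarrow> ('a \<Rightarrow> 'b::real_vector) \<Rightarrow> bool" where
  "linear_over A h \<longleftrightarrow>
     (\<forall>x\<in>A. \<forall>y\<in>A. h (x + y) = h x + h y) \<and> (\<forall>c. \<forall>x\<in>A. h (c *\<^sub>R x) = c *\<^sub>R h x)"

definition bilinear_over ::
  "'a::real_vector set \<Rightarrow> 'b::real_vector set \<Rightarrow> ('a \<Rightarrow> 'b \<Rightarrow> 'c::real_vector) \<Rightarrow> bool" where
  "bilinear_over A A' B \<longleftrightarrow>
     (\<forall>x\<in>A. linear_over A' (B x)) \<and> (\<forall>y\<in>A'. linear_over A (\<lambda>x. B x y))"

definition dual_of :: "'a::real_vector set \<Rightarrow> ('a \<Rightarrow> real) set" where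
  "dual_of A = {h. supported_on A h \<and> linear_over A h}"


section \<open>Smooth manifolds\<close>

text \<open>
  \<open>C\<^sup>k\<close> maps on a relatively open subset \<open>A\<close> of a linear subspace \<open>V\<close>. The derivative within \<open>A\<close>
  is determined only on \<open>V\<close>, so only its values in directions of \<open>V\<close> are constrained.
\<close>

primrec Ck_on :: "nat \<Rightarrow> 'e::euclidean_space set \<Rightarrow> 'e set \<Rightarrow> ('e \<Rightarrow> 'f::real_normed_vector) \<Rightarrow> bool"
where
  "Ck_on 0 V A f \<longleftrightarrow> continuous_on A f"
| "Ck_on (Suc k) V A f \<longleftrightarrow>
     (\<exists>D. (\<forall>x\<in>A. (f has_derivative D x) (at x within A)) \<and> (\<forall>v\<in>V. Ck_on k V A (\<lambda>x. D x v)))"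

definition smooth_on :: "'e::euclidean_space set \<Rightarrow> 'e set \<Rightarrow> ('e \<Rightarrow> 'f::real_normed_vector) \<Rightarrow> bool"
where
  "smooth_on V A f \<longleftrightarrow> (\<forall>k. Ck_on k V A f)"

text \<open>
  Manifolds are modelled on a linear subspace of a Euclidean space rather than on the whole space,
  so that every dimension, including 0, is available for a manifold and for its submanifolds.
  A chart is a pair of its domain and a map whose values outside the domain are irrelevant.
\<close>

type_synonym ('p, 'e) chart = "'p set \<times> ('p \<Rightarrow> 'e)"

record ('p, 'e) smooth_structure =
  top_of :: "'p topology"
  model :: "'e set"
  atlas :: "('p, 'e) chart set"

abbreviation points :: "('p, 'e) smooth_structure \<Rightarrow> 'p set" where
  "points M \<equiv> topspace (top_of M)"

definition is_chart :: "('p, 'e::euclidean_space) smooth_structure \<Rightarrow> ('p, 'e) chart \<Rightarrow> bool" where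
  "is_chart M = (\<lambda>(U, \<phi>).
     openin (top_of M) U \<and>
     openin (top_of_set (model M)) (\<phi> ` U) \<and>
     homeomorphic_map (subtopology (top_of M) U) (top_of_set (\<phi> ` U)) \<phi>)"

definition smooth_transition ::
  "('p, 'e::euclidean_space) smooth_structure \<Rightarrow> ('p, 'e) chart \<Rightarrow> ('p, 'e) chart \<Rightarrow> bool" where
  "smooth_transition M = (\<lambda>(U, \<phi>) (U', \<phi>').
     smooth_on (model M) (\<phi> ` (U \<inter> U')) (\<phi>' \<circ> inv_into U \<phi>))"

definition smooth_manifold :: "('p, 'e::euclidean_space) smooth_structure \<Rightarrow> bool" where
  "smooth_manifold M \<longleftrightarrow>
     subspace (model M) \<and> Hausdorff_space (top_of M) \<and> second_countable (top_of M) \<and>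
     (\<Union>(U, \<phi>)\<in>atlas M. U) = points M \<and>
     (\<forall>c\<in>atlas M. is_chart M c) \<and>
     (\<forall>c\<in>atlas M. \<forall>c'\<in>atlas M. smooth_transition M c c')"

definition maximal_atlas :: "('p, 'e::euclidean_space) smooth_structure \<Rightarrow> ('p, 'e) chart set" where
  "maximal_atlas M =
     {c. is_chart M c \<and> (\<forall>c'\<in>atlas M. smooth_transition M c c' \<and> smooth_transition M c' c)}"

definition smooth_functions :: "('p, 'e::euclidean_space) smooth_structure \<Rightarrow> ('p \<Rightarrow> real) set" where
  "smooth_functions M =
     {f. supported_on (points M) f \<and>
         (\<forall>(U, \<phi>)\<in>atlas M. smooth_on (model M) (\<phi> ` U) (f \<circ> inv_into U \<phi>))}"

definition adapted_charts ::
  "('p, 'e::euclidean_space) smooth_structure \<Rightarrow> 'p set \<Rightarrow> 'e set \<Rightarrow> ('p, 'e) chart set" where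
  "adapted_charts M S W = {(U, \<phi>) \<in> maximal_atlas M. \<phi> ` (U \<inter> S) = \<phi> ` U \<inter> W}"

text \<open>Here \<open>dim W\<close> is the dimension of the submanifold.\<close>

definition embedded_submanifold ::
  "('p, 'e::euclidean_space) smooth_structure \<Rightarrow> 'p set \<Rightarrow> 'e set \<Rightarrow> bool" where
  "embedded_submanifold M S W \<longleftrightarrow>
     S \<subseteq> points M \<and> subspace W \<and> W \<subseteq> model M \<and>
     (\<forall>q\<in>S. \<exists>(U, \<phi>)\<in>adapted_charts M S W. q \<in> U)"

definition submanifold ::
  "('p, 'e::euclidean_space) smooth_structure \<Rightarrow> 'p set \<Rightarrow> 'e set \<Rightarrow> ('p, 'e) smooth_structure" where
  "submanifold M S W =
     \<lparr>top_of = subtopology (top_of M) S, model = W,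
      atlas = (\<lambda>(U, \<phi>). (U \<inter> S, \<phi>)) ` adapted_charts M S W\<rparr>"


section \<open>Tensor fields\<close>

type_synonym 'p tvec = "('p \<Rightarrow> real) \<Rightarrow> real"
type_synonym 'p covec = "'p tvec \<Rightarrow> real"
type_synonym 'p bivec = "'p covec \<Rightarrow> 'p covec \<Rightarrow> real"

text \<open>Tangent vectors are derivations of the algebra of smooth functions at a point.\<close>

definition tangent :: "('p, 'e::euclidean_space) smooth_structure \<Rightarrow> 'p \<Rightarrow> 'p tvec set" where
  "tangent M p =
     {v. supported_on (smooth_functions M) v \<and> linear_over (smooth_functions M) v \<and>
         (\<forall>f\<in>smooth_functions M. \<forall>g\<in>smooth_functions M. v (f * g) = f p * v g + g p * v f)}"

definition cotangent :: "('p, 'e::euclidean_space) smooth_structure \<Rightarrow> 'p \<Rightarrow> 'p covec set" where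
  "cotangent M p = dual_of (tangent M p)"

text \<open>An element of \<open>\<Lambda>\<^sup>2 V\<close> is identified with a skew-symmetric bilinear form on the dual of \<open>V\<close>.\<close>

definition bivectors :: "('p, 'e::euclidean_space) smooth_structure \<Rightarrow> 'p \<Rightarrow> 'p bivec set" where
  "bivectors M p =
     {P. supported_on2 (cotangent M p) (cotangent M p) P \<and>
         bilinear_over (cotangent M p) (cotangent M p) P \<and>
         (\<forall>\<alpha>\<in>cotangent M p. \<forall>\<beta>\<in>cotangent M p. P \<alpha> \<beta> = - P \<beta> \<alpha>)}"

text \<open>A tensor field is smooth iff its contractions with smooth fields are smooth functions.\<close>

definition vector_fields :: "('p, 'e::euclidean_space) smooth_structure \<Rightarrow> ('p \<Rightarrow> 'p tvec) set" where
  "vector_fields M =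
     {X. supported_on (points M) X \<and> (\<forall>p\<in>points M. X p \<in> tangent M p) \<and>
         (\<forall>f\<in>smooth_functions M. (\<lambda>p. X p f) \<in> smooth_functions M)}"

definition one_forms :: "('p, 'e::euclidean_space) smooth_structure \<Rightarrow> ('p \<Rightarrow> 'p covec) set" where
  "one_forms M =
     {\<alpha>. supported_on (points M) \<alpha> \<and> (\<forall>p\<in>points M. \<alpha> p \<in> cotangent M p) \<and>
         (\<forall>X\<in>vector_fields M. (\<lambda>p. \<alpha> p (X p)) \<in> smooth_functions M)}"

definition bivector_fields :: "('p, 'e::euclidean_space) smooth_structure \<Rightarrow> ('p \<Rightarrow> 'p bivec) set"
where
  "bivector_fields M =
     {P. supported_on (points M) P \<and> (\<forall>p\<in>points M. P p \<in> bivectors M p) \<and>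
         (\<forall>\<alpha>\<in>one_forms M. \<forall>\<beta>\<in>one_forms M. (\<lambda>p. P p (\<alpha> p) (\<beta> p)) \<in> smooth_functions M)}"

definition d0 :: "('p, 'e::euclidean_space) smooth_structure \<Rightarrow> ('p \<Rightarrow> real) \<Rightarrow> 'p \<Rightarrow> 'p covec" where
  "d0 M f p v = (if p \<in> points M \<and> v \<in> tangent M p then v f else 0)"

definition commutator :: "('p \<Rightarrow> 'p tvec) \<Rightarrow> ('p \<Rightarrow> 'p tvec) \<Rightarrow> 'p \<Rightarrow> 'p tvec" where
  "commutator X Y p f = X p (\<lambda>q. Y q f) - Y p (\<lambda>q. X q f)"

text \<open>
  The exterior derivative of a 1-form, pointwise, by the invariant formula
  \<open>d\<beta>(X,Y) = X(\<beta>(Y)) - Y(\<beta>(X)) - \<beta>([X,Y])\<close>, the value of which at \<open>p\<close> depends on \<open>X p\<close> and \<open>Y p\<close> only.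
\<close>

definition d1 ::
  "('p, 'e::euclidean_space) smooth_structure \<Rightarrow> ('p \<Rightarrow> 'p covec) \<Rightarrow> 'p \<Rightarrow> 'p tvec \<Rightarrow> 'p tvec \<Rightarrow> real" where
  "d1 M \<beta> p u v =
     (if p \<in> points M \<and> u \<in> tangent M p \<and> v \<in> tangent M p then
        (THE c. \<forall>X\<in>vector_fields M. \<forall>Y\<in>vector_fields M. X p = u \<and> Y p = v \<longrightarrow>
           c = X p (\<lambda>q. \<beta> q (Y q)) - Y p (\<lambda>q. \<beta> q (X q)) - \<beta> p (commutator X Y p))
      else 0)"

definition module_mult :: "('p \<Rightarrow> real) \<Rightarrow> ('p \<Rightarrow> 'b::real_vector) \<Rightarrow> 'p \<Rightarrow> 'b" (infixr "\<bullet>\<^sub>s" 75) where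
  "f \<bullet>\<^sub>s s = (\<lambda>q. f q *\<^sub>R s q)"


section \<open>Lie and Poisson algebras\<close>

definition lie_bracket_on :: "'a::real_vector set \<Rightarrow> ('a \<Rightarrow> 'a \<Rightarrow> 'a) \<Rightarrow> bool" where
  "lie_bracket_on A B \<longleftrightarrow>
     (\<forall>x\<in>A. \<forall>y\<in>A. B x y \<in> A) \<and> bilinear_over A A B \<and>
     (\<forall>x\<in>A. \<forall>y\<in>A. B x y = - B y x) \<and>
     (\<forall>x\<in>A. \<forall>y\<in>A. \<forall>z\<in>A. B x (B y z) + B y (B z x) + B z (B x y) = 0)"

definition poisson_algebra_on :: "'a::real_vector set \<Rightarrow> ('a \<Rightarrow> 'a \<Rightarrow> 'a) \<Rightarrow> ('a \<Rightarrow> 'a \<Rightarrow> 'a) \<Rightarrow> bool" where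
  "poisson_algebra_on A m B \<longleftrightarrow>
     subspace A \<and>
     (\<forall>x\<in>A. \<forall>y\<in>A. m x y \<in> A) \<and> bilinear_over A A m \<and>
     (\<forall>x\<in>A. \<forall>y\<in>A. m x y = m y x) \<and>
     (\<forall>x\<in>A. \<forall>y\<in>A. \<forall>z\<in>A. m (m x y) z = m x (m y z)) \<and>
     lie_bracket_on A B \<and>
     (\<forall>x\<in>A. \<forall>y\<in>A. \<forall>z\<in>A. B x (m y z) = m (B x y) z + m y (B x z)) \<and>
     (\<forall>x\<in>A. \<forall>y\<in>A. \<forall>z\<in>A. B (m x y) z = m (B x z) y + m x (B y z))"

definition poisson_hom_onto ::
  "'a::real_vector set \<Rightarrow> ('a \<Rightarrow> 'a \<Rightarrow> 'a) \<Rightarrow> ('a \<Rightarrow> 'a \<Rightarrow> 'a) \<Rightarrow>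
   'b::real_vector set \<Rightarrow> ('b \<Rightarrow> 'b \<Rightarrow> 'b) \<Rightarrow> ('b \<Rightarrow> 'b \<Rightarrow> 'b) \<Rightarrow> ('a \<Rightarrow> 'b) \<Rightarrow> bool" where
  "poisson_hom_onto A m B A' m' B' h \<longleftrightarrow>
     h ` A = A' \<and> linear_over A h \<and>
     (\<forall>x\<in>A. \<forall>y\<in>A. h (m x y) = m' (h x) (h y)) \<and>
     (\<forall>x\<in>A. \<forall>y\<in>A. h (B x y) = B' (h x) (h y))"


section \<open>Poisson manifolds and Poisson submanifolds\<close>

definition poisson_bracket ::
  "('p, 'e::euclidean_space) smooth_structure \<Rightarrow> ('p \<Rightarrow> 'p bivec) \<Rightarrow> ('p \<Rightarrow> real) \<Rightarrow> ('p \<Rightarrow> real) \<Rightarrow> 'p \<Rightarrow> real"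
where
  "poisson_bracket M P f g = (\<lambda>p. P p (d0 M f p) (d0 M g p))"

definition poisson_manifold ::
  "('p, 'e::euclidean_space) smooth_structure \<Rightarrow> ('p \<Rightarrow> 'p bivec) \<Rightarrow> bool" where
  "poisson_manifold M P \<longleftrightarrow>
     smooth_manifold M \<and> P \<in> bivector_fields M \<and>
     (\<forall>f\<in>smooth_functions M. \<forall>g\<in>smooth_functions M. \<forall>h\<in>smooth_functions M.
        poisson_bracket M P f (poisson_bracket M P g h) +
        poisson_bracket M P g (poisson_bracket M P h f) +
        poisson_bracket M P h (poisson_bracket M P f g) = 0)"

text \<open>
  The contraction of \<open>P p\<close> with a covector, i.e. the tangent vector \<open>v\<close> with \<open>\<beta>(v) = P p \<alpha> \<beta>\<close>.
\<close>

definition sharp ::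
  "('p, 'e::euclidean_space) smooth_structure \<Rightarrow> ('p \<Rightarrow> 'p bivec) \<Rightarrow> 'p \<Rightarrow> 'p covec \<Rightarrow> 'p tvec" where
  "sharp M P p \<alpha> = (\<lambda>f. P p \<alpha> (d0 M f p))"

definition form_bracket ::
  "('p, 'e::euclidean_space) smooth_structure \<Rightarrow> ('p \<Rightarrow> 'p bivec) \<Rightarrow>
   ('p \<Rightarrow> 'p covec) \<Rightarrow> ('p \<Rightarrow> 'p covec) \<Rightarrow> 'p \<Rightarrow> 'p covec" where
  "form_bracket M P \<alpha> \<beta> = (\<lambda>p v.
     d1 M \<beta> p (sharp M P p (\<alpha> p)) v - d1 M \<alpha> p (sharp M P p (\<beta> p)) v
     - d0 M (\<lambda>q. \<alpha> q (sharp M P q (\<beta> q))) p v)"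

text \<open>
  In the following, \<open>M\<close> is the ambient manifold and \<open>N\<close> is a submanifold with its induced structure,
  so that \<open>points N\<close> is the underlying set \<open>S\<close>.
\<close>

definition push ::
  "('p, 'e::euclidean_space) smooth_structure \<Rightarrow> ('p, 'e) smooth_structure \<Rightarrow> 'p tvec \<Rightarrow> 'p tvec" where
  "push M N w = (\<lambda>f. if f \<in> smooth_functions M then w (restrict0 (points N) f) else 0)"

definition pull ::
  "('p, 'e::euclidean_space) smooth_structure \<Rightarrow> ('p, 'e) smooth_structure \<Rightarrow> 'p \<Rightarrow> 'p covec \<Rightarrow> 'p covec" where
  "pull M N q \<alpha> = (\<lambda>w. if w \<in> tangent N q then \<alpha> (push M N w) else 0)"

text \<open>
  \<open>Q \<in> \<Lambda>\<^sup>2 T\<^sub>qS\<close> is mapped to \<open>P \<in> \<Lambda>\<^sup>2 T\<^sub>qM\<close> by the inclusion induced by \<open>T\<^sub>qS \<subseteq> T\<^sub>qM\<close>.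
\<close>

definition bivector_push ::
  "('p, 'e::euclidean_space) smooth_structure \<Rightarrow> ('p, 'e) smooth_structure \<Rightarrow> 'p \<Rightarrow> 'p bivec \<Rightarrow> 'p bivec"
where
  "bivector_push M N q Q = (\<lambda>\<alpha> \<beta>.
     if \<alpha> \<in> cotangent M q \<and> \<beta> \<in> cotangent M q then Q (pull M N q \<alpha>) (pull M N q \<beta>) else 0)"

definition poisson_submanifold ::
  "('p, 'e::euclidean_space) smooth_structure \<Rightarrow> ('p \<Rightarrow> 'p bivec) \<Rightarrow> 'p set \<Rightarrow> 'e set \<Rightarrow> bool" where
  "poisson_submanifold M P S W \<longleftrightarrow>
     embedded_submanifold M S W \<and>
     (\<forall>q\<in>S. P q \<in> bivector_push M (submanifold M S W) q ` bivectors (submanifold M S W) q)"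

definition restricted_bivector ::
  "('p, 'e::euclidean_space) smooth_structure \<Rightarrow> ('p \<Rightarrow> 'p bivec) \<Rightarrow> ('p, 'e) smooth_structure \<Rightarrow>
   'p \<Rightarrow> 'p bivec" where
  "restricted_bivector M P N q =
     (if q \<in> points N then (THE Q. Q \<in> bivectors N q \<and> P q = bivector_push M N q Q) else 0)"


section \<open>The restricted Lie algebroid and the normal bundle\<close>

definition vector_fields_along ::
  "('p, 'e::euclidean_space) smooth_structure \<Rightarrow> ('p, 'e) smooth_structure \<Rightarrow> ('p \<Rightarrow> 'p tvec) set" where
  "vector_fields_along M N =
     {V. supported_on (points N) V \<and> (\<forall>q\<in>points N. V q \<in> tangent M q) \<and>
         (\<forall>f\<in>smooth_functions M. (\<lambda>q. V q f) \<in> smooth_functions N)}"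

definition one_forms_along ::
  "('p, 'e::euclidean_space) smooth_structure \<Rightarrow> ('p, 'e) smooth_structure \<Rightarrow> ('p \<Rightarrow> 'p covec) set" where
  "one_forms_along M N =
     {\<sigma>. supported_on (points N) \<sigma> \<and> (\<forall>q\<in>points N. \<sigma> q \<in> cotangent M q) \<and>
         (\<forall>V\<in>vector_fields_along M N. (\<lambda>q. \<sigma> q (V q)) \<in> smooth_functions N)}"

text \<open>
  The anchor \<open>P\<^sup>\<natural>|\<^sub>S\<close> takes values in \<open>TS\<close>; the following is the value as an element of \<open>T\<^sub>qS\<close>, where
  \<open>T\<^sub>qS\<close> consists of derivations of functions on \<open>S\<close>.
\<close>

definition anchor ::
  "('p, 'e::euclidean_space) smooth_structure \<Rightarrow> ('p \<Rightarrow> 'p bivec) \<Rightarrow> ('p, 'e) smooth_structure \<Rightarrow>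
   'p \<Rightarrow> 'p covec \<Rightarrow> 'p tvec" where
  "anchor M P N q \<alpha> =
     (if q \<in> points N then (THE w. w \<in> tangent N q \<and> push M N w = sharp M P q \<alpha>) else 0)"

text \<open>
  The unique Lie algebroid bracket on \<open>T\<^sup>*\<^sub>SM\<close>, with the anchor above, for which restriction of 1-forms
  to \<open>S\<close> is a Lie algebra homomorphism. Restriction need not be surjective on global sections
  (\<open>S\<close> need not be closed), so the Leibniz rule is needed for uniqueness.
\<close>

definition restricted_bracket ::
  "('p, 'e::euclidean_space) smooth_structure \<Rightarrow> ('p \<Rightarrow> 'p bivec) \<Rightarrow> ('p, 'e) smooth_structure \<Rightarrow>
   ('p \<Rightarrow> 'p covec) \<Rightarrow> ('p \<Rightarrow> 'p covec) \<Rightarrow> 'p \<Rightarrow> 'p covec" where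
  "restricted_bracket M P N =
     (THE B. supported_on2 (one_forms_along M N) (one_forms_along M N) B \<and>
        lie_bracket_on (one_forms_along M N) B \<and>
        (\<forall>\<sigma>\<in>one_forms_along M N. \<forall>\<tau>\<in>one_forms_along M N. \<forall>f\<in>smooth_functions N.
           B \<sigma> (f \<bullet>\<^sub>s \<tau>) = f \<bullet>\<^sub>s B \<sigma> \<tau> + (\<lambda>q. anchor M P N q (\<sigma> q) f) \<bullet>\<^sub>s \<tau>) \<and>
        (\<forall>\<alpha>\<in>one_forms M. \<forall>\<beta>\<in>one_forms M.
           B (restrict0 (points N) \<alpha>) (restrict0 (points N) \<beta>)
             = restrict0 (points N) (form_bracket M P \<alpha> \<beta>)))"

text \<open>The fibre \<open>E\<^sub>q = T\<^sub>qM / T\<^sub>qS\<close> consists of cosets; \<open>nu\<close> is the quotient projection.\<close>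

definition nu ::
  "('p, 'e::euclidean_space) smooth_structure \<Rightarrow> ('p, 'e) smooth_structure \<Rightarrow> 'p \<Rightarrow> 'p tvec \<Rightarrow> 'p tvec set"
where
  "nu M N q v = {v + push M N w | w. w \<in> tangent N q}"

text \<open>
  A functional on \<open>E\<^sub>q\<close> is linear for the quotient vector space structure, i.e. the one that makes
  \<open>nu\<close> linear.
\<close>

definition conormal ::
  "('p, 'e::euclidean_space) smooth_structure \<Rightarrow> ('p, 'e) smooth_structure \<Rightarrow> 'p \<Rightarrow> ('p tvec set \<Rightarrow> real) set"
where
  "conormal M N q =
     {h. supported_on (nu M N q ` tangent M q) h \<and> linear_over (tangent M q) (\<lambda>v. h (nu M N q v))}"

type_synonym 'p consec = "'p \<Rightarrow> 'p tvec set \<Rightarrow> real"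

text \<open>\<open>\<Gamma>E\<^sup>*\<close>; smooth sections of \<open>E\<close> are locally images under \<open>nu\<close> of smooth sections of \<open>T\<^sub>SM\<close>.\<close>

definition conormal_sections ::
  "('p, 'e::euclidean_space) smooth_structure \<Rightarrow> ('p, 'e) smooth_structure \<Rightarrow> 'p consec set" where
  "conormal_sections M N =
     {\<eta>. supported_on (points N) \<eta> \<and> (\<forall>q\<in>points N. \<eta> q \<in> conormal M N q) \<and>
         (\<forall>V\<in>vector_fields_along M N. (\<lambda>q. \<eta> q (nu M N q (V q))) \<in> smooth_functions N)}"

definition nu_dual ::
  "('p, 'e::euclidean_space) smooth_structure \<Rightarrow> ('p, 'e) smooth_structure \<Rightarrow>
   'p consec \<Rightarrow> 'p \<Rightarrow> 'p covec" where
  "nu_dual M N \<eta> = (\<lambda>q v. if v \<in> tangent M q then \<eta> q (nu M N q v) else 0)"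

definition conormal_bracket ::
  "('p, 'e::euclidean_space) smooth_structure \<Rightarrow> ('p \<Rightarrow> 'p bivec) \<Rightarrow> ('p, 'e) smooth_structure \<Rightarrow>
   'p consec \<Rightarrow> 'p consec \<Rightarrow> 'p consec" where
  "conormal_bracket M P N \<eta>\<^sub>1 \<eta>\<^sub>2 =
     (if \<eta>\<^sub>1 \<in> conormal_sections M N \<and> \<eta>\<^sub>2 \<in> conormal_sections M N then
        (THE \<eta>. \<eta> \<in> conormal_sections M N \<and>
           nu_dual M N \<eta> = restricted_bracket M P N (nu_dual M N \<eta>\<^sub>1) (nu_dual M N \<eta>\<^sub>2))
      else 0)"


section \<open>Infinitesimal Poisson algebras\<close>

text \<open>The pair \<open>(f, \<eta>)\<close> stands for \<open>f \<oplus> \<eta>\<close>, that is, for the fibrewise affine function on \<open>E\<close> with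
  value \<open>f q + \<eta> q z\<close> at \<open>z \<in> E\<^sub>q\<close>. The fibrewise linear functions are the pairs \<open>(0, \<eta>)\<close>.\<close>

definition affine_functions ::
  "('p, 'e::euclidean_space) smooth_structure \<Rightarrow> ('p, 'e) smooth_structure \<Rightarrow>
   (('p \<Rightarrow> real) \<times> 'p consec) set" where
  "affine_functions M N = smooth_functions N \<times> conormal_sections M N"

definition affine_mult ::
  "('p \<Rightarrow> real) \<times> 'p consec \<Rightarrow> ('p \<Rightarrow> real) \<times> 'p consec \<Rightarrow> ('p \<Rightarrow> real) \<times> 'p consec" where
  "affine_mult = (\<lambda>(f\<^sub>1, \<eta>\<^sub>1) (f\<^sub>2, \<eta>\<^sub>2). (f\<^sub>1 * f\<^sub>2, f\<^sub>1 \<bullet>\<^sub>s \<eta>\<^sub>2 + f\<^sub>2 \<bullet>\<^sub>s \<eta>\<^sub>1))"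

definition infinitesimal_poisson_algebras ::
  "('p, 'e::euclidean_space) smooth_structure \<Rightarrow> ('p \<Rightarrow> 'p bivec) \<Rightarrow> ('p, 'e) smooth_structure \<Rightarrow>
   (('p \<Rightarrow> real) \<times> 'p consec \<Rightarrow> ('p \<Rightarrow> real) \<times> 'p consec \<Rightarrow> ('p \<Rightarrow> real) \<times> 'p consec) set" where
  "infinitesimal_poisson_algebras M P N =
     {B. supported_on2 (affine_functions M N) (affine_functions M N) B \<and>
         poisson_algebra_on (affine_functions M N) affine_mult B \<and>
         poisson_hom_onto (affine_functions M N) affine_mult B
           (smooth_functions N) (*) (poisson_bracket N (restricted_bivector M P N)) fst \<and>
         (\<forall>\<eta>\<^sub>1\<in>conormal_sections M N. \<forall>\<eta>\<^sub>2\<in>conormal_sections M N.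
            B (0, \<eta>\<^sub>1) (0, \<eta>\<^sub>2) = (0, conormal_bracket M P N \<eta>\<^sub>1 \<eta>\<^sub>2))}"


section \<open>Poisson triples\<close>

definition contravariant_derivative ::
  "('p, 'e::euclidean_space) smooth_structure \<Rightarrow> ('p \<Rightarrow> 'p bivec) \<Rightarrow> ('p, 'e) smooth_structure \<Rightarrow>
   (('p \<Rightarrow> 'p covec) \<Rightarrow> 'p consec \<Rightarrow> 'p consec) \<Rightarrow> bool" where
  "contravariant_derivative M P N D \<longleftrightarrow>
     supported_on2 (one_forms N) (conormal_sections M N) D \<and>
     (\<forall>\<alpha>\<in>one_forms N. \<forall>\<eta>\<in>conormal_sections M N. D \<alpha> \<eta> \<in> conormal_sections M N) \<and>
     (\<forall>\<alpha>\<in>one_forms N. linear_over (conormal_sections M N) (D \<alpha>)) \<and>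
     (\<forall>\<alpha>\<in>one_forms N. \<forall>\<beta>\<in>one_forms N. \<forall>\<eta>\<in>conormal_sections M N.
        D (\<alpha> + \<beta>) \<eta> = D \<alpha> \<eta> + D \<beta> \<eta>) \<and>
     (\<forall>f\<in>smooth_functions N. \<forall>\<alpha>\<in>one_forms N. \<forall>\<eta>\<in>conormal_sections M N.
        D (f \<bullet>\<^sub>s \<alpha>) \<eta> = f \<bullet>\<^sub>s D \<alpha> \<eta>) \<and>
     (\<forall>f\<in>smooth_functions N. \<forall>\<alpha>\<in>one_forms N. \<forall>\<eta>\<in>conormal_sections M N.
        D \<alpha> (f \<bullet>\<^sub>s \<eta>) =
          f \<bullet>\<^sub>s D \<alpha> \<eta> + (\<lambda>q. sharp N (restricted_bivector M P N) q (\<alpha> q) f) \<bullet>\<^sub>s \<eta>)"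

definition curvature ::
  "('p, 'e::euclidean_space) smooth_structure \<Rightarrow> ('p \<Rightarrow> 'p bivec) \<Rightarrow> ('p, 'e) smooth_structure \<Rightarrow>
   (('p \<Rightarrow> 'p covec) \<Rightarrow> 'p consec \<Rightarrow> 'p consec) \<Rightarrow>
   ('p \<Rightarrow> 'p covec) \<Rightarrow> ('p \<Rightarrow> 'p covec) \<Rightarrow> 'p consec \<Rightarrow> 'p consec" where
  "curvature M P N D \<alpha> \<beta> \<eta> =
     D \<alpha> (D \<beta> \<eta>) - D \<beta> (D \<alpha> \<eta>) - D (form_bracket N (restricted_bivector M P N) \<alpha> \<beta>) \<eta>"

definition skew_form_valued ::
  "('p, 'e::euclidean_space) smooth_structure \<Rightarrow> ('p, 'e) smooth_structure \<Rightarrow>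
   (('p \<Rightarrow> 'p covec) \<Rightarrow> ('p \<Rightarrow> 'p covec) \<Rightarrow> 'p consec) \<Rightarrow> bool" where
  "skew_form_valued M N K \<longleftrightarrow>
     supported_on2 (one_forms N) (one_forms N) K \<and>
     (\<forall>\<alpha>\<in>one_forms N. \<forall>\<beta>\<in>one_forms N. K \<alpha> \<beta> \<in> conormal_sections M N \<and> K \<alpha> \<beta> = - K \<beta> \<alpha>) \<and>
     (\<forall>\<alpha>\<in>one_forms N. \<forall>\<beta>\<in>one_forms N. \<forall>\<gamma>\<in>one_forms N.
        K (\<alpha> + \<beta>) \<gamma> = K \<alpha> \<gamma> + K \<beta> \<gamma> \<and> K \<gamma> (\<alpha> + \<beta>) = K \<gamma> \<alpha> + K \<gamma> \<beta>) \<and>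
     (\<forall>f\<in>smooth_functions N. \<forall>\<alpha>\<in>one_forms N. \<forall>\<beta>\<in>one_forms N.
        K (f \<bullet>\<^sub>s \<alpha>) \<beta> = f \<bullet>\<^sub>s K \<alpha> \<beta> \<and> K \<alpha> (f \<bullet>\<^sub>s \<beta>) = f \<bullet>\<^sub>s K \<alpha> \<beta>)"

text \<open>
  The first component \<open>L\<close> of a Poisson triple is the given bracket of \<open>E\<^sup>*\<close>, and \<open>ad \<eta> = L \<eta>\<close>.
\<close>

definition poisson_triples ::
  "('p, 'e::euclidean_space) smooth_structure \<Rightarrow> ('p \<Rightarrow> 'p bivec) \<Rightarrow> ('p, 'e) smooth_structure \<Rightarrow>
   (('p consec \<Rightarrow> 'p consec \<Rightarrow> 'p consec) \<times>
    (('p \<Rightarrow> 'p covec) \<Rightarrow> 'p consec \<Rightarrow> 'p consec) \<times>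
    (('p \<Rightarrow> 'p covec) \<Rightarrow> ('p \<Rightarrow> 'p covec) \<Rightarrow> 'p consec)) set" where
  "poisson_triples M P N =
     {(L, D, K).
        L = conormal_bracket M P N \<and> contravariant_derivative M P N D \<and> skew_form_valued M N K \<and>
        (\<forall>\<alpha>\<in>one_forms N. \<forall>\<eta>\<in>conormal_sections M N. \<forall>\<zeta>\<in>conormal_sections M N.
           D \<alpha> (L \<eta> \<zeta>) - L \<eta> (D \<alpha> \<zeta>) = L (D \<alpha> \<eta>) \<zeta>) \<and>
        (\<forall>\<alpha>\<in>one_forms N. \<forall>\<beta>\<in>one_forms N. \<forall>\<zeta>\<in>conormal_sections M N.
           curvature M P N D \<alpha> \<beta> \<zeta> = L (K \<alpha> \<beta>) \<zeta>) \<and>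
        (\<forall>\<alpha>\<in>one_forms N. \<forall>\<beta>\<in>one_forms N. \<forall>\<gamma>\<in>one_forms N.
           (let br = form_bracket N (restricted_bivector M P N) in
            (D \<alpha> (K \<beta> \<gamma>) + K \<alpha> (br \<beta> \<gamma>)) +
            (D \<beta> (K \<gamma> \<alpha>) + K \<beta> (br \<gamma> \<alpha>)) +
            (D \<gamma> (K \<alpha> \<beta>) + K \<gamma> (br \<alpha> \<beta>)) = 0))}"

definition triple_bracket ::
  "('p, 'e::euclidean_space) smooth_structure \<Rightarrow> ('p \<Rightarrow> 'p bivec) \<Rightarrow> ('p, 'e) smooth_structure \<Rightarrow>
   ('p consec \<Rightarrow> 'p consec \<Rightarrow> 'p consec) \<times>
   (('p \<Rightarrow> 'p covec) \<Rightarrow> 'p consec \<Rightarrow> 'p consec) \<times>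
   (('p \<Rightarrow> 'p covec) \<Rightarrow> ('p \<Rightarrow> 'p covec) \<Rightarrow> 'p consec) \<Rightarrow>
   ('p \<Rightarrow> real) \<times> 'p consec \<Rightarrow> ('p \<Rightarrow> real) \<times> 'p consec \<Rightarrow> ('p \<Rightarrow> real) \<times> 'p consec" where
  "triple_bracket M P N = (\<lambda>(L, D, K) (f\<^sub>1, \<eta>\<^sub>1) (f\<^sub>2, \<eta>\<^sub>2).
     if (f\<^sub>1, \<eta>\<^sub>1) \<in> affine_functions M N \<and> (f\<^sub>2, \<eta>\<^sub>2) \<in> affine_functions M N then
       (poisson_bracket N (restricted_bivector M P N) f\<^sub>1 f\<^sub>2,
        D (d0 N f\<^sub>1) \<eta>\<^sub>2 - D (d0 N f\<^sub>2) \<eta>\<^sub>1 + L \<eta>\<^sub>1 \<eta>\<^sub>2 + K (d0 N f\<^sub>1) (d0 N f\<^sub>2))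
     else 0)"

end

theory Submission
  imports Defs
begin

text \<open>
  The formula for the bracket involves a Poisson triple only through its values on exact forms,
  \<open>D f = \<D>\<^bsub>df\<^esub>\<close> and \<open>K f g = \<K>(df, dg)\<close>. For operators \<open>D\<close>, \<open>K\<close> on functions that are derivations in
  each function, the Leibniz and Jacobi identities of the bracket, evaluated on arguments \<open>f \<oplus> 0\<close> and
  \<open>0 \<oplus> \<eta>\<close>, are equivalent to the axioms of a triple for exact forms. A derivation in \<open>f\<close> factors
  through \<open>df\<close>, so that \<open>D\<close> and \<open>K\<close> extend uniquely to operators that are \<open>C\<^sup>\<infinity>(S)\<close>-linear in 1-forms;
  the defects of the axioms are then \<open>C\<^sup>\<infinity>(S)\<close>-linear as well, and since 1-forms are locally spanned by
  exact ones, they vanish.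

  The existence of the bracket of the restricted algebroid, and its axioms, are obtained without
  choosing extensions of forms from \<open>S\<close> to \<open>M\<close>, from a pointwise Koszul formula and the same
  reduction to exact forms, on which the bracket is \<open>[df, dg] = d{f, g}\<close>.
\<close>

section \<open>Calculus on relatively open subsets of a subspace\<close>

text \<open>Tangent vectors are derivations of global smooth functions, and \<open>d1\<close>,
  \<open>anchor\<close>, \<open>restricted_bivector\<close>, \<open>restricted_bracket\<close> and
  \<open>conormal_bracket\<close> are definite descriptions, so nothing can be computed before
  locality, existence and uniqueness are settled. Locality rests on bump functions; that tangent
  vectors are combinations of coordinate derivatives rests on Hadamard's lemma with smooth
  remainders.

  The obstacle that shapes the work on \<open>S\<close> is that \<open>S\<close> need not be closed
  in \<open>M\<close>: functions on \<open>S\<close> extend to \<open>M\<close> only locally, so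
  arguments are made near one point and transported by the locality of derivations.

  The inclusion of a submanifold is axiomatised in such a way that a manifold also counts as a
  submanifold of itself. Results about forms along \<open>S\<close> therefore also speak of forms on
  \<open>M\<close> and, with the induced bivector, of the bracket of 1-forms on \<open>S\<close>;
  the Lie algebroid identities are proved once for all three.\<close>

lemma orthonormal_basis_expansion:
  fixes V :: "'e::euclidean_space set"
  assumes "subspace V"
  obtains B where "finite B" "B \<subseteq> V" "\<And>b c. b \<in> B \<Longrightarrow> c \<in> B \<Longrightarrow> b \<bullet> c = (if b = c then 1 else 0)"
    "\<And>w. w \<in> V \<Longrightarrow> (\<Sum>b\<in>B. (w \<bullet> b) *\<^sub>R b) = w"
proof -
  obtain B where B: "B \<subseteq> V" "pairwise orthogonal B" "\<And>x. x \<in> B \<Longrightarrow> norm x = 1"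
    "independent B" "span B = V"
    using orthonormal_basis_subspace[OF assms] by metis
  have fin: "finite B"
    using B(4) independent_imp_finite by blast
  have dot: "b \<bullet> c = (if b = c then 1 else 0)" if "b \<in> B" "c \<in> B" for b c
    using that B(2,3) by (auto simp: pairwise_def orthogonal_def dot_square_norm)
  have "(\<Sum>b\<in>B. (w \<bullet> b) *\<^sub>R b) = w" if "w \<in> V" for w
  proof -
    have "w \<in> span B" using that B(5) by simp
    then obtain c where c: "w = (\<Sum>b\<in>B. c b *\<^sub>R b)"
      using fin by (auto simp: span_finite)
    have "w \<bullet> b = c b" if "b \<in> B" for b
    proof -
      have "w \<bullet> b = (\<Sum>a\<in>B. if a = b then c b else 0)"
        unfolding c inner_sum_left using dot that by (intro sum.cong) auto
      then show ?thesis using fin that by simp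
    qed
    then show ?thesis unfolding c by (intro sum.cong) auto
  qed
  with that fin B(1) dot show ?thesis by blast
qed

lemma Ck_on_cong:
  assumes "\<And>x. x \<in> A \<Longrightarrow> f x = g x"
  shows "Ck_on k V A f \<longleftrightarrow> Ck_on k V A g"
proof (cases k)
  case 0
  then show ?thesis using assms continuous_on_cong by (metis Ck_on.simps(1))
next
  case (Suc n)
  have "(f has_derivative D) (at x within A) \<longleftrightarrow> (g has_derivative D) (at x within A)"
    if "x \<in> A" for D x
    using that assms has_derivative_transform by (metis (no_types, lifting))
  then show ?thesis unfolding Suc Ck_on.simps by (auto cong: conj_cong)
qed

lemma smooth_on_cong:
  assumes "\<And>x. x \<in> A \<Longrightarrow> f x = g x"
  shows "smooth_on V A f \<longleftrightarrow> smooth_on V A g"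
  unfolding smooth_on_def by (simp add: Ck_on_cong[OF assms])

lemma Ck_on_subset:
  assumes "Ck_on k V A f" "A' \<subseteq> A" "V' \<subseteq> V"
  shows "Ck_on k V' A' f"
  using assms(1)
proof (induction k arbitrary: f)
  case 0
  then show ?case using assms(2) continuous_on_subset by auto
next
  case (Suc k)
  then obtain D where "\<forall>x\<in>A. (f has_derivative D x) (at x within A)" "\<forall>v\<in>V. Ck_on k V A (\<lambda>x. D x v)"
    by auto
  then have "\<forall>x\<in>A'. (f has_derivative D x) (at x within A')" "\<forall>v\<in>V'. Ck_on k V' A' (\<lambda>x. D x v)"
    using Suc.IH assms(2,3) has_derivative_subset by blast+
  then show ?case by auto
qed

lemma smooth_on_subset:
  assumes "smooth_on V A f" "A' \<subseteq> A" "V' \<subseteq> V"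
  shows "smooth_on V' A' f"
  unfolding smooth_on_def
proof
  show "Ck_on k V' A' f" for k
    by (rule Ck_on_subset[OF _ assms(2,3)]) (use assms(1) in \<open>simp add: smooth_on_def\<close>)
qed

lemma Ck_on_SucD: "Ck_on (Suc k) V A f \<Longrightarrow> Ck_on k V A f"
proof (induction k arbitrary: f)
  case 0
  then show ?case using has_derivative_continuous_on by auto
next
  case (Suc k)
  then obtain D where "\<forall>x\<in>A. (f has_derivative D x) (at x within A)"
    "\<forall>v\<in>V. Ck_on (Suc k) V A (\<lambda>x. D x v)"
    by (metis Ck_on.simps(2))
  then show ?case using Suc.IH by auto
qed

lemma Ck_on_bounded_linear:
  assumes "bounded_linear L" "Ck_on k V A f"
  shows "Ck_on k V A (\<lambda>x. L (f x))"
  using assms(2)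
proof (induction k arbitrary: f)
  case 0
  then show ?case using bounded_linear.continuous_on[OF assms(1)] by auto
next
  case (Suc k)
  then obtain D where "\<forall>x\<in>A. (f has_derivative D x) (at x within A)"
    "\<forall>v\<in>V. Ck_on k V A (\<lambda>x. D x v)" by auto
  then have "\<forall>x\<in>A. ((\<lambda>x. L (f x)) has_derivative (\<lambda>v. L (D x v))) (at x within A)"
    "\<forall>v\<in>V. Ck_on k V A (\<lambda>x. L (D x v))"
    using Suc.IH bounded_linear.has_derivative[OF assms(1)] by blast+
  then show ?case by (auto intro!: exI[of _ "\<lambda>x v. L (D x v)"])
qed

lemma Ck_on_const: "Ck_on k V A (\<lambda>x. c)"
proof (induction k arbitrary: c)
  case (Suc k)
  show ?case using Suc.IH[of 0] by (auto intro!: exI[of _ "\<lambda>x v. 0"])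
qed auto

lemma Ck_on_id: "Ck_on k V A (\<lambda>x. x)"
proof (cases k)
  case (Suc n)
  show ?thesis unfolding Suc using Ck_on_const by (auto intro!: exI[of _ "\<lambda>x v. v"])
qed auto

lemma Ck_on_add:
  "Ck_on k V A f \<Longrightarrow> Ck_on k V A g \<Longrightarrow> Ck_on k V A (\<lambda>x. f x + g x)"
proof (induction k arbitrary: f g)
  case (Suc k)
  obtain D where "\<forall>x\<in>A. (f has_derivative D x) (at x within A)"
    "\<forall>v\<in>V. Ck_on k V A (\<lambda>x. D x v)" using Suc.prems(1) by auto
  moreover obtain D' where "\<forall>x\<in>A. (g has_derivative D' x) (at x within A)"
    "\<forall>v\<in>V. Ck_on k V A (\<lambda>x. D' x v)" using Suc.prems(2) by auto
  ultimately have "\<forall>x\<in>A. ((\<lambda>x. f x + g x) has_derivative (\<lambda>v. D x v + D' x v)) (at x within A)"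
    "\<forall>v\<in>V. Ck_on k V A (\<lambda>x. D x v + D' x v)"
    using Suc.IH has_derivative_add by blast+
  then show ?case by (auto intro!: exI[of _ "\<lambda>x v. D x v + D' x v"])
qed (auto intro: continuous_on_add)

lemma Ck_on_sum:
  "(\<And>i. i \<in> I \<Longrightarrow> Ck_on k V A (f i)) \<Longrightarrow> Ck_on k V A (\<lambda>x. \<Sum>i\<in>I. f i x)"
  by (induction I rule: infinite_finite_induct) (auto simp: Ck_on_const Ck_on_add)

lemma Ck_on_scaleR:
  fixes f :: "'e::euclidean_space \<Rightarrow> real" and g :: "'e \<Rightarrow> 'f::real_normed_vector"
  shows "Ck_on k V A f \<Longrightarrow> Ck_on k V A g \<Longrightarrow> Ck_on k V A (\<lambda>x. f x *\<^sub>R g x)"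
proof (induction k arbitrary: f g)
  case (Suc k)
  obtain D where D: "\<forall>x\<in>A. (f has_derivative D x) (at x within A)"
    "\<forall>v\<in>V. Ck_on k V A (\<lambda>x. D x v)" using Suc.prems(1) by auto
  obtain D' where D': "\<forall>x\<in>A. (g has_derivative D' x) (at x within A)"
    "\<forall>v\<in>V. Ck_on k V A (\<lambda>x. D' x v)" using Suc.prems(2) by auto
  have "\<forall>x\<in>A. ((\<lambda>x. f x *\<^sub>R g x) has_derivative (\<lambda>v. f x *\<^sub>R D' x v + D x v *\<^sub>R g x)) (at x within A)"
    using D D' by (auto intro!: has_derivative_scaleR)
  moreover have "\<forall>v\<in>V. Ck_on k V A (\<lambda>x. f x *\<^sub>R D' x v + D x v *\<^sub>R g x)"
    using D D' Suc.IH Ck_on_SucD[OF Suc.prems(1)] Ck_on_SucD[OF Suc.prems(2)]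
    by (auto intro!: Ck_on_add)
  ultimately show ?case by (auto intro!: exI[of _ "\<lambda>x v. f x *\<^sub>R D' x v + D x v *\<^sub>R g x"])
qed (auto intro: continuous_on_scaleR)

lemma smooth_on_bounded_linear: "bounded_linear L \<Longrightarrow> smooth_on V A f \<Longrightarrow> smooth_on V A (\<lambda>x. L (f x))"
  unfolding smooth_on_def by (simp add: Ck_on_bounded_linear)

lemma smooth_on_const: "smooth_on V A (\<lambda>x. c)"
  unfolding smooth_on_def by (simp add: Ck_on_const)

lemma smooth_on_id: "smooth_on V A (\<lambda>x. x)"
  unfolding smooth_on_def by (simp add: Ck_on_id)

lemma smooth_on_add:
  "smooth_on V A f \<Longrightarrow> smooth_on V A g \<Longrightarrow> smooth_on V A (\<lambda>x. f x + g x)"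
  unfolding smooth_on_def by (simp add: Ck_on_add)

lemma smooth_on_sum:
  "(\<And>i. i \<in> I \<Longrightarrow> smooth_on V A (f i)) \<Longrightarrow> smooth_on V A (\<lambda>x. \<Sum>i\<in>I. f i x)"
  unfolding smooth_on_def by (simp add: Ck_on_sum)

lemma smooth_on_scaleR:
  "smooth_on V A f \<Longrightarrow> smooth_on V A g \<Longrightarrow> smooth_on V A (\<lambda>x. f x *\<^sub>R g x)"
  unfolding smooth_on_def by (simp add: Ck_on_scaleR)

lemma smooth_on_mult:
  fixes f g :: "'e::euclidean_space \<Rightarrow> real"
  shows "smooth_on V A f \<Longrightarrow> smooth_on V A g \<Longrightarrow> smooth_on V A (\<lambda>x. f x * g x)"
  using smooth_on_scaleR[of V A f g] by simp

text \<open>The difference quotients involve only vectors \<open>z - y\<close> of \<open>V\<close>.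
  A derivative within \<open>B\<close> may thus be exchanged for any bounded linear map with the
  same values on \<open>V\<close>, which replaces the non-unique derivatives in \<open>Ck_on\<close>
  by explicit ones.\<close>

lemma has_derivative_cong_on_subspace:
  assumes V: "subspace V" "B \<subseteq> V" "y \<in> B" and D: "(g has_derivative D) (at y within B)"
    and D': "bounded_linear D'" "\<And>w. w \<in> V \<Longrightarrow> D' w = D w"
  shows "(g has_derivative D') (at y within B)"
proof -
  have "((\<lambda>z. (g z - g y - D' (z - y)) /\<^sub>R norm (z - y)) \<longlongrightarrow> 0) (at y within B)"
  proof (rule Lim_transform_within[OF _ zero_less_one])
    show "((\<lambda>z. (g z - g y - D (z - y)) /\<^sub>R norm (z - y)) \<longlongrightarrow> 0) (at y within B)"
      using D by (simp add: has_derivative_at_within)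
    show "(g z - g y - D (z - y)) /\<^sub>R norm (z - y) = (g z - g y - D' (z - y)) /\<^sub>R norm (z - y)"
      if "z \<in> B" for z
    proof -
      have "z - y \<in> V" using subspace_diff[OF V(1)] V(2,3) that by blast
      then show ?thesis using D'(2) by simp
    qed
  qed
  then show ?thesis using D'(1) by (simp add: has_derivative_at_within)
qed

lemma Ck_on_compose:
  fixes f :: "'d::euclidean_space \<Rightarrow> 'e::euclidean_space" and g :: "'e \<Rightarrow> 'f::real_normed_vector"
  assumes "subspace V'" "B \<subseteq> V'" "f ` A \<subseteq> B"
  shows "Ck_on k V A f \<Longrightarrow> Ck_on k V' B g \<Longrightarrow> Ck_on k V A (\<lambda>x. g (f x))"
proof (induction k arbitrary: g)
  case 0
  then show ?case using continuous_on_compose2[of B g A f] assms(3) by simp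
next
  case (Suc k)
  obtain E where E: "finite E" "E \<subseteq> V'" "\<And>w. w \<in> V' \<Longrightarrow> (\<Sum>b\<in>E. (w \<bullet> b) *\<^sub>R b) = w"
    using orthonormal_basis_expansion[OF assms(1)] by metis
  obtain D where D: "\<forall>x\<in>A. (f has_derivative D x) (at x within A)"
    "\<forall>v\<in>V. Ck_on k V A (\<lambda>x. D x v)" using Suc.prems(1) by auto
  obtain D' where D': "\<forall>x\<in>B. (g has_derivative D' x) (at x within B)"
    "\<forall>v\<in>V'. Ck_on k V' B (\<lambda>x. D' x v)" using Suc.prems(2) by auto
  \<comment> \<open>\<open>D x v\<close> need not lie in \<open>V'\<close>, whereas the derivative
    of \<open>g\<close> is known to be \<open>C^k\<close> only in directions of \<open>V'\<close>.
    \<open>G y\<close> is \<open>D' y\<close> after orthogonal projection onto \<open>V'\<close>,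
    hence a sum of products that the induction hypothesis covers.\<close>
  define G where "G y w = (\<Sum>b\<in>E. (w \<bullet> b) *\<^sub>R D' y b)" for y w
  have G: "(g has_derivative G y) (at y within B)" if y: "y \<in> B" for y
  proof -
    interpret L: bounded_linear "D' y" using D'(1) y has_derivative_bounded_linear by blast
    show ?thesis
    proof (rule has_derivative_cong_on_subspace[OF assms(1,2) y])
      show "(g has_derivative D' y) (at y within B)" using D'(1) y by blast
      show "bounded_linear (G y)"
        unfolding G_def by (intro bounded_linear_sum bounded_linear_scaleR_const bounded_linear_inner_left)
      show "G y w = D' y w" if "w \<in> V'" for w
      proof -
        have "D' y w = D' y (\<Sum>b\<in>E. (w \<bullet> b) *\<^sub>R b)" using E(3) that by simp
        then show ?thesis unfolding G_def by (simp add: L.sum L.scaleR)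
      qed
    qed
  qed
  have "\<forall>x\<in>A. ((\<lambda>x. g (f x)) has_derivative (\<lambda>v. G (f x) (D x v))) (at x within A)"
  proof
    fix x assume x: "x \<in> A"
    show "((\<lambda>x. g (f x)) has_derivative (\<lambda>v. G (f x) (D x v))) (at x within A)"
      by (rule has_derivative_in_compose2[of B g G f A]) (use G D(1) assms(3) x in auto)
  qed
  moreover have "Ck_on k V A (\<lambda>x. G (f x) (D x v))" if "v \<in> V" for v
    unfolding G_def
  proof (intro Ck_on_sum Ck_on_scaleR)
    fix b assume b: "b \<in> E"
    show "Ck_on k V A (\<lambda>x. D x v \<bullet> b)"
      by (rule Ck_on_bounded_linear[OF bounded_linear_inner_left]) (use D(2) that in simp)
    show "Ck_on k V A (\<lambda>x. D' (f x) b)"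
      by (rule Suc.IH[OF Ck_on_SucD[OF Suc.prems(1)]]) (use D'(2) b E(2) in auto)
  qed
  ultimately show ?case by (auto intro!: exI[of _ "\<lambda>x v. G (f x) (D x v)"])
qed

lemma smooth_on_compose:
  fixes f :: "'d::euclidean_space \<Rightarrow> 'e::euclidean_space"
  assumes "subspace V'" "B \<subseteq> V'" "f ` A \<subseteq> B" "smooth_on V A f" "smooth_on V' B g"
  shows "smooth_on V A (\<lambda>x. g (f x))"
  using assms(4,5) unfolding smooth_on_def by (simp add: Ck_on_compose[OF assms(1-3)])

text \<open>The witnesses \<open>D\<close> in \<open>Ck_on\<close> may differ with the order
  \<open>k\<close>. This choice is fixed by \<open>f\<close> alone, so that smoothness of all orders
  refers to the same derivative.\<close>

definition dir_deriv :: "('e::euclidean_space \<Rightarrow> 'f::real_normed_vector) \<Rightarrow> 'e \<Rightarrow> 'e \<Rightarrow> 'f" where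
  "dir_deriv f v x = vector_derivative (\<lambda>t. f (x + t *\<^sub>R v)) (at 0)"

lemma has_vector_derivative_dir:
  assumes V: "subspace V" and A: "openin (top_of_set V) A" and x: "x \<in> A" and v: "v \<in> V"
    and D: "(f has_derivative D) (at x within A)"
  shows "((\<lambda>t. f (x + t *\<^sub>R v)) has_vector_derivative D v) (at 0)"
proof -
  obtain T where T: "open T" "A = V \<inter> T" using A by (auto simp: openin_open)
  \<comment> \<open>Since \<open>A\<close> is relatively open in \<open>V\<close> and
    \<open>v\<close> lies in \<open>V\<close>, the line through \<open>x\<close> in direction
    \<open>v\<close> stays in \<open>A\<close> for small times.\<close>
  define I where "I = (\<lambda>t::real. x + t *\<^sub>R v) -` T"
  have I: "open I" "0 \<in> I"
    unfolding I_def using T x by (auto intro!: continuous_open_vimage continuous_intros)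
  have "(\<lambda>t. x + t *\<^sub>R v) ` I \<subseteq> A"
    using T x v V by (auto simp: I_def intro!: subspace_add subspace_scale)
  then have "(f has_derivative D) (at (x + 0 *\<^sub>R v) within (\<lambda>t. x + t *\<^sub>R v) ` I)"
    using D has_derivative_subset by force
  moreover have "((\<lambda>t. x + t *\<^sub>R v) has_derivative (\<lambda>t. t *\<^sub>R v)) (at 0 within I)"
    by (auto intro!: derivative_eq_intros)
  ultimately have "((\<lambda>t. f (x + t *\<^sub>R v)) has_derivative (\<lambda>t. D (t *\<^sub>R v))) (at 0 within I)"
    by (rule has_derivative_in_compose[rotated])
  moreover have "D (t *\<^sub>R v) = t *\<^sub>R D v" for t
    by (rule linear_scale[OF bounded_linear.linear[OF has_derivative_bounded_linear[OF D]]])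
  moreover have "at 0 within I = at 0" using I at_within_open by blast
  ultimately show ?thesis by (simp only: has_vector_derivative_def)
qed

lemma dir_deriv_eq:
  assumes "subspace V" "openin (top_of_set V) A" "x \<in> A" "v \<in> V"
    "(f has_derivative D) (at x within A)"
  shows "dir_deriv f v x = D v"
  unfolding dir_deriv_def by (rule vector_derivative_at[OF has_vector_derivative_dir[OF assms]])

lemma Ck_on_Suc_iff:
  assumes "subspace V" "openin (top_of_set V) A"
  shows "Ck_on (Suc k) V A f \<longleftrightarrow>
    (\<forall>x\<in>A. \<exists>D. (f has_derivative D) (at x within A)) \<and> (\<forall>v\<in>V. Ck_on k V A (dir_deriv f v))"
    (is "?L \<longleftrightarrow> ?R")
proof
  assume ?L
  then obtain D where D: "\<forall>x\<in>A. (f has_derivative D x) (at x within A)"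
    "\<forall>v\<in>V. Ck_on k V A (\<lambda>x. D x v)" by auto
  have "Ck_on k V A (dir_deriv f v)" if "v \<in> V" for v
    using D that dir_deriv_eq[OF assms] Ck_on_cong[of A "dir_deriv f v" "\<lambda>x. D x v" k V] by blast
  then show ?R using D by blast
next
  assume R: ?R
  then obtain D where D: "\<forall>x\<in>A. (f has_derivative D x) (at x within A)" by metis
  have "Ck_on k V A (\<lambda>x. D x v)" if "v \<in> V" for v
    using D that dir_deriv_eq[OF assms] Ck_on_cong[of A "dir_deriv f v" "\<lambda>x. D x v" k V] R by blast
  then show ?L using D by auto
qed

lemma smooth_on_dir_deriv:
  assumes "subspace V" "openin (top_of_set V) A" "smooth_on V A f" "v \<in> V"
  shows "smooth_on V A (dir_deriv f v)"
  using assms(3,4) Ck_on_Suc_iff[OF assms(1,2)] unfolding smooth_on_def by blast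

lemma smooth_on_has_derivative:
  assumes "smooth_on V A f"
  obtains D where "\<And>x. x \<in> A \<Longrightarrow> (f has_derivative D x) (at x within A)"
proof -
  have "Ck_on (Suc 0) V A f" using assms unfolding smooth_on_def by blast
  then show thesis using that by auto
qed

lemma smooth_on_imp_continuous_on:
  assumes "smooth_on V A f"
  shows "continuous_on A f"
proof -
  have "Ck_on 0 V A f" using assms unfolding smooth_on_def by blast
  then show ?thesis by simp
qed

lemma smooth_on_dir_has_vector_derivative:
  assumes "subspace V" "openin (top_of_set V) A" "x \<in> A" "v \<in> V" "smooth_on V A f"
  shows "((\<lambda>t. f (x + t *\<^sub>R v)) has_vector_derivative dir_deriv f v x) (at 0)"
proof -
  obtain D where D: "(f has_derivative D) (at x within A)"
    using smooth_on_has_derivative[OF assms(5)] assms(3) by metis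
  show ?thesis
    using has_vector_derivative_dir[OF assms(1-4) D] dir_deriv_eq[OF assms(1-4) D] by simp
qed

text \<open>Derivatives chosen on different neighbourhoods fit together because all of them compute
  the one function \<open>dir_deriv f v\<close>, to which the induction hypothesis applies.\<close>

lemma Ck_on_locally:
  assumes V: "subspace V"
  shows "openin (top_of_set V) A \<Longrightarrow>
    (\<And>x. x \<in> A \<Longrightarrow> \<exists>T. open T \<and> x \<in> T \<and> Ck_on k V (A \<inter> T) f) \<Longrightarrow> Ck_on k V A f"
proof (induction k arbitrary: f)
  case 0
  have "continuous (at x within A) f" if x: "x \<in> A" for x
  proof -
    obtain T where T: "open T" "x \<in> T" "continuous_on (A \<inter> T) f"
      using 0(2)[OF x] by auto
    then have "continuous (at x within A \<inter> T) f"
      using x by (auto simp: continuous_on_eq_continuous_within)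
    moreover have "at x within A \<inter> T = at x within A"
      using at_within_nhd[of x T "A \<inter> T" A] T by auto
    ultimately show ?thesis by (simp add: continuous_within)
  qed
  then show ?case by (simp add: continuous_on_eq_continuous_within)
next
  case (Suc k)
  have "\<exists>D. (f has_derivative D) (at x within A)" if x: "x \<in> A" for x
  proof -
    obtain T where T: "open T" "x \<in> T" "Ck_on (Suc k) V (A \<inter> T) f"
      using Suc.prems(2)[OF x] by auto
    moreover have "at x within A \<inter> T = at x within A"
      using at_within_nhd[of x T "A \<inter> T" A] T by auto
    ultimately show ?thesis using x by auto (metis IntI)
  qed
  moreover have "Ck_on k V A (dir_deriv f v)" if v: "v \<in> V" for v
  proof (rule Suc.IH)
    show "openin (top_of_set V) A" by fact
    fix x assume x: "x \<in> A"
    then obtain T where T: "open T" "x \<in> T" "Ck_on (Suc k) V (A \<inter> T) f"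
      using Suc.prems(2)[OF x] by auto
    moreover have "openin (top_of_set V) (A \<inter> T)"
      using Suc.prems(1) T(1) by (auto simp: openin_open)
    ultimately show "\<exists>T. open T \<and> x \<in> T \<and> Ck_on k V (A \<inter> T) (dir_deriv f v)"
      using Ck_on_Suc_iff[OF V] v by blast
  qed
  ultimately show ?case using Ck_on_Suc_iff[OF V Suc.prems(1)] by blast
qed

lemma smooth_on_locally:
  assumes "subspace V" "openin (top_of_set V) A"
    "\<And>x. x \<in> A \<Longrightarrow> \<exists>T. open T \<and> x \<in> T \<and> smooth_on V (A \<inter> T) f"
  shows "smooth_on V A f"
  unfolding smooth_on_def
proof
  fix k
  show "Ck_on k V A f"
  proof (rule Ck_on_locally[OF assms(1,2)])
    fix x assume "x \<in> A"
    then show "\<exists>T. open T \<and> x \<in> T \<and> Ck_on k V (A \<inter> T) f"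
      using assms(3)[of x] unfolding smooth_on_def by auto
  qed
qed

text \<open>The derivative is determined on \<open>V\<close> only; it is normalised by projecting
  every direction to \<open>V\<close> first, which yields a formula in smooth coefficients.\<close>

lemma smooth_on_has_derivative_expansion:
  assumes V: "subspace V" "openin (top_of_set V) C" "x \<in> C" "smooth_on V C H"
    and E: "finite E" "E \<subseteq> V" "\<And>w. w \<in> V \<Longrightarrow> (\<Sum>b\<in>E. (w \<bullet> b) *\<^sub>R b) = w"
  shows "(H has_derivative (\<lambda>w. \<Sum>b\<in>E. (w \<bullet> b) *\<^sub>R dir_deriv H b x)) (at x within C)"
proof -
  obtain D where D: "(H has_derivative D) (at x within C)"
    using smooth_on_has_derivative[OF V(4)] V(3) by metis
  interpret L: bounded_linear D using D has_derivative_bounded_linear by blast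
  show ?thesis
  proof (rule has_derivative_cong_on_subspace[OF V(1) openin_imp_subset[OF V(2)] V(3) D])
    show "bounded_linear (\<lambda>w. \<Sum>b\<in>E. (w \<bullet> b) *\<^sub>R dir_deriv H b x)"
      by (intro bounded_linear_sum bounded_linear_scaleR_const bounded_linear_inner_left)
    fix w assume "w \<in> V"
    then have "D w = D (\<Sum>b\<in>E. (w \<bullet> b) *\<^sub>R b)" using E(3) by simp
    also have "\<dots> = (\<Sum>b\<in>E. (w \<bullet> b) *\<^sub>R dir_deriv H b x)"
      using dir_deriv_eq[OF V(1-3) _ D] E(2) by (auto simp: L.sum L.scaleR intro!: sum.cong)
    finally show "(\<Sum>b\<in>E. (w \<bullet> b) *\<^sub>R dir_deriv H b x) = D w" by simp
  qed
qed

section \<open>Hadamard's lemma\<close>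

lemma radial_segment_in_convex:
  fixes y0 :: "'e::real_vector"
  assumes "convex C" "y0 \<in> C" "x \<in> C" "0 \<le> t" "t \<le> 1"
  shows "y0 + t *\<^sub>R (x - y0) \<in> C"
proof -
  have "(1 - t) *\<^sub>R y0 + t *\<^sub>R x \<in> C" using convexD_alt[OF assms] .
  then show ?thesis by (simp add: algebra_simps)
qed

text \<open>Differentiation under the integral: the chain rule for \<open>y0 + t (y - y0)\<close>
  produces one more factor \<open>t\<close>, so the induction on \<open>k\<close> has to allow an
  arbitrary weight \<open>t ^ j\<close>.\<close>

lemma Ck_on_radial_integral:
  fixes H :: "'e::euclidean_space \<Rightarrow> real"
  assumes V: "subspace V" "openin (top_of_set V) C" "convex C" "y0 \<in> C"
  shows "smooth_on V C H \<Longrightarrow>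
    Ck_on k V C (\<lambda>y. integral {0..1} (\<lambda>t. t ^ j * H (y0 + t *\<^sub>R (y - y0))))"
proof (induction k arbitrary: H j)
  case 0
  have "continuous_on (C \<times> cbox 0 1) (\<lambda>(x, t). t ^ j * H (y0 + t *\<^sub>R (x - y0)))"
    unfolding case_prod_beta
    by (intro continuous_intros continuous_on_compose2[OF smooth_on_imp_continuous_on[OF 0]])
      (auto intro!: radial_segment_in_convex[OF V(3,4)])
  then show ?case
    using integral_continuous_on_param[of C 0 1 "\<lambda>x t. t ^ j * H (y0 + t *\<^sub>R (x - y0))"] by simp
next
  case (Suc k)
  obtain E where E: "finite E" "E \<subseteq> V" "\<And>w. w \<in> V \<Longrightarrow> (\<Sum>b\<in>E. (w \<bullet> b) *\<^sub>R b) = w"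
    using orthonormal_basis_expansion[OF V(1)] by metis
  \<comment> \<open>The derivative of the integrand in \<open>x\<close>, as an element of the space
    of bounded linear maps, which is the form that the Leibniz rule for parameter integrals asks
    for.\<close>
  define d where "d x t = (\<Sum>b\<in>E. (t ^ Suc j * dir_deriv H b (y0 + t *\<^sub>R (x - y0))) *\<^sub>R blinfun_inner_left b)"
    for x t
  have d_apply: "d x t w = t ^ Suc j * (\<Sum>b\<in>E. (w \<bullet> b) * dir_deriv H b (y0 + t *\<^sub>R (x - y0)))" for x t w
    unfolding d_def by (simp add: blinfun.sum_left blinfun.scaleR_left sum_distrib_left algebra_simps)
  have cont_d: "continuous_on (C \<times> cbox 0 1) (\<lambda>(x, t). d x t)"
    unfolding d_def case_prod_beta
  proof (intro continuous_intros)
    fix b assume "b \<in> E"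
    then have "continuous_on C (dir_deriv H b)"
      using smooth_on_imp_continuous_on smooth_on_dir_deriv[OF V(1,2) Suc.prems] E(2) by blast
    then show "continuous_on (C \<times> cbox 0 1) (\<lambda>x. dir_deriv H b (y0 + snd x *\<^sub>R (fst x - y0)))"
      by (rule continuous_on_compose2)
        (auto intro!: continuous_intros radial_segment_in_convex[OF V(3,4)])
  qed
  have deriv: "((\<lambda>y. integral (cbox 0 1) (\<lambda>t. t ^ j * H (y0 + t *\<^sub>R (y - y0)))) has_derivative
    blinfun_apply (integral (cbox 0 1) (d x))) (at x within C)" if x: "x \<in> C" for x
  proof (rule leibniz_rule[OF _ _ cont_d x V(3)])
    fix x and t :: real assume xt: "x \<in> C" "t \<in> cbox 0 1"
    have in_C: "(\<lambda>x. y0 + t *\<^sub>R (x - y0)) ` C \<subseteq> C"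
      using xt by (auto intro!: radial_segment_in_convex[OF V(3,4)])
    have "((\<lambda>x. H (y0 + t *\<^sub>R (x - y0))) has_derivative
        (\<lambda>w. \<Sum>b\<in>E. ((t *\<^sub>R w) \<bullet> b) *\<^sub>R dir_deriv H b (y0 + t *\<^sub>R (x - y0)))) (at x within C)"
      by (rule has_derivative_in_compose2[OF
            smooth_on_has_derivative_expansion[OF V(1,2) _ Suc.prems E] in_C xt(1)])
        (auto intro!: derivative_eq_intros)
    then have "((\<lambda>x. t ^ j * H (y0 + t *\<^sub>R (x - y0))) has_derivative
        (\<lambda>w. t ^ j * (\<Sum>b\<in>E. ((t *\<^sub>R w) \<bullet> b) *\<^sub>R dir_deriv H b (y0 + t *\<^sub>R (x - y0))))) (at x within C)"
      by (rule has_derivative_mult_right)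
    moreover have "(\<lambda>w. t ^ j * (\<Sum>b\<in>E. ((t *\<^sub>R w) \<bullet> b) *\<^sub>R dir_deriv H b (y0 + t *\<^sub>R (x - y0)))) = d x t"
      by (auto simp: d_apply sum_distrib_left algebra_simps intro!: sum.cong)
    ultimately show "((\<lambda>x. t ^ j * H (y0 + t *\<^sub>R (x - y0))) has_derivative d x t) (at x within C)"
      by simp
  next
    fix x assume x: "x \<in> C"
    have "continuous_on (cbox 0 1) (\<lambda>t. t ^ j * H (y0 + t *\<^sub>R (x - y0)))"
      by (intro continuous_intros continuous_on_compose2[OF smooth_on_imp_continuous_on[OF Suc.prems]])
        (auto intro!: radial_segment_in_convex[OF V(3,4)] x)
    then show "(\<lambda>t. t ^ j * H (y0 + t *\<^sub>R (x - y0))) integrable_on cbox 0 1"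
      by (rule integrable_continuous)
  qed
  have "Ck_on k V C (\<lambda>x. integral (cbox 0 1) (d x) v)" if v: "v \<in> V" for v
  proof -
    let ?H = "\<lambda>z. \<Sum>b\<in>E. (v \<bullet> b) * dir_deriv H b z"
    have "smooth_on V C ?H"
      using smooth_on_dir_deriv[OF V(1,2) Suc.prems] E(2)
      by (intro smooth_on_sum smooth_on_mult smooth_on_const) auto
    then have *: "Ck_on k V C (\<lambda>y. integral {0..1} (\<lambda>t. t ^ Suc j * ?H (y0 + t *\<^sub>R (y - y0))))"
      by (rule Suc.IH)
    have "integral (cbox 0 1) (d x) v = integral {0..1} (\<lambda>t. t ^ Suc j * ?H (y0 + t *\<^sub>R (x - y0)))"
      if x: "x \<in> C" for x
    proof -
      have "continuous_on (cbox 0 1) (\<lambda>t. (\<lambda>(x, t). d x t) (x, t))"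
        by (rule continuous_on_compose2[OF cont_d]) (auto intro!: continuous_intros x)
      then have "d x integrable_on cbox 0 1"
        by (intro integrable_continuous) simp
      from integral_linear[OF this blinfun.bounded_linear_left[of v]]
      show ?thesis by (simp add: o_def d_apply)
    qed
    then show ?thesis using Ck_on_cong[of C _ _ k V] * by (metis (no_types, lifting))
  qed
  then show ?case using deriv by (auto intro!: exI[of _ "\<lambda>x. blinfun_apply (integral {0..1} (d x))"])
qed

text \<open>Integrate the derivative of \<open>H\<close> along the segment from \<open>y0\<close> to
  \<open>y\<close>: the factors \<open>(y - y0) \<bullet> b\<close> leave the integral, and what
  remains is \<open>G b y\<close>. At \<open>y = y0\<close> the integrand is constant, which gives
  the value of \<open>G b\<close> there.\<close>

lemma hadamard:
  fixes H :: "'e::euclidean_space \<Rightarrow> real"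
  assumes V: "subspace V" "openin (top_of_set V) C" "convex C" "y0 \<in> C" "smooth_on V C H"
    and E: "finite E" "E \<subseteq> V" "\<And>w. w \<in> V \<Longrightarrow> (\<Sum>b\<in>E. (w \<bullet> b) *\<^sub>R b) = w"
  obtains G where "\<And>b. b \<in> E \<Longrightarrow> smooth_on V C (G b)" "\<And>b. b \<in> E \<Longrightarrow> G b y0 = dir_deriv H b y0"
    "\<And>y. y \<in> C \<Longrightarrow> H y = H y0 + (\<Sum>b\<in>E. ((y - y0) \<bullet> b) * G b y)"
proof -
  \<comment> \<open>The factor \<open>t ^ 0\<close> matches the weighted integrals of
    \<open>Ck_on_radial_integral\<close>.\<close>
  define G where "G b y = integral {0..1} (\<lambda>t::real. t ^ 0 * dir_deriv H b (y0 + t *\<^sub>R (y - y0)))" for b y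
  have sm: "smooth_on V C (dir_deriv H b)" if "b \<in> E" for b
    using smooth_on_dir_deriv[OF V(1,2,5)] E(2) that by blast
  show thesis
  proof
    show "smooth_on V C (G b)" if "b \<in> E" for b
      using Ck_on_radial_integral[OF V(1-4) sm[OF that]] unfolding smooth_on_def G_def by blast
    show "G b y0 = dir_deriv H b y0" for b unfolding G_def by simp
    fix y assume y: "y \<in> C"
    let ?c = "\<lambda>t::real. y0 + t *\<^sub>R (y - y0)"
    have in_C: "?c ` {0..1} \<subseteq> C" using radial_segment_in_convex[OF V(3,4) y] by auto
    have "((\<lambda>t. H (?c t)) has_vector_derivative (\<Sum>b\<in>E. ((y - y0) \<bullet> b) * dir_deriv H b (?c t)))
        (at t within {0..1})" if t: "t \<in> {0..1}" for t
    proof -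
      have "((\<lambda>t. H (?c t)) has_derivative
          (\<lambda>s. \<Sum>b\<in>E. ((s *\<^sub>R (y - y0)) \<bullet> b) *\<^sub>R dir_deriv H b (?c t))) (at t within {0..1})"
        by (rule has_derivative_in_compose2[OF
              smooth_on_has_derivative_expansion[OF V(1,2) _ V(5) E] in_C t])
          (auto intro!: derivative_eq_intros)
      then show ?thesis
        by (simp add: has_vector_derivative_def sum_distrib_left mult.assoc)
    qed
    then have "((\<lambda>t. \<Sum>b\<in>E. ((y - y0) \<bullet> b) * dir_deriv H b (?c t)) has_integral H (?c 1) - H (?c 0)) {0..1}"
      by (intro fundamental_theorem_of_calculus) auto
    then have "integral {0..1} (\<lambda>t. \<Sum>b\<in>E. ((y - y0) \<bullet> b) * dir_deriv H b (?c t)) = H y - H y0"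
      by (simp add: integral_unique)
    moreover have "integral {0..1} (\<lambda>t. \<Sum>b\<in>E. ((y - y0) \<bullet> b) * dir_deriv H b (?c t))
        = (\<Sum>b\<in>E. ((y - y0) \<bullet> b) * G b y)"
    proof -
      have "(\<lambda>t. dir_deriv H b (?c t)) integrable_on {0..1}" if "b \<in> E" for b
      proof (rule integrable_continuous_interval)
        show "continuous_on {0..1} (\<lambda>t. dir_deriv H b (?c t))"
          by (rule continuous_on_compose2[OF smooth_on_imp_continuous_on[OF sm[OF that]] _ in_C])
            (intro continuous_intros)
      qed
      then show ?thesis
        unfolding G_def using E(1) by (simp add: integral_sum integrable_on_mult_right)
    qed
    ultimately show "H y = H y0 + (\<Sum>b\<in>E. ((y - y0) \<bullet> b) * G b y)" by simp
  qed
qed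

section \<open>Bump functions\<close>

text \<open>The family is closed under differentiation up to linear combinations, so the smoothness
  of \<open>exp (- 1 / t)\<close>, extended by zero, becomes an induction that never meets explicit
  higher derivatives.\<close>

definition flat :: "nat \<Rightarrow> real \<Rightarrow> real" where
  "flat n t = (if t > 0 then exp (- (1 / t)) / t ^ n else 0)"

text \<open>A single term of the exponential series, of order \<open>n + 2\<close>, bounds
  \<open>exp (1 / t)\<close> from below. Two powers more than \<open>n\<close> leave
  \<open>t ^ 2\<close>, enough for the difference quotient at 0 to vanish.\<close>

lemma flat_bound: "\<bar>flat n t\<bar> \<le> fact (n + 2) * t ^ 2"
proof (cases "t > 0")
  case True
  have "(1 / t) ^ (n + 2) / fact (n + 2) \<le> exp (1 / t)"
  proof -
    have "(\<lambda>i. (1 / t) ^ i /\<^sub>R fact i) sums exp (1 / t)" by (rule exp_converges)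
    then have "(\<Sum>i\<in>{n + 2}. (1 / t) ^ i /\<^sub>R fact i) \<le> exp (1 / t)"
      unfolding sums_iff using True by (metis (no_types, lifting) sum_le_suminf finite.intros
          scaleR_nonneg_nonneg inverse_nonnegative_iff_nonnegative fact_ge_zero zero_le_power
          less_imp_le zero_less_divide_1_iff)
    then show ?thesis by (simp add: divide_inverse mult.commute)
  qed
  then have "t ^ 2 * ((1 / t) ^ (n + 2) / exp (1 / t)) \<le> t ^ 2 * fact (n + 2)"
    by (intro mult_left_mono)
      (simp_all add: pos_divide_le_eq[of "exp _"] pos_divide_le_eq[of "fact _"] mult.commute
        del: fact_Suc power_Suc add_2_eq_Suc')
  moreover have "exp (- (1 / t)) / t ^ n = t ^ 2 * ((1 / t) ^ (n + 2) / exp (1 / t))"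
    using True by (simp add: exp_minus field_simps power_add power2_eq_square)
  ultimately have "exp (- (1 / t)) / t ^ n \<le> fact (n + 2) * t ^ 2"
    by (simp add: mult.commute del: fact_Suc)
  then show ?thesis using True by (simp add: flat_def)
qed (simp add: flat_def)

lemma has_field_derivative_power:
  fixes x :: real
  assumes "x > 0"
  shows "((\<lambda>x. x ^ n) has_field_derivative real n * x ^ n / x) (at x)"
  using DERIV_pow[of n x] assms by (cases n) auto

lemma flat_has_derivative:
  "(flat n has_field_derivative flat (n + 2) t - real n * flat (n + 1) t) (at t)"
proof -
  consider "t > 0" | "t < 0" | "t = 0" by linarith
  then show ?thesis
  proof cases
    case 1
    have "((\<lambda>t. exp (- (1 / t))) has_field_derivative exp (- (1 / t)) / t ^ 2) (at t)"
      using 1 by (auto intro!: derivative_eq_intros simp: power2_eq_square)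
    from DERIV_divide[OF this has_field_derivative_power[OF 1]]
    have "((\<lambda>t. exp (- (1 / t)) / t ^ n) has_field_derivative flat (n + 2) t - real n * flat (n + 1) t) (at t)"
      by (rule DERIV_cong) (use 1 in \<open>auto simp: flat_def field_simps power2_eq_square\<close>)
    then show ?thesis
      by (rule has_field_derivative_transform_within_open[of _ _ _ "{0<..}"]) (use 1 in \<open>auto simp: flat_def\<close>)
  next
    case 2
    have "((\<lambda>t. 0) has_field_derivative flat (n + 2) t - real n * flat (n + 1) t) (at t)"
      using 2 by (simp add: flat_def)
    then show ?thesis
      by (rule has_field_derivative_transform_within_open[of _ _ _ "{..<0}"]) (use 2 in \<open>auto simp: flat_def\<close>)
  next
    case 3
    have "((\<lambda>h. flat n h / h) \<longlongrightarrow> 0) (at 0)"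
    proof (rule Lim_null_comparison)
      have "norm (flat n h / h) \<le> fact (n + 2) * \<bar>h\<bar>" for h
      proof (cases "h = 0")
        case False
        have "\<bar>flat n h\<bar> \<le> fact (n + 2) * \<bar>h\<bar> * \<bar>h\<bar>"
          using flat_bound[of n h] by (simp add: power2_eq_square abs_mult[symmetric] mult.assoc del: fact_Suc)
        then show ?thesis using False by (simp add: pos_divide_le_eq del: fact_Suc)
      qed simp
      then show "\<forall>\<^sub>F h in at 0. norm (flat n h / h) \<le> fact (n + 2) * \<bar>h\<bar>"
        by (intro always_eventually allI)
      show "((\<lambda>h. fact (n + 2) * \<bar>h\<bar>) \<longlongrightarrow> (0::real)) (at 0)"
        by (auto intro!: tendsto_eq_intros)
    qed
    then show ?thesis using 3 by (simp add: DERIV_def flat_def)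
  qed
qed

lemma Ck_on_flat: "Ck_on k V A (flat n)"
proof (induction k arbitrary: n)
  case 0
  show ?case
    using DERIV_isCont[OF flat_has_derivative] by (auto intro!: continuous_at_imp_continuous_on)
next
  case (Suc k)
  have "(flat n has_derivative (\<lambda>v. (flat (n + 2) x - real n * flat (n + 1) x) * v)) (at x within A)" for x
    using flat_has_derivative[of n x] has_derivative_at_withinI by (metis has_field_derivative_def)
  moreover have "Ck_on k V A (\<lambda>x. (flat (n + 2) x - real n * flat (n + 1) x) * v)" for v
  proof -
    have "Ck_on k V A (\<lambda>x. v *\<^sub>R flat (n + 2) x + (- real n * v) *\<^sub>R flat (n + 1) x)"
      by (intro Ck_on_add Ck_on_scaleR Ck_on_const Suc.IH)
    then show ?thesis by (simp add: algebra_simps)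
  qed
  ultimately show ?case
    by (auto intro!: exI[of _ "\<lambda>x v. (flat (n + 2) x - real n * flat (n + 1) x) * v"])
qed

text \<open>Serves the positive denominator of the bump function; all powers are treated together to
  have a family closed under differentiation.\<close>

lemma Ck_on_inverse_power: "Ck_on k V {0<..} (\<lambda>x::real. inverse x ^ n)"
proof (induction k arbitrary: n)
  case 0
  show ?case by (auto intro!: continuous_intros)
next
  case (Suc k)
  have "((\<lambda>x::real. inverse x ^ n) has_derivative (\<lambda>v. (- real n * inverse x ^ (n + 1)) * v)) (at x within {0<..})"
    if "x > 0" for x
  proof -
    have "((\<lambda>x::real. inverse (x ^ n)) has_field_derivative - real n * inverse x ^ (n + 1)) (at x)"
      by (rule derivative_eq_intros has_field_derivative_power that)+
        (use that in \<open>auto simp: field_simps\<close>)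
    then have "((\<lambda>x::real. inverse x ^ n) has_field_derivative - real n * inverse x ^ (n + 1)) (at x)"
      by (simp add: power_inverse)
    then show ?thesis by (metis has_field_derivative_def has_derivative_at_withinI)
  qed
  moreover have "Ck_on k V {0<..} (\<lambda>x. (- real n * inverse x ^ (n + 1)) * v)" for v
  proof -
    have "Ck_on k V {0<..} (\<lambda>x. (- real n * v) *\<^sub>R inverse x ^ (n + 1))"
      by (intro Ck_on_scaleR Ck_on_const Suc.IH)
    then show ?thesis by (simp add: algebra_simps)
  qed
  ultimately show ?case
    by (auto intro!: exI[of _ "\<lambda>x v. (- real n * inverse x ^ (n + 1)) * v"])
qed

text \<open>\<open>u\<close> vanishes outside the ball of radius \<open>s\<close>, \<open>w\<close>
  inside the ball of radius \<open>r\<close>, and by \<open>r < s\<close> they never vanish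
  together; the bump is \<open>u / (u + w)\<close>. Squared distances keep everything smooth at the
  centre.\<close>

lemma ex_smooth_bump:
  fixes y0 :: "'e::euclidean_space"
  assumes "0 < r" "r < s"
  obtains \<psi> :: "'e \<Rightarrow> real" where "smooth_on UNIV UNIV \<psi>"
    "\<And>y. dist y0 y \<le> r \<Longrightarrow> \<psi> y = 1" "\<And>y. s \<le> dist y0 y \<Longrightarrow> \<psi> y = 0"
proof -
  define N :: "'e \<Rightarrow> real" where "N y = (y - y0) \<bullet> (y - y0)" for y
  have N_dist: "N y = (dist y0 y)\<^sup>2" for y
    by (simp add: N_def dist_norm norm_minus_commute[of y0 y] power2_norm_eq_inner)
  define u where "u y = flat 0 (s\<^sup>2 - N y)" for y
  define w where "w y = flat 0 (N y - r\<^sup>2)" for y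
  have rs: "r\<^sup>2 < s\<^sup>2" using assms by (simp add: power_strict_mono)
  have sub: "subspace (UNIV :: 'x::euclidean_space set)" by simp
  have sm_N: "smooth_on UNIV UNIV N"
  proof -
    have "smooth_on UNIV UNIV (\<lambda>y. \<Sum>b\<in>Basis. ((y - y0) \<bullet> b) * ((y - y0) \<bullet> b))"
    proof (intro smooth_on_sum smooth_on_mult)
      fix b :: 'e
      have "smooth_on UNIV UNIV (\<lambda>y::'e. (y + - y0) \<bullet> b)"
        by (intro smooth_on_bounded_linear[OF bounded_linear_inner_left] smooth_on_add
            smooth_on_id smooth_on_const)
      then show "smooth_on UNIV UNIV (\<lambda>y. (y - y0) \<bullet> b)" "smooth_on UNIV UNIV (\<lambda>y. (y - y0) \<bullet> b)"
        by simp_all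
    qed
    then show ?thesis unfolding N_def by (simp add: euclidean_inner[symmetric])
  qed
  have sm_flat: "smooth_on UNIV UNIV (flat 0)" unfolding smooth_on_def using Ck_on_flat by blast
  have sm_u: "smooth_on UNIV UNIV u"
  proof -
    have "smooth_on UNIV UNIV (\<lambda>y. s\<^sup>2 + (-1) * N y)"
      by (intro smooth_on_add smooth_on_mult smooth_on_const sm_N)
    from smooth_on_compose[OF sub subset_UNIV subset_UNIV this sm_flat]
    show ?thesis unfolding u_def by simp
  qed
  have sm_w: "smooth_on UNIV UNIV w"
  proof -
    have "smooth_on UNIV UNIV (\<lambda>y. N y + - r\<^sup>2)"
      by (intro smooth_on_add smooth_on_const sm_N)
    from smooth_on_compose[OF sub subset_UNIV subset_UNIV this sm_flat]
    show ?thesis unfolding w_def by simp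
  qed
  have nonneg: "flat 0 t \<ge> 0" and pos: "t > 0 \<Longrightarrow> flat 0 t > 0" for t by (auto simp: flat_def)
  have "u y + w y > 0" for y
  proof (cases "N y < s\<^sup>2")
    case True then show ?thesis using nonneg pos by (simp add: u_def w_def add_pos_nonneg)
  next
    case False then show ?thesis using nonneg pos rs by (simp add: u_def w_def add_nonneg_pos)
  qed
  then have "(\<lambda>y. u y + w y) ` UNIV \<subseteq> {0<..}" by auto
  moreover have "smooth_on UNIV {0<..} (\<lambda>x::real. inverse x ^ 1)"
    unfolding smooth_on_def using Ck_on_inverse_power by blast
  ultimately have "smooth_on UNIV UNIV (\<lambda>y. inverse (u y + w y) ^ 1)"
    by (rule smooth_on_compose[OF sub subset_UNIV _ smooth_on_add[OF sm_u sm_w]])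
  then have "smooth_on UNIV UNIV (\<lambda>y. u y * inverse (u y + w y))"
    by (intro smooth_on_mult sm_u) simp
  moreover have "u y * inverse (u y + w y) = 1" if "dist y0 y \<le> r" for y
  proof -
    have "N y \<le> r\<^sup>2" using that by (simp add: N_dist power_mono)
    then have "w y = 0" "u y > 0" using rs pos by (auto simp: w_def u_def flat_def)
    then show ?thesis by simp
  qed
  moreover have "u y * inverse (u y + w y) = 0" if "s \<le> dist y0 y" for y
  proof -
    have "s\<^sup>2 \<le> N y" using that assms by (simp add: N_dist power_mono)
    then show ?thesis by (simp add: u_def flat_def)
  qed
  ultimately show thesis using that by blast
qed

section \<open>Function spaces and tangent vectors\<close>

lemma scaleR_fun_apply [simp]: "(c *\<^sub>R f) x = c *\<^sub>R f x"
  by (simp add: scaleR_fun_def)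

lemma sum_fun_apply: "(\<Sum>i\<in>I. f i) x = (\<Sum>i\<in>I. f i x)"
  by (induction I rule: infinite_finite_induct) auto

text \<open>Smooth functions vanish off the manifold by convention, so a constant counts as smooth
  only after this truncation.\<close>

definition const_on :: "'p set \<Rightarrow> real \<Rightarrow> 'p \<Rightarrow> real" where
  "const_on A c = restrict0 A (\<lambda>_. c)"

lemma const_on_apply [simp]: "x \<in> A \<Longrightarrow> const_on A c x = c"
  by (simp add: const_on_def restrict0_def)

lemma smooth_functions_supported: "f \<in> smooth_functions X \<Longrightarrow> supported_on (points X) f"
  by (simp add: smooth_functions_def)

lemma tangent_supported: "v \<in> tangent X p \<Longrightarrow> f \<notin> smooth_functions X \<Longrightarrow> v f = 0"
  by (simp add: tangent_def supported_on_def)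

lemma tangent_add:
  "v \<in> tangent X p \<Longrightarrow> f \<in> smooth_functions X \<Longrightarrow> g \<in> smooth_functions X \<Longrightarrow> v (f + g) = v f + v g"
  by (simp add: tangent_def linear_over_def)

lemma tangent_scaleR:
  "v \<in> tangent X p \<Longrightarrow> f \<in> smooth_functions X \<Longrightarrow> v (c *\<^sub>R f) = c * v f"
  by (simp add: tangent_def linear_over_def)

lemma tangent_mult:
  "v \<in> tangent X p \<Longrightarrow> f \<in> smooth_functions X \<Longrightarrow> g \<in> smooth_functions X \<Longrightarrow>
    v (f * g) = f p * v g + g p * v f"
  by (simp add: tangent_def)

text \<open>What the locality of derivations takes: constants, sums, products, a local criterion for
  smoothness, and bump functions. Charts are not mentioned, so manifold and submanifold are treated
  alike.\<close>

locale function_space =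
  fixes X :: "('p, 'e::euclidean_space) smooth_structure"
  assumes const_smooth [simp]: "const_on (points X) c \<in> smooth_functions X"
    and add_smooth [simp]:
      "f \<in> smooth_functions X \<Longrightarrow> g \<in> smooth_functions X \<Longrightarrow> f + g \<in> smooth_functions X"
    and mult_smooth [simp]:
      "f \<in> smooth_functions X \<Longrightarrow> g \<in> smooth_functions X \<Longrightarrow> f * g \<in> smooth_functions X"
    and smooth_locally:
      "supported_on (points X) f \<Longrightarrow>
       (\<And>p. p \<in> points X \<Longrightarrow>
          \<exists>G g. openin (top_of X) G \<and> p \<in> G \<and> g \<in> smooth_functions X \<and> (\<forall>x\<in>G. f x = g x)) \<Longrightarrow>
       f \<in> smooth_functions X"
    and ex_bump:
      "openin (top_of X) G \<Longrightarrow> p \<in> G \<Longrightarrow>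
       \<exists>\<rho>\<in>smooth_functions X. \<exists>G'. openin (top_of X) G' \<and> p \<in> G' \<and>
         (\<forall>x\<in>G'. \<rho> x = 1) \<and> (\<forall>x. x \<notin> G \<longrightarrow> \<rho> x = 0)"
begin

lemma smooth_eq_0: "f \<in> smooth_functions X \<Longrightarrow> x \<notin> points X \<Longrightarrow> f x = 0"
  using smooth_functions_supported by (auto simp: supported_on_def)

lemma zero_smooth [simp]: "0 \<in> smooth_functions X"
proof -
  have "const_on (points X) 0 = 0" by (auto simp: const_on_def restrict0_def fun_eq_iff)
  then show ?thesis using const_smooth[of 0] by simp
qed

lemma scaleR_eq_const_mult:
  assumes "f \<in> smooth_functions X"
  shows "c *\<^sub>R f = const_on (points X) c * f"
proof
  show "(c *\<^sub>R f) x = (const_on (points X) c * f) x" for x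
    using smooth_eq_0[OF assms, of x] by (cases "x \<in> points X") auto
qed

lemma scaleR_smooth [simp]: "f \<in> smooth_functions X \<Longrightarrow> c *\<^sub>R f \<in> smooth_functions X"
  by (simp add: scaleR_eq_const_mult)

lemma minus_smooth [simp]: "f \<in> smooth_functions X \<Longrightarrow> - f \<in> smooth_functions X"
  using scaleR_smooth[of f "-1"] by simp

lemma diff_smooth [simp]:
  "f \<in> smooth_functions X \<Longrightarrow> g \<in> smooth_functions X \<Longrightarrow> f - g \<in> smooth_functions X"
  using add_smooth[of f "- g"] by simp

lemma sum_smooth [simp]:
  "(\<And>i. i \<in> I \<Longrightarrow> f i \<in> smooth_functions X) \<Longrightarrow> (\<Sum>i\<in>I. f i) \<in> smooth_functions X"
  by (induction I rule: infinite_finite_induct) auto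

lemma tangent_zero_fun: "v \<in> tangent X p \<Longrightarrow> v 0 = 0"
  using tangent_scaleR[of v X p 0 0] by simp

lemma tangent_minus: "v \<in> tangent X p \<Longrightarrow> f \<in> smooth_functions X \<Longrightarrow> v (- f) = - v f"
  using tangent_scaleR[of v X p f "-1"] by simp

lemma tangent_diff:
  "v \<in> tangent X p \<Longrightarrow> f \<in> smooth_functions X \<Longrightarrow> g \<in> smooth_functions X \<Longrightarrow> v (f - g) = v f - v g"
  using tangent_add[of v X p f "- g"] by (simp add: tangent_minus)

lemma tangent_sum:
  "v \<in> tangent X p \<Longrightarrow> (\<And>i. i \<in> I \<Longrightarrow> f i \<in> smooth_functions X) \<Longrightarrow> v (\<Sum>i\<in>I. f i) = (\<Sum>i\<in>I. v (f i))"
  by (induction I rule: infinite_finite_induct) (auto simp: tangent_zero_fun tangent_add)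

text \<open>For a bump function \<open>\<rho>\<close> that is 1 at \<open>p\<close> and 0 off
  \<open>G\<close>, the product \<open>\<rho> * f\<close> is 0, and the product rule at
  \<open>p\<close> leaves \<open>v f\<close>.\<close>

lemma tangent_vanishing_local:
  assumes v: "v \<in> tangent X p" and f: "f \<in> smooth_functions X"
    and G: "openin (top_of X) G" "p \<in> G" "\<And>x. x \<in> G \<Longrightarrow> f x = 0"
  shows "v f = 0"
proof -
  obtain \<rho> where \<rho>: "\<rho> \<in> smooth_functions X" "\<rho> p = 1" "\<And>x. x \<notin> G \<Longrightarrow> \<rho> x = 0"
    using ex_bump[OF G(1,2)] by blast
  have "\<rho> * f = 0" using \<rho>(3) G(3) by (auto simp: fun_eq_iff)
  then have "\<rho> p * v f + f p * v \<rho> = 0"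
    using tangent_mult[OF v \<rho>(1) f] tangent_zero_fun[OF v] by simp
  then show ?thesis using \<rho>(2) G(3)[OF G(2)] by simp
qed

lemma tangent_local:
  assumes v: "v \<in> tangent X p" and f: "f \<in> smooth_functions X" "g \<in> smooth_functions X"
    and G: "openin (top_of X) G" "p \<in> G" "\<And>x. x \<in> G \<Longrightarrow> f x = g x"
  shows "v f = v g"
proof -
  have "v (f - g) = 0"
    by (rule tangent_vanishing_local[OF v _ G(1,2)]) (use f G(3) in auto)
  then show ?thesis using tangent_diff[OF v f] by simp
qed

text \<open>The unit is idempotent, so the product rule gives \<open>v 1 = 2 v 1\<close>.\<close>

lemma tangent_const: "v \<in> tangent X p \<Longrightarrow> p \<in> points X \<Longrightarrow> v (const_on (points X) c) = 0"
proof -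
  assume v: "v \<in> tangent X p" and p: "p \<in> points X"
  let ?e = "const_on (points X) 1"
  have "?e * ?e = ?e" by (auto simp: const_on_def restrict0_def fun_eq_iff)
  then have "v ?e = 0" using tangent_mult[OF v const_smooth[of 1] const_smooth[of 1]] p by simp
  moreover have "const_on (points X) c = c *\<^sub>R ?e"
    by (auto simp: const_on_def restrict0_def fun_eq_iff)
  ultimately show ?thesis using tangent_scaleR[OF v const_smooth[of 1]] by simp
qed

end

section \<open>Charts\<close>

lemma smooth_on_locally_openin:
  assumes "subspace V" "openin (top_of_set V) A"
    "\<And>x. x \<in> A \<Longrightarrow> \<exists>A'. openin (top_of_set V) A' \<and> x \<in> A' \<and> smooth_on V A' f"
  shows "smooth_on V A f"
proof (rule smooth_on_locally[OF assms(1,2)])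
  fix x assume x: "x \<in> A"
  then obtain A' where A': "openin (top_of_set V) A'" "x \<in> A'" "smooth_on V A' f" using assms(3) by blast
  then obtain T where T: "open T" "A' = V \<inter> T" by (auto simp: openin_open)
  have "A \<inter> T \<subseteq> A'" using T(2) openin_imp_subset[OF assms(2)] by blast
  then have "smooth_on V (A \<inter> T) f" using smooth_on_subset[OF A'(3)] by blast
  then show "\<exists>T. open T \<and> x \<in> T \<and> smooth_on V (A \<inter> T) f" using T A'(2) by blast
qed

lemma
  assumes "is_chart M (U, \<phi>)"
  shows chart_domain_open: "openin (top_of M) U"
    and chart_range_open: "openin (top_of_set (model M)) (\<phi> ` U)"
    and chart_homeo: "homeomorphic_map (subtopology (top_of M) U) (top_of_set (\<phi> ` U)) \<phi>"
    and chart_topspace: "topspace (subtopology (top_of M) U) = U"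
  using assms openin_subset[of "top_of M" U] by (auto simp: is_chart_def)

lemma chart_inj: "is_chart M (U, \<phi>) \<Longrightarrow> inj_on \<phi> U"
  using homeomorphic_imp_injective_map[OF chart_homeo] chart_topspace by metis

lemma chart_inv: "is_chart M (U, \<phi>) \<Longrightarrow> p \<in> U \<Longrightarrow> inv_into U \<phi> (\<phi> p) = p"
  using chart_inj inv_into_f_f by metis

lemma chart_preimage_open:
  assumes c: "is_chart M (U, \<phi>)" and B: "open B"
  shows "openin (top_of M) {p \<in> U. \<phi> p \<in> B}"
proof -
  have "openin (top_of_set (\<phi> ` U)) (\<phi> ` U \<inter> B)" using B by (rule openin_open_Int)
  from openin_continuous_map_preimage[OF homeomorphic_imp_continuous_map[OF chart_homeo[OF c]] this]
  have "openin (subtopology (top_of M) U) {p \<in> U. \<phi> p \<in> \<phi> ` U \<inter> B}"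
    unfolding chart_topspace[OF c] .
  then have "openin (top_of M) {p \<in> U. \<phi> p \<in> \<phi> ` U \<inter> B}"
    using openin_open_subtopology[OF chart_domain_open[OF c]] by blast
  moreover have "{p \<in> U. \<phi> p \<in> \<phi> ` U \<inter> B} = {p \<in> U. \<phi> p \<in> B}" by auto
  ultimately show ?thesis by simp
qed

lemma chart_image_open:
  assumes c: "is_chart M (U, \<phi>)" and A: "openin (top_of M) A" "A \<subseteq> U"
  shows "openin (top_of_set (model M)) (\<phi> ` A)"
proof -
  have "openin (subtopology (top_of M) U) A"
    using A openin_open_subtopology[OF chart_domain_open[OF c]] by blast
  then have "openin (top_of_set (\<phi> ` U)) (\<phi> ` A)"
    using homeomorphic_imp_open_map[OF chart_homeo[OF c]] by (simp add: open_map_def)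
  then show ?thesis using openin_trans chart_range_open[OF c] by blast
qed

lemma chart_preimage_compact:
  assumes c: "is_chart M (U, \<phi>)" and K: "compact (\<phi> ` U \<inter> K)"
  shows "compactin (top_of M) {p \<in> U. \<phi> p \<in> K}"
proof -
  have "\<phi> ` {p \<in> U. \<phi> p \<in> K} = \<phi> ` U \<inter> K" by auto
  then have "compactin (top_of_set (\<phi> ` U)) (\<phi> ` {p \<in> U. \<phi> p \<in> K})"
    using K by (simp add: compactin_subtopology)
  then have "compactin (subtopology (top_of M) U) {p \<in> U. \<phi> p \<in> K}"
    using homeomorphic_map_compactness[OF chart_homeo[OF c], of "{p \<in> U. \<phi> p \<in> K}"]
      chart_topspace[OF c] by auto
  then show ?thesis by (simp add: compactin_subtopology)
qed

lemma chart_ex_ball: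
  assumes c: "is_chart M (U, \<phi>)" and G: "openin (top_of M) G" "p \<in> G" "p \<in> U"
  obtains r where "r > 0" "cball (\<phi> p) r \<inter> model M \<subseteq> \<phi> ` (U \<inter> G)"
proof -
  have "openin (top_of_set (model M)) (\<phi> ` (U \<inter> G))"
    using chart_image_open[OF c openin_Int[OF chart_domain_open[OF c] G(1)]] by blast
  moreover have "\<phi> p \<in> \<phi> ` (U \<inter> G)" using G by blast
  ultimately show thesis using that by (meson openin_contains_cball)
qed

lemma smooth_transition_iff:
  "smooth_transition M (U, \<phi>) (U', \<phi>') \<longleftrightarrow>
    smooth_on (model M) (\<phi> ` (U \<inter> U')) (\<phi>' \<circ> inv_into U \<phi>)"
  by (simp add: smooth_transition_def)

locale manifold =
  fixes M :: "('p, 'e::euclidean_space) smooth_structure"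
  assumes smooth_manifold: "smooth_manifold M"
begin

abbreviation "V \<equiv> model M"
abbreviation "T \<equiv> top_of M"

lemma subspace_V: "subspace V"
  and Hausdorff: "Hausdorff_space T"
  and atlas_is_chart: "c \<in> atlas M \<Longrightarrow> is_chart M c"
  and atlas_transition: "c \<in> atlas M \<Longrightarrow> c' \<in> atlas M \<Longrightarrow> smooth_transition M c c'"
  using smooth_manifold by (auto simp: smooth_manifold_def)

lemma atlas_covers:
  assumes "p \<in> points M"
  obtains U \<phi> where "(U, \<phi>) \<in> atlas M" "p \<in> U"
proof -
  have "p \<in> (\<Union>(U, \<phi>)\<in>atlas M. U)" using assms smooth_manifold by (simp add: smooth_manifold_def)
  then show thesis using that by blast
qed

lemma atlas_subset_maximal: "c \<in> atlas M \<Longrightarrow> c \<in> maximal_atlas M"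
  using atlas_is_chart atlas_transition by (simp add: maximal_atlas_def)

lemma maximal_is_chart: "c \<in> maximal_atlas M \<Longrightarrow> is_chart M c"
  by (simp add: maximal_atlas_def)

text \<open>Compatibility is postulated only against the atlas. Around each point the transition
  factors through a chart of the atlas, and smoothness is local.\<close>

lemma maximal_transition:
  assumes c: "(U, \<phi>) \<in> maximal_atlas M" and c': "(U', \<phi>') \<in> maximal_atlas M"
  shows "smooth_transition M (U, \<phi>) (U', \<phi>')"
  unfolding smooth_transition_iff
proof (rule smooth_on_locally_openin[OF subspace_V])
  note chart = maximal_is_chart[OF c] maximal_is_chart[OF c']
  note dom = chart_domain_open[OF chart(1)] chart_domain_open[OF chart(2)]
  show "openin (top_of_set V) (\<phi> ` (U \<inter> U'))"
    using chart_image_open[OF chart(1) openin_Int[OF dom]] by blast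
  fix x assume "x \<in> \<phi> ` (U \<inter> U')"
  then obtain p where p: "x = \<phi> p" "p \<in> U" "p \<in> U'" by blast
  obtain U0 \<phi>0 where c0: "(U0, \<phi>0) \<in> atlas M" "p \<in> U0"
    using atlas_covers openin_subset[OF dom(1)] p(2) by blast
  note chart0 = atlas_is_chart[OF c0(1)]
  let ?A = "\<phi> ` (U \<inter> U' \<inter> U0)"
  have "openin (top_of_set V) ?A"
    using chart_image_open[OF chart(1) openin_Int[OF openin_Int[OF dom] chart_domain_open[OF chart0]]]
    by blast
  moreover have "x \<in> ?A" using p c0 by blast
  moreover have "smooth_on V ?A (\<phi>' \<circ> inv_into U \<phi>)"
  proof -
    have 1: "smooth_on V (\<phi> ` (U \<inter> U0)) (\<phi>0 \<circ> inv_into U \<phi>)"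
      "smooth_on V (\<phi>0 ` (U0 \<inter> U')) (\<phi>' \<circ> inv_into U0 \<phi>0)"
      using c c' c0(1) by (auto simp: maximal_atlas_def smooth_transition_iff)
    have "smooth_on V ?A (\<lambda>y. (\<phi>' \<circ> inv_into U0 \<phi>0) ((\<phi>0 \<circ> inv_into U \<phi>) y))"
    proof (rule smooth_on_compose[OF subspace_V _ _ smooth_on_subset[OF 1(1)] 1(2)])
      show "\<phi>0 ` (U0 \<inter> U') \<subseteq> V"
        using openin_imp_subset[OF chart_range_open[OF chart0]] by blast
      show "(\<phi>0 \<circ> inv_into U \<phi>) ` ?A \<subseteq> \<phi>0 ` (U0 \<inter> U')"
        using chart_inv[OF chart(1)] by auto
    qed auto
    then show ?thesis
    proof (rule smooth_on_cong[THEN iffD1, rotated])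
      fix y assume "y \<in> ?A"
      then show "(\<phi>' \<circ> inv_into U0 \<phi>0) ((\<phi>0 \<circ> inv_into U \<phi>) y) = (\<phi>' \<circ> inv_into U \<phi>) y"
        using chart_inv[OF chart(1)] chart_inv[OF chart0] by auto
    qed
  qed
  ultimately show "\<exists>A'. openin (top_of_set V) A' \<and> x \<in> A' \<and> smooth_on V A' (\<phi>' \<circ> inv_into U \<phi>)"
    by blast
qed

lemma smooth_function_in_atlas_chart:
  "f \<in> smooth_functions M \<Longrightarrow> (U, \<phi>) \<in> atlas M \<Longrightarrow> smooth_on V (\<phi> ` U) (f \<circ> inv_into U \<phi>)"
  by (auto simp: smooth_functions_def)

lemma smooth_function_in_chart:
  assumes f: "f \<in> smooth_functions M" and c: "(U, \<phi>) \<in> maximal_atlas M"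
  shows "smooth_on V (\<phi> ` U) (f \<circ> inv_into U \<phi>)"
proof (rule smooth_on_locally_openin[OF subspace_V])
  note chart = maximal_is_chart[OF c]
  note dom = chart_domain_open[OF chart]
  show "openin (top_of_set V) (\<phi> ` U)" using chart_range_open[OF chart] .
  fix x assume "x \<in> \<phi> ` U"
  then obtain p where p: "x = \<phi> p" "p \<in> U" by blast
  obtain U0 \<phi>0 where c0: "(U0, \<phi>0) \<in> atlas M" "p \<in> U0"
    using atlas_covers openin_subset[OF dom] p(2) by blast
  note chart0 = atlas_is_chart[OF c0(1)]
  let ?A = "\<phi> ` (U \<inter> U0)"
  have "openin (top_of_set V) ?A"
    using chart_image_open[OF chart openin_Int[OF dom chart_domain_open[OF chart0]]] by blast
  moreover have "x \<in> ?A" using p c0 by blast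
  moreover have "smooth_on V ?A (f \<circ> inv_into U \<phi>)"
  proof -
    have 1: "smooth_on V ?A (\<phi>0 \<circ> inv_into U \<phi>)"
      using c c0(1) by (auto simp: maximal_atlas_def smooth_transition_iff)
    have "smooth_on V ?A (\<lambda>y. (f \<circ> inv_into U0 \<phi>0) ((\<phi>0 \<circ> inv_into U \<phi>) y))"
    proof (rule smooth_on_compose[OF subspace_V _ _ 1 smooth_function_in_atlas_chart[OF f c0(1)]])
      show "\<phi>0 ` U0 \<subseteq> V" using openin_imp_subset[OF chart_range_open[OF chart0]] .
      show "(\<phi>0 \<circ> inv_into U \<phi>) ` ?A \<subseteq> \<phi>0 ` U0" using chart_inv[OF chart] by auto
    qed
    then show ?thesis
    proof (rule smooth_on_cong[THEN iffD1, rotated])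
      fix y assume "y \<in> ?A"
      then show "(f \<circ> inv_into U0 \<phi>0) ((\<phi>0 \<circ> inv_into U \<phi>) y) = (f \<circ> inv_into U \<phi>) y"
        using chart_inv[OF chart] chart_inv[OF chart0] by auto
    qed
  qed
  ultimately show "\<exists>A'. openin (top_of_set V) A' \<and> x \<in> A' \<and> smooth_on V A' (f \<circ> inv_into U \<phi>)"
    by blast
qed

text \<open>Extension by zero is smooth because \<open>?K\<close>, the preimage of the closed ball
  of radius \<open>s\<close>, is compact and, by the Hausdorff property, closed in the whole
  manifold. A point of \<open>?K\<close> has a neighbourhood mapped into the ball of radius
  \<open>r\<close>; off \<open>?K\<close> the function is 0.\<close>

lemma cutoff_smooth:
  assumes c: "(U, \<phi>) \<in> maximal_atlas M" and r: "cball y0 r \<inter> V \<subseteq> \<phi> ` U" and s: "s < r"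
    and h: "smooth_on V (ball y0 r \<inter> V) h" "\<And>y. y \<in> V \<Longrightarrow> s \<le> dist y0 y \<Longrightarrow> h y = 0"
  shows "(\<lambda>p. if p \<in> U \<and> dist y0 (\<phi> p) < r then h (\<phi> p) else 0) \<in> smooth_functions M"
    (is "?F \<in> _")
proof -
  note chart = maximal_is_chart[OF c]
  note dom = chart_domain_open[OF chart]
  have range_V: "\<phi> ` U \<subseteq> V" using openin_imp_subset[OF chart_range_open[OF chart]] .
  let ?K = "{p \<in> U. \<phi> p \<in> cball y0 s}"
  have "\<phi> ` U \<inter> cball y0 s = cball y0 s \<inter> V"
    using r s range_V by auto
  then have "compact (\<phi> ` U \<inter> cball y0 s)"
    using compact_Int_closed[OF compact_cball closed_subspace[OF subspace_V]] by simp
  then have K_closed: "closedin T ?K"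
    using compactin_imp_closedin[OF Hausdorff chart_preimage_compact[OF chart]] by blast
  have supp: "supported_on (points M) ?F"
    using openin_subset[OF dom] by (auto simp: supported_on_def)
  have "smooth_on V (\<phi>' ` U') (?F \<circ> inv_into U' \<phi>')" if c': "(U', \<phi>') \<in> atlas M" for U' \<phi>'
  proof (rule smooth_on_locally_openin[OF subspace_V])
    note chart' = atlas_is_chart[OF c']
    note dom' = chart_domain_open[OF chart']
    show "openin (top_of_set V) (\<phi>' ` U')" using chart_range_open[OF chart'] .
    fix x assume "x \<in> \<phi>' ` U'"
    then obtain p where p: "x = \<phi>' p" "p \<in> U'" by blast
    show "\<exists>A. openin (top_of_set V) A \<and> x \<in> A \<and> smooth_on V A (?F \<circ> inv_into U' \<phi>')"
    proof (cases "p \<in> ?K")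
      case True
      let ?G = "U' \<inter> {p \<in> U. \<phi> p \<in> ball y0 r}"
      have "openin (top_of_set V) (\<phi>' ` ?G)"
        using chart_image_open[OF chart' openin_Int[OF dom' chart_preimage_open[OF chart open_ball]]]
        by blast
      moreover have "x \<in> \<phi>' ` ?G" using p True s by auto
      moreover have "smooth_on V (\<phi>' ` ?G) (?F \<circ> inv_into U' \<phi>')"
      proof -
        have "smooth_on V (\<phi>' ` (U' \<inter> U)) (\<phi> \<circ> inv_into U' \<phi>')"
          using c c' by (auto simp: maximal_atlas_def smooth_transition_iff)
        then have 1: "smooth_on V (\<phi>' ` ?G) (\<phi> \<circ> inv_into U' \<phi>')"
          by (rule smooth_on_subset) auto
        have "smooth_on V (\<phi>' ` ?G) (\<lambda>y. h ((\<phi> \<circ> inv_into U' \<phi>') y))"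
        proof (rule smooth_on_compose[OF subspace_V _ _ 1 h(1)])
          show "(\<phi> \<circ> inv_into U' \<phi>') ` \<phi>' ` ?G \<subseteq> ball y0 r \<inter> V"
            using chart_inv[OF chart'] range_V by auto
        qed auto
        then show ?thesis
        proof (rule smooth_on_cong[THEN iffD1, rotated])
          fix y assume "y \<in> \<phi>' ` ?G"
          then show "h ((\<phi> \<circ> inv_into U' \<phi>') y) = (?F \<circ> inv_into U' \<phi>') y"
            using chart_inv[OF chart'] by auto
        qed
      qed
      ultimately show ?thesis by blast
    next
      case False
      let ?G = "U' \<inter> (topspace T - ?K)"
      have "openin T ?G" using openin_Int[OF dom'] K_closed by (simp add: closedin_def)
      then have "openin (top_of_set V) (\<phi>' ` ?G)" by (rule chart_image_open[OF chart']) blast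
      moreover have "x \<in> \<phi>' ` ?G" using p False openin_subset[OF dom'] by blast
      moreover have "smooth_on V (\<phi>' ` ?G) (?F \<circ> inv_into U' \<phi>')"
      proof (rule smooth_on_cong[THEN iffD1, OF _ smooth_on_const[of V _ 0]])
        fix y assume "y \<in> \<phi>' ` ?G"
        then obtain x where x: "x \<in> U'" "x \<notin> ?K" "y = \<phi>' x" by blast
        have "h (\<phi> x) = 0" if "x \<in> U"
          using h(2)[of "\<phi> x"] range_V x(2) that by auto
        then show "0 = (?F \<circ> inv_into U' \<phi>') y"
          using chart_inv[OF chart' x(1)] x(3) by auto
      qed
      ultimately show ?thesis by blast
    qed
  qed
  then show ?thesis using supp by (auto simp: smooth_functions_def)
qed

sublocale function_space M
proof
  show "const_on (points M) c \<in> smooth_functions M" for c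
  proof -
    have "smooth_on V (\<phi> ` U) (const_on (points M) c \<circ> inv_into U \<phi>)" if "(U, \<phi>) \<in> atlas M" for U \<phi>
    proof (rule smooth_on_cong[THEN iffD1, OF _ smooth_on_const[of V _ c]])
      fix y assume "y \<in> \<phi> ` U"
      then show "c = (const_on (points M) c \<circ> inv_into U \<phi>) y"
        using chart_inv[OF atlas_is_chart[OF that]]
          openin_subset[OF chart_domain_open[OF atlas_is_chart[OF that]]] by auto
    qed
    then show ?thesis by (auto simp: smooth_functions_def supported_on_def const_on_def restrict0_def)
  qed
next
  fix f g assume fg: "f \<in> smooth_functions M" "g \<in> smooth_functions M"
  show "f + g \<in> smooth_functions M"
  proof -
    have "smooth_on V (\<phi> ` U) ((f + g) \<circ> inv_into U \<phi>)" if "(U, \<phi>) \<in> atlas M" for U \<phi>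
      using smooth_on_add[OF fg[THEN smooth_function_in_atlas_chart, OF that]] by (simp add: o_def)
    then show ?thesis using fg by (auto simp: smooth_functions_def supported_on_def)
  qed
  show "f * g \<in> smooth_functions M"
  proof -
    have "smooth_on V (\<phi> ` U) ((f * g) \<circ> inv_into U \<phi>)" if "(U, \<phi>) \<in> atlas M" for U \<phi>
      using smooth_on_mult[OF fg[THEN smooth_function_in_atlas_chart, OF that]] by (simp add: o_def)
    then show ?thesis using fg by (auto simp: smooth_functions_def supported_on_def)
  qed
next
  fix f :: "'p \<Rightarrow> real"
  assume supp: "supported_on (points M) f"
    and loc: "\<And>p. p \<in> points M \<Longrightarrow>
      \<exists>G g. openin T G \<and> p \<in> G \<and> g \<in> smooth_functions M \<and> (\<forall>x\<in>G. f x = g x)"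
  have "smooth_on V (\<phi> ` U) (f \<circ> inv_into U \<phi>)" if c: "(U, \<phi>) \<in> atlas M" for U \<phi>
  proof (rule smooth_on_locally_openin[OF subspace_V])
    note chart = atlas_is_chart[OF c]
    note dom = chart_domain_open[OF chart]
    show "openin (top_of_set V) (\<phi> ` U)" using chart_range_open[OF chart] .
    fix x assume "x \<in> \<phi> ` U"
    then obtain p where p: "x = \<phi> p" "p \<in> U" by blast
    then obtain G g where G: "openin T G" "p \<in> G" "g \<in> smooth_functions M" "\<forall>x\<in>G. f x = g x"
      using loc openin_subset[OF dom] by blast
    have "openin (top_of_set V) (\<phi> ` (U \<inter> G))"
      using chart_image_open[OF chart openin_Int[OF dom G(1)]] by blast
    moreover have "x \<in> \<phi> ` (U \<inter> G)" using p G(2) by blast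
    moreover have "smooth_on V (\<phi> ` (U \<inter> G)) (f \<circ> inv_into U \<phi>)"
    proof (rule smooth_on_cong[THEN iffD1, rotated])
      show "smooth_on V (\<phi> ` (U \<inter> G)) (g \<circ> inv_into U \<phi>)"
        by (rule smooth_on_subset[OF smooth_function_in_atlas_chart[OF G(3) c]]) auto
      fix y assume "y \<in> \<phi> ` (U \<inter> G)"
      then show "(g \<circ> inv_into U \<phi>) y = (f \<circ> inv_into U \<phi>) y"
        using chart_inv[OF chart] G(4) by auto
    qed
    ultimately show "\<exists>A'. openin (top_of_set V) A' \<and> x \<in> A' \<and> smooth_on V A' (f \<circ> inv_into U \<phi>)"
      by blast
  qed
  then show "f \<in> smooth_functions M" using supp by (auto simp: smooth_functions_def)
next
  fix G p assume G: "openin T G" "p \<in> G"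
  then obtain U \<phi> where c: "(U, \<phi>) \<in> atlas M" "p \<in> U" using atlas_covers openin_subset by blast
  note chart = atlas_is_chart[OF c(1)]
  obtain r where r: "r > 0" "cball (\<phi> p) r \<inter> V \<subseteq> \<phi> ` (U \<inter> G)"
    using chart_ex_ball[OF chart G c(2)] by blast
  \<comment> \<open>Nested radii: \<open>\<psi>\<close> is 1 up to \<open>r / 3\<close> and 0 from
    \<open>r / 2\<close> on, while the image of the chart contains all points of \<open>V\<close> in
    the closed ball of radius \<open>r\<close>.\<close>
  have r_less: "0 < r / 3" "r / 3 < r / 2" using r(1) by auto
  obtain \<psi> :: "'e \<Rightarrow> real" where \<psi>: "smooth_on UNIV UNIV \<psi>"
    "\<And>y. dist (\<phi> p) y \<le> r / 3 \<Longrightarrow> \<psi> y = 1" "\<And>y. r / 2 \<le> dist (\<phi> p) y \<Longrightarrow> \<psi> y = 0"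
    by (rule ex_smooth_bump[OF r_less, of "\<phi> p"]) blast
  let ?\<rho> = "\<lambda>x. if x \<in> U \<and> dist (\<phi> p) (\<phi> x) < r then \<psi> (\<phi> x) else 0"
  let ?G' = "{x \<in> U. \<phi> x \<in> ball (\<phi> p) (r / 3)}"
  have "?\<rho> \<in> smooth_functions M"
  proof (rule cutoff_smooth[OF atlas_subset_maximal[OF c(1)], where s = "r / 2"])
    show "cball (\<phi> p) r \<inter> V \<subseteq> \<phi> ` U" using r(2) by blast
    show "smooth_on V (ball (\<phi> p) r \<inter> V) \<psi>" by (rule smooth_on_subset[OF \<psi>(1)]) auto
  qed (use r(1) \<psi>(3) in auto)
  moreover have "openin T ?G'" by (rule chart_preimage_open[OF chart open_ball])
  moreover have "p \<in> ?G'" using c(2) r(1) by simp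
  moreover have "\<forall>x\<in>?G'. ?\<rho> x = 1" using r(1) \<psi>(2) by auto
  moreover have "?\<rho> x = 0" if "x \<notin> G" for x
  proof -
    have "\<not> (x \<in> U \<and> dist (\<phi> p) (\<phi> x) < r)"
    proof
      assume x: "x \<in> U \<and> dist (\<phi> p) (\<phi> x) < r"
      then have "\<phi> x \<in> cball (\<phi> p) r \<inter> V"
        using openin_imp_subset[OF chart_range_open[OF chart]] by (auto simp: less_imp_le)
      then have "\<phi> x \<in> \<phi> ` (U \<inter> G)" using r(2) by blast
      then show False using x that chart_inj[OF chart] by (auto simp: inj_on_def)
    qed
    then show ?thesis by auto
  qed
  ultimately show "\<exists>\<rho>\<in>smooth_functions M. \<exists>G'. openin T G' \<and> p \<in> G' \<and>
      (\<forall>x\<in>G'. \<rho> x = 1) \<and> (\<forall>x. x \<notin> G \<longrightarrow> \<rho> x = 0)"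
    by (intro bexI[of _ ?\<rho>] exI[of _ ?G'] conjI allI impI)
qed

text \<open>One cutoff \<open>\<psi>\<close> serves every \<open>h\<close>. It makes coordinate
  functions, partial derivatives and Hadamard remainders, which live on a coordinate ball, into
  global smooth functions that are unchanged on \<open>G\<close>.\<close>

lemma chart_cutoff:
  assumes c: "(U, \<phi>) \<in> maximal_atlas M" and p: "p \<in> U"
  obtains r G and \<psi> :: "'e \<Rightarrow> real" where "r > 0" "cball (\<phi> p) r \<inter> V \<subseteq> \<phi> ` U"
    "openin T G" "p \<in> G" "G \<subseteq> {x \<in> U. dist (\<phi> p) (\<phi> x) < r}"
    "\<And>x. x \<in> G \<Longrightarrow> \<psi> (\<phi> x) = 1"
    "\<And>h :: 'e \<Rightarrow> real. smooth_on V (ball (\<phi> p) r \<inter> V) h \<Longrightarrow>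
      (\<lambda>x. if x \<in> U \<and> dist (\<phi> p) (\<phi> x) < r then \<psi> (\<phi> x) * h (\<phi> x) else 0) \<in> smooth_functions M"
proof -
  note chart = maximal_is_chart[OF c]
  obtain r where r: "r > 0" "cball (\<phi> p) r \<inter> V \<subseteq> \<phi> ` (U \<inter> U)"
    using chart_ex_ball[OF chart chart_domain_open[OF chart] p p] by blast
  then have r': "cball (\<phi> p) r \<inter> V \<subseteq> \<phi> ` U" by simp
  have r_less: "0 < r / 3" "r / 3 < r / 2" using r(1) by auto
  obtain \<psi> :: "'e \<Rightarrow> real" where \<psi>: "smooth_on UNIV UNIV \<psi>"
    "\<And>y. dist (\<phi> p) y \<le> r / 3 \<Longrightarrow> \<psi> y = 1" "\<And>y. r / 2 \<le> dist (\<phi> p) y \<Longrightarrow> \<psi> y = 0"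
    by (rule ex_smooth_bump[OF r_less, of "\<phi> p"]) blast
  show thesis
  proof (rule that[OF r(1) r' chart_preimage_open[OF chart open_ball[of "\<phi> p" "r / 3"]]])
    fix h :: "'e \<Rightarrow> real" assume h: "smooth_on V (ball (\<phi> p) r \<inter> V) h"
    have "smooth_on V (ball (\<phi> p) r \<inter> V) \<psi>" by (rule smooth_on_subset[OF \<psi>(1)]) auto
    then show "(\<lambda>x. if x \<in> U \<and> dist (\<phi> p) (\<phi> x) < r then \<psi> (\<phi> x) * h (\<phi> x) else 0)
        \<in> smooth_functions M"
      using h r(1) \<psi>(3)
      by (intro cutoff_smooth[OF c r', of "r / 2" "\<lambda>y. \<psi> y * h y"] smooth_on_mult) auto
  qed (use p r(1) \<psi>(2) in auto)
qed

text \<open>The frame consists of cut-off coordinate functions \<open>x b\<close> and coordinate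
  fields \<open>d b\<close>. Near \<open>q\<close>, Hadamard's lemma writes \<open>f\<close> as a
  constant plus products of \<open>x b - x b q\<close> with smooth functions, and a derivation at
  \<open>q\<close> sees of them only \<open>v (x b)\<close> times a partial derivative of
  \<open>f\<close>.\<close>

lemma ex_frame:
  assumes p: "p \<in> points M"
  shows "\<exists>(E :: 'e set) x d G. finite E \<and> openin T G \<and> p \<in> G \<and>
    (\<forall>b\<in>E. x b \<in> smooth_functions M \<and> d b \<in> vector_fields M) \<and>
    (\<forall>q\<in>G. \<forall>v\<in>tangent M q. v = (\<Sum>b\<in>E. v (x b) *\<^sub>R d b q))"
proof -
  obtain E where E: "finite E" "E \<subseteq> V" "\<And>w. w \<in> V \<Longrightarrow> (\<Sum>b\<in>E. (w \<bullet> b) *\<^sub>R b) = w"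
    using orthonormal_basis_expansion[OF subspace_V] by metis
  obtain U \<phi> where c0: "(U, \<phi>) \<in> atlas M" "p \<in> U" using atlas_covers[OF p] .
  note c = atlas_subset_maximal[OF c0(1)] and chart = atlas_is_chart[OF c0(1)]
  obtain r G \<psi> where r: "r > 0" "cball (\<phi> p) r \<inter> V \<subseteq> \<phi> ` U"
    and G: "openin T G" "p \<in> G" "G \<subseteq> {x \<in> U. dist (\<phi> p) (\<phi> x) < r}"
      "\<And>x. x \<in> G \<Longrightarrow> \<psi> (\<phi> x) = 1"
    and cut: "\<And>h :: 'e \<Rightarrow> real. smooth_on V (ball (\<phi> p) r \<inter> V) h \<Longrightarrow>
      (\<lambda>x. if x \<in> U \<and> dist (\<phi> p) (\<phi> x) < r then \<psi> (\<phi> x) * h (\<phi> x) else 0) \<in> smooth_functions M"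
    using chart_cutoff[OF c c0(2)] by blast
  let ?B = "ball (\<phi> p) r \<inter> V"
  have range_V: "\<phi> ` U \<subseteq> V" using openin_imp_subset[OF chart_range_open[OF chart]] .
  have B_open: "openin (top_of_set V) ?B"
    by (metis inf_commute open_ball openin_open_Int)
  have B_convex: "convex ?B"
    by (intro convex_Int convex_ball subspace_imp_convex subspace_V)
  have sm: "smooth_on V ?B (f \<circ> inv_into U \<phi>)" if "f \<in> smooth_functions M" for f
    by (rule smooth_on_subset[OF smooth_function_in_chart[OF that c]]) (use r(2) in auto)
  let ?D = "\<lambda>x. x \<in> U \<and> dist (\<phi> p) (\<phi> x) < r"
  have in_B: "\<phi> x \<in> ?B" if "?D x" for x using that range_V by auto
  define x where "x b = (\<lambda>q. if ?D q then \<psi> (\<phi> q) * (\<phi> q \<bullet> b) else 0)" for b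
  \<comment> \<open>The value 0 on non-smooth \<open>f\<close> is forced by the convention that
    tangent vectors are supported on the smooth functions.\<close>
  define d where "d b = (\<lambda>q f. if f \<in> smooth_functions M \<and> ?D q
      then \<psi> (\<phi> q) * dir_deriv (f \<circ> inv_into U \<phi>) b (\<phi> q) else 0)" for b
  have x_smooth: "x b \<in> smooth_functions M" for b
    unfolding x_def
    by (intro cut smooth_on_bounded_linear[OF bounded_linear_inner_left] smooth_on_id)
  have d_field: "d b \<in> vector_fields M" if b: "b \<in> E" for b
  proof -
    have bV: "b \<in> V" using b E(2) by blast
    note der = smooth_on_dir_has_vector_derivative[OF subspace_V B_open in_B bV sm]
    have "d b q \<in> tangent M q" for q
    proof (cases "?D q")
      case True
      have add: "dir_deriv ((f + g) \<circ> inv_into U \<phi>) b (\<phi> q)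
        = dir_deriv (f \<circ> inv_into U \<phi>) b (\<phi> q) + dir_deriv (g \<circ> inv_into U \<phi>) b (\<phi> q)"
        if "f \<in> smooth_functions M" "g \<in> smooth_functions M" for f g
        using vector_derivative_at[OF has_vector_derivative_add[OF der[OF True that(1)] der[OF True that(2)]]]
        by (simp add: dir_deriv_def)
      have scale: "dir_deriv ((c *\<^sub>R f) \<circ> inv_into U \<phi>) b (\<phi> q) = c * dir_deriv (f \<circ> inv_into U \<phi>) b (\<phi> q)"
        if "f \<in> smooth_functions M" for c f
        using vector_derivative_at[OF has_vector_derivative_mult_right[OF der[OF True that], of c]]
        by (simp add: dir_deriv_def)
      have mult: "dir_deriv ((f * g) \<circ> inv_into U \<phi>) b (\<phi> q)
        = f q * dir_deriv (g \<circ> inv_into U \<phi>) b (\<phi> q) + g q * dir_deriv (f \<circ> inv_into U \<phi>) b (\<phi> q)"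
        if "f \<in> smooth_functions M" "g \<in> smooth_functions M" for f g
        using vector_derivative_at[OF has_vector_derivative_mult[OF der[OF True that(1)] der[OF True that(2)]]]
          chart_inv[OF chart] True
        by (simp add: dir_deriv_def)
      show ?thesis
        using True
        by (auto simp: tangent_def supported_on_def linear_over_def d_def add scale mult algebra_simps)
    next
      case False
      then have "d b q = 0" by (auto simp: d_def fun_eq_iff)
      then show ?thesis by (simp add: tangent_def supported_on_def linear_over_def)
    qed
    moreover have "supported_on (points M) (d b)"
      using openin_subset[OF chart_domain_open[OF chart]]
      by (auto simp: supported_on_def d_def fun_eq_iff)
    moreover have "(\<lambda>q. d b q f) \<in> smooth_functions M" if f: "f \<in> smooth_functions M" for f
      using cut[OF smooth_on_dir_deriv[OF subspace_V B_open sm[OF f] bV]] f by (simp add: d_def)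
    ultimately show ?thesis by (simp add: vector_fields_def)
  qed
  have "v = (\<Sum>b\<in>E. v (x b) *\<^sub>R d b q)" if q: "q \<in> G" and v: "v \<in> tangent M q" for q v
  proof
    fix f
    have Dq: "?D q" using q G(3) by blast
    have qM: "q \<in> points M" using q openin_subset[OF G(1)] by blast
    show "v f = (\<Sum>b\<in>E. v (x b) *\<^sub>R d b q) f"
    proof (cases "f \<in> smooth_functions M")
      case False
      then show ?thesis using v by (simp add: tangent_supported sum_fun_apply d_def)
    next
      case f: True
      let ?H = "f \<circ> inv_into U \<phi>"
      obtain g where g: "\<And>b. b \<in> E \<Longrightarrow> smooth_on V ?B (g b)"
        "\<And>b. b \<in> E \<Longrightarrow> g b (\<phi> q) = dir_deriv ?H b (\<phi> q)"
        "\<And>y. y \<in> ?B \<Longrightarrow> ?H y = ?H (\<phi> q) + (\<Sum>b\<in>E. ((y - \<phi> q) \<bullet> b) * g b y)"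
        using hadamard[OF subspace_V B_open B_convex in_B[OF Dq] sm[OF f] E] by blast
      define k where "k b = (\<lambda>q. if ?D q then \<psi> (\<phi> q) * g b (\<phi> q) else 0)" for b
      have k: "k b \<in> smooth_functions M" if "b \<in> E" for b
        unfolding k_def by (rule cut[OF g(1)[OF that]])
      \<comment> \<open>The Hadamard expansion of \<open>f\<close> around \<open>q\<close>, with
        every ingredient cut off to make it a global smooth function; it equals \<open>f\<close> on
        \<open>G\<close>, where the cutoff is 1.\<close>
      define F where "F = const_on (points M) (f q) + (\<Sum>b\<in>E. (x b - const_on (points M) (\<phi> q \<bullet> b)) * k b)"
      have "v f = v F"
      proof (rule tangent_local[OF v f _ G(1) q])
        show "F \<in> smooth_functions M" unfolding F_def using x_smooth k by simp
        fix z assume z: "z \<in> G"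
        have Dz: "?D z" using z G(3) by blast
        have "z \<in> points M" using z openin_subset[OF G(1)] by blast
        then show "f z = F z"
          using g(3)[OF in_B[OF Dz]] chart_inv[OF chart] Dz Dq G(4)[OF z]
          by (simp add: F_def sum_fun_apply x_def k_def inner_diff_left)
      qed
      also have "\<dots> = (\<Sum>b\<in>E. k b q * v (x b))"
        unfolding F_def using x_smooth k v qM Dq G(4)[OF q]
        by (simp add: tangent_add tangent_sum tangent_mult tangent_diff tangent_const x_def[of _]
            del: mult_eq_0_iff)
      also have "\<dots> = (\<Sum>b\<in>E. v (x b) *\<^sub>R d b q) f"
        using g(2) Dq f G(4)[OF q] by (auto simp: sum_fun_apply k_def d_def intro!: sum.cong)
      finally show ?thesis .
    qed
  qed
  then show ?thesis
    using E(1) G(1,2) x_smooth d_field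
    by (intro exI[of _ E] exI[of _ x] exI[of _ d] exI[of _ G]) simp
qed

end

text \<open>For vector fields and forms, local frames take the place of charts. The index type is
  fixed to that of the model space since a formula of HOL cannot quantify over types.\<close>

locale framed_space = function_space X
  for X :: "('p, 'e::euclidean_space) smooth_structure" +
  assumes ex_frame: "p \<in> points X \<Longrightarrow> \<exists>(E :: 'e set) x d G. finite E \<and> openin (top_of X) G \<and> p \<in> G \<and>
    (\<forall>b\<in>E. x b \<in> smooth_functions X \<and> d b \<in> vector_fields X) \<and>
    (\<forall>q\<in>G. \<forall>v\<in>tangent X q. v = (\<Sum>b\<in>E. v (x b) *\<^sub>R d b q))"

sublocale manifold \<subseteq> framed_space M
  using ex_frame by unfold_locales

section \<open>Embedded submanifolds\<close>

locale embedded = manifold M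
  for M :: "('p, 'e::euclidean_space) smooth_structure" +
  fixes S :: "'p set" and W :: "'e set"
  assumes embedded: "embedded_submanifold M S W"
begin

abbreviation "N \<equiv> submanifold M S W"

lemma subspace_W: "subspace W" and W_subset: "W \<subseteq> V" and S_subset: "S \<subseteq> points M"
  using embedded by (auto simp: embedded_submanifold_def)

lemma points_N [simp]: "points N = S"
  using S_subset by (auto simp: submanifold_def)

lemma top_N: "top_of N = subtopology T S" and model_N: "model N = W"
  by (auto simp: submanifold_def)

lemma atlas_N_iff: "(A, \<phi>) \<in> atlas N \<longleftrightarrow> (\<exists>U. (U, \<phi>) \<in> adapted_charts M S W \<and> A = U \<inter> S)"
  by (auto simp: submanifold_def image_iff split: prod.splits)

lemma adapted_maximal: "(U, \<phi>) \<in> adapted_charts M S W \<Longrightarrow> (U, \<phi>) \<in> maximal_atlas M"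
  and adapted_image: "(U, \<phi>) \<in> adapted_charts M S W \<Longrightarrow> \<phi> ` (U \<inter> S) = \<phi> ` U \<inter> W"
  by (auto simp: adapted_charts_def)

lemma adapted_inv:
  assumes "(U, \<phi>) \<in> adapted_charts M S W" "p \<in> U" "p \<in> S"
  shows "inv_into (U \<inter> S) \<phi> (\<phi> p) = p"
  using assms chart_inj[OF maximal_is_chart[OF adapted_maximal]]
  by (intro inv_into_f_f) (auto intro: inj_on_subset)

lemma adapted_inv_eq:
  assumes c: "(U, \<phi>) \<in> adapted_charts M S W" and y: "y \<in> \<phi> ` (U \<inter> S)"
  shows "inv_into (U \<inter> S) \<phi> y = inv_into U \<phi> y"
  using y adapted_inv[OF c] chart_inv[OF maximal_is_chart[OF adapted_maximal[OF c]]] by auto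

lemma adapted_is_chart:
  assumes c: "(U, \<phi>) \<in> adapted_charts M S W"
  shows "is_chart N (U \<inter> S, \<phi>)"
proof -
  note chart = maximal_is_chart[OF adapted_maximal[OF c]]
  have "openin (top_of N) (U \<inter> S)"
    using chart_domain_open[OF chart] by (auto simp: top_N openin_subtopology)
  moreover have "openin (top_of_set W) (\<phi> ` (U \<inter> S))"
  proof -
    obtain B where "open B" "\<phi> ` U = V \<inter> B"
      using chart_range_open[OF chart] by (auto simp: openin_open)
    then have "\<phi> ` (U \<inter> S) = W \<inter> B" using adapted_image[OF c] W_subset by blast
    then show ?thesis using \<open>open B\<close> by (auto simp: openin_open)
  qed
  moreover have "homeomorphic_map (subtopology (top_of N) (U \<inter> S)) (top_of_set (\<phi> ` (U \<inter> S))) \<phi>"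
  proof -
    have "homeomorphic_map (subtopology (subtopology T U) (U \<inter> S))
        (subtopology (top_of_set (\<phi> ` U)) (\<phi> ` (U \<inter> S))) \<phi>"
    proof (rule homeomorphic_map_subtopologies[OF chart_homeo[OF chart]])
      show "\<phi> ` (topspace (subtopology T U) \<inter> (U \<inter> S)) = topspace (top_of_set (\<phi> ` U)) \<inter> \<phi> ` (U \<inter> S)"
        unfolding chart_topspace[OF chart] by auto
    qed
    moreover have "\<phi> ` U \<inter> \<phi> ` (U \<inter> S) = \<phi> ` (U \<inter> S)" "U \<inter> (U \<inter> S) = U \<inter> S" "S \<inter> (U \<inter> S) = U \<inter> S"
      by auto
    ultimately show ?thesis by (simp add: top_N subtopology_subtopology)
  qed
  ultimately show ?thesis by (simp add: is_chart_def model_N)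
qed

lemma smooth_manifold_N: "smooth_manifold N"
  unfolding smooth_manifold_def
proof (intro conjI ballI)
  show "subspace (model N)" using subspace_W by (simp add: model_N)
  show "Hausdorff_space (top_of N)"
    unfolding top_N by (rule Hausdorff_space_subtopology[OF Hausdorff])
  show "second_countable (top_of N)"
    unfolding top_N using smooth_manifold
    by (intro second_countable_subtopology) (simp add: smooth_manifold_def)
  show "(\<Union>(U, \<phi>)\<in>atlas N. U) = points N"
  proof
    show "(\<Union>(U, \<phi>)\<in>atlas N. U) \<subseteq> points N" by (auto simp: atlas_N_iff)
    show "points N \<subseteq> (\<Union>(U, \<phi>)\<in>atlas N. U)"
    proof
      fix q assume "q \<in> points N"
      then have "q \<in> S" by simp
      then obtain U \<phi> where "(U, \<phi>) \<in> adapted_charts M S W" "q \<in> U"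
        using embedded by (auto simp: embedded_submanifold_def)
      then have "(U \<inter> S, \<phi>) \<in> atlas N" "q \<in> U \<inter> S" using \<open>q \<in> S\<close> by (auto simp: atlas_N_iff)
      then show "q \<in> (\<Union>(U, \<phi>)\<in>atlas N. U)" by blast
    qed
  qed
  fix c assume c: "c \<in> atlas N"
  then obtain U \<phi> where U: "c = (U \<inter> S, \<phi>)" "(U, \<phi>) \<in> adapted_charts M S W"
    by (cases c) (auto simp: atlas_N_iff)
  show "is_chart N c" unfolding U(1) by (rule adapted_is_chart[OF U(2)])
  fix c' assume c': "c' \<in> atlas N"
  then obtain U' \<phi>' where U': "c' = (U' \<inter> S, \<phi>')" "(U', \<phi>') \<in> adapted_charts M S W"
    by (cases c') (auto simp: atlas_N_iff)
  have "smooth_on V (\<phi> ` (U \<inter> U')) (\<phi>' \<circ> inv_into U \<phi>)"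
    using maximal_transition[OF adapted_maximal[OF U(2)] adapted_maximal[OF U'(2)]]
    by (simp add: smooth_transition_iff)
  then have "smooth_on W (\<phi> ` ((U \<inter> S) \<inter> (U' \<inter> S))) (\<phi>' \<circ> inv_into U \<phi>)"
    by (rule smooth_on_subset) (use W_subset in auto)
  then have "smooth_on W (\<phi> ` ((U \<inter> S) \<inter> (U' \<inter> S))) (\<phi>' \<circ> inv_into (U \<inter> S) \<phi>)"
  proof (rule smooth_on_cong[THEN iffD1, rotated])
    show "(\<phi>' \<circ> inv_into U \<phi>) y = (\<phi>' \<circ> inv_into (U \<inter> S) \<phi>) y"
      if "y \<in> \<phi> ` ((U \<inter> S) \<inter> (U' \<inter> S))" for y
      using adapted_inv_eq[OF U(2), of y] that by auto
  qed
  then show "smooth_transition N c c'" by (simp add: U(1) U'(1) smooth_transition_iff model_N)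
qed

sublocale N: manifold N
  by unfold_locales (rule smooth_manifold_N)

lemma restrict_smooth:
  assumes f: "f \<in> smooth_functions M"
  shows "restrict0 S f \<in> smooth_functions N"
proof -
  have "smooth_on W (\<phi> ` (U \<inter> S)) (restrict0 S f \<circ> inv_into (U \<inter> S) \<phi>)"
    if c: "(U, \<phi>) \<in> adapted_charts M S W" for U \<phi>
  proof (rule smooth_on_cong[THEN iffD1, rotated])
    show "smooth_on W (\<phi> ` (U \<inter> S)) (f \<circ> inv_into U \<phi>)"
      by (rule smooth_on_subset[OF smooth_function_in_chart[OF f adapted_maximal[OF c]]])
        (use W_subset in auto)
    show "(f \<circ> inv_into U \<phi>) y = (restrict0 S f \<circ> inv_into (U \<inter> S) \<phi>) y"
      if "y \<in> \<phi> ` (U \<inter> S)" for y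
      using adapted_inv_eq[OF c that] inv_into_into[OF that] by (simp add: restrict0_def)
  qed
  then show ?thesis
    by (auto simp: smooth_functions_def supported_on_def restrict0_def atlas_N_iff model_N)
qed

text \<open>In an adapted chart, compose \<open>g\<close> with the orthogonal projection
  \<open>pr\<close> onto \<open>W\<close>, then cut off. Agreement is claimed near \<open>q\<close>
  only, as \<open>S\<close> need not be closed in \<open>M\<close>.\<close>

lemma local_extension:
  assumes g: "g \<in> smooth_functions N" and q: "q \<in> S"
  shows "\<exists>F\<in>smooth_functions M. \<exists>G. openin (top_of N) G \<and> q \<in> G \<and> (\<forall>x\<in>G. F x = g x)"
proof -
  obtain U \<phi> where c: "(U, \<phi>) \<in> adapted_charts M S W" "q \<in> U"
    using embedded q by (auto simp: embedded_submanifold_def)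
  obtain r G \<psi> where r: "r > 0" "cball (\<phi> q) r \<inter> V \<subseteq> \<phi> ` U"
    and G: "openin T G" "q \<in> G" "G \<subseteq> {x \<in> U. dist (\<phi> q) (\<phi> x) < r}"
      "\<And>x. x \<in> G \<Longrightarrow> \<psi> (\<phi> x) = 1"
    and cut: "\<And>h :: 'e \<Rightarrow> real. smooth_on V (ball (\<phi> q) r \<inter> V) h \<Longrightarrow>
      (\<lambda>x. if x \<in> U \<and> dist (\<phi> q) (\<phi> x) < r then \<psi> (\<phi> x) * h (\<phi> x) else 0) \<in> smooth_functions M"
    using chart_cutoff[OF adapted_maximal[OF c(1)] c(2)] by blast
  obtain E where E: "finite E" "E \<subseteq> W" "\<And>b c. b \<in> E \<Longrightarrow> c \<in> E \<Longrightarrow> b \<bullet> c = (if b = c then 1 else 0)"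
    "\<And>w. w \<in> W \<Longrightarrow> (\<Sum>b\<in>E. (w \<bullet> b) *\<^sub>R b) = w"
    using orthonormal_basis_expansion[OF subspace_W] by metis
  define pr where "pr y = (\<Sum>b\<in>E. (y \<bullet> b) *\<^sub>R b)" for y
  have pr_W: "pr y \<in> W" for y
    unfolding pr_def using E(2) by (intro subspace_sum subspace_scale subspace_W) auto
  have pr_linear: "bounded_linear pr"
    unfolding pr_def by (intro bounded_linear_sum bounded_linear_scaleR_const bounded_linear_inner_left)
  \<comment> \<open>The projection does not increase norms and fixes \<open>\<phi> q\<close>, so it
    keeps the ball around \<open>\<phi> q\<close> inside the image of the chart, where
    \<open>g\<close> can be evaluated.\<close>
  have pr_norm: "norm (pr y) \<le> norm y" for y
  proof -
    have "pr y \<bullet> b = y \<bullet> b" if "b \<in> E" for b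
    proof -
      have "pr y \<bullet> b = (\<Sum>a\<in>E. if a = b then y \<bullet> b else 0)"
        unfolding pr_def inner_sum_left using E(3) that by (intro sum.cong) auto
      then show ?thesis using E(1) that by simp
    qed
    moreover have "z \<bullet> pr y = (\<Sum>b\<in>E. (y \<bullet> b) * (z \<bullet> b))" for z
      by (simp add: pr_def inner_sum_right)
    ultimately have "pr y \<bullet> pr y = y \<bullet> pr y" by simp
    then have "norm (pr y) * norm (pr y) \<le> norm y * norm (pr y)"
      using norm_cauchy_schwarz[of y "pr y"] power2_norm_eq_inner[of "pr y"]
      by (simp add: power2_eq_square)
    then show ?thesis by (cases "pr y = 0") auto
  qed
  have qW: "\<phi> q \<in> W" using adapted_image[OF c(1)] c(2) q by blast
  have pr_ball: "pr y \<in> \<phi> ` (U \<inter> S)" if "y \<in> ball (\<phi> q) r \<inter> V" for y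
  proof -
    have "pr (\<phi> q) = \<phi> q" using E(4)[OF qW] by (simp add: pr_def)
    then have "dist (\<phi> q) (pr y) = norm (pr (\<phi> q - y))"
      by (simp add: dist_norm linear_diff[OF bounded_linear.linear[OF pr_linear]])
    also have "\<dots> \<le> dist (\<phi> q) y" using pr_norm by (simp add: dist_norm)
    finally have "pr y \<in> cball (\<phi> q) r \<inter> V" using that pr_W W_subset by auto
    then show ?thesis using r(2) adapted_image[OF c(1)] pr_W by blast
  qed
  let ?h = "\<lambda>y. (g \<circ> inv_into (U \<inter> S) \<phi>) (pr y)"
  let ?F = "\<lambda>x. if x \<in> U \<and> dist (\<phi> q) (\<phi> x) < r then \<psi> (\<phi> x) * ?h (\<phi> x) else 0"
  have "?F \<in> smooth_functions M"
  proof (rule cut)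
    show "smooth_on V (ball (\<phi> q) r \<inter> V) ?h"
    proof (rule smooth_on_compose[OF subspace_W])
      show "\<phi> ` (U \<inter> S) \<subseteq> W" using adapted_image[OF c(1)] by blast
      show "pr ` (ball (\<phi> q) r \<inter> V) \<subseteq> \<phi> ` (U \<inter> S)" using pr_ball by blast
      show "smooth_on V (ball (\<phi> q) r \<inter> V) pr"
        by (rule smooth_on_bounded_linear[OF pr_linear smooth_on_id])
      show "smooth_on W (\<phi> ` (U \<inter> S)) (g \<circ> inv_into (U \<inter> S) \<phi>)"
        using N.smooth_function_in_atlas_chart[OF g] c(1) by (auto simp: atlas_N_iff model_N)
    qed
  qed
  moreover have "openin (top_of N) (G \<inter> S)" using G(1) by (auto simp: top_N openin_subtopology)
  moreover have "?F x = g x" if x: "x \<in> G \<inter> S" for x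
  proof -
    have xU: "x \<in> U" "dist (\<phi> q) (\<phi> x) < r" using x G(3) by auto
    have "\<phi> x \<in> W" using adapted_image[OF c(1)] xU x by blast
    then have "pr (\<phi> x) = \<phi> x" using E(4) by (simp add: pr_def)
    then show ?thesis using xU x G(4) adapted_inv[OF c(1)] by simp
  qed
  moreover have "q \<in> G \<inter> S" using G(2) q by blast
  ultimately show ?thesis by (intro bexI[of _ ?F] exI[of _ "G \<inter> S"] conjI ballI)
qed

end

section \<open>Vector fields and 1-forms along a submanifold\<close>

lemma module_mult_apply [simp]: "(f \<bullet>\<^sub>s s) q = f q *\<^sub>R s q"
  by (simp add: module_mult_def)

lemma restrict0_apply [simp]: "x \<in> A \<Longrightarrow> restrict0 A f x = f x"
  by (simp add: restrict0_def)

lemma restrict0_supported: "supported_on A f \<Longrightarrow> restrict0 A f = f"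
  by (auto simp: restrict0_def supported_on_def fun_eq_iff)

definition contract :: "('p \<Rightarrow> 'p covec) \<Rightarrow> ('p \<Rightarrow> 'p tvec) \<Rightarrow> 'p \<Rightarrow> real" where
  "contract \<sigma> V = (\<lambda>q. \<sigma> q (V q))"

lemma subspace_tangent: "subspace (tangent X p)"
  by (auto simp: subspace_def tangent_def supported_on_def linear_over_def algebra_simps)

lemma subspace_cotangent: "subspace (cotangent X p)"
  by (auto simp: subspace_def cotangent_def dual_of_def supported_on_def linear_over_def algebra_simps)

lemma cotangent_supported: "\<alpha> \<in> cotangent X p \<Longrightarrow> v \<notin> tangent X p \<Longrightarrow> \<alpha> v = 0"
  by (simp add: cotangent_def dual_of_def supported_on_def)

lemma cotangent_add:
  "\<alpha> \<in> cotangent X p \<Longrightarrow> v \<in> tangent X p \<Longrightarrow> w \<in> tangent X p \<Longrightarrow> \<alpha> (v + w) = \<alpha> v + \<alpha> w"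
  by (simp add: cotangent_def dual_of_def linear_over_def)

lemma cotangent_scaleR:
  "\<alpha> \<in> cotangent X p \<Longrightarrow> v \<in> tangent X p \<Longrightarrow> \<alpha> (c *\<^sub>R v) = c * \<alpha> v"
  by (simp add: cotangent_def dual_of_def linear_over_def)

lemma cotangent_zero: "\<alpha> \<in> cotangent X p \<Longrightarrow> \<alpha> 0 = 0"
  using cotangent_scaleR[of \<alpha> X p 0 0] subspace_0[OF subspace_tangent, of X p] by simp

lemma cotangent_minus: "\<alpha> \<in> cotangent X p \<Longrightarrow> v \<in> tangent X p \<Longrightarrow> \<alpha> (- v) = - \<alpha> v"
  using cotangent_scaleR[of \<alpha> X p v "-1"] by simp

lemma cotangent_diff:
  "\<alpha> \<in> cotangent X p \<Longrightarrow> v \<in> tangent X p \<Longrightarrow> w \<in> tangent X p \<Longrightarrow> \<alpha> (v - w) = \<alpha> v - \<alpha> w"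
  using cotangent_add[of \<alpha> X p v "- w"] cotangent_minus[of \<alpha> X p w]
    subspace_neg[OF subspace_tangent, of w X p] by simp

lemma cotangent_sum:
  "\<alpha> \<in> cotangent X p \<Longrightarrow> (\<And>i. i \<in> I \<Longrightarrow> v i \<in> tangent X p) \<Longrightarrow> \<alpha> (\<Sum>i\<in>I. v i) = (\<Sum>i\<in>I. \<alpha> (v i))"
  by (induction I rule: infinite_finite_induct)
    (auto simp: cotangent_zero cotangent_add subspace_sum[OF subspace_tangent])

lemma cotangent_eqI:
  assumes "\<alpha> \<in> cotangent X p" "\<beta> \<in> cotangent X p" "\<And>v. v \<in> tangent X p \<Longrightarrow> \<alpha> v = \<beta> v"
  shows "\<alpha> = \<beta>"
proof
  show "\<alpha> v = \<beta> v" for v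
    using assms(3) cotangent_supported[OF assms(1)] cotangent_supported[OF assms(2)]
    by (cases "v \<in> tangent X p") auto
qed

lemma d0_apply: "p \<in> points X \<Longrightarrow> v \<in> tangent X p \<Longrightarrow> d0 X f p v = v f"
  by (simp add: d0_def)

lemma d0_cotangent: "d0 X f p \<in> cotangent X p"
  by (auto simp: cotangent_def dual_of_def supported_on_def linear_over_def d0_def
      subspace_add[OF subspace_tangent] subspace_scale[OF subspace_tangent])

lemma d0_outside: "p \<notin> points X \<Longrightarrow> d0 X f p = 0"
  by (simp add: d0_def fun_eq_iff)

lemma d0_nonsmooth: "f \<notin> smooth_functions X \<Longrightarrow> d0 X f p = 0"
  by (auto simp: d0_def fun_eq_iff tangent_supported)

lemma d0_add:
  "f \<in> smooth_functions X \<Longrightarrow> g \<in> smooth_functions X \<Longrightarrow> d0 X (f + g) = d0 X f + d0 X g"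
  by (auto simp: d0_def fun_eq_iff tangent_add)

lemma d0_scaleR: "f \<in> smooth_functions X \<Longrightarrow> d0 X (c *\<^sub>R f) = c *\<^sub>R d0 X f"
  by (auto simp: d0_def fun_eq_iff tangent_scaleR)

lemma d0_mult:
  "f \<in> smooth_functions X \<Longrightarrow> g \<in> smooth_functions X \<Longrightarrow> d0 X (f * g) = f \<bullet>\<^sub>s d0 X g + g \<bullet>\<^sub>s d0 X f"
  by (auto simp: d0_def fun_eq_iff tangent_mult)

lemma push_apply:
  "f \<in> smooth_functions M \<Longrightarrow> push M N w f = w (restrict0 (points N) f)"
  by (simp add: push_def)

text \<open>The inclusion of a submanifold, reduced to topology and to restriction and local
  extension of functions. These properties also hold for \<open>N = M\<close>, so results about
  sections along \<open>N\<close> specialise to ordinary fields and forms.\<close>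

locale pair = M: framed_space M + N: framed_space N
  for M N :: "('p, 'e::euclidean_space) smooth_structure" +
  assumes points_subset: "points N \<subseteq> points M"
    and open_N: "openin (top_of M) G \<Longrightarrow> openin (top_of N) (G \<inter> points N)"
    and restrict_smooth: "f \<in> smooth_functions M \<Longrightarrow> restrict0 (points N) f \<in> smooth_functions N"
    and local_extension: "g \<in> smooth_functions N \<Longrightarrow> q \<in> points N \<Longrightarrow>
      \<exists>F\<in>smooth_functions M. \<exists>G. openin (top_of N) G \<and> q \<in> G \<and> (\<forall>x\<in>G. F x = g x)"
begin

abbreviation "S \<equiv> points N"
abbreviation "forms \<equiv> one_forms_along M N"
abbreviation "vfields \<equiv> vector_fields_along M N"

text \<open>A section of the cotangent bundle of \<open>M\<close> along \<open>S\<close>, not a form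
  on \<open>S\<close>: it still pairs with vectors transversal to \<open>S\<close>.\<close>

definition exact :: "('p \<Rightarrow> real) \<Rightarrow> 'p \<Rightarrow> 'p covec" where
  "exact f = restrict0 S (d0 M f)"

lemma S_in_M: "q \<in> S \<Longrightarrow> q \<in> points M"
  using points_subset by blast

lemma extend_smooth:
  assumes "g \<in> smooth_functions N" "q \<in> S"
  obtains F G where "F \<in> smooth_functions M" "openin (top_of N) G" "q \<in> G"
    "\<forall>x\<in>G. restrict0 S F x = g x"
proof -
  obtain F G where F: "F \<in> smooth_functions M" "openin (top_of N) G" "q \<in> G" "\<forall>x\<in>G. F x = g x"
    using local_extension[OF assms] by blast
  show thesis
  proof (rule that[OF F(1-3)])
    show "\<forall>x\<in>G. restrict0 S F x = g x"
      using F(4) openin_subset[OF F(2)] by auto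
  qed
qed

lemma field_tangent: "V \<in> vfields \<Longrightarrow> q \<in> S \<Longrightarrow> V q \<in> tangent M q"
  and field_outside: "V \<in> vfields \<Longrightarrow> q \<notin> S \<Longrightarrow> V q = 0"
  and field_smooth: "V \<in> vfields \<Longrightarrow> f \<in> smooth_functions M \<Longrightarrow> (\<lambda>q. V q f) \<in> smooth_functions N"
  by (auto simp: vector_fields_along_def supported_on_def)

lemma form_cotangent: "\<sigma> \<in> forms \<Longrightarrow> q \<in> S \<Longrightarrow> \<sigma> q \<in> cotangent M q"
  and form_outside: "\<sigma> \<in> forms \<Longrightarrow> q \<notin> S \<Longrightarrow> \<sigma> q = 0"
  and contract_smooth: "\<sigma> \<in> forms \<Longrightarrow> V \<in> vfields \<Longrightarrow> contract \<sigma> V \<in> smooth_functions N"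
  by (auto simp: one_forms_along_def supported_on_def contract_def)

lemma fieldI:
  assumes "\<And>q. q \<notin> S \<Longrightarrow> V q = 0" "\<And>q. q \<in> S \<Longrightarrow> V q \<in> tangent M q"
    "\<And>f. f \<in> smooth_functions M \<Longrightarrow> (\<lambda>q. V q f) \<in> smooth_functions N"
  shows "V \<in> vfields"
  using assms by (simp add: vector_fields_along_def supported_on_def)

lemma formI:
  assumes "\<And>q. q \<notin> S \<Longrightarrow> \<sigma> q = 0" "\<And>q. q \<in> S \<Longrightarrow> \<sigma> q \<in> cotangent M q"
    "\<And>V. V \<in> vfields \<Longrightarrow> contract \<sigma> V \<in> smooth_functions N"
  shows "\<sigma> \<in> forms"
  using assms by (simp add: one_forms_along_def supported_on_def contract_def)

lemma field_add: "V \<in> vfields \<Longrightarrow> V' \<in> vfields \<Longrightarrow> V + V' \<in> vfields"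
proof (rule fieldI)
  assume V: "V \<in> vfields" "V' \<in> vfields"
  show "(\<lambda>q. (V + V') q f) \<in> smooth_functions N" if "f \<in> smooth_functions M" for f
    using N.add_smooth[OF field_smooth[OF V(1) that] field_smooth[OF V(2) that]]
    by (simp add: plus_fun_def)
qed (auto simp: field_outside field_tangent subspace_add[OF subspace_tangent])

lemma field_mult: "a \<in> smooth_functions N \<Longrightarrow> V \<in> vfields \<Longrightarrow> a \<bullet>\<^sub>s V \<in> vfields"
proof (rule fieldI)
  assume a: "a \<in> smooth_functions N" "V \<in> vfields"
  show "(\<lambda>q. (a \<bullet>\<^sub>s V) q f) \<in> smooth_functions N" if "f \<in> smooth_functions M" for f
    using N.mult_smooth[OF a(1) field_smooth[OF a(2) that]] by (simp add: times_fun_def)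
qed (auto simp: field_outside field_tangent subspace_scale[OF subspace_tangent])

lemma zero_field: "0 \<in> vfields"
proof (rule fieldI)
  show "(\<lambda>q. (0 :: 'p \<Rightarrow> 'p tvec) q f) \<in> smooth_functions N" for f
    using N.zero_smooth by (simp add: zero_fun_def)
qed (auto simp: subspace_0[OF subspace_tangent])

text \<open>Real scalars become constant functions, so that real linearity follows from linearity
  over functions.\<close>

lemma scaleR_eq_module_mult:
  assumes "\<And>q. q \<notin> S \<Longrightarrow> s q = 0"
  shows "c *\<^sub>R s = const_on S c \<bullet>\<^sub>s s"
proof
  show "(c *\<^sub>R s) q = (const_on S c \<bullet>\<^sub>s s) q" for q
    using assms by (cases "q \<in> S") auto
qed

lemma field_scaleR: "V \<in> vfields \<Longrightarrow> c *\<^sub>R V \<in> vfields"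
  by (subst scaleR_eq_module_mult) (auto simp: field_outside intro!: field_mult)

lemma field_diff: "V \<in> vfields \<Longrightarrow> V' \<in> vfields \<Longrightarrow> V - V' \<in> vfields"
  using field_add[of V "(-1) *\<^sub>R V'"] field_scaleR[of V' "-1"] by simp

lemma field_sum: "(\<And>i. i \<in> I \<Longrightarrow> V i \<in> vfields) \<Longrightarrow> (\<Sum>i\<in>I. V i) \<in> vfields"
  by (induction I rule: infinite_finite_induct) (auto simp: zero_field field_add)

lemma form_add: "\<sigma> \<in> forms \<Longrightarrow> \<tau> \<in> forms \<Longrightarrow> \<sigma> + \<tau> \<in> forms"
proof (rule formI)
  assume s: "\<sigma> \<in> forms" "\<tau> \<in> forms"
  show "contract (\<sigma> + \<tau>) V \<in> smooth_functions N" if "V \<in> vfields" for V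
    using N.add_smooth[OF contract_smooth[OF s(1) that] contract_smooth[OF s(2) that]]
    by (simp add: plus_fun_def contract_def)
qed (auto simp: form_outside form_cotangent subspace_add[OF subspace_cotangent])

lemma form_mult: "a \<in> smooth_functions N \<Longrightarrow> \<sigma> \<in> forms \<Longrightarrow> a \<bullet>\<^sub>s \<sigma> \<in> forms"
proof (rule formI)
  assume a: "a \<in> smooth_functions N" "\<sigma> \<in> forms"
  show "contract (a \<bullet>\<^sub>s \<sigma>) V \<in> smooth_functions N" if "V \<in> vfields" for V
    using N.mult_smooth[OF a(1) contract_smooth[OF a(2) that]] by (simp add: times_fun_def contract_def)
qed (auto simp: form_outside form_cotangent subspace_scale[OF subspace_cotangent])

lemma zero_form: "0 \<in> forms"
proof (rule formI)
  show "contract 0 V \<in> smooth_functions N" for V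
    using N.zero_smooth by (simp add: zero_fun_def contract_def)
qed (auto simp: subspace_0[OF subspace_cotangent])

lemma form_scaleR: "\<sigma> \<in> forms \<Longrightarrow> c *\<^sub>R \<sigma> \<in> forms"
  by (subst scaleR_eq_module_mult) (auto simp: form_outside intro!: form_mult)

lemma form_minus: "\<sigma> \<in> forms \<Longrightarrow> - \<sigma> \<in> forms"
  using form_scaleR[of \<sigma> "-1"] by simp

lemma form_diff: "\<sigma> \<in> forms \<Longrightarrow> \<tau> \<in> forms \<Longrightarrow> \<sigma> - \<tau> \<in> forms"
  using form_add[of \<sigma> "- \<tau>"] form_minus by simp

lemma form_sum: "(\<And>i. i \<in> I \<Longrightarrow> \<sigma> i \<in> forms) \<Longrightarrow> (\<Sum>i\<in>I. \<sigma> i) \<in> forms"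
  by (induction I rule: infinite_finite_induct) (auto simp: zero_form form_add)

lemma exact_apply: "q \<in> S \<Longrightarrow> v \<in> tangent M q \<Longrightarrow> exact f q v = v f"
  by (simp add: exact_def d0_apply S_in_M)

lemma exact_at: "q \<in> S \<Longrightarrow> exact f q = d0 M f q"
  by (simp add: exact_def)

lemma exact_outside: "q \<notin> S \<Longrightarrow> exact f q = 0"
  by (simp add: exact_def restrict0_def)

lemma contract_exact: "V \<in> vfields \<Longrightarrow> contract (exact f) V = (\<lambda>q. V q f)"
proof
  fix q assume "V \<in> vfields"
  then show "contract (exact f) V q = V q f"
    by (cases "q \<in> S") (simp_all add: contract_def exact_apply field_tangent field_outside exact_outside)
qed

lemma exact_form: "f \<in> smooth_functions M \<Longrightarrow> exact f \<in> forms"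
  by (rule formI) (auto simp: contract_exact field_smooth, auto simp: exact_def restrict0_def d0_cotangent)

lemma restrict_field:
  assumes "V \<in> vector_fields M"
  shows "restrict0 S V \<in> vfields"
proof (rule fieldI)
  show "(\<lambda>q. restrict0 S V q f) \<in> smooth_functions N" if "f \<in> smooth_functions M" for f
  proof -
    have "(\<lambda>q. V q f) \<in> smooth_functions M" using assms that by (simp add: vector_fields_def)
    from restrict_smooth[OF this]
    show ?thesis by (simp add: restrict0_def if_distrib[of "\<lambda>v. v f"] cong: if_cong)
  qed
qed (use assms S_in_M in \<open>auto simp: restrict0_def vector_fields_def\<close>)

lemma ex_frame_along:
  assumes q: "q \<in> S"
  obtains E :: "'e set" and G x d where "finite E" "openin (top_of N) G" "q \<in> G"
    "\<forall>b\<in>E. x b \<in> smooth_functions M" "\<forall>b\<in>E. d b \<in> vector_fields M"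
    "\<forall>b\<in>E. restrict0 S (d b) \<in> vfields"
    "\<forall>z\<in>G. \<forall>v\<in>tangent M z. v = (\<Sum>b\<in>E. v (x b) *\<^sub>R restrict0 S (d b) z)"
proof -
  obtain E :: "'e set" and x d G where f: "finite E" "openin (top_of M) G" "q \<in> G"
    "\<forall>b\<in>E. x b \<in> smooth_functions M \<and> d b \<in> vector_fields M"
    "\<forall>z\<in>G. \<forall>v\<in>tangent M z. v = (\<Sum>b\<in>E. v (x b) *\<^sub>R d b z)"
    using M.ex_frame[OF S_in_M[OF q]] by blast
  show thesis
  proof (rule that[OF f(1) open_N[OF f(2)]])
    show "\<forall>z\<in>G \<inter> S. \<forall>v\<in>tangent M z. v = (\<Sum>b\<in>E. v (x b) *\<^sub>R restrict0 S (d b) z)"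
      using f(5) by simp
  qed (use f q restrict_field in auto)
qed

lemma form_at_frame:
  assumes "\<alpha> \<in> cotangent M z" "v \<in> tangent M z" "\<And>b. b \<in> E \<Longrightarrow> d b \<in> tangent M z"
    "v = (\<Sum>b\<in>E. v (x b) *\<^sub>R d b)"
  shows "\<alpha> v = (\<Sum>b\<in>E. v (x b) * \<alpha> (d b))"
proof -
  have "\<alpha> v = \<alpha> (\<Sum>b\<in>E. v (x b) *\<^sub>R d b)" using assms(4) by simp
  also have "\<dots> = (\<Sum>b\<in>E. v (x b) * \<alpha> (d b))"
    by (subst cotangent_sum[OF assms(1)])
      (simp_all add: assms(3) subspace_scale[OF subspace_tangent] cotangent_scaleR[OF assms(1)])
  finally show ?thesis .
qed

text \<open>Take the linear combination of frame functions whose coefficients are the values of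
  \<open>\<alpha>\<close> on the frame. Pointwise statements about forms can thereby be tested on
  differentials.\<close>

lemma covector_exact:
  assumes q: "q \<in> S" and \<alpha>: "\<alpha> \<in> cotangent M q"
  obtains f where "f \<in> smooth_functions M" "d0 M f q = \<alpha>"
proof -
  obtain E :: "'e set" and G x d where F: "finite E" "openin (top_of N) G" "q \<in> G"
    "\<forall>b\<in>E. x b \<in> smooth_functions M" "\<forall>b\<in>E. d b \<in> vector_fields M"
    "\<forall>b\<in>E. restrict0 S (d b) \<in> vfields"
    "\<forall>z\<in>G. \<forall>v\<in>tangent M z. v = (\<Sum>b\<in>E. v (x b) *\<^sub>R restrict0 S (d b) z)"
    using ex_frame_along[OF q] .
  note f = F(1-3) bspec[OF F(4)] bspec[OF F(5)] bspec[OF F(6)] bspec[OF bspec[OF F(7)]]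
  let ?f = "\<Sum>b\<in>E. \<alpha> (restrict0 S (d b) q) *\<^sub>R x b"
  have "d0 M ?f q = \<alpha>"
  proof (rule cotangent_eqI[OF d0_cotangent \<alpha>])
    fix v assume v: "v \<in> tangent M q"
    have "\<alpha> v = (\<Sum>b\<in>E. v (x b) * \<alpha> (restrict0 S (d b) q))"
      by (rule form_at_frame[OF \<alpha> v _ f(7)[OF f(3) v]]) (use f(6) field_tangent q in blast)
    also have "\<dots> = v ?f"
      using v f(4) by (simp add: M.tangent_sum tangent_scaleR mult.commute)
    finally show "d0 M ?f q v = \<alpha> v" using v q by (simp add: d0_apply S_in_M)
  qed
  moreover have "?f \<in> smooth_functions M" using f(4) by simp
  ultimately show thesis using that by blast
qed

lemma ex_field_through:
  assumes q: "q \<in> S" and v: "v \<in> tangent M q"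
  obtains V where "V \<in> vfields" "V q = v"
proof -
  obtain E :: "'e set" and G x d where F: "finite E" "openin (top_of N) G" "q \<in> G"
    "\<forall>b\<in>E. x b \<in> smooth_functions M" "\<forall>b\<in>E. d b \<in> vector_fields M"
    "\<forall>b\<in>E. restrict0 S (d b) \<in> vfields"
    "\<forall>z\<in>G. \<forall>v\<in>tangent M z. v = (\<Sum>b\<in>E. v (x b) *\<^sub>R restrict0 S (d b) z)"
    using ex_frame_along[OF q] .
  note f = F(1-3) bspec[OF F(4)] bspec[OF F(5)] bspec[OF F(6)] bspec[OF bspec[OF F(7)]]
  let ?V = "\<Sum>b\<in>E. v (x b) *\<^sub>R restrict0 S (d b)"
  have "?V q = v" using f(7)[OF f(3) v] by (simp add: sum_fun_apply)
  moreover have "?V \<in> vfields" using f(6) by (intro field_sum field_scaleR)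
  ultimately show thesis using that by blast
qed

text \<open>In a frame the contraction is a sum of products of two functions that both vanish at
  \<open>q\<close>, and a derivation at \<open>q\<close> kills such products.\<close>

lemma contract_vanishing:
  assumes q: "q \<in> S" and \<delta>: "\<delta> \<in> forms" "\<delta> q = 0" and V: "V \<in> vfields" "V q = 0"
    and w: "w \<in> tangent N q"
  shows "w (contract \<delta> V) = 0"
proof -
  obtain E :: "'e set" and G x d where F: "finite E" "openin (top_of N) G" "q \<in> G"
    "\<forall>b\<in>E. x b \<in> smooth_functions M" "\<forall>b\<in>E. d b \<in> vector_fields M"
    "\<forall>b\<in>E. restrict0 S (d b) \<in> vfields"
    "\<forall>z\<in>G. \<forall>v\<in>tangent M z. v = (\<Sum>b\<in>E. v (x b) *\<^sub>R restrict0 S (d b) z)"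
    using ex_frame_along[OF q] .
  note f = F(1-3) bspec[OF F(4)] bspec[OF F(5)] bspec[OF F(6)] bspec[OF bspec[OF F(7)]]
  let ?F = "\<Sum>b\<in>E. (\<lambda>z. V z (x b)) * contract \<delta> (restrict0 S (d b))"
  have sm: "(\<lambda>z. V z (x b)) \<in> smooth_functions N" "contract \<delta> (restrict0 S (d b)) \<in> smooth_functions N"
    if "b \<in> E" for b
    using that f(4,6) field_smooth[OF V(1)] contract_smooth[OF \<delta>(1)] by auto
  have "w (contract \<delta> V) = w ?F"
  proof (rule N.tangent_local[OF w contract_smooth[OF \<delta>(1) V(1)] _ f(2,3)])
    show "?F \<in> smooth_functions N" using sm by simp
    fix z assume z: "z \<in> G"
    then have zS: "z \<in> S" using openin_subset[OF f(2)] by blast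
    show "contract \<delta> V z = ?F z"
      unfolding contract_def sum_fun_apply times_fun_apply
      by (rule form_at_frame[OF form_cotangent[OF \<delta>(1) zS] field_tangent[OF V(1) zS] _
            f(7)[OF z field_tangent[OF V(1) zS]]])
        (use f(6) field_tangent zS in blast)
  qed
  also have "\<dots> = 0"
    using sm \<delta>(2) V(2) w by (simp add: N.tangent_sum tangent_mult contract_def)
  finally show ?thesis .
qed

lemma contract_indep:
  assumes q: "q \<in> S" and \<delta>: "\<delta> \<in> forms" "\<delta> q = 0" and V: "V \<in> vfields" "V' \<in> vfields" "V q = V' q"
    and w: "w \<in> tangent N q"
  shows "w (contract \<delta> V) = w (contract \<delta> V')"
proof -
  have "w (contract \<delta> (V - V')) = 0"
    by (rule contract_vanishing[OF q \<delta> field_diff[OF V(1,2)] _ w]) (simp add: V(3))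
  moreover have "contract \<delta> (V - V') = contract \<delta> V - contract \<delta> V'"
  proof
    fix z
    show "contract \<delta> (V - V') z = (contract \<delta> V - contract \<delta> V') z"
      using V(1,2) \<delta>(1)
      by (cases "z \<in> S") (auto simp: contract_def form_outside form_cotangent field_tangent
          cotangent_diff[OF form_cotangent])
  qed
  ultimately show ?thesis
    using N.tangent_diff[OF w contract_smooth[OF \<delta>(1) V(1)] contract_smooth[OF \<delta>(1) V(2)]] by simp
qed

text \<open>The expansion of \<open>\<sigma>\<close> in a frame holds only on \<open>G\<close>.
  Multiplication by a bump function makes it an identity of global sections, to which operators on
  sections can be applied.\<close>

lemma local_representation:
  assumes \<sigma>: "\<sigma> \<in> forms" and q: "q \<in> S"
  obtains \<rho> G E and a x :: "'e \<Rightarrow> 'p \<Rightarrow> real"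
  where "\<rho> \<in> smooth_functions N" "openin (top_of N) G" "q \<in> G" "\<forall>z\<in>G. \<rho> z = 1" "finite E"
    "\<forall>b\<in>E. a b \<in> smooth_functions N" "\<forall>b\<in>E. x b \<in> smooth_functions M"
    "\<rho> \<bullet>\<^sub>s \<sigma> = (\<Sum>b\<in>E. a b \<bullet>\<^sub>s exact (x b))"
proof -
  obtain E :: "'e set" and G x d where F: "finite E" "openin (top_of N) G" "q \<in> G"
    "\<forall>b\<in>E. x b \<in> smooth_functions M" "\<forall>b\<in>E. d b \<in> vector_fields M"
    "\<forall>b\<in>E. restrict0 S (d b) \<in> vfields"
    "\<forall>z\<in>G. \<forall>v\<in>tangent M z. v = (\<Sum>b\<in>E. v (x b) *\<^sub>R restrict0 S (d b) z)"
    using ex_frame_along[OF q] .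
  note f = F(1-3) bspec[OF F(4)] bspec[OF F(5)] bspec[OF F(6)] bspec[OF bspec[OF F(7)]]
  obtain \<rho> G' where \<rho>: "\<rho> \<in> smooth_functions N" "openin (top_of N) G'" "q \<in> G'"
    "\<forall>z\<in>G'. \<rho> z = 1" "\<forall>z. z \<notin> G \<longrightarrow> \<rho> z = 0"
    using N.ex_bump[OF f(2,3)] by blast
  define a where "a b = \<rho> * contract \<sigma> (restrict0 S (d b))" for b
  have "(\<rho> \<bullet>\<^sub>s \<sigma>) z = (\<Sum>b\<in>E. a b \<bullet>\<^sub>s exact (x b)) z" for z
  proof (cases "z \<in> G")
    case False
    then show ?thesis using \<rho>(5) by (simp add: sum_fun_apply a_def)
  next
    case True
    then have zS: "z \<in> S" using openin_subset[OF f(2)] by blast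
    have "\<sigma> z = (\<Sum>b\<in>E. contract \<sigma> (restrict0 S (d b)) z *\<^sub>R exact (x b) z)"
    proof (rule cotangent_eqI[OF form_cotangent[OF \<sigma> zS]])
      show "(\<Sum>b\<in>E. contract \<sigma> (restrict0 S (d b)) z *\<^sub>R exact (x b) z) \<in> cotangent M z"
        by (intro subspace_sum subspace_scale subspace_cotangent) (simp add: exact_at zS d0_cotangent)
      fix v assume v: "v \<in> tangent M z"
      have "\<sigma> z v = (\<Sum>b\<in>E. v (x b) * \<sigma> z (restrict0 S (d b) z))"
        by (rule form_at_frame[OF form_cotangent[OF \<sigma> zS] v _ f(7)[OF True v]])
          (use f(6) field_tangent zS in blast)
      then show "\<sigma> z v = (\<Sum>b\<in>E. contract \<sigma> (restrict0 S (d b)) z *\<^sub>R exact (x b) z) v"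
        using zS v by (simp add: sum_fun_apply contract_def exact_apply mult.commute)
    qed
    then show ?thesis by (simp add: sum_fun_apply a_def scaleR_sum_right)
  qed
  then have "\<rho> \<bullet>\<^sub>s \<sigma> = (\<Sum>b\<in>E. a b \<bullet>\<^sub>s exact (x b))" by blast
  moreover have "a b \<in> smooth_functions N" if "b \<in> E" for b
    unfolding a_def using \<rho>(1) contract_smooth[OF \<sigma> f(6)[OF that]] by simp
  ultimately show thesis
    using that[OF \<rho>(1-4) f(1) _ F(4)] by blast
qed

text \<open>\<open>L\<close> has to scale only by the value of the function at \<open>q\<close>, so
  the value at \<open>q\<close> of any tensorial defect qualifies. It is applied to
  \<open>\<rho>\<close> times \<open>\<sigma>\<close> from \<open>local_representation\<close>, and
  \<open>\<rho> q = 1\<close>.\<close>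

lemma tensor_vanishes:
  fixes L :: "('p \<Rightarrow> 'p covec) \<Rightarrow> 'b::real_vector"
  assumes q: "q \<in> S" and \<sigma>: "\<sigma> \<in> forms"
    and add: "\<And>\<sigma> \<tau>. \<sigma> \<in> forms \<Longrightarrow> \<tau> \<in> forms \<Longrightarrow> L (\<sigma> + \<tau>) = L \<sigma> + L \<tau>"
    and mult: "\<And>a \<sigma>. a \<in> smooth_functions N \<Longrightarrow> \<sigma> \<in> forms \<Longrightarrow> L (a \<bullet>\<^sub>s \<sigma>) = a q *\<^sub>R L \<sigma>"
    and exact: "\<And>x. x \<in> smooth_functions M \<Longrightarrow> L (exact x) = 0"
  shows "L \<sigma> = 0"
proof -
  obtain \<rho> G E and a x :: "'e \<Rightarrow> 'p \<Rightarrow> real"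
    where r: "\<rho> \<in> smooth_functions N" "openin (top_of N) G" "q \<in> G" "\<forall>z\<in>G. \<rho> z = 1" "finite E"
      "\<forall>b\<in>E. a b \<in> smooth_functions N" "\<forall>b\<in>E. x b \<in> smooth_functions M"
      "\<rho> \<bullet>\<^sub>s \<sigma> = (\<Sum>b\<in>E. a b \<bullet>\<^sub>s exact (x b))"
    using local_representation[OF \<sigma> q] .
  have L0: "L 0 = 0" using add[OF zero_form zero_form] by simp
  have "L (\<Sum>b\<in>E'. a b \<bullet>\<^sub>s exact (x b)) = 0" if "E' \<subseteq> E" for E'
    using finite_subset[OF that r(5)] that
  proof (induction E' rule: finite_induct)
    case (insert b E')
    have "L (a b \<bullet>\<^sub>s exact (x b)) = 0" using mult exact r(6,7) exact_form insert.prems by simp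
    moreover have "a b \<bullet>\<^sub>s exact (x b) \<in> forms" "(\<Sum>b\<in>E'. a b \<bullet>\<^sub>s exact (x b)) \<in> forms"
      using insert.prems r(6,7) by (auto intro!: form_mult exact_form form_sum)
    ultimately have sum: "L (a b \<bullet>\<^sub>s exact (x b) + (\<Sum>b\<in>E'. a b \<bullet>\<^sub>s exact (x b))) = 0"
    proof -
      have "L (\<Sum>b\<in>E'. a b \<bullet>\<^sub>s exact (x b)) = 0" using insert.IH insert.prems by blast
      with \<open>L (a b \<bullet>\<^sub>s exact (x b)) = 0\<close> show ?thesis
        by (simp only: add[OF \<open>a b \<bullet>\<^sub>s exact (x b) \<in> forms\<close> \<open>(\<Sum>b\<in>E'. a b \<bullet>\<^sub>s exact (x b)) \<in> forms\<close>] add_0)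
    qed
    then show ?case by (simp only: sum.insert[OF insert.hyps])
  qed (simp add: L0)
  then have "L (\<rho> \<bullet>\<^sub>s \<sigma>) = 0" using r(8) by simp
  then show ?thesis using mult[OF r(1) \<sigma>] r(3,4) by simp
qed

text \<open>A field \<open>V\<close> along \<open>S\<close> need not be the restriction of a field
  on \<open>M\<close>, so smoothness of \<open>\<alpha>\<close> cannot be applied to
  \<open>V\<close> itself. It is applied to the frame fields, and the coefficients of
  \<open>V\<close> are smooth on \<open>S\<close>.\<close>

lemma restrict_one_form:
  assumes \<alpha>: "\<alpha> \<in> one_forms M"
  shows "restrict0 S \<alpha> \<in> forms"
proof (rule formI)
  show cot: "restrict0 S \<alpha> q \<in> cotangent M q" if "q \<in> S" for q
    using \<alpha> that S_in_M by (simp add: one_forms_def)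
  show "restrict0 S \<alpha> q = 0" if "q \<notin> S" for q using that by (simp add: restrict0_def)
  fix V assume V: "V \<in> vfields"
  show "contract (restrict0 S \<alpha>) V \<in> smooth_functions N"
  proof (rule N.smooth_locally)
    show "supported_on S (contract (restrict0 S \<alpha>) V)"
      by (simp add: supported_on_def contract_def restrict0_def)
    fix q assume q: "q \<in> S"
  obtain E :: "'e set" and G x d where F: "finite E" "openin (top_of N) G" "q \<in> G"
    "\<forall>b\<in>E. x b \<in> smooth_functions M" "\<forall>b\<in>E. d b \<in> vector_fields M"
    "\<forall>b\<in>E. restrict0 S (d b) \<in> vfields"
    "\<forall>z\<in>G. \<forall>v\<in>tangent M z. v = (\<Sum>b\<in>E. v (x b) *\<^sub>R restrict0 S (d b) z)"
    using ex_frame_along[OF q] .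
  note f = F(1-3) bspec[OF F(4)] bspec[OF F(5)] bspec[OF F(6)] bspec[OF bspec[OF F(7)]]
    let ?F = "\<Sum>b\<in>E. (\<lambda>z. V z (x b)) * restrict0 S (contract \<alpha> (d b))"
    have "?F \<in> smooth_functions N"
    proof (intro N.sum_smooth N.mult_smooth restrict_smooth)
      fix b assume b: "b \<in> E"
      show "(\<lambda>z. V z (x b)) \<in> smooth_functions N" using field_smooth[OF V f(4)[OF b]] .
      show "contract \<alpha> (d b) \<in> smooth_functions M"
        using \<alpha> f(5)[OF b] by (simp add: one_forms_def contract_def)
    qed
    moreover have "contract (restrict0 S \<alpha>) V z = ?F z" if z: "z \<in> G" for z
    proof -
      have zS: "z \<in> S" using openin_subset[OF f(2)] z by blast
      have "restrict0 S \<alpha> z (V z) = (\<Sum>b\<in>E. V z (x b) * restrict0 S \<alpha> z (restrict0 S (d b) z))"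
        by (rule form_at_frame[OF cot[OF zS] field_tangent[OF V zS] _ f(7)[OF z field_tangent[OF V zS]]])
          (use f(6) field_tangent zS in blast)
      then show ?thesis using zS by (simp add: contract_def sum_fun_apply)
    qed
    ultimately show "\<exists>G g. openin (top_of N) G \<and> q \<in> G \<and> g \<in> smooth_functions N \<and>
        (\<forall>x\<in>G. contract (restrict0 S \<alpha>) V x = g x)"
      using f(2,3) by blast
  qed
qed

section \<open>Tangent vectors and covectors under the inclusion of the submanifold\<close>

lemma push_tangent:
  assumes w: "w \<in> tangent N q" and q: "q \<in> S"
  shows "push M N w \<in> tangent M q"
proof -
  have res: "restrict0 S (f + g) = restrict0 S f + restrict0 S g"
    "restrict0 S (f * g) = restrict0 S f * restrict0 S g"
    "restrict0 S (c *\<^sub>R f) = c *\<^sub>R restrict0 S f" for f g :: "'p \<Rightarrow> real" and c :: real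
    by (simp_all add: restrict0_def fun_eq_iff)
  show ?thesis
    unfolding tangent_def[of M] supported_on_def linear_over_def mem_Collect_eq
  proof (intro conjI ballI allI impI)
    show "push M N w f = 0" if "f \<notin> smooth_functions M" for f using that by (simp add: push_def)
    fix f assume f: "f \<in> smooth_functions M"
    show "push M N w (c *\<^sub>R f) = c *\<^sub>R push M N w f" for c
      using tangent_scaleR[OF w restrict_smooth[OF f]] f by (simp add: push_apply res)
    fix g assume g: "g \<in> smooth_functions M"
    show "push M N w (f + g) = push M N w f + push M N w g"
      using tangent_add[OF w restrict_smooth[OF f] restrict_smooth[OF g]] f g by (simp add: push_apply res)
    show "push M N w (f * g) = f q * push M N w g + g q * push M N w f"
      using tangent_mult[OF w restrict_smooth[OF f] restrict_smooth[OF g]] f g q by (simp add: push_apply res)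
  qed
qed

text \<open>Near \<open>q\<close> each smooth function on \<open>N\<close> is the restriction of one
  on \<open>M\<close>, so a tangent vector of \<open>N\<close> is determined by its values on
  restrictions.\<close>

lemma push_inject:
  assumes w: "w \<in> tangent N q" "w' \<in> tangent N q" and q: "q \<in> S"
    and eq: "\<And>F. F \<in> smooth_functions M \<Longrightarrow> w (restrict0 S F) = w' (restrict0 S F)"
  shows "w = w'"
proof
  fix g
  show "w g = w' g"
  proof (cases "g \<in> smooth_functions N")
    case True
    obtain F G where F: "F \<in> smooth_functions M" "openin (top_of N) G" "q \<in> G"
      "\<forall>x\<in>G. restrict0 S F x = g x" using extend_smooth[OF True q] .
    have "w (restrict0 S F) = w g"
      by (rule N.tangent_local[OF w(1) restrict_smooth[OF F(1)] True F(2,3) bspec[OF F(4)]])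
    moreover have "w' (restrict0 S F) = w' g"
      by (rule N.tangent_local[OF w(2) restrict_smooth[OF F(1)] True F(2,3) bspec[OF F(4)]])
    ultimately show ?thesis using eq[OF F(1)] by simp
  qed (simp add: tangent_supported[OF w(1)] tangent_supported[OF w(2)])
qed

lemma push_add:
  "w \<in> tangent N q \<Longrightarrow> w' \<in> tangent N q \<Longrightarrow> push M N (w + w') = push M N w + push M N w'"
  by (auto simp: push_def fun_eq_iff)

lemma push_scaleR: "push M N (c *\<^sub>R w) = c *\<^sub>R push M N w"
  by (auto simp: push_def fun_eq_iff)

lemma pull_apply: "w \<in> tangent N q \<Longrightarrow> pull M N q \<alpha> w = \<alpha> (push M N w)"
  by (simp add: pull_def)

lemma pull_cotangent: "\<alpha> \<in> cotangent M q \<Longrightarrow> q \<in> S \<Longrightarrow> pull M N q \<alpha> \<in> cotangent N q"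
  by (auto simp: cotangent_def[of N] dual_of_def supported_on_def linear_over_def pull_def
      push_add push_scaleR cotangent_add cotangent_scaleR push_tangent
      subspace_add[OF subspace_tangent] subspace_scale[OF subspace_tangent])

lemma pull_d0: "f \<in> smooth_functions M \<Longrightarrow> q \<in> S \<Longrightarrow> pull M N q (d0 M f q) = d0 N (restrict0 S f) q"
  by (auto simp: pull_def fun_eq_iff d0_apply S_in_M push_tangent push_apply) (auto simp: d0_def)

lemma pull_add: "pull M N q (\<alpha> + \<beta>) = pull M N q \<alpha> + pull M N q \<beta>"
  and pull_scaleR: "pull M N q (c *\<^sub>R \<alpha>) = c *\<^sub>R pull M N q \<alpha>"
  by (auto simp: pull_def fun_eq_iff)

end

lemma fields_along_self: "vector_fields_along X X = vector_fields X"
  by (simp add: vector_fields_along_def vector_fields_def)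

lemma forms_along_self: "one_forms_along X X = one_forms X"
  by (simp add: one_forms_along_def one_forms_def fields_along_self)

context framed_space
begin

lemma restrict_self: "f \<in> smooth_functions X \<Longrightarrow> restrict0 (points X) f = f"
  by (rule restrict0_supported[OF smooth_functions_supported])

lemma pair_self: "pair X X"
proof
  fix g q assume "g \<in> smooth_functions X" "q \<in> points X"
  then show "\<exists>F\<in>smooth_functions X. \<exists>G. openin (top_of X) G \<and> q \<in> G \<and> (\<forall>x\<in>G. F x = g x)"
    by (intro bexI[of _ g] exI[of _ "points X"]) auto
qed (auto simp: restrict_self intro: openin_Int)

section \<open>Commutators and the exterior derivative of 1-forms\<close>

lemma commutator_tangent:
  assumes A: "A \<in> vector_fields X" and B: "B \<in> vector_fields X" and p: "p \<in> points X"
  shows "commutator A B p \<in> tangent X p"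
proof -
  have sm: "(\<lambda>q. A q f) \<in> smooth_functions X" "(\<lambda>q. B q f) \<in> smooth_functions X"
    if "f \<in> smooth_functions X" for f using A B that by (auto simp: vector_fields_def)
  have out: "A q = 0" "B q = 0" if "q \<notin> points X" for q
    using A B that by (auto simp: vector_fields_def supported_on_def)
  have tan: "A q \<in> tangent X q" "B q \<in> tangent X q" if "q \<in> points X" for q
    using A B that by (auto simp: vector_fields_def)
  have non: "(\<lambda>q. C q f) = 0" if "f \<notin> smooth_functions X" "C = A \<or> C = B" for C f
  proof
    show "C q f = 0 q" for q
      using that(2) out[of q] tangent_supported[OF tan(1) that(1), of q]
        tangent_supported[OF tan(2) that(1), of q] by (cases "q \<in> points X") auto
  qed
  have add: "(\<lambda>q. C q (f + g)) = (\<lambda>q. C q f) + (\<lambda>q. C q g)"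
    if "f \<in> smooth_functions X" "g \<in> smooth_functions X" "C = A \<or> C = B" for C f g
  proof
    show "C q (f + g) = ((\<lambda>q. C q f) + (\<lambda>q. C q g)) q" for q
      using that out by (cases "q \<in> points X") (auto simp: tangent_add[OF tan(1)] tangent_add[OF tan(2)])
  qed
  have scale: "(\<lambda>q. C q (c *\<^sub>R f)) = c *\<^sub>R (\<lambda>q. C q f)"
    if "f \<in> smooth_functions X" "C = A \<or> C = B" for C f c
  proof
    show "C q (c *\<^sub>R f) = (c *\<^sub>R (\<lambda>q. C q f)) q" for q
      using that out by (cases "q \<in> points X") (auto simp: tangent_scaleR[OF tan(1)] tangent_scaleR[OF tan(2)])
  qed
  have mult: "(\<lambda>q. C q (f * g)) = f * (\<lambda>q. C q g) + g * (\<lambda>q. C q f)"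
    if "f \<in> smooth_functions X" "g \<in> smooth_functions X" "C = A \<or> C = B" for C f g
  proof
    show "C q (f * g) = (f * (\<lambda>q. C q g) + g * (\<lambda>q. C q f)) q" for q
      using that out by (cases "q \<in> points X") (auto simp: tangent_mult[OF tan(1)] tangent_mult[OF tan(2)])
  qed
  note T = tan[OF p]
  have AB: "A = A \<or> A = B" "B = A \<or> B = B" by simp_all
  show ?thesis
    unfolding tangent_def supported_on_def linear_over_def mem_Collect_eq commutator_def
  proof (intro conjI ballI allI impI)
    show "A p (\<lambda>q. B q f) - B p (\<lambda>q. A q f) = 0" if "f \<notin> smooth_functions X" for f
      unfolding non[OF that AB(1)] non[OF that AB(2)] tangent_zero_fun[OF T(1)] tangent_zero_fun[OF T(2)]
      by simp
    fix f assume f: "f \<in> smooth_functions X"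
    show "A p (\<lambda>q. B q (c *\<^sub>R f)) - B p (\<lambda>q. A q (c *\<^sub>R f))
        = c *\<^sub>R (A p (\<lambda>q. B q f) - B p (\<lambda>q. A q f))" for c
      unfolding scale[OF f AB(1)] scale[OF f AB(2)] tangent_scaleR[OF T(1) sm(2)[OF f]]
        tangent_scaleR[OF T(2) sm(1)[OF f]]
      by (simp add: right_diff_distrib)
    fix g assume g: "g \<in> smooth_functions X"
    show "A p (\<lambda>q. B q (f + g)) - B p (\<lambda>q. A q (f + g))
        = A p (\<lambda>q. B q f) - B p (\<lambda>q. A q f) + (A p (\<lambda>q. B q g) - B p (\<lambda>q. A q g))"
      unfolding add[OF f g AB(1)] add[OF f g AB(2)] tangent_add[OF T(1) sm(2)[OF f] sm(2)[OF g]]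
        tangent_add[OF T(2) sm(1)[OF f] sm(1)[OF g]]
      by simp
    show "A p (\<lambda>q. B q (f * g)) - B p (\<lambda>q. A q (f * g))
        = f p * (A p (\<lambda>q. B q g) - B p (\<lambda>q. A q g)) + g p * (A p (\<lambda>q. B q f) - B p (\<lambda>q. A q f))"
      unfolding mult[OF f g AB(1)] mult[OF f g AB(2)]
        tangent_add[OF T(1) mult_smooth[OF f sm(2)[OF g]] mult_smooth[OF g sm(2)[OF f]]]
        tangent_add[OF T(2) mult_smooth[OF f sm(1)[OF g]] mult_smooth[OF g sm(1)[OF f]]]
        tangent_mult[OF T(1) f sm(2)[OF g]] tangent_mult[OF T(1) g sm(2)[OF f]]
        tangent_mult[OF T(2) f sm(1)[OF g]] tangent_mult[OF T(2) g sm(1)[OF f]]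
      by (simp add: algebra_simps)
  qed
qed

text \<open>This makes the description in \<open>d1\<close> meaningful. Subtracting
  \<open>dg\<close> with \<open>dg = \<beta>\<close> at \<open>p\<close> removes the commutator
  term, because the invariant formula vanishes on exact forms. What is left contracts a form that
  vanishes at \<open>p\<close>, so only the values of the fields at \<open>p\<close> matter.\<close>

lemma d1_eq:
  assumes \<beta>: "\<beta> \<in> one_forms X" and p: "p \<in> points X"
    and A: "A \<in> vector_fields X" and B: "B \<in> vector_fields X"
  shows "d1 X \<beta> p (A p) (B p)
    = A p (contract \<beta> B) - B p (contract \<beta> A) - \<beta> p (commutator A B p)"
proof -
  interpret self: pair X X by (rule pair_self)
  note self = fields_along_self forms_along_self
  let ?F = "\<lambda>A B. A p (contract \<beta> B) - B p (contract \<beta> A) - \<beta> p (commutator A B p)"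
  obtain g where g: "g \<in> smooth_functions X" "d0 X g p = \<beta> p"
    using self.covector_exact[OF p] \<beta> p by (auto simp: one_forms_def)
  let ?\<delta> = "\<beta> - self.exact g"
  have \<delta>: "?\<delta> \<in> one_forms X" "?\<delta> p = 0"
    using self.form_diff[OF _ self.exact_form[OF g(1)]] \<beta> g(2) p by (auto simp: self self.exact_at)
  have tan: "A p \<in> tangent X p" if "A \<in> vector_fields X" for A using that p by (simp add: vector_fields_def)
  have F: "?F A B = A p (contract ?\<delta> B) - B p (contract ?\<delta> A)"
    if A: "A \<in> vector_fields X" and B: "B \<in> vector_fields X" for A B
  proof -
    have 1: "contract ?\<delta> C = contract \<beta> C - (\<lambda>q. C q g)" if "C \<in> vector_fields X" for C
      using self.contract_exact[unfolded self, OF that, of g] by (simp add: contract_def fun_eq_iff)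
    have 2: "contract \<beta> C \<in> smooth_functions X" "(\<lambda>q. C q g) \<in> smooth_functions X"
      if "C \<in> vector_fields X" for C
      using that \<beta> g(1) by (auto simp: one_forms_def vector_fields_def contract_def)
    have "\<beta> p (commutator A B p) = A p (\<lambda>q. B q g) - B p (\<lambda>q. A q g)"
      using d0_apply[OF p commutator_tangent[OF A B p], of g] g(2) by (simp add: commutator_def)
    then show ?thesis
      using 1[OF A] 1[OF B] 2[OF A] 2[OF B] tan[OF A] tan[OF B] by (simp add: tangent_diff)
  qed
  have indep: "?F A' B' = ?F A B"
    if "A' \<in> vector_fields X" "B' \<in> vector_fields X" "A' p = A p" "B' p = B p" for A' B'
  proof -
    have "A p (contract ?\<delta> B') = A p (contract ?\<delta> B)"
      by (rule self.contract_indep[unfolded self, OF p \<delta> that(2) B that(4) tan[OF A]])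
    moreover have "B p (contract ?\<delta> A') = B p (contract ?\<delta> A)"
      by (rule self.contract_indep[unfolded self, OF p \<delta> that(1) A that(3) tan[OF B]])
    ultimately show ?thesis
      using F[OF A B] F[OF that(1,2)] unfolding that(3,4) by linarith
  qed
  have "d1 X \<beta> p (A p) (B p) = (THE c. \<forall>A'\<in>vector_fields X. \<forall>B'\<in>vector_fields X.
      A' p = A p \<and> B' p = B p \<longrightarrow> c = ?F A' B')"
    unfolding d1_def contract_def using p tan A B by simp
  also have "\<dots> = ?F A B"
  proof (rule the_equality)
    show "\<forall>A'\<in>vector_fields X. \<forall>B'\<in>vector_fields X. A' p = A p \<and> B' p = B p \<longrightarrow> ?F A B = ?F A' B'"
      by (intro ballI impI indep[symmetric]) simp_all
    show "c = ?F A B" if "\<forall>A'\<in>vector_fields X. \<forall>B'\<in>vector_fields X.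
        A' p = A p \<and> B' p = B p \<longrightarrow> c = ?F A' B'" for c
      using bspec[OF bspec[OF that A] B] by simp
  qed
  finally show ?thesis .
qed

end

section \<open>Bivectors and the anchor\<close>

lemma bivector_linear:
  assumes "B \<in> bivectors X p" "\<alpha> \<in> cotangent X p"
  shows "linear_over (cotangent X p) (B \<alpha>)" "linear_over (cotangent X p) (\<lambda>\<beta>. B \<beta> \<alpha>)"
proof -
  have "bilinear_over (cotangent X p) (cotangent X p) B" using assms(1) unfolding bivectors_def by blast
  then show "linear_over (cotangent X p) (B \<alpha>)" "linear_over (cotangent X p) (\<lambda>\<beta>. B \<beta> \<alpha>)"
    using assms(2) unfolding bilinear_over_def by blast+
qed

lemma
  assumes "B \<in> bivectors X p" "\<alpha> \<in> cotangent X p" "\<beta> \<in> cotangent X p" "\<gamma> \<in> cotangent X p"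
  shows bivector_add_left: "B (\<alpha> + \<beta>) \<gamma> = B \<alpha> \<gamma> + B \<beta> \<gamma>"
    and bivector_add_right: "B \<gamma> (\<alpha> + \<beta>) = B \<gamma> \<alpha> + B \<gamma> \<beta>"
  using bivector_linear[OF assms(1,4)] assms(2,3) unfolding linear_over_def by blast+

lemma
  assumes "B \<in> bivectors X p" "\<alpha> \<in> cotangent X p" "\<beta> \<in> cotangent X p"
  shows bivector_scaleR_left: "B (c *\<^sub>R \<alpha>) \<beta> = c * B \<alpha> \<beta>"
    and bivector_scaleR_right: "B \<alpha> (c *\<^sub>R \<beta>) = c * B \<alpha> \<beta>"
  using bivector_linear[OF assms(1,2)] bivector_linear[OF assms(1,3)] assms(2,3)
  unfolding linear_over_def by simp_all

lemma bivector_skew: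
  assumes "B \<in> bivectors X p" "\<alpha> \<in> cotangent X p" "\<beta> \<in> cotangent X p"
  shows "B \<alpha> \<beta> = - B \<beta> \<alpha>"
  using assms unfolding bivectors_def by blast

lemma bivector_zero_right: "B \<in> bivectors X p \<Longrightarrow> \<alpha> \<in> cotangent X p \<Longrightarrow> B \<alpha> 0 = 0"
  using bivector_scaleR_right[of B X p \<alpha> 0 0] subspace_0[OF subspace_cotangent, of X p] by simp

lemma bivector_zero_left: "B \<in> bivectors X p \<Longrightarrow> \<alpha> \<in> cotangent X p \<Longrightarrow> B 0 \<alpha> = 0"
  using bivector_scaleR_left[of B X p 0 \<alpha> 0] subspace_0[OF subspace_cotangent, of X p] by simp

lemma bivector_diff_left:
  assumes "B \<in> bivectors X p" "\<alpha> \<in> cotangent X p" "\<beta> \<in> cotangent X p" "\<gamma> \<in> cotangent X p"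
  shows "B (\<alpha> - \<beta>) \<gamma> = B \<alpha> \<gamma> - B \<beta> \<gamma>"
  using bivector_add_left[OF assms(1,2) subspace_scale[OF subspace_cotangent assms(3), of "-1"] assms(4)]
    bivector_scaleR_left[OF assms(1,3,4), of "-1"] by simp

lemma bivector_diff_right:
  assumes "B \<in> bivectors X p" "\<alpha> \<in> cotangent X p" "\<beta> \<in> cotangent X p" "\<gamma> \<in> cotangent X p"
  shows "B \<gamma> (\<alpha> - \<beta>) = B \<gamma> \<alpha> - B \<gamma> \<beta>"
  using bivector_add_right[OF assms(1,2) subspace_scale[OF subspace_cotangent assms(3), of "-1"] assms(4)]
    bivector_scaleR_right[OF assms(1,4,3), of "-1"] by simp

section \<open>Contraction of bivectors with covectors\<close>

context framed_space
begin

lemma d0_one_form: "f \<in> smooth_functions X \<Longrightarrow> d0 X f \<in> one_forms X"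
proof -
  assume f: "f \<in> smooth_functions X"
  interpret self: pair X X by (rule pair_self)
  have "self.exact f = d0 X f"
    unfolding self.exact_def by (rule restrict0_supported) (simp add: supported_on_def d0_outside)
  then show ?thesis using self.exact_form[OF f] by (simp add: forms_along_self)
qed

lemma ex_vector_field_through:
  assumes "p \<in> points X" "v \<in> tangent X p"
  obtains V where "V \<in> vector_fields X" "V p = v"
proof -
  interpret self: pair X X by (rule pair_self)
  show thesis
    using self.ex_field_through[OF assms] that unfolding fields_along_self by blast
qed

lemma sharp_tangent:
  assumes B: "P p \<in> bivectors X p" and p: "p \<in> points X" and \<alpha>: "\<alpha> \<in> cotangent X p"
  shows "sharp X P p \<alpha> \<in> tangent X p"
  unfolding tangent_def supported_on_def linear_over_def mem_Collect_eq sharp_def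
proof (intro conjI ballI allI impI)
  show "P p \<alpha> (d0 X f p) = 0" if "f \<notin> smooth_functions X" for f
    using that by (simp add: d0_nonsmooth bivector_zero_right[OF B \<alpha>])
  fix f assume f: "f \<in> smooth_functions X"
  show "P p \<alpha> (d0 X (c *\<^sub>R f) p) = c *\<^sub>R P p \<alpha> (d0 X f p)" for c
    using f by (simp add: d0_scaleR bivector_scaleR_right[OF B \<alpha> d0_cotangent])
  fix g assume g: "g \<in> smooth_functions X"
  show "P p \<alpha> (d0 X (f + g) p) = P p \<alpha> (d0 X f p) + P p \<alpha> (d0 X g p)"
    using f g by (simp add: d0_add bivector_add_right[OF B d0_cotangent d0_cotangent \<alpha>])
  show "P p \<alpha> (d0 X (f * g) p) = f p * P p \<alpha> (d0 X g p) + g p * P p \<alpha> (d0 X f p)"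
    using f g
    by (simp add: d0_mult bivector_add_right[OF B _ _ \<alpha>] bivector_scaleR_right[OF B \<alpha>] d0_cotangent
        subspace_scale[OF subspace_cotangent])
qed

text \<open>\<open>sharp\<close> is defined by its values on functions; the pairing with an
  arbitrary covector follows because every covector at \<open>p\<close> is a differential.\<close>

lemma cotangent_sharp:
  assumes B: "P p \<in> bivectors X p" and p: "p \<in> points X"
    and \<alpha>: "\<alpha> \<in> cotangent X p" and \<beta>: "\<beta> \<in> cotangent X p"
  shows "\<beta> (sharp X P p \<alpha>) = P p \<alpha> \<beta>"
proof -
  interpret self: pair X X by (rule pair_self)
  obtain g where "g \<in> smooth_functions X" "d0 X g p = \<beta>" using self.covector_exact[OF p \<beta>] .
  then show ?thesis
    using d0_apply[OF p sharp_tangent[of P, OF B p \<alpha>], of g] by (simp add: sharp_def)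
qed

lemma vanishing_contraction:
  assumes p: "p \<in> points X" and \<delta>: "\<delta> \<in> one_forms X" "\<delta> p = 0"
    and A: "A \<in> vector_fields X" "A p = 0" and v: "v \<in> tangent X p"
  shows "v (contract \<delta> A) = 0"
proof -
  interpret self: pair X X by (rule pair_self)
  show ?thesis
    by (rule self.contract_vanishing[unfolded forms_along_self fields_along_self, OF p \<delta> A v])
qed

end

text \<open>\<open>Q\<close> is a parameter, identified with
  \<open>restricted_bivector M P N\<close> in \<open>restricted_bivector_eq\<close>. It is assumed
  to induce \<open>P\<close> pointwise, while its smoothness and Jacobi identity are derived. Thus
  the locale can also be instantiated with \<open>N\<close>, \<open>N\<close>, \<open>Q\<close>,
  \<open>Q\<close>.\<close>

locale poisson_pair = pair M N
  for M N :: "('p, 'e::euclidean_space) smooth_structure" +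
  fixes P Q :: "'p \<Rightarrow> 'p bivec"
  assumes P_field: "P \<in> bivector_fields M"
    and jacobi: "f \<in> smooth_functions M \<Longrightarrow> g \<in> smooth_functions M \<Longrightarrow> h \<in> smooth_functions M \<Longrightarrow>
      poisson_bracket M P f (poisson_bracket M P g h) +
      poisson_bracket M P g (poisson_bracket M P h f) +
      poisson_bracket M P h (poisson_bracket M P f g) = 0"
    and Q_bivector: "q \<in> points N \<Longrightarrow> Q q \<in> bivectors N q"
    and Q_outside: "q \<notin> points N \<Longrightarrow> Q q = 0"
    and P_push: "q \<in> points N \<Longrightarrow> P q = bivector_push M N q (Q q)"
begin

lemma P_bivector: "p \<in> points M \<Longrightarrow> P p \<in> bivectors M p"
  using P_field by (simp add: bivector_fields_def)

lemma P_outside: "p \<notin> points M \<Longrightarrow> P p = 0"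
  using P_field by (simp add: bivector_fields_def supported_on_def)

abbreviation "br \<equiv> poisson_bracket M P"

lemma br_apply: "br f g p = P p (d0 M f p) (d0 M g p)"
  by (simp add: poisson_bracket_def)

lemma br_smooth: "f \<in> smooth_functions M \<Longrightarrow> g \<in> smooth_functions M \<Longrightarrow> br f g \<in> smooth_functions M"
  using P_field M.d0_one_form by (simp add: bivector_fields_def poisson_bracket_def)

lemma br_skew: "br g f = - br f g"
proof
  show "br g f p = (- br f g) p" for p
    using bivector_skew[OF P_bivector d0_cotangent d0_cotangent, of p g f]
    by (cases "p \<in> points M") (simp_all add: br_apply P_outside)
qed

lemma br_add_right:
  assumes "g \<in> smooth_functions M" "h \<in> smooth_functions M"
  shows "br f (g + h) = br f g + br f h"
proof
  show "br f (g + h) p = (br f g + br f h) p" for p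
    using bivector_add_right[OF P_bivector d0_cotangent d0_cotangent d0_cotangent, of p f g h]
    by (cases "p \<in> points M") (simp_all add: br_apply P_outside d0_add[OF assms])
qed

lemma br_scaleR_right:
  assumes "g \<in> smooth_functions M"
  shows "br f (c *\<^sub>R g) = c *\<^sub>R br f g"
proof
  show "br f (c *\<^sub>R g) p = (c *\<^sub>R br f g) p" for p
    using bivector_scaleR_right[OF P_bivector d0_cotangent d0_cotangent, of p f c g]
    by (cases "p \<in> points M") (simp_all add: br_apply P_outside d0_scaleR[OF assms])
qed

lemma br_minus_right: "g \<in> smooth_functions M \<Longrightarrow> br f (- g) = - br f g"
  using br_scaleR_right[of g f "-1"] by simp

lemma br_diff_left:
  assumes "f \<in> smooth_functions M" "g \<in> smooth_functions M"
  shows "br (f - g) h = br f h - br g h"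
proof -
  have "br (f - g) h = - br h (f + - g)" using br_skew[of "f - g" h] by simp
  also have "\<dots> = br f h - br g h"
    using br_add_right[OF assms(1), of "- g" h] assms(2) br_skew[of f h] br_skew[of g h]
    by (simp add: br_minus_right)
  finally show ?thesis .
qed

definition sharp_field :: "('p \<Rightarrow> 'p covec) \<Rightarrow> 'p \<Rightarrow> 'p tvec" where
  "sharp_field \<alpha> = (\<lambda>p. sharp M P p (\<alpha> p))"

lemma sharp_field:
  assumes \<alpha>: "\<alpha> \<in> one_forms M"
  shows "sharp_field \<alpha> \<in> vector_fields M"
  unfolding vector_fields_def mem_Collect_eq supported_on_def
proof (intro conjI ballI allI impI)
  have cot: "\<alpha> p \<in> cotangent M p" if "p \<in> points M" for p using \<alpha> that by (simp add: one_forms_def)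
  show "sharp_field \<alpha> p = 0" if "p \<notin> points M" for p
    using that by (simp add: sharp_field_def sharp_def P_outside zero_fun_def)
  show "sharp_field \<alpha> p \<in> tangent M p" if "p \<in> points M" for p
    unfolding sharp_field_def by (rule M.sharp_tangent[of P, OF P_bivector[OF that] that cot[OF that]])
  show "(\<lambda>p. sharp_field \<alpha> p f) \<in> smooth_functions M" if "f \<in> smooth_functions M" for f
    using P_field \<alpha> M.d0_one_form[OF that] by (simp add: bivector_fields_def sharp_field_def sharp_def)
qed

lemma sharp_field_d0: "sharp_field (d0 M f) p g = br f g p"
  by (simp add: sharp_field_def sharp_def br_apply)

text \<open>Both sides evaluate \<open>bivector_push M N q (Q q)\<close> on differentials. Hence
  contractions of \<open>P\<close> are tangent to \<open>S\<close>, which is the existence part for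
  the anchor.\<close>

lemma push_sharp:
  assumes q: "q \<in> S" and \<alpha>: "\<alpha> \<in> cotangent M q"
  shows "push M N (sharp N Q q (pull M N q \<alpha>)) = sharp M P q \<alpha>"
proof
  fix f
  show "push M N (sharp N Q q (pull M N q \<alpha>)) f = sharp M P q \<alpha> f"
  proof (cases "f \<in> smooth_functions M")
    case True
    then show ?thesis
      using q \<alpha> P_push[OF q]
      by (simp add: push_apply sharp_def bivector_push_def d0_cotangent pull_d0)
  next
    case False
    then show ?thesis
      using bivector_zero_right[OF P_bivector[OF S_in_M[OF q]] \<alpha>]
      by (simp add: push_def sharp_def d0_nonsmooth)
  qed
qed

section \<open>The anchor of the restricted algebroid\<close>

lemma pull_sharp_tangent:
  "q \<in> S \<Longrightarrow> \<alpha> \<in> cotangent M q \<Longrightarrow> sharp N Q q (pull M N q \<alpha>) \<in> tangent N q"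
  using N.sharp_tangent[of Q, OF Q_bivector] pull_cotangent by blast

lemma anchor_eq:
  assumes q: "q \<in> S" and \<alpha>: "\<alpha> \<in> cotangent M q"
  shows "anchor M P N q \<alpha> = sharp N Q q (pull M N q \<alpha>)"
proof -
  have "(THE w. w \<in> tangent N q \<and> push M N w = sharp M P q \<alpha>) = sharp N Q q (pull M N q \<alpha>)"
  proof (rule the_equality)
    show "sharp N Q q (pull M N q \<alpha>) \<in> tangent N q \<and>
        push M N (sharp N Q q (pull M N q \<alpha>)) = sharp M P q \<alpha>"
      using pull_sharp_tangent[OF assms] push_sharp[OF assms] by simp
    fix w assume w: "w \<in> tangent N q \<and> push M N w = sharp M P q \<alpha>"
    show "w = sharp N Q q (pull M N q \<alpha>)"
    proof (rule push_inject[OF conjunct1[OF w] pull_sharp_tangent[OF assms] q])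
      fix F assume "F \<in> smooth_functions M"
      then show "w (restrict0 S F) = sharp N Q q (pull M N q \<alpha>) (restrict0 S F)"
        using fun_cong[OF conjunct2[OF w], of F] fun_cong[OF push_sharp[OF assms], of F]
        by (simp add: push_apply)
    qed
  qed
  then show ?thesis using q by (simp add: anchor_def)
qed

lemma anchor_tangent: "q \<in> S \<Longrightarrow> \<alpha> \<in> cotangent M q \<Longrightarrow> anchor M P N q \<alpha> \<in> tangent N q"
  by (simp add: anchor_eq pull_sharp_tangent)

lemma anchor_restrict:
  assumes "q \<in> S" "\<alpha> \<in> cotangent M q" "F \<in> smooth_functions M"
  shows "anchor M P N q \<alpha> (restrict0 S F) = P q \<alpha> (d0 M F q)"
  using fun_cong[OF push_sharp[OF assms(1,2)], of F] assms
  by (simp add: anchor_eq push_apply sharp_def)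

lemma anchor_add:
  assumes q: "q \<in> S" and a: "\<alpha> \<in> cotangent M q" "\<beta> \<in> cotangent M q"
  shows "anchor M P N q (\<alpha> + \<beta>) = anchor M P N q \<alpha> + anchor M P N q \<beta>"
proof
  fix f
  show "anchor M P N q (\<alpha> + \<beta>) f = (anchor M P N q \<alpha> + anchor M P N q \<beta>) f"
    using bivector_add_left[OF Q_bivector[OF q] pull_cotangent[OF a(1) q] pull_cotangent[OF a(2) q] d0_cotangent]
    by (simp add: anchor_eq[OF q] a subspace_add[OF subspace_cotangent] pull_add sharp_def)
qed

lemma anchor_scaleR:
  assumes q: "q \<in> S" and a: "\<alpha> \<in> cotangent M q"
  shows "anchor M P N q (c *\<^sub>R \<alpha>) = c *\<^sub>R anchor M P N q \<alpha>"
proof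
  fix f
  show "anchor M P N q (c *\<^sub>R \<alpha>) f = (c *\<^sub>R anchor M P N q \<alpha>) f"
    using bivector_scaleR_left[OF Q_bivector[OF q] pull_cotangent[OF a q] d0_cotangent]
    by (simp add: anchor_eq[OF q] a subspace_scale[OF subspace_cotangent] pull_scaleR sharp_def)
qed

definition anchor_field :: "('p \<Rightarrow> 'p covec) \<Rightarrow> 'p \<Rightarrow> 'p tvec" where
  "anchor_field \<sigma> = (\<lambda>q. anchor M P N q (\<sigma> q))"

lemma anchor_field_outside: "q \<notin> S \<Longrightarrow> anchor_field \<sigma> q = 0"
  by (simp add: anchor_field_def anchor_def)

lemma anchor_field_tangent: "\<sigma> \<in> forms \<Longrightarrow> q \<in> S \<Longrightarrow> anchor_field \<sigma> q \<in> tangent N q"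
  by (simp add: anchor_field_def anchor_tangent form_cotangent)

lemma anchor_field_add:
  "\<sigma> \<in> forms \<Longrightarrow> \<tau> \<in> forms \<Longrightarrow> anchor_field (\<sigma> + \<tau>) = anchor_field \<sigma> + anchor_field \<tau>"
proof
  fix q assume "\<sigma> \<in> forms" "\<tau> \<in> forms"
  then show "anchor_field (\<sigma> + \<tau>) q = (anchor_field \<sigma> + anchor_field \<tau>) q"
    using anchor_add[of q "\<sigma> q" "\<tau> q"]
    by (cases "q \<in> S") (simp_all add: anchor_field_outside anchor_field_def form_cotangent, simp add: anchor_def)
qed

lemma anchor_field_mult:
  "\<sigma> \<in> forms \<Longrightarrow> anchor_field (a \<bullet>\<^sub>s \<sigma>) = a \<bullet>\<^sub>s anchor_field \<sigma>"
proof
  fix q assume "\<sigma> \<in> forms"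
  then show "anchor_field (a \<bullet>\<^sub>s \<sigma>) q = (a \<bullet>\<^sub>s anchor_field \<sigma>) q"
    using anchor_scaleR[of q "\<sigma> q" "a q"]
    by (cases "q \<in> S") (simp_all add: anchor_field_outside anchor_field_def form_cotangent, simp add: anchor_def)
qed

lemma anchor_field_minus: "\<sigma> \<in> forms \<Longrightarrow> anchor_field (- \<sigma>) = - anchor_field \<sigma>"
proof
  fix q assume "\<sigma> \<in> forms"
  then show "anchor_field (- \<sigma>) q = (- anchor_field \<sigma>) q"
    using anchor_scaleR[of q "\<sigma> q" "-1"]
    by (cases "q \<in> S") (simp_all add: anchor_field_outside anchor_field_def form_cotangent, simp add: anchor_def)
qed

lemma anchor_field_exact:
  assumes "f \<in> smooth_functions M" "F \<in> smooth_functions M"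
  shows "(\<lambda>q. anchor_field (exact f) q (restrict0 S F)) = restrict0 S (br f F)"
proof
  show "anchor_field (exact f) q (restrict0 S F) = restrict0 S (br f F) q" for q
    using anchor_restrict[OF _ d0_cotangent assms(2), of q f]
    by (cases "q \<in> S")
      (simp_all add: anchor_field_outside anchor_field_def exact_at br_apply, simp_all add: anchor_def restrict0_def)
qed

text \<open>Skew-symmetry turns the derivative of \<open>F\<close> along the anchor into a
  contraction of \<open>\<sigma>\<close> with the Hamiltonian field of \<open>F\<close>. That field
  lives on \<open>M\<close>, so smoothness of \<open>\<sigma>\<close> yields smoothness of the
  anchor.\<close>

lemma anchor_field_restrict:
  assumes "\<sigma> \<in> forms" "F \<in> smooth_functions M" "q \<in> S"
  shows "anchor_field \<sigma> q (restrict0 S F) = - contract \<sigma> (restrict0 S (sharp_field (d0 M F))) q"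
proof -
  have "anchor_field \<sigma> q (restrict0 S F) = P q (\<sigma> q) (d0 M F q)"
    using assms by (simp add: anchor_field_def anchor_restrict form_cotangent)
  also have "\<dots> = - P q (d0 M F q) (\<sigma> q)"
    by (rule bivector_skew[OF P_bivector[OF S_in_M[OF assms(3)]] form_cotangent[OF assms(1,3)] d0_cotangent])
  also have "P q (d0 M F q) (\<sigma> q) = \<sigma> q (sharp M P q (d0 M F q))"
    by (rule M.cotangent_sharp[of P, OF P_bivector[OF S_in_M[OF assms(3)]] S_in_M[OF assms(3)]
          d0_cotangent form_cotangent[OF assms(1,3)], symmetric])
  finally show ?thesis using assms by (simp add: contract_def sharp_field_def)
qed

lemma anchor_field_smooth:
  assumes \<sigma>: "\<sigma> \<in> forms" and f: "f \<in> smooth_functions N"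
  shows "(\<lambda>q. anchor_field \<sigma> q f) \<in> smooth_functions N"
proof (rule N.smooth_locally)
  show "supported_on S (\<lambda>q. anchor_field \<sigma> q f)"
    by (simp add: supported_on_def anchor_field_outside)
  fix q assume q: "q \<in> S"
  obtain F G where F: "F \<in> smooth_functions M" "openin (top_of N) G" "q \<in> G"
    "\<forall>x\<in>G. restrict0 S F x = f x" using extend_smooth[OF f q] .
  let ?g = "- contract \<sigma> (restrict0 S (sharp_field (d0 M F)))"
  have "?g \<in> smooth_functions N"
    by (intro N.minus_smooth contract_smooth[OF \<sigma>] restrict_field sharp_field M.d0_one_form F(1))
  moreover have "anchor_field \<sigma> z f = ?g z" if z: "z \<in> G" for z
  proof -
    have zS: "z \<in> S" using openin_subset[OF F(2)] z by blast
    have "anchor_field \<sigma> z (restrict0 S F) = anchor_field \<sigma> z f"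
      by (rule N.tangent_local[OF anchor_field_tangent[OF \<sigma> zS] restrict_smooth[OF F(1)] f F(2) z
            bspec[OF F(4)]])
    then show ?thesis using anchor_field_restrict[OF \<sigma> F(1) zS] by simp
  qed
  ultimately show "\<exists>G g. openin (top_of N) G \<and> q \<in> G \<and> g \<in> smooth_functions N \<and>
      (\<forall>x\<in>G. anchor_field \<sigma> x f = g x)"
    using F(2,3) by (intro exI[of _ G] exI[of _ ?g]) blast
qed

section \<open>The bracket of 1-forms along a submanifold\<close>

text \<open>
  The Koszul formula \<open>[\<sigma>,\<tau>](V) = \<sigma>\<^sup>\<sharp>(\<tau>(V)) - \<tau>\<^sup>\<sharp>(\<sigma>(V)) + (L\<^sub>V P)(\<sigma>,\<tau>)\<close>, where \<open>L\<^sub>V P\<close> is expanded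
  by means of functions \<open>f\<close>, \<open>g\<close> whose differentials at the point are the values of \<open>\<sigma>\<close>, \<open>\<tau>\<close>.
  Since \<open>\<sigma>\<^sup>\<sharp>\<close> is tangent to the submanifold, no extension of \<open>\<sigma>\<close>, \<open>\<tau>\<close> to the ambient manifold is needed.
\<close>

definition koszul ::
  "('p \<Rightarrow> 'p covec) \<Rightarrow> ('p \<Rightarrow> 'p covec) \<Rightarrow> ('p \<Rightarrow> real) \<Rightarrow> ('p \<Rightarrow> real) \<Rightarrow> ('p \<Rightarrow> 'p tvec) \<Rightarrow> 'p \<Rightarrow> real"
where
  "koszul \<sigma> \<tau> f g V q = V q (br f g) + anchor_field \<sigma> q (contract (\<tau> - exact g) V)
     - anchor_field \<tau> q (contract (\<sigma> - exact f) V)"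

lemma koszul_skew:
  assumes "f \<in> smooth_functions M" "g \<in> smooth_functions M" "V \<in> vfields" "q \<in> S"
  shows "koszul \<tau> \<sigma> g f V q = - koszul \<sigma> \<tau> f g V q"
  using M.tangent_minus[OF field_tangent[OF assms(3,4)] br_smooth[OF assms(1,2)]] br_skew[of f g]
  by (simp add: koszul_def)

text \<open>The forms \<open>\<sigma> - exact f\<close> and \<open>\<tau> - exact g\<close> vanish
  at \<open>q\<close>, so the derivatives of their contractions at \<open>q\<close> depend only on
  the value of the field there.\<close>

lemma koszul_indep_field:
  assumes q: "q \<in> S" and \<sigma>: "\<sigma> \<in> forms" "\<tau> \<in> forms"
    and f: "f \<in> smooth_functions M" "d0 M f q = \<sigma> q" and g: "g \<in> smooth_functions M" "d0 M g q = \<tau> q"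
    and V: "V \<in> vfields" "V' \<in> vfields" "V q = V' q"
  shows "koszul \<sigma> \<tau> f g V q = koszul \<sigma> \<tau> f g V' q"
proof -
  have "anchor_field \<sigma> q (contract (\<tau> - exact g) V) = anchor_field \<sigma> q (contract (\<tau> - exact g) V')"
    by (rule contract_indep[OF q _ _ V anchor_field_tangent[OF \<sigma>(1) q]])
      (auto intro: form_diff \<sigma> exact_form g(1) simp: exact_at q g(2))
  moreover have "anchor_field \<tau> q (contract (\<sigma> - exact f) V) = anchor_field \<tau> q (contract (\<sigma> - exact f) V')"
    by (rule contract_indep[OF q _ _ V anchor_field_tangent[OF \<sigma>(2) q]])
      (auto intro: form_diff \<sigma> exact_form f(1) simp: exact_at q f(2))
  ultimately show ?thesis unfolding koszul_def V(3) by simp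
qed

lemma contract_diff_form: "contract (\<sigma> - \<tau>) V = contract \<sigma> V - contract \<tau> V"
  by (simp add: contract_def fun_eq_iff)

text \<open>Passing from \<open>f\<close> to \<open>f'\<close> with \<open>h = f' - f\<close>,
  \<open>dh = 0\<close> at \<open>q\<close>, changes the formula by \<open>V {h, g}\<close> plus the
  derivative of \<open>V h\<close> along the anchor of \<open>\<tau>\<close>. They cancel, since the
  commutator of \<open>V\<close> with the Hamiltonian field of \<open>g\<close> is a tangent vector
  and kills \<open>h\<close>.\<close>

lemma koszul_indep_function:
  assumes q: "q \<in> S" and \<sigma>: "\<sigma> \<in> forms" "\<tau> \<in> forms"
    and f: "f \<in> smooth_functions M" "d0 M f q = \<sigma> q" and f': "f' \<in> smooth_functions M" "d0 M f' q = \<sigma> q"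
    and g: "g \<in> smooth_functions M" "d0 M g q = \<tau> q" and V: "V \<in> vfields"
  shows "koszul \<sigma> \<tau> f g V q = koszul \<sigma> \<tau> f' g V q"
proof -
  \<comment> \<open>The commutator takes a field on \<open>M\<close>; by
    \<open>koszul_indep_field\<close> the field \<open>V\<close> along \<open>S\<close> may be
    exchanged for the restriction of one.\<close>
  obtain Z where Z: "Z \<in> vector_fields M" "Z q = V q"
    using M.ex_vector_field_through[OF S_in_M[OF q] field_tangent[OF V q]] .
  let ?V = "restrict0 S Z"
  have V': "?V \<in> vfields" "V q = ?V q" using restrict_field[OF Z(1)] Z(2) q by simp_all
  define h where "h = f' - f"
  have h: "h \<in> smooth_functions M" using f(1) f'(1) by (simp add: h_def)
  have Zh: "(\<lambda>z. Z z h) \<in> smooth_functions M" using Z(1) h by (simp add: vector_fields_def)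
  have ham: "sharp_field (d0 M g) \<in> vector_fields M" by (intro sharp_field M.d0_one_form g(1))
  have "commutator Z (sharp_field (d0 M g)) q h = 0"
  proof -
    have T: "commutator Z (sharp_field (d0 M g)) q \<in> tangent M q"
      by (rule M.commutator_tangent[OF Z(1) ham S_in_M[OF q]])
    have "commutator Z (sharp_field (d0 M g)) q f' = commutator Z (sharp_field (d0 M g)) q f"
      using d0_apply[OF S_in_M[OF q] T, of f] d0_apply[OF S_in_M[OF q] T, of f'] f(2) f'(2) by simp
    then show ?thesis unfolding h_def using M.tangent_diff[OF T f'(1) f(1)] by simp
  qed
  then have com: "Z q (br g h) = br g (\<lambda>z. Z z h) q"
    by (simp add: commutator_def sharp_field_d0 flip: fun_eq_iff)
  have "contract (exact h) ?V = restrict0 S (\<lambda>z. Z z h)"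
    unfolding contract_exact[OF V'(1)] by (auto simp: restrict0_def fun_eq_iff)
  then have 1: "anchor_field \<tau> q (contract (exact h) ?V) = br g (\<lambda>z. Z z h) q"
    using anchor_restrict[OF q form_cotangent[OF \<sigma>(2) q] Zh] g(2)
    by (simp add: anchor_field_def br_apply)
  have "exact h = exact f' - exact f"
  proof -
    have "d0 M f' = d0 M (h + f)" by (simp add: h_def)
    then show ?thesis unfolding d0_add[OF h f(1)] by (auto simp: exact_def restrict0_def fun_eq_iff)
  qed
  then have "contract (\<sigma> - exact f) ?V = contract (\<sigma> - exact f') ?V + contract (exact h) ?V"
    by (simp add: contract_def fun_eq_iff)
  then have 2: "anchor_field \<tau> q (contract (\<sigma> - exact f) ?V)
      = anchor_field \<tau> q (contract (\<sigma> - exact f') ?V) + br g (\<lambda>z. Z z h) q"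
    using 1 tangent_add[OF anchor_field_tangent[OF \<sigma>(2) q]
        contract_smooth[OF form_diff[OF \<sigma>(1) exact_form[OF f'(1)]] V'(1)]
        contract_smooth[OF exact_form[OF h] V'(1)]] by simp
  have T: "Z q \<in> tangent M q" using Z field_tangent[OF V q] by simp
  have "br f' g = br h g + br f g" using br_diff_left[OF f'(1) f(1), of g] by (simp add: h_def)
  then have "Z q (br f' g) = Z q (br h g) + Z q (br f g)"
    using tangent_add[OF T br_smooth[OF h g(1)] br_smooth[OF f(1) g(1)]] by simp
  moreover have "Z q (br h g) = - br g (\<lambda>z. Z z h) q"
    using M.tangent_minus[OF T br_smooth[OF g(1) h]] br_skew[of h g] com by simp
  ultimately have "koszul \<sigma> \<tau> f g ?V q = koszul \<sigma> \<tau> f' g ?V q"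
    using 2 q by (simp add: koszul_def)
  then show ?thesis
    using koszul_indep_field[OF q \<sigma> f g V V'] koszul_indep_field[OF q \<sigma> f' g V V'] by simp
qed

text \<open>The functions and the field are chosen separately at each point, so the definition shows
  neither linearity nor smoothness. Both are recovered once the choices are known to be immaterial,
  in \<open>form_br_eq\<close>.\<close>

definition form_br :: "('p \<Rightarrow> 'p covec) \<Rightarrow> ('p \<Rightarrow> 'p covec) \<Rightarrow> 'p \<Rightarrow> 'p covec" where
  "form_br \<sigma> \<tau> q v = (if \<sigma> \<in> forms \<and> \<tau> \<in> forms \<and> q \<in> S \<and> v \<in> tangent M q then
     (SOME c. \<exists>f\<in>smooth_functions M. \<exists>g\<in>smooth_functions M. \<exists>V\<in>vfields.
        d0 M f q = \<sigma> q \<and> d0 M g q = \<tau> q \<and> V q = v \<and> c = koszul \<sigma> \<tau> f g V q) else 0)"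

lemma form_br_eq:
  assumes q: "q \<in> S" and \<sigma>: "\<sigma> \<in> forms" "\<tau> \<in> forms"
    and f: "f \<in> smooth_functions M" "d0 M f q = \<sigma> q" and g: "g \<in> smooth_functions M" "d0 M g q = \<tau> q"
    and V: "V \<in> vfields"
  shows "form_br \<sigma> \<tau> q (V q) = koszul \<sigma> \<tau> f g V q"
proof -
  let ?R = "\<lambda>c. \<exists>f\<in>smooth_functions M. \<exists>g\<in>smooth_functions M. \<exists>V'\<in>vfields.
        d0 M f q = \<sigma> q \<and> d0 M g q = \<tau> q \<and> V' q = V q \<and> c = koszul \<sigma> \<tau> f g V' q"
  have unique: "c = koszul \<sigma> \<tau> f g V q" if R: "?R c" for c
  proof -
    obtain f' g' V' where R': "f' \<in> smooth_functions M" "g' \<in> smooth_functions M" "V' \<in> vfields"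
      "d0 M f' q = \<sigma> q" "d0 M g' q = \<tau> q" "V' q = V q" "c = koszul \<sigma> \<tau> f' g' V' q"
      using R by blast
    have "c = koszul \<sigma> \<tau> f' g' V q"
      using koszul_indep_field[OF q \<sigma> R'(1,4,2,5,3) V R'(6)] R'(7) by simp
    also have "\<dots> = koszul \<sigma> \<tau> f g' V q"
      by (rule koszul_indep_function[OF q \<sigma> R'(1,4) f R'(2,5) V])
    \<comment> \<open>Independence of the second function is reduced to independence of the first by
      skew-symmetry.\<close>
    also have "\<dots> = - koszul \<tau> \<sigma> g' f V q" using koszul_skew[OF f(1) R'(2) V q] by simp
    also have "\<dots> = - koszul \<tau> \<sigma> g f V q"
      using koszul_indep_function[OF q \<sigma>(2,1) R'(2,5) g f V] by simp
    also have "\<dots> = koszul \<sigma> \<tau> f g V q" using koszul_skew[OF f(1) g(1) V q] by simp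
    finally show ?thesis .
  qed
  have "?R (koszul \<sigma> \<tau> f g V q)" using f g V by blast
  then have "(SOME c. ?R c) = koszul \<sigma> \<tau> f g V q"
    by (rule some_equality[where P = ?R]) (rule unique)
  then show ?thesis using q \<sigma> field_tangent[OF V q] by (simp add: form_br_def)
qed

lemma form_primitive:
  assumes "\<sigma> \<in> forms" "q \<in> S"
  obtains f where "f \<in> smooth_functions M" "d0 M f q = \<sigma> q"
  using covector_exact[OF assms(2) form_cotangent[OF assms]] .

lemma contract_add_field:
  assumes "\<delta> \<in> forms" "V \<in> vfields" "V' \<in> vfields"
  shows "contract \<delta> (V + V') = contract \<delta> V + contract \<delta> V'"
proof
  show "contract \<delta> (V + V') q = (contract \<delta> V + contract \<delta> V') q" for q
    using assms cotangent_add[OF form_cotangent[OF assms(1)] field_tangent[OF assms(2)] field_tangent[OF assms(3)], of q]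
    by (cases "q \<in> S") (simp_all add: contract_def form_outside)
qed

lemma contract_scaleR_field:
  assumes "\<delta> \<in> forms" "V \<in> vfields"
  shows "contract \<delta> (c *\<^sub>R V) = c *\<^sub>R contract \<delta> V"
proof
  show "contract \<delta> (c *\<^sub>R V) q = (c *\<^sub>R contract \<delta> V) q" for q
    using assms cotangent_scaleR[OF form_cotangent[OF assms(1)] field_tangent[OF assms(2)], of q c]
    by (cases "q \<in> S") (simp_all add: contract_def form_outside)
qed

lemma form_br_outside: "q \<notin> S \<Longrightarrow> form_br \<sigma> \<tau> q = 0"
  by (simp add: form_br_def fun_eq_iff)

lemma form_br_cotangent:
  assumes q: "q \<in> S" and \<sigma>: "\<sigma> \<in> forms" "\<tau> \<in> forms"
  shows "form_br \<sigma> \<tau> q \<in> cotangent M q"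
proof -
  obtain f where f: "f \<in> smooth_functions M" "d0 M f q = \<sigma> q" using form_primitive[OF \<sigma>(1) q] .
  obtain g where g: "g \<in> smooth_functions M" "d0 M g q = \<tau> q" using form_primitive[OF \<sigma>(2) q] .
  note eq = form_br_eq[OF q \<sigma> f g]
  have \<delta>: "\<tau> - exact g \<in> forms" "\<sigma> - exact f \<in> forms"
    using \<sigma> f(1) g(1) by (simp_all add: form_diff exact_form)
  note anc = anchor_field_tangent[OF \<sigma>(1) q] anchor_field_tangent[OF \<sigma>(2) q]
  show ?thesis
    unfolding cotangent_def dual_of_def supported_on_def linear_over_def mem_Collect_eq
  proof (intro conjI ballI allI impI)
    show "form_br \<sigma> \<tau> q v = 0" if "v \<notin> tangent M q" for v using that by (simp add: form_br_def)
    fix v assume v: "v \<in> tangent M q"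
    obtain V where V: "V \<in> vfields" "V q = v" using ex_field_through[OF q v] .
    show "form_br \<sigma> \<tau> q (c *\<^sub>R v) = c *\<^sub>R form_br \<sigma> \<tau> q v" for c
    proof -
      have "koszul \<sigma> \<tau> f g (c *\<^sub>R V) q = c * koszul \<sigma> \<tau> f g V q"
        unfolding koszul_def contract_scaleR_field[OF \<delta>(1) V(1)] contract_scaleR_field[OF \<delta>(2) V(1)]
          tangent_scaleR[OF anc(1) contract_smooth[OF \<delta>(1) V(1)]]
          tangent_scaleR[OF anc(2) contract_smooth[OF \<delta>(2) V(1)]] scaleR_fun_apply
        by (simp add: algebra_simps)
      then show ?thesis using eq[OF V(1)] eq[OF field_scaleR[OF V(1)], of c] V(2) by simp
    qed
    fix w assume w: "w \<in> tangent M q"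
    obtain U where U: "U \<in> vfields" "U q = w" using ex_field_through[OF q w] .
    show "form_br \<sigma> \<tau> q (v + w) = form_br \<sigma> \<tau> q v + form_br \<sigma> \<tau> q w"
    proof -
      have "koszul \<sigma> \<tau> f g (V + U) q = koszul \<sigma> \<tau> f g V q + koszul \<sigma> \<tau> f g U q"
        unfolding koszul_def contract_add_field[OF \<delta>(1) V(1) U(1)] contract_add_field[OF \<delta>(2) V(1) U(1)]
          tangent_add[OF anc(1) contract_smooth[OF \<delta>(1) V(1)] contract_smooth[OF \<delta>(1) U(1)]]
          tangent_add[OF anc(2) contract_smooth[OF \<delta>(2) V(1)] contract_smooth[OF \<delta>(2) U(1)]]
        by simp
      then show ?thesis using eq[OF V(1)] eq[OF U(1)] eq[OF field_add[OF V(1) U(1)]] V(2) U(2) by simp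
    qed
  qed
qed

lemma form_br_eqI:
  assumes \<sigma>: "\<sigma> \<in> forms" "\<tau> \<in> forms" and \<theta>: "\<And>q. q \<in> S \<Longrightarrow> \<theta> q \<in> cotangent M q"
    "\<And>q. q \<notin> S \<Longrightarrow> \<theta> q = 0"
    and eq: "\<And>q V. q \<in> S \<Longrightarrow> V \<in> vfields \<Longrightarrow> form_br \<sigma> \<tau> q (V q) = \<theta> q (V q)"
  shows "form_br \<sigma> \<tau> = \<theta>"
proof
  fix q
  show "form_br \<sigma> \<tau> q = \<theta> q"
  proof (cases "q \<in> S")
    case True
    show ?thesis
    proof (rule cotangent_eqI[OF form_br_cotangent[OF True \<sigma>] \<theta>(1)[OF True]])
      fix v assume v: "v \<in> tangent M q"
      obtain V where V: "V \<in> vfields" "V q = v" using ex_field_through[OF True v] .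
      show "form_br \<sigma> \<tau> q v = \<theta> q v" using eq[OF True V(1)] V(2) by simp
    qed
  qed (simp add: form_br_outside \<theta>(2))
qed

section \<open>Algebraic rules for the bracket along the submanifold\<close>

lemma form_br_skew:
  assumes \<sigma>: "\<sigma> \<in> forms" "\<tau> \<in> forms"
  shows "form_br \<tau> \<sigma> = - form_br \<sigma> \<tau>"
proof (rule form_br_eqI[OF \<sigma>(2,1)])
  show "(- form_br \<sigma> \<tau>) q \<in> cotangent M q" if "q \<in> S" for q
    using subspace_neg[OF subspace_cotangent form_br_cotangent[OF that \<sigma>]] by simp
  show "(- form_br \<sigma> \<tau>) q = 0" if "q \<notin> S" for q using that by (simp add: form_br_outside)
  fix q V assume q: "q \<in> S" and V: "V \<in> vfields"
  obtain f where f: "f \<in> smooth_functions M" "d0 M f q = \<sigma> q" using form_primitive[OF \<sigma>(1) q] .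
  obtain g where g: "g \<in> smooth_functions M" "d0 M g q = \<tau> q" using form_primitive[OF \<sigma>(2) q] .
  show "form_br \<tau> \<sigma> q (V q) = (- form_br \<sigma> \<tau>) q (V q)"
    using form_br_eq[OF q \<sigma> f g V] form_br_eq[OF q \<sigma>(2,1) g f V] koszul_skew[OF f(1) g(1) V q] by simp
qed

lemma exact_add:
  "f \<in> smooth_functions M \<Longrightarrow> g \<in> smooth_functions M \<Longrightarrow> exact (f + g) = exact f + exact g"
  by (auto simp: exact_def d0_add restrict0_def fun_eq_iff)

lemma exact_scaleR: "f \<in> smooth_functions M \<Longrightarrow> exact (c *\<^sub>R f) = c *\<^sub>R exact f"
  by (auto simp: exact_def d0_scaleR restrict0_def fun_eq_iff)

lemma form_br_add_right:
  assumes \<sigma>: "\<sigma> \<in> forms" and \<tau>: "\<tau> \<in> forms" "\<tau>' \<in> forms"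
  shows "form_br \<sigma> (\<tau> + \<tau>') = form_br \<sigma> \<tau> + form_br \<sigma> \<tau>'"
proof (rule form_br_eqI[OF \<sigma> form_add[OF \<tau>]])
  show "(form_br \<sigma> \<tau> + form_br \<sigma> \<tau>') q \<in> cotangent M q" if "q \<in> S" for q
    using subspace_add[OF subspace_cotangent form_br_cotangent[OF that \<sigma> \<tau>(1)]
        form_br_cotangent[OF that \<sigma> \<tau>(2)]] by simp
  show "(form_br \<sigma> \<tau> + form_br \<sigma> \<tau>') q = 0" if "q \<notin> S" for q using that by (simp add: form_br_outside)
  fix q V assume q: "q \<in> S" and V: "V \<in> vfields"
  obtain f where f: "f \<in> smooth_functions M" "d0 M f q = \<sigma> q" using form_primitive[OF \<sigma> q] .
  obtain g where g: "g \<in> smooth_functions M" "d0 M g q = \<tau> q" using form_primitive[OF \<tau>(1) q] .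
  obtain g' where g': "g' \<in> smooth_functions M" "d0 M g' q = \<tau>' q" using form_primitive[OF \<tau>(2) q] .
  have gg': "g + g' \<in> smooth_functions M" "d0 M (g + g') q = (\<tau> + \<tau>') q"
    using g g' by (simp_all add: d0_add)
  have \<delta>: "\<tau> - exact g \<in> forms" "\<tau>' - exact g' \<in> forms"
    using \<tau> g(1) g'(1) by (simp_all add: form_diff exact_form)
  have 1: "contract (\<tau> + \<tau>' - exact (g + g')) V = contract (\<tau> - exact g) V + contract (\<tau>' - exact g') V"
    by (simp add: contract_def exact_add[OF g(1) g'(1)] fun_eq_iff)
  have "anchor_field \<sigma> q (contract (\<tau> + \<tau>' - exact (g + g')) V)
      = anchor_field \<sigma> q (contract (\<tau> - exact g) V) + anchor_field \<sigma> q (contract (\<tau>' - exact g') V)"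
    unfolding 1
    by (rule tangent_add[OF anchor_field_tangent[OF \<sigma> q] contract_smooth[OF \<delta>(1) V] contract_smooth[OF \<delta>(2) V]])
  moreover have "V q (br f (g + g')) = V q (br f g) + V q (br f g')"
    unfolding br_add_right[OF g(1) g'(1)]
    by (rule tangent_add[OF field_tangent[OF V q] br_smooth[OF f(1) g(1)] br_smooth[OF f(1) g'(1)]])
  ultimately show "form_br \<sigma> (\<tau> + \<tau>') q (V q) = (form_br \<sigma> \<tau> + form_br \<sigma> \<tau>') q (V q)"
    unfolding form_br_eq[OF q \<sigma> form_add[OF \<tau>] f gg' V] plus_fun_apply
      form_br_eq[OF q \<sigma> \<tau>(1) f g V] form_br_eq[OF q \<sigma> \<tau>(2) f g' V] koszul_def
      anchor_field_add[OF \<tau>]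
    by linarith
qed

lemma form_br_mult_right:
  assumes h: "h \<in> smooth_functions N" and \<sigma>: "\<sigma> \<in> forms" and \<tau>: "\<tau> \<in> forms"
  shows "form_br \<sigma> (h \<bullet>\<^sub>s \<tau>) = h \<bullet>\<^sub>s form_br \<sigma> \<tau> + (\<lambda>q. anchor_field \<sigma> q h) \<bullet>\<^sub>s \<tau>"
    (is "_ = ?R")
proof (rule form_br_eqI[OF \<sigma> form_mult[OF h \<tau>]])
  show "?R q \<in> cotangent M q" if "q \<in> S" for q
    using subspace_add[OF subspace_cotangent
        subspace_scale[OF subspace_cotangent form_br_cotangent[OF that \<sigma> \<tau>]]
        subspace_scale[OF subspace_cotangent form_cotangent[OF \<tau> that]]] by simp
  show "?R q = 0" if "q \<notin> S" for q using that by (simp add: form_br_outside form_outside[OF \<tau>])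
  fix q V assume q: "q \<in> S" and V: "V \<in> vfields"
  obtain f where f: "f \<in> smooth_functions M" "d0 M f q = \<sigma> q" using form_primitive[OF \<sigma> q] .
  obtain g where g: "g \<in> smooth_functions M" "d0 M g q = \<tau> q" using form_primitive[OF \<tau> q] .
  \<comment> \<open>A constant multiple of \<open>g\<close> will do, since only the differential at
    \<open>q\<close> has to match. The derivative of \<open>h\<close> enters through the product
    rule for \<open>h * contract \<tau> V\<close>.\<close>
  let ?g = "h q *\<^sub>R g"
  have hg: "?g \<in> smooth_functions M" "d0 M ?g q = (h \<bullet>\<^sub>s \<tau>) q"
    using g by (simp_all add: d0_scaleR)
  note T = anchor_field_tangent[OF \<sigma> q]
  note sm = contract_smooth[OF \<tau> V] contract_smooth[OF exact_form[OF g(1)] V]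
  have 1: "contract (h \<bullet>\<^sub>s \<tau> - exact ?g) V = h * contract \<tau> V - h q *\<^sub>R contract (exact g) V"
    by (simp add: contract_def exact_scaleR[OF g(1)] fun_eq_iff)
  have e1: "anchor_field \<sigma> q (contract (h \<bullet>\<^sub>s \<tau> - exact ?g) V)
      = h q * anchor_field \<sigma> q (contract \<tau> V) + contract \<tau> V q * anchor_field \<sigma> q h
        - h q * anchor_field \<sigma> q (contract (exact g) V)"
    unfolding 1 N.tangent_diff[OF T N.mult_smooth[OF h sm(1)] N.scaleR_smooth[OF sm(2)]]
      tangent_mult[OF T h sm(1)] tangent_scaleR[OF T sm(2)] by simp
  have e2: "anchor_field \<sigma> q (contract (\<tau> - exact g) V)
      = anchor_field \<sigma> q (contract \<tau> V) - anchor_field \<sigma> q (contract (exact g) V)"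
    unfolding contract_diff_form by (rule N.tangent_diff[OF T sm])
  have e3: "V q (br f ?g) = h q * V q (br f g)"
    unfolding br_scaleR_right[OF g(1)]
    by (rule tangent_scaleR[OF field_tangent[OF V q] br_smooth[OF f(1) g(1)]])
  have "koszul \<sigma> (h \<bullet>\<^sub>s \<tau>) f ?g V q
      = h q * koszul \<sigma> \<tau> f g V q + anchor_field \<sigma> q h * contract \<tau> V q"
    unfolding koszul_def anchor_field_mult[OF \<tau>] e1 e2 e3 by (simp add: algebra_simps)
  then show "form_br \<sigma> (h \<bullet>\<^sub>s \<tau>) q (V q) = ?R q (V q)"
    unfolding form_br_eq[OF q \<sigma> form_mult[OF h \<tau>] f hg V]
    by (simp add: contract_def form_br_eq[OF q \<sigma> \<tau> f g V])
qed

text \<open>With \<open>f\<close> and \<open>g\<close> themselves as the auxiliary functions, the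
  correction terms of the Koszul formula vanish.\<close>

lemma form_br_exact:
  assumes f: "f \<in> smooth_functions M" and g: "g \<in> smooth_functions M"
  shows "form_br (exact f) (exact g) = exact (br f g)"
proof (rule form_br_eqI[OF exact_form[OF f] exact_form[OF g]])
  show "exact (br f g) q \<in> cotangent M q" if "q \<in> S" for q using that by (simp add: exact_at d0_cotangent)
  show "exact (br f g) q = 0" if "q \<notin> S" for q using that by (rule exact_outside)
  fix q V assume q: "q \<in> S" and V: "V \<in> vfields"
  have "contract (\<sigma> - \<sigma>) V = 0" for \<sigma> by (simp add: contract_def fun_eq_iff)
  then have "koszul (exact f) (exact g) f g V q = V q (br f g)"
    unfolding koszul_def
    using N.tangent_zero_fun[OF anchor_field_tangent[OF exact_form[OF f] q]]
      N.tangent_zero_fun[OF anchor_field_tangent[OF exact_form[OF g] q]] by simp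
  then show "form_br (exact f) (exact g) q (V q) = exact (br f g) q (V q)"
    using form_br_eq[OF q exact_form[OF f] exact_form[OF g] f _ g _ V] q
    by (simp add: exact_at d0_apply S_in_M field_tangent[OF V])
qed

lemma form_br_add_left:
  assumes "\<sigma> \<in> forms" "\<sigma>' \<in> forms" "\<tau> \<in> forms"
  shows "form_br (\<sigma> + \<sigma>') \<tau> = form_br \<sigma> \<tau> + form_br \<sigma>' \<tau>"
  using form_br_add_right[OF assms(3,1,2)] form_br_skew[OF assms(3) form_add[OF assms(1,2)]]
    form_br_skew[OF assms(3,1)] form_br_skew[OF assms(3,2)] by simp

lemma form_br_mult_left:
  assumes "h \<in> smooth_functions N" "\<sigma> \<in> forms" "\<tau> \<in> forms"
  shows "form_br (h \<bullet>\<^sub>s \<sigma>) \<tau> = h \<bullet>\<^sub>s form_br \<sigma> \<tau> - (\<lambda>q. anchor_field \<tau> q h) \<bullet>\<^sub>s \<sigma>"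
  unfolding form_br_skew[OF assms(3) form_mult[OF assms(1,2)]] form_br_mult_right[OF assms(1,3,2)]
    form_br_skew[OF assms(3,2)]
  by (simp add: fun_eq_iff)

text \<open>Near a point \<open>\<tau>\<close> is replaced by \<open>\<rho>\<close> times
  \<open>\<tau>\<close>, a combination of exact forms, and the Leibniz rule reduces smoothness to
  the exact case. One argument is kept fixed so that the lemma can be used for each argument in
  turn.\<close>

lemma form_br_locally_smooth:
  assumes \<sigma>: "\<sigma> \<in> forms" and exact: "\<And>x. x \<in> smooth_functions M \<Longrightarrow> form_br \<sigma> (exact x) \<in> forms"
    and \<tau>: "\<tau> \<in> forms"
  shows "form_br \<sigma> \<tau> \<in> forms"
proof (rule formI)
  show "form_br \<sigma> \<tau> q = 0" if "q \<notin> S" for q using that by (rule form_br_outside)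
  show "form_br \<sigma> \<tau> q \<in> cotangent M q" if "q \<in> S" for q using that \<sigma> \<tau> by (rule form_br_cotangent)
  fix V assume V: "V \<in> vfields"
  show "contract (form_br \<sigma> \<tau>) V \<in> smooth_functions N"
  proof (rule N.smooth_locally)
    show "supported_on S (contract (form_br \<sigma> \<tau>) V)"
      by (simp add: supported_on_def contract_def form_br_outside)
    fix q assume q: "q \<in> S"
    obtain \<rho> G E and a x :: "'e \<Rightarrow> 'p \<Rightarrow> real"
      where r: "\<rho> \<in> smooth_functions N" "openin (top_of N) G" "q \<in> G" "\<forall>z\<in>G. \<rho> z = 1" "finite E"
        "\<forall>b\<in>E. a b \<in> smooth_functions N" "\<forall>b\<in>E. x b \<in> smooth_functions M"
        "\<rho> \<bullet>\<^sub>s \<tau> = (\<Sum>b\<in>E. a b \<bullet>\<^sub>s exact (x b))"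
      using local_representation[OF \<tau> q] .
    have "form_br \<sigma> (\<Sum>b\<in>E'. a b \<bullet>\<^sub>s exact (x b)) \<in> forms" if "E' \<subseteq> E" for E'
      using finite_subset[OF that r(5)] that
    proof (induction E' rule: finite_induct)
      case empty
      have "form_br \<sigma> 0 = 0" using form_br_add_right[OF \<sigma> zero_form zero_form] by simp
      then show ?case unfolding sum.empty using zero_form by metis
    next
      case (insert b E')
      have b: "a b \<in> smooth_functions N" "x b \<in> smooth_functions M" using insert.prems r(6,7) by auto
      have sum: "(\<Sum>b\<in>E'. a b \<bullet>\<^sub>s exact (x b)) \<in> forms"
        using insert.prems r(6,7) by (intro form_sum form_mult exact_form) auto
      have "form_br \<sigma> (a b \<bullet>\<^sub>s exact (x b)) \<in> forms"
        unfolding form_br_mult_right[OF b(1) \<sigma> exact_form[OF b(2)]]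
        by (intro form_add form_mult b anchor_field_smooth \<sigma> exact exact_form)
      moreover have "form_br \<sigma> (\<Sum>b\<in>E'. a b \<bullet>\<^sub>s exact (x b)) \<in> forms"
        using insert.IH insert.prems by blast
      ultimately show ?case
        unfolding sum.insert[OF insert.hyps] form_br_add_right[OF \<sigma> form_mult[OF b(1) exact_form[OF b(2)]] sum]
        by (rule form_add)
    qed
    then have "form_br \<sigma> (\<rho> \<bullet>\<^sub>s \<tau>) \<in> forms" unfolding r(8) by blast
    then have "contract (form_br \<sigma> (\<rho> \<bullet>\<^sub>s \<tau>)) V \<in> smooth_functions N" using V by (rule contract_smooth)
    moreover have "contract (form_br \<sigma> \<tau>) V z = contract (form_br \<sigma> (\<rho> \<bullet>\<^sub>s \<tau>)) V z" if z: "z \<in> G" for z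
    proof -
      have zS: "z \<in> S" using openin_subset[OF r(2)] z by blast
      \<comment> \<open>\<open>\<rho>\<close> is constant near \<open>z\<close>, so the derivative
        term of the Leibniz rule disappears and both brackets agree on \<open>G\<close>.\<close>
      have "anchor_field \<sigma> z \<rho> = anchor_field \<sigma> z (const_on S 1)"
        by (rule N.tangent_local[OF anchor_field_tangent[OF \<sigma> zS] r(1) N.const_smooth r(2) z])
          (use r(4) openin_subset[OF r(2)] in auto)
      then have "anchor_field \<sigma> z \<rho> = 0"
        using N.tangent_const[OF anchor_field_tangent[OF \<sigma> zS] zS] by simp
      then show ?thesis
        unfolding form_br_mult_right[OF r(1) \<sigma> \<tau>] contract_def using r(4) z by simp
    qed
    ultimately show "\<exists>G g. openin (top_of N) G \<and> q \<in> G \<and> g \<in> smooth_functions N \<and>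
        (\<forall>x\<in>G. contract (form_br \<sigma> \<tau>) V x = g x)"
      using r(2,3) by (intro exI[of _ G] exI[of _ "contract (form_br \<sigma> (\<rho> \<bullet>\<^sub>s \<tau>)) V"]) blast
  qed
qed

lemma form_br_form:
  assumes \<sigma>: "\<sigma> \<in> forms" and \<tau>: "\<tau> \<in> forms"
  shows "form_br \<sigma> \<tau> \<in> forms"
proof (rule form_br_locally_smooth[OF \<sigma> _ \<tau>])
  fix x assume x: "x \<in> smooth_functions M"
  have "form_br (exact x) \<sigma> \<in> forms"
    by (rule form_br_locally_smooth[OF exact_form[OF x] _ \<sigma>])
      (simp add: form_br_exact x exact_form br_smooth)
  then show "form_br \<sigma> (exact x) \<in> forms"
    using form_br_skew[OF exact_form[OF x] \<sigma>] form_minus by simp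
qed

text \<open>At a point, split \<open>\<alpha> = df + \<gamma>\<close> and
  \<open>\<beta> = dg + \<delta>\<close> with \<open>\<gamma>\<close>, \<open>\<delta>\<close> zero
  there. The commutator terms of \<open>d1\<close> are then evaluated on \<open>f\<close> and
  \<open>g\<close>, and the invariant formula turns into the Koszul formula.\<close>

lemma form_bracket_restrict:
  assumes \<alpha>: "\<alpha> \<in> one_forms M" and \<beta>: "\<beta> \<in> one_forms M"
  shows "restrict0 S (form_bracket M P \<alpha> \<beta>) = form_br (restrict0 S \<alpha>) (restrict0 S \<beta>)"
proof -
  let ?A = "sharp_field \<alpha>" and ?B = "sharp_field \<beta>"
  note rf = restrict_one_form[OF \<alpha>] restrict_one_form[OF \<beta>]
  have eq: "form_br (restrict0 S \<alpha>) (restrict0 S \<beta>) q v = form_bracket M P \<alpha> \<beta> q v"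
    if q: "q \<in> S" and v: "v \<in> tangent M q" for q v
  proof -
    have cot: "\<alpha> p \<in> cotangent M p" "\<beta> p \<in> cotangent M p" if "p \<in> points M" for p
      using that \<alpha> \<beta> by (auto simp: one_forms_def)
    have qM: "q \<in> points M" using q by (rule S_in_M)
    obtain Z where Z: "Z \<in> vector_fields M" "Z q = v" using M.ex_vector_field_through[OF qM v] .
    obtain f where f: "f \<in> smooth_functions M" "d0 M f q = \<alpha> q"
      using form_primitive[OF rf(1) q] q by auto
    obtain g where g: "g \<in> smooth_functions M" "d0 M g q = \<beta> q"
      using form_primitive[OF rf(2) q] q by auto
    have AB: "?A \<in> vector_fields M" "?B \<in> vector_fields M" using \<alpha> \<beta> sharp_field by blast+
    note TA = M.sharp_tangent[of P, OF P_bivector[OF qM] qM cot(1)[OF qM]]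
      and TB = M.sharp_tangent[of P, OF P_bivector[OF qM] qM cot(2)[OF qM]]
    have TA': "?A q \<in> tangent M q" and TB': "?B q \<in> tangent M q"
      using TA TB by (simp_all add: sharp_field_def)
    define \<gamma> where "\<gamma> = \<alpha> - d0 M f"
    define \<delta> where "\<delta> = \<beta> - d0 M g"
    have forms_M: "\<gamma> \<in> one_forms M" "\<delta> \<in> one_forms M"
    proof -
      interpret MM: pair M M by (rule M.pair_self)
      show "\<gamma> \<in> one_forms M" "\<delta> \<in> one_forms M"
        using MM.form_diff \<alpha> \<beta> M.d0_one_form f(1) g(1)
        unfolding \<gamma>_def \<delta>_def forms_along_self by blast+
    qed
    \<comment> \<open>The derivative of \<open>P(\<gamma>, \<delta>)\<close> at \<open>q\<close> is
      0 as both forms vanish there. Expanding it expresses the derivative of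
      \<open>P(\<alpha>, \<beta>)\<close> by terms in which at least one form is exact.\<close>
    have vanish: "v (contract \<delta> (sharp_field \<gamma>)) = 0"
    proof (rule M.vanishing_contraction[OF qM forms_M(2) _ sharp_field[OF forms_M(1)] _ v])
      show "\<delta> q = 0" using g(2) by (simp add: \<delta>_def)
      have "\<gamma> q = 0" using f(2) by (simp add: \<gamma>_def)
      then show "sharp_field \<gamma> q = 0"
        unfolding sharp_field_def sharp_def
        using bivector_zero_left[OF P_bivector[OF qM] d0_cotangent] by (simp add: zero_fun_def)
    qed
    define PF where "PF \<alpha> \<beta> = (\<lambda>p. P p (\<alpha> p) (\<beta> p))" for \<alpha> \<beta> :: "'p \<Rightarrow> 'p covec"
    have PF_smooth: "PF \<mu> \<nu> \<in> smooth_functions M" if "\<mu> \<in> one_forms M" "\<nu> \<in> one_forms M" for \<mu> \<nu>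
      using P_field that by (simp add: PF_def bivector_fields_def)
    have PF_contract: "contract \<nu> (sharp_field \<mu>) = PF \<mu> \<nu>" if "\<mu> \<in> one_forms M" "\<nu> \<in> one_forms M" for \<mu> \<nu>
    proof
      show "contract \<nu> (sharp_field \<mu>) p = PF \<mu> \<nu> p" for p
        using that M.cotangent_sharp[of P, OF P_bivector, of p "\<mu> p" "\<nu> p"]
        by (cases "p \<in> points M")
          (auto simp: contract_def sharp_field_def PF_def one_forms_def supported_on_def P_outside)
    qed
    have PF_skew: "PF \<beta> \<alpha> = - PF \<alpha> \<beta>"
    proof
      show "PF \<beta> \<alpha> p = (- PF \<alpha> \<beta>) p" for p
        using bivector_skew[OF P_bivector cot(2) cot(1), of p]
        by (cases "p \<in> points M") (simp_all add: PF_def P_outside)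
    qed
    have PF_f: "(\<lambda>z. ?B z f) = - PF (d0 M f) \<beta>"
    proof
      show "?B p f = (- PF (d0 M f) \<beta>) p" for p
        using bivector_skew[OF P_bivector cot(2) d0_cotangent, of p f]
        by (cases "p \<in> points M") (simp_all add: PF_def P_outside sharp_field_def sharp_def)
    qed
    have PF_g: "(\<lambda>z. ?A z g) = PF \<alpha> (d0 M g)"
      by (simp add: PF_def sharp_field_def sharp_def)
    have br_PF: "br f g = PF (d0 M f) (d0 M g)" by (simp add: PF_def poisson_bracket_def)
    have "PF \<gamma> \<delta> = PF \<alpha> \<beta> - PF \<alpha> (d0 M g) - PF (d0 M f) \<beta> + br f g"
    proof
      fix p
      show "PF \<gamma> \<delta> p = (PF \<alpha> \<beta> - PF \<alpha> (d0 M g) - PF (d0 M f) \<beta> + br f g) p"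
      proof (cases "p \<in> points M")
        case True
        note B = P_bivector[OF True] and c = cot[OF True]
        note dc = subspace_diff[OF subspace_cotangent c(2) d0_cotangent, of g]
        show ?thesis
          by (simp add: PF_def \<gamma>_def \<delta>_def br_PF bivector_diff_left[OF B c(1) d0_cotangent dc]
              bivector_diff_right[OF B c(2) d0_cotangent c(1)]
              bivector_diff_right[OF B c(2) d0_cotangent d0_cotangent])
      qed (simp add: PF_def P_outside br_PF)
    qed
    then have vPF: "v (PF \<alpha> \<beta>) = v (PF \<alpha> (d0 M g)) + v (PF (d0 M f) \<beta>) - v (br f g)"
    proof -
      assume e: "PF \<gamma> \<delta> = PF \<alpha> \<beta> - PF \<alpha> (d0 M g) - PF (d0 M f) \<beta> + br f g"
      note s = PF_smooth[OF \<alpha> \<beta>] PF_smooth[OF \<alpha> M.d0_one_form[OF g(1)]]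
        PF_smooth[OF M.d0_one_form[OF f(1)] \<beta>] br_smooth[OF f(1) g(1)]
      have "v (PF \<gamma> \<delta>) = 0" using vanish PF_contract[OF forms_M] by simp
      then show ?thesis
        unfolding e tangent_add[OF v M.diff_smooth[OF M.diff_smooth[OF s(1,2)] s(3)] s(4)]
          M.tangent_diff[OF v M.diff_smooth[OF s(1,2)] s(3)] M.tangent_diff[OF v s(1,2)]
        by simp
    qed
    have smZ: "contract \<alpha> Z \<in> smooth_functions M" "contract \<beta> Z \<in> smooth_functions M"
      "(\<lambda>z. Z z f) \<in> smooth_functions M" "(\<lambda>z. Z z g) \<in> smooth_functions M"
      using \<alpha> \<beta> Z(1) f(1) g(1) by (auto simp: one_forms_def vector_fields_def contract_def)
    have d1\<beta>: "d1 M \<beta> q (?A q) v = ?A q (contract \<beta> Z) - v (PF \<alpha> \<beta>) - \<beta> q (commutator ?A Z q)"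
      using M.d1_eq[OF \<beta> qM AB(1) Z(1)] Z(2) PF_contract[OF \<alpha> \<beta>] by simp
    have d1\<alpha>: "d1 M \<alpha> q (?B q) v = ?B q (contract \<alpha> Z) - v (PF \<beta> \<alpha>) - \<alpha> q (commutator ?B Z q)"
      using M.d1_eq[OF \<alpha> qM AB(2) Z(1)] Z(2) PF_contract[OF \<beta> \<alpha>] by simp
    have com\<beta>: "\<beta> q (commutator ?A Z q) = ?A q (\<lambda>z. Z z g) - v (PF \<alpha> (d0 M g))"
      using d0_apply[OF qM M.commutator_tangent[OF AB(1) Z(1) qM], of g] g(2) Z(2) PF_g
      by (simp add: commutator_def)
    have com\<alpha>: "\<alpha> q (commutator ?B Z q) = ?B q (\<lambda>z. Z z f) + v (PF (d0 M f) \<beta>)"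
    proof -
      have "\<alpha> q (commutator ?B Z q) = ?B q (\<lambda>z. Z z f) - v (\<lambda>z. ?B z f)"
        using d0_apply[OF qM M.commutator_tangent[OF AB(2) Z(1) qM], of f] f(2) Z(2)
        by (simp add: commutator_def)
      then show ?thesis
        unfolding PF_f M.tangent_minus[OF v PF_smooth[OF M.d0_one_form[OF f(1)] \<beta>]] by simp
    qed
    have d0: "d0 M (\<lambda>z. \<alpha> z (sharp M P z (\<beta> z))) q v = v (PF \<beta> \<alpha>)"
      using d0_apply[OF qM v] PF_contract[OF \<beta> \<alpha>] by (simp add: contract_def sharp_field_def)
    have fb: "form_bracket M P \<alpha> \<beta> q v = v (br f g)
        + (?A q (contract \<beta> Z) - ?A q (\<lambda>z. Z z g)) - (?B q (contract \<alpha> Z) - ?B q (\<lambda>z. Z z f))"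
      using d1\<beta> d1\<alpha> vPF com\<beta> com\<alpha> d0
      by (simp add: form_bracket_def sharp_field_def)
    let ?V = "restrict0 S Z"
    have V: "?V \<in> vfields" "?V q = v" using restrict_field[OF Z(1)] Z(2) q by simp_all
    have res: "contract (restrict0 S \<mu> - exact k) ?V = restrict0 S (contract \<mu> Z - (\<lambda>z. Z z k))"
      for \<mu> k
      unfolding contract_diff_form contract_exact[OF V(1)]
      by (auto simp: contract_def restrict0_def fun_eq_iff)
    have anc: "anchor_field (restrict0 S \<mu>) q (restrict0 S F) = sharp_field \<mu> q F"
      if "\<mu> \<in> one_forms M" "F \<in> smooth_functions M" for \<mu> F
      using anchor_restrict[OF q _ that(2), of "\<mu> q"] that(1) q qM
      by (simp add: anchor_field_def sharp_field_def sharp_def one_forms_def)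
    have "form_br (restrict0 S \<alpha>) (restrict0 S \<beta>) q v = koszul (restrict0 S \<alpha>) (restrict0 S \<beta>) f g ?V q"
      using form_br_eq[OF q rf f(1) _ g(1) _ V(1)] f(2) g(2) V(2) q by simp
    also have "\<dots> = v (br f g) + ?A q (contract \<beta> Z - (\<lambda>z. Z z g)) - ?B q (contract \<alpha> Z - (\<lambda>z. Z z f))"
      unfolding koszul_def V(2) res anc[OF \<alpha> M.diff_smooth[OF smZ(2,4)]]
        anc[OF \<beta> M.diff_smooth[OF smZ(1,3)]] by simp
    also have "\<dots> = form_bracket M P \<alpha> \<beta> q v"
      unfolding fb M.tangent_diff[OF TA' smZ(2,4)] M.tangent_diff[OF TB' smZ(1,3)] by simp
    finally show ?thesis .
  qed
  have out: "form_bracket M P \<alpha> \<beta> q v = 0" if "v \<notin> tangent M q" for q v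
    using that by (simp add: form_bracket_def d1_def d0_def)
  show ?thesis
  proof (intro ext)
    fix q v
    show "restrict0 S (form_bracket M P \<alpha> \<beta>) q v = form_br (restrict0 S \<alpha>) (restrict0 S \<beta>) q v"
    proof (cases "q \<in> S \<and> v \<in> tangent M q")
      case True
      then show ?thesis using eq by simp
    next
      case False
      then have "form_br (restrict0 S \<alpha>) (restrict0 S \<beta>) q v = 0" by (auto simp: form_br_def)
      then show ?thesis using False out by (cases "q \<in> S") (simp_all add: restrict0_def)
    qed
  qed
qed

end

section \<open>The restricted Lie algebroid\<close>

context poisson_pair
begin

text \<open>The defect \<open>L\<close> is skew and tensorial in both arguments, so exact forms
  decide, and on them it is the Jacobi identity of \<open>P\<close>. The result in turn makes the
  Jacobiator tensorial.\<close>

lemma anchor_form_br: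
  assumes q: "q \<in> S" and \<sigma>: "\<sigma> \<in> forms" and \<tau>: "\<tau> \<in> forms" and h: "h \<in> smooth_functions N"
  shows "anchor_field (form_br \<sigma> \<tau>) q h
    = anchor_field \<sigma> q (\<lambda>z. anchor_field \<tau> z h) - anchor_field \<tau> q (\<lambda>z. anchor_field \<sigma> z h)"
proof -
  define L where "L \<sigma> \<tau> = anchor_field (form_br \<sigma> \<tau>) q h
    - (anchor_field \<sigma> q (\<lambda>z. anchor_field \<tau> z h) - anchor_field \<tau> q (\<lambda>z. anchor_field \<sigma> z h))"
    for \<sigma> \<tau>
  have skew: "L \<tau> \<sigma> = - L \<sigma> \<tau>" if "\<sigma> \<in> forms" "\<tau> \<in> forms" for \<sigma> \<tau>
    unfolding L_def form_br_skew[OF that] anchor_field_minus[OF form_br_form[OF that]] by simp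
  have add: "L \<mu> (\<nu> + \<nu>') = L \<mu> \<nu> + L \<mu> \<nu>'"
    if "\<mu> \<in> forms" "\<nu> \<in> forms" "\<nu>' \<in> forms" for \<mu> \<nu> \<nu>'
  proof -
    have 1: "(\<lambda>z. anchor_field (\<nu> + \<nu>') z h) = (\<lambda>z. anchor_field \<nu> z h) + (\<lambda>z. anchor_field \<nu>' z h)"
      unfolding anchor_field_add[OF that(2,3)] by (simp add: plus_fun_def)
    have 2: "anchor_field \<mu> q (\<lambda>z. anchor_field (\<nu> + \<nu>') z h)
        = anchor_field \<mu> q (\<lambda>z. anchor_field \<nu> z h) + anchor_field \<mu> q (\<lambda>z. anchor_field \<nu>' z h)"
      unfolding 1
      by (rule tangent_add[OF anchor_field_tangent[OF that(1) q] anchor_field_smooth[OF that(2) h]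
            anchor_field_smooth[OF that(3) h]])
    have 3: "anchor_field (form_br \<mu> (\<nu> + \<nu>')) q h
        = anchor_field (form_br \<mu> \<nu>) q h + anchor_field (form_br \<mu> \<nu>') q h"
      unfolding form_br_add_right[OF that] anchor_field_add[OF form_br_form[OF that(1,2)] form_br_form[OF that(1,3)]]
        plus_fun_apply ..
    have 4: "anchor_field (\<nu> + \<nu>') q u = anchor_field \<nu> q u + anchor_field \<nu>' q u" for u
      unfolding anchor_field_add[OF that(2,3)] plus_fun_apply ..
    show ?thesis unfolding L_def 2 3 4 by simp
  qed
  have mult: "L \<mu> (a \<bullet>\<^sub>s \<nu>) = a q *\<^sub>R L \<mu> \<nu>"
    if "a \<in> smooth_functions N" "\<mu> \<in> forms" "\<nu> \<in> forms" for a \<mu> \<nu>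
  proof -
    have 1: "(\<lambda>z. anchor_field (a \<bullet>\<^sub>s \<nu>) z h) = a * (\<lambda>z. anchor_field \<nu> z h)"
      unfolding anchor_field_mult[OF that(3)] by (simp add: times_fun_def)
    have 2: "anchor_field (form_br \<mu> (a \<bullet>\<^sub>s \<nu>)) q h
        = a q * anchor_field (form_br \<mu> \<nu>) q h + anchor_field \<mu> q a * anchor_field \<nu> q h"
      unfolding form_br_mult_right[OF that]
        anchor_field_add[OF form_mult[OF that(1) form_br_form[OF that(2,3)]]
          form_mult[OF anchor_field_smooth[OF that(2,1)] that(3)]]
        anchor_field_mult[OF form_br_form[OF that(2,3)]] anchor_field_mult[OF that(3)]
      by simp
    have 3: "anchor_field \<mu> q (\<lambda>z. anchor_field (a \<bullet>\<^sub>s \<nu>) z h)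
        = a q * anchor_field \<mu> q (\<lambda>z. anchor_field \<nu> z h) + anchor_field \<nu> q h * anchor_field \<mu> q a"
      unfolding 1
      by (rule tangent_mult[OF anchor_field_tangent[OF that(2) q] that(1) anchor_field_smooth[OF that(3) h]])
    have 4: "anchor_field (a \<bullet>\<^sub>s \<nu>) q u = a q * anchor_field \<nu> q u" for u
      unfolding anchor_field_mult[OF that(3)] by simp
    show ?thesis unfolding L_def 2 3 4 by (simp add: algebra_simps)
  qed
  have exact: "L (exact x) (exact y) = 0" if x: "x \<in> smooth_functions M" and y: "y \<in> smooth_functions M" for x y
  proof -
    let ?A = "anchor_field (exact x)" and ?B = "anchor_field (exact y)"
    have fields: "?A \<in> vector_fields N" "?B \<in> vector_fields N"
      using x y exact_form anchor_field_tangent anchor_field_smooth anchor_field_outside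
      by (auto simp: vector_fields_def supported_on_def)
    \<comment> \<open>Both sides are tangent to \<open>N\<close>, so they may be compared on
      restrictions of functions \<open>F\<close> on \<open>M\<close>, where the anchor acts by the
      bracket of \<open>M\<close>.\<close>
    have "anchor_field (exact (br x y)) q = commutator ?A ?B q"
    proof (rule push_inject[OF anchor_field_tangent[OF exact_form[OF br_smooth[OF x y]] q]
          N.commutator_tangent[OF fields q] q])
      fix F assume F: "F \<in> smooth_functions M"
      have val: "anchor_field (exact u) q (restrict0 S G) = br u G q"
        if "u \<in> smooth_functions M" "G \<in> smooth_functions M" for u G
        using fun_cong[OF anchor_field_exact[OF that], of q] q by simp
      have "br x (br y F) q + br y (br F x) q + br F (br x y) q = 0"
        using fun_cong[OF jacobi[OF x y F], of q] by simp
      moreover have "br y (br F x) q = - br y (br x F) q"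
        unfolding br_skew[of F x] br_minus_right[OF br_smooth[OF x F]] by simp
      moreover have "br F (br x y) q = - br (br x y) F q"
        unfolding br_skew[of F "br x y"] by simp
      ultimately show "anchor_field (exact (br x y)) q (restrict0 S F) = commutator ?A ?B q (restrict0 S F)"
        unfolding commutator_def anchor_field_exact[OF x F] anchor_field_exact[OF y F]
          val[OF br_smooth[OF x y] F] val[OF x br_smooth[OF y F]] val[OF y br_smooth[OF x F]]
        by simp
    qed
    then show ?thesis unfolding L_def form_br_exact[OF x y] by (simp add: commutator_def)
  qed
  have "L (exact x) \<tau> = 0" if x: "x \<in> smooth_functions M" for x
    by (rule tensor_vanishes[OF q \<tau>, of "L (exact x)"])
      (auto simp: add mult exact exact_form x)
  have "- L \<tau> \<sigma> = 0"
  proof (rule tensor_vanishes[OF q \<sigma>, of "\<lambda>\<sigma>. - L \<tau> \<sigma>"])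
    show "- L \<tau> (exact x) = 0" if x: "x \<in> smooth_functions M" for x
      using \<open>\<And>x. x \<in> smooth_functions M \<Longrightarrow> L (exact x) \<tau> = 0\<close>[OF x] skew[OF \<tau> exact_form[OF x]] by simp
  qed (auto simp: add mult \<tau>)
  then show ?thesis using skew[OF \<tau> \<sigma>] by (simp add: L_def)
qed

section \<open>The Jacobi identity for forms along the submanifold\<close>

definition jacobiator :: "('p \<Rightarrow> 'p covec) \<Rightarrow> ('p \<Rightarrow> 'p covec) \<Rightarrow> ('p \<Rightarrow> 'p covec) \<Rightarrow> 'p \<Rightarrow> 'p covec" where
  "jacobiator \<sigma> \<tau> \<upsilon> = form_br \<sigma> (form_br \<tau> \<upsilon>) + form_br \<tau> (form_br \<upsilon> \<sigma>) + form_br \<upsilon> (form_br \<sigma> \<tau>)"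

lemma jacobiator_cyclic: "jacobiator \<tau> \<upsilon> \<sigma> = jacobiator \<sigma> \<tau> \<upsilon>"
  by (simp add: jacobiator_def add.commute add.left_commute)

lemma jacobiator_add:
  assumes "\<sigma> \<in> forms" "\<tau> \<in> forms" "\<upsilon> \<in> forms" "\<upsilon>' \<in> forms"
  shows "jacobiator \<sigma> \<tau> (\<upsilon> + \<upsilon>') = jacobiator \<sigma> \<tau> \<upsilon> + jacobiator \<sigma> \<tau> \<upsilon>'"
  unfolding jacobiator_def form_br_add_right[OF assms(2-4)] form_br_add_left[OF assms(3,4,1)]
    form_br_add_right[OF assms(1) form_br_form[OF assms(2,3)] form_br_form[OF assms(2,4)]]
    form_br_add_right[OF assms(2) form_br_form[OF assms(3,1)] form_br_form[OF assms(4,1)]]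
    form_br_add_left[OF assms(3,4) form_br_form[OF assms(1,2)]]
  by (simp only: add_ac)

lemma form_br_minus_right:
  "\<sigma> \<in> forms \<Longrightarrow> \<tau> \<in> forms \<Longrightarrow> form_br \<sigma> (- \<tau>) = - form_br \<sigma> \<tau>"
proof -
  assume s: "\<sigma> \<in> forms" "\<tau> \<in> forms"
  have "form_br \<sigma> 0 = 0" using form_br_add_right[OF s(1) zero_form zero_form] by simp
  then show ?thesis
    using form_br_add_right[OF s(1,2) form_minus[OF s(2)]] by (simp add: eq_neg_iff_add_eq_0 add.commute)
qed

text \<open>The terms with one derivative of \<open>h\<close> are symmetric in
  \<open>\<sigma>\<close>, \<open>\<tau>\<close> and cancel. Those multiplying
  \<open>\<upsilon>\<close> form the commutator of the anchors of \<open>\<sigma>\<close> and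
  \<open>\<tau>\<close> minus the anchor of their bracket, which is 0 by
  \<open>anchor_form_br\<close>.\<close>

lemma jacobiator_mult:
  assumes h: "h \<in> smooth_functions N" and \<sigma>: "\<sigma> \<in> forms" "\<tau> \<in> forms" "\<upsilon> \<in> forms" and q: "q \<in> S"
  shows "jacobiator \<sigma> \<tau> (h \<bullet>\<^sub>s \<upsilon>) q = h q *\<^sub>R jacobiator \<sigma> \<tau> \<upsilon> q"
proof -
  note f = form_br_form[OF \<sigma>(1,2)] form_br_form[OF \<sigma>(1,3)] form_br_form[OF \<sigma>(2,3)]
  have twice: "form_br \<mu> (form_br \<nu> (h \<bullet>\<^sub>s \<upsilon>)) q = h q *\<^sub>R form_br \<mu> (form_br \<nu> \<upsilon>) q
      + anchor_field \<mu> q h *\<^sub>R form_br \<nu> \<upsilon> q + anchor_field \<nu> q h *\<^sub>R form_br \<mu> \<upsilon> q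
      + anchor_field \<mu> q (\<lambda>z. anchor_field \<nu> z h) *\<^sub>R \<upsilon> q"
    if "\<mu> \<in> forms" "\<nu> \<in> forms" for \<mu> \<nu>
    unfolding form_br_mult_right[OF h that(2) \<sigma>(3)]
      form_br_add_right[OF that(1) form_mult[OF h form_br_form[OF that(2) \<sigma>(3)]]
        form_mult[OF anchor_field_smooth[OF that(2) h] \<sigma>(3)]]
      form_br_mult_right[OF h that(1) form_br_form[OF that(2) \<sigma>(3)]]
      form_br_mult_right[OF anchor_field_smooth[OF that(2) h] that(1) \<sigma>(3)]
    by (simp only: plus_fun_apply module_mult_apply add_ac)
  have 2: "form_br \<tau> (form_br (h \<bullet>\<^sub>s \<upsilon>) \<sigma>) q = - form_br \<tau> (form_br \<sigma> (h \<bullet>\<^sub>s \<upsilon>)) q"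
    "form_br \<tau> (form_br \<upsilon> \<sigma>) q = - form_br \<tau> (form_br \<sigma> \<upsilon>) q"
    unfolding form_br_skew[OF \<sigma>(1) form_mult[OF h \<sigma>(3)]] form_br_skew[OF \<sigma>(1,3)]
      form_br_minus_right[OF \<sigma>(2) form_br_form[OF \<sigma>(1) form_mult[OF h \<sigma>(3)]]]
      form_br_minus_right[OF \<sigma>(2) form_br_form[OF \<sigma>(1,3)]]
    by (simp_all only: uminus_apply)
  have 3: "form_br (h \<bullet>\<^sub>s \<upsilon>) (form_br \<sigma> \<tau>) q
      = h q *\<^sub>R form_br \<upsilon> (form_br \<sigma> \<tau>) q - anchor_field (form_br \<sigma> \<tau>) q h *\<^sub>R \<upsilon> q"
    unfolding form_br_mult_left[OF h \<sigma>(3) f(1)] by (simp only: minus_apply module_mult_apply)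
  show ?thesis
  proof
    fix v
    show "jacobiator \<sigma> \<tau> (h \<bullet>\<^sub>s \<upsilon>) q v = (h q *\<^sub>R jacobiator \<sigma> \<tau> \<upsilon> q) v"
      unfolding jacobiator_def plus_fun_apply 2 twice[OF \<sigma>(1,2)] twice[OF \<sigma>(2,1)] 3
        anchor_form_br[OF q \<sigma>(1,2) h] scaleR_fun_apply minus_apply uminus_apply
      by (simp add: algebra_simps)
  qed
qed

lemma jacobiator_exact:
  assumes "f \<in> smooth_functions M" "g \<in> smooth_functions M" "h \<in> smooth_functions M"
  shows "jacobiator (exact f) (exact g) (exact h) = 0"
proof -
  have "jacobiator (exact f) (exact g) (exact h) = exact (br f (br g h) + br g (br h f) + br h (br f g))"
    using assms by (simp add: jacobiator_def form_br_exact br_smooth exact_add)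
  also have "\<dots> = exact 0" unfolding jacobi[OF assms] ..
  also have "exact 0 = 0" using exact_scaleR[OF M.zero_smooth, of 0] by simp
  finally show ?thesis .
qed

text \<open>Tensoriality is available in the last slot; cyclic invariance brings each argument there
  in turn until all three are exact.\<close>

lemma form_br_jacobi:
  assumes \<sigma>: "\<sigma> \<in> forms" "\<tau> \<in> forms" "\<upsilon> \<in> forms"
  shows "jacobiator \<sigma> \<tau> \<upsilon> = 0"
proof
  fix q
  show "jacobiator \<sigma> \<tau> \<upsilon> q = 0 q"
  proof (cases "q \<in> S")
    case False
    then show ?thesis by (simp add: jacobiator_def form_br_outside)
  next
    case q: True
    have red: "jacobiator \<mu> \<nu> \<omega> q = 0"
      if "\<mu> \<in> forms" "\<nu> \<in> forms" "\<omega> \<in> forms"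
        "\<And>x. x \<in> smooth_functions M \<Longrightarrow> jacobiator \<mu> \<nu> (exact x) q = 0" for \<mu> \<nu> \<omega>
      by (rule tensor_vanishes[OF q that(3), of "\<lambda>\<omega>. jacobiator \<mu> \<nu> \<omega> q"])
        (simp_all only: jacobiator_add[OF that(1,2)] jacobiator_mult[OF _ that(1,2) _ q] that(4) plus_fun_apply)
    have "jacobiator \<sigma> \<tau> \<upsilon> q = 0"
    proof (rule red[OF \<sigma>])
      fix x assume x: "x \<in> smooth_functions M"
      have "jacobiator (exact x) \<sigma> \<tau> q = 0"
      proof (rule red[OF exact_form[OF x] \<sigma>(1,2)])
        fix y assume y: "y \<in> smooth_functions M"
        have "jacobiator (exact y) (exact x) \<sigma> q = 0"
          by (rule red[OF exact_form[OF y] exact_form[OF x] \<sigma>(1)]) (simp add: jacobiator_exact x y)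
        then show "jacobiator (exact x) \<sigma> (exact y) q = 0"
          using jacobiator_cyclic[of "exact x" \<sigma> "exact y"] by simp
      qed
      then show "jacobiator \<sigma> \<tau> (exact x) q = 0"
        using jacobiator_cyclic[of \<sigma> \<tau> "exact x"] by simp
    qed
    then show ?thesis by simp
  qed
qed

lemma form_br_scaleR_right:
  assumes "\<sigma> \<in> forms" "\<tau> \<in> forms"
  shows "form_br \<sigma> (c *\<^sub>R \<tau>) = c *\<^sub>R form_br \<sigma> \<tau>"
proof -
  have 1: "c *\<^sub>R \<tau> = const_on S c \<bullet>\<^sub>s \<tau>" "c *\<^sub>R form_br \<sigma> \<tau> = const_on S c \<bullet>\<^sub>s form_br \<sigma> \<tau>"
    using form_outside[OF assms(2)] form_br_outside by (auto intro!: scaleR_eq_module_mult)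
  have "(\<lambda>q. anchor_field \<sigma> q (const_on S c)) = 0"
  proof
    show "anchor_field \<sigma> q (const_on S c) = 0 q" for q
      using N.tangent_const[OF anchor_field_tangent[OF assms(1)], of q c]
      by (cases "q \<in> S") (simp_all add: anchor_field_outside)
  qed
  then show ?thesis
    unfolding 1 form_br_mult_right[OF N.const_smooth assms] by (simp add: fun_eq_iff)
qed

lemma lie_bracket_form_br: "lie_bracket_on forms form_br"
  unfolding lie_bracket_on_def bilinear_over_def linear_over_def
proof (intro conjI ballI allI)
  fix \<sigma> \<tau> \<upsilon> assume s: "\<sigma> \<in> forms" "\<tau> \<in> forms" "\<upsilon> \<in> forms"
  show "form_br \<sigma> (form_br \<tau> \<upsilon>) + form_br \<tau> (form_br \<upsilon> \<sigma>) + form_br \<upsilon> (form_br \<sigma> \<tau>) = 0"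
    using form_br_jacobi[OF s] unfolding jacobiator_def .
next
  fix \<sigma> \<tau> and c :: real assume s: "\<sigma> \<in> forms" "\<tau> \<in> forms"
  show "form_br (c *\<^sub>R \<tau>) \<sigma> = c *\<^sub>R form_br \<tau> \<sigma>"
    unfolding form_br_skew[OF s(1) form_scaleR[OF s(2)]] form_br_skew[OF s]
      form_br_scaleR_right[OF s] by simp
qed (simp_all add: form_br_form form_br_add_right form_br_add_left form_br_scaleR_right,
    rule form_br_skew)

text \<open>Existence is \<open>form_br\<close>. For uniqueness, two candidates agree on
  restrictions of differentials of functions on \<open>M\<close>, and their difference is tensorial
  because the derivative terms of the Leibniz rule are the same for both.\<close>

lemma restricted_bracket_eq: "restricted_bracket M P N = form_br"
  unfolding restricted_bracket_def
proof (rule the_equality)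
  let ?C = "\<lambda>B. supported_on2 forms forms B \<and> lie_bracket_on forms B \<and>
        (\<forall>\<sigma>\<in>forms. \<forall>\<tau>\<in>forms. \<forall>f\<in>smooth_functions N.
           B \<sigma> (f \<bullet>\<^sub>s \<tau>) = f \<bullet>\<^sub>s B \<sigma> \<tau> + (\<lambda>q. anchor M P N q (\<sigma> q) f) \<bullet>\<^sub>s \<tau>) \<and>
        (\<forall>\<alpha>\<in>one_forms M. \<forall>\<beta>\<in>one_forms M.
           B (restrict0 S \<alpha>) (restrict0 S \<beta>) = restrict0 S (form_bracket M P \<alpha> \<beta>))"
  show "?C form_br"
  proof (intro conjI ballI)
    show "supported_on2 forms forms form_br"
      by (auto simp: supported_on2_def form_br_def fun_eq_iff)
    show "form_br \<sigma> (f \<bullet>\<^sub>s \<tau>) = f \<bullet>\<^sub>s form_br \<sigma> \<tau> + (\<lambda>q. anchor M P N q (\<sigma> q) f) \<bullet>\<^sub>s \<tau>"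
      if "\<sigma> \<in> forms" "\<tau> \<in> forms" "f \<in> smooth_functions N" for \<sigma> \<tau> f
      using form_br_mult_right[OF that(3,1,2)] by (simp add: anchor_field_def)
  qed (simp_all add: lie_bracket_form_br form_bracket_restrict)
  fix B assume C: "?C B"
  have lie: "B \<sigma> (\<tau> + \<tau>') = B \<sigma> \<tau> + B \<sigma> \<tau>'" "B \<tau> \<sigma> = - B \<sigma> \<tau>"
    if "\<sigma> \<in> forms" "\<tau> \<in> forms" "\<tau>' \<in> forms" for \<sigma> \<tau> \<tau>'
    using C that unfolding lie_bracket_on_def bilinear_over_def linear_over_def by blast+
  have leib: "B \<sigma> (f \<bullet>\<^sub>s \<tau>) = f \<bullet>\<^sub>s B \<sigma> \<tau> + (\<lambda>q. anchor_field \<sigma> q f) \<bullet>\<^sub>s \<tau>"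
    if "\<sigma> \<in> forms" "\<tau> \<in> forms" "f \<in> smooth_functions N" for \<sigma> \<tau> f
    using C that unfolding anchor_field_def by blast
  have closed: "B \<sigma> \<tau> \<in> forms" if "\<sigma> \<in> forms" "\<tau> \<in> forms" for \<sigma> \<tau>
    using C that unfolding lie_bracket_on_def by blast
  have ex: "B (exact x) (exact y) = form_br (exact x) (exact y)"
    if "x \<in> smooth_functions M" "y \<in> smooth_functions M" for x y
  proof -
    have "B (exact x) (exact y) = restrict0 S (form_bracket M P (d0 M x) (d0 M y))"
      using C M.d0_one_form[OF that(1)] M.d0_one_form[OF that(2)] unfolding exact_def by blast
    then show ?thesis
      unfolding form_bracket_restrict[OF M.d0_one_form[OF that(1)] M.d0_one_form[OF that(2)]] exact_def .
  qed
  have red: "B \<mu> \<nu> q = form_br \<mu> \<nu> q"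
    if q: "q \<in> S" and \<mu>: "\<mu> \<in> forms" and \<nu>: "\<nu> \<in> forms"
      and e: "\<And>x. x \<in> smooth_functions M \<Longrightarrow> B \<mu> (exact x) q = form_br \<mu> (exact x) q" for \<mu> \<nu> q
  proof -
    have "B \<mu> \<nu> q - form_br \<mu> \<nu> q = 0"
    proof (rule tensor_vanishes[OF q \<nu>, of "\<lambda>\<nu>. B \<mu> \<nu> q - form_br \<mu> \<nu> q"])
      show "B \<mu> (\<sigma> + \<tau>) q - form_br \<mu> (\<sigma> + \<tau>) q = B \<mu> \<sigma> q - form_br \<mu> \<sigma> q + (B \<mu> \<tau> q - form_br \<mu> \<tau> q)"
        if "\<sigma> \<in> forms" "\<tau> \<in> forms" for \<sigma> \<tau>
        unfolding lie(1)[OF \<mu> that] form_br_add_right[OF \<mu> that] by simp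
      show "B \<mu> (a \<bullet>\<^sub>s \<sigma>) q - form_br \<mu> (a \<bullet>\<^sub>s \<sigma>) q = a q *\<^sub>R (B \<mu> \<sigma> q - form_br \<mu> \<sigma> q)"
        if "a \<in> smooth_functions N" "\<sigma> \<in> forms" for a \<sigma>
        unfolding leib[OF \<mu> that(2,1)] form_br_mult_right[OF that(1) \<mu> that(2)]
        by (simp add: scaleR_diff_right)
    qed (simp add: e)
    then show ?thesis by simp
  qed
  show "B = form_br"
  proof (intro ext)
    fix \<sigma> \<tau> q v
    show "B \<sigma> \<tau> q v = form_br \<sigma> \<tau> q v"
    proof (cases "\<sigma> \<in> forms \<and> \<tau> \<in> forms")
      case False
      then have "B \<sigma> \<tau> = 0" "form_br \<sigma> \<tau> = 0"
        using C by (auto simp: supported_on2_def form_br_def fun_eq_iff)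
      then show ?thesis by simp
    next
      case True
      then have s: "\<sigma> \<in> forms" "\<tau> \<in> forms" by auto
      show ?thesis
      proof (cases "q \<in> S")
        case False
        then show ?thesis using form_outside[OF closed[OF s]] form_br_outside by simp
      next
        case q: True
        have "B \<sigma> (exact x) q = form_br \<sigma> (exact x) q" if x: "x \<in> smooth_functions M" for x
        proof -
          have "B (exact x) \<sigma> q = form_br (exact x) \<sigma> q"
            by (rule red[OF q exact_form[OF x] s(1)]) (simp add: ex x)
          then show ?thesis
            unfolding lie(2)[OF exact_form[OF x] s(1,1)] form_br_skew[OF exact_form[OF x] s(1)] by simp
        qed
        then have "B \<sigma> \<tau> q = form_br \<sigma> \<tau> q" by (rule red[OF q s])
        then show ?thesis by simp
      qed
    qed
  qed
qed

end

section \<open>The Poisson structure of the submanifold\<close>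

lemma bivector_supported:
  "B \<in> bivectors X p \<Longrightarrow> \<alpha> \<notin> cotangent X p \<or> \<beta> \<notin> cotangent X p \<Longrightarrow> B \<alpha> \<beta> = 0"
  unfolding bivectors_def supported_on2_def by blast

context pair
begin

text \<open>Each covector of \<open>N\<close> is a differential \<open>dg\<close>, and near
  \<open>q\<close> the function \<open>g\<close> is the restriction of a function on
  \<open>M\<close>.\<close>

lemma pull_surjective:
  assumes q: "q \<in> S" and \<beta>: "\<beta> \<in> cotangent N q"
  obtains F where "F \<in> smooth_functions M" "pull M N q (d0 M F q) = \<beta>"
proof -
  interpret NN: pair N N by (rule N.pair_self)
  obtain g where g: "g \<in> smooth_functions N" "d0 N g q = \<beta>" using NN.covector_exact[OF q \<beta>] .
  obtain F G where F: "F \<in> smooth_functions M" "openin (top_of N) G" "q \<in> G"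
    "\<forall>x\<in>G. restrict0 S F x = g x" using extend_smooth[OF g(1) q] .
  have "d0 N (restrict0 S F) q = d0 N g q"
  proof (rule cotangent_eqI[OF d0_cotangent d0_cotangent])
    fix v assume v: "v \<in> tangent N q"
    show "d0 N (restrict0 S F) q v = d0 N g q v"
      using N.tangent_local[OF v restrict_smooth[OF F(1)] g(1) F(2,3) bspec[OF F(4)]] q v
      by (simp add: d0_apply)
  qed
  then show thesis using that[OF F(1)] pull_d0[OF F(1) q] g(2) by simp
qed

text \<open>Pullbacks of covectors of \<open>M\<close> exhaust those of \<open>N\<close>. This is
  the uniqueness part for \<open>restricted_bivector\<close>.\<close>

lemma bivector_push_inject:
  assumes q: "q \<in> S" and B: "B \<in> bivectors N q" "B' \<in> bivectors N q"
    and eq: "bivector_push M N q B = bivector_push M N q B'"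
  shows "B = B'"
proof (intro ext)
  fix \<alpha> \<beta>
  show "B \<alpha> \<beta> = B' \<alpha> \<beta>"
  proof (cases "\<alpha> \<in> cotangent N q \<and> \<beta> \<in> cotangent N q")
    case True
    obtain F where F: "pull M N q (d0 M F q) = \<alpha>" using pull_surjective[OF q] True by blast
    obtain G where G: "pull M N q (d0 M G q) = \<beta>" using pull_surjective[OF q] True by blast
    have "bivector_push M N q B (d0 M F q) (d0 M G q) = bivector_push M N q B' (d0 M F q) (d0 M G q)"
      unfolding eq ..
    then show ?thesis unfolding bivector_push_def F G by (simp add: d0_cotangent)
  next
    case False
    then show ?thesis using bivector_supported[OF B(1)] bivector_supported[OF B(2)] by metis
  qed
qed

end

context poisson_pair
begin

lemma restricted_bivector_eq: "restricted_bivector M P N = Q"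
proof
  fix q
  show "restricted_bivector M P N q = Q q"
  proof (cases "q \<in> S")
    case True
    have "(THE B. B \<in> bivectors N q \<and> P q = bivector_push M N q B) = Q q"
    proof (rule the_equality)
      show "Q q \<in> bivectors N q \<and> P q = bivector_push M N q (Q q)"
        using Q_bivector[OF True] P_push[OF True] by simp
      show "B = Q q" if "B \<in> bivectors N q \<and> P q = bivector_push M N q B" for B
        using bivector_push_inject[OF True _ Q_bivector[OF True]] that P_push[OF True] by simp
    qed
    then show ?thesis using True by (simp add: restricted_bivector_def)
  qed (simp add: restricted_bivector_def Q_outside)
qed

abbreviation "brN \<equiv> poisson_bracket N Q"

lemma brN_apply: "brN f g q = Q q (d0 N f q) (d0 N g q)"
  by (simp add: poisson_bracket_def)

text \<open>The differential of a function on \<open>S\<close> is the pullback of that of a local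
  extension, and \<open>P q\<close> is \<open>Q q\<close> evaluated on pullbacks. Smoothness and the
  Jacobi identity of the bracket on \<open>S\<close> are transferred from \<open>M\<close> in this
  way.\<close>

lemma brN_local:
  assumes q: "q \<in> S" and f: "f \<in> smooth_functions N" "F \<in> smooth_functions M"
    and g: "g \<in> smooth_functions N" "K \<in> smooth_functions M"
    and G: "openin (top_of N) G" "q \<in> G" "\<forall>x\<in>G. restrict0 S F x = f x" "\<forall>x\<in>G. restrict0 S K x = g x"
  shows "brN f g q = br F K q"
proof -
  have d: "d0 N h q = pull M N q (d0 M H q)"
    if "h \<in> smooth_functions N" "H \<in> smooth_functions M" "\<forall>x\<in>G. restrict0 S H x = h x" for h H
    unfolding pull_d0[OF that(2) q]
  proof (rule cotangent_eqI[OF d0_cotangent d0_cotangent])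
    fix v assume v: "v \<in> tangent N q"
    show "d0 N h q v = d0 N (restrict0 S H) q v"
      using N.tangent_local[OF v restrict_smooth[OF that(2)] that(1) G(1,2) bspec[OF that(3)]] q v
      by (simp add: d0_apply)
  qed
  show ?thesis
    unfolding brN_apply br_apply d[OF f G(3)] d[OF g G(4)] P_push[OF q] bivector_push_def
    by (simp add: d0_cotangent)
qed

lemma common_extension:
  assumes q: "q \<in> S" and f: "f \<in> smooth_functions N" and g: "g \<in> smooth_functions N"
  obtains F K G where "F \<in> smooth_functions M" "K \<in> smooth_functions M" "openin (top_of N) G" "q \<in> G"
    "\<forall>x\<in>G. restrict0 S F x = f x" "\<forall>x\<in>G. restrict0 S K x = g x"
proof -
  obtain F G where F: "F \<in> smooth_functions M" "openin (top_of N) G" "q \<in> G"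
    "\<forall>x\<in>G. restrict0 S F x = f x" using extend_smooth[OF f q] .
  obtain K G' where K: "K \<in> smooth_functions M" "openin (top_of N) G'" "q \<in> G'"
    "\<forall>x\<in>G'. restrict0 S K x = g x" using extend_smooth[OF g q] .
  show thesis
    by (rule that[OF F(1) K(1) openin_Int[OF F(2) K(2)]]) (use F K in auto)
qed

lemma brN_outside: "q \<notin> S \<Longrightarrow> brN f g q = 0"
  by (simp add: brN_apply Q_outside)

lemma brN_extension:
  assumes q: "q \<in> S" and f: "f \<in> smooth_functions N" and g: "g \<in> smooth_functions N"
    and F: "F \<in> smooth_functions M" "K \<in> smooth_functions M" and G: "openin (top_of N) G"
    "\<forall>x\<in>G. restrict0 S F x = f x" "\<forall>x\<in>G. restrict0 S K x = g x"
  shows "\<forall>x\<in>G. restrict0 S (br F K) x = brN f g x"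
proof
  fix x assume x: "x \<in> G"
  then have "x \<in> S" using openin_subset[OF G(1)] by blast
  then show "restrict0 S (br F K) x = brN f g x"
    using brN_local[OF _ f F(1) g F(2) G(1) x G(2,3)] by simp
qed

lemma brN_smooth:
  assumes f: "f \<in> smooth_functions N" and g: "g \<in> smooth_functions N"
  shows "brN f g \<in> smooth_functions N"
proof (rule N.smooth_locally)
  show "supported_on S (brN f g)" by (simp add: supported_on_def brN_outside)
  fix q assume q: "q \<in> S"
  obtain F K G where F: "F \<in> smooth_functions M" "K \<in> smooth_functions M" "openin (top_of N) G" "q \<in> G"
    "\<forall>x\<in>G. restrict0 S F x = f x" "\<forall>x\<in>G. restrict0 S K x = g x"
    using common_extension[OF q f g] .
  show "\<exists>G h. openin (top_of N) G \<and> q \<in> G \<and> h \<in> smooth_functions N \<and> (\<forall>x\<in>G. brN f g x = h x)"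
    using F(3,4) brN_extension[OF q f g F(1-3,5,6)] restrict_smooth[OF br_smooth[OF F(1,2)]]
    by (intro exI[of _ G] exI[of _ "restrict0 S (br F K)"]) simp
qed

lemma sharp_N_field:
  assumes \<alpha>: "\<alpha> \<in> one_forms N" and smooth: "\<And>f. f \<in> smooth_functions N \<Longrightarrow> (\<lambda>q. Q q (\<alpha> q) (d0 N f q)) \<in> smooth_functions N"
  shows "(\<lambda>q. sharp N Q q (\<alpha> q)) \<in> vector_fields N"
  unfolding vector_fields_def mem_Collect_eq supported_on_def
proof (intro conjI ballI allI impI)
  have cot: "\<alpha> q \<in> cotangent N q" if "q \<in> S" for q using \<alpha> that by (simp add: one_forms_def)
  show "sharp N Q q (\<alpha> q) = 0" if "q \<notin> S" for q
    using that by (simp add: sharp_def Q_outside zero_fun_def)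
  show "sharp N Q q (\<alpha> q) \<in> tangent N q" if "q \<in> S" for q
    by (rule N.sharp_tangent[of Q, OF Q_bivector[OF that] that cot[OF that]])
  show "(\<lambda>q. sharp N Q q (\<alpha> q) f) \<in> smooth_functions N" if "f \<in> smooth_functions N" for f
    using smooth[OF that] by (simp add: sharp_def)
qed

text \<open>Smoothness on pairs of differentials makes each \<open>df\<close> contract to a smooth
  field, hence \<open>Q(df, \<beta>)\<close> is smooth for every form \<open>\<beta>\<close>.
  Skew-symmetry then makes every form contract to a smooth field, which settles arbitrary
  pairs.\<close>

lemma Q_field: "Q \<in> bivector_fields N"
proof -
  have cot: "\<alpha> q \<in> cotangent N q" if "\<alpha> \<in> one_forms N" "q \<in> S" for \<alpha> q using that by (simp add: one_forms_def)
  have contr: "(\<lambda>q. \<beta> q (sharp N Q q (\<alpha> q))) = (\<lambda>q. Q q (\<alpha> q) (\<beta> q))"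
    if "\<alpha> \<in> one_forms N" "\<beta> \<in> one_forms N" for \<alpha> \<beta>
  proof
    show "\<beta> q (sharp N Q q (\<alpha> q)) = Q q (\<alpha> q) (\<beta> q)" for q
    proof (cases "q \<in> S")
      case True
      show ?thesis
        by (rule N.cotangent_sharp[of Q, OF Q_bivector[OF True] True cot[OF that(1) True] cot[OF that(2) True]])
    next
      case False
      then have "\<beta> q = 0" using that(2) by (simp add: one_forms_def supported_on_def)
      then show ?thesis using False by (simp add: Q_outside)
    qed
  qed
  have df: "(\<lambda>q. Q q (d0 N f q) (\<beta> q)) \<in> smooth_functions N"
    if f: "f \<in> smooth_functions N" and \<beta>: "\<beta> \<in> one_forms N" for f \<beta>
  proof -
    have "(\<lambda>q. sharp N Q q (d0 N f q)) \<in> vector_fields N"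
      by (rule sharp_N_field[OF N.d0_one_form[OF f]])
        (use brN_smooth[OF f] in \<open>simp add: poisson_bracket_def\<close>)
    then have "(\<lambda>q. \<beta> q (sharp N Q q (d0 N f q))) \<in> smooth_functions N"
      using \<beta> by (simp add: one_forms_def)
    then show ?thesis unfolding contr[OF N.d0_one_form[OF f] \<beta>] .
  qed
  have "(\<lambda>q. Q q (\<alpha> q) (\<beta> q)) \<in> smooth_functions N"
    if \<alpha>: "\<alpha> \<in> one_forms N" and \<beta>: "\<beta> \<in> one_forms N" for \<alpha> \<beta>
  proof -
    have "(\<lambda>q. sharp N Q q (\<alpha> q)) \<in> vector_fields N"
    proof (rule sharp_N_field[OF \<alpha>])
      fix f assume f: "f \<in> smooth_functions N"
      have "(\<lambda>q. Q q (\<alpha> q) (d0 N f q)) = - (\<lambda>q. Q q (d0 N f q) (\<alpha> q))"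
      proof
        show "Q q (\<alpha> q) (d0 N f q) = (- (\<lambda>q. Q q (d0 N f q) (\<alpha> q))) q" for q
          using bivector_skew[OF Q_bivector cot[OF \<alpha>] d0_cotangent, of q f]
          by (cases "q \<in> S") (simp_all add: Q_outside)
      qed
      then show "(\<lambda>q. Q q (\<alpha> q) (d0 N f q)) \<in> smooth_functions N"
        using N.minus_smooth[OF df[OF f \<alpha>]] by simp
    qed
    then have "(\<lambda>q. \<beta> q (sharp N Q q (\<alpha> q))) \<in> smooth_functions N"
      using \<beta> by (simp add: one_forms_def)
    then show ?thesis unfolding contr[OF \<alpha> \<beta>] .
  qed
  then show ?thesis by (simp add: bivector_fields_def supported_on_def Q_outside Q_bivector)
qed

lemma brN_jacobi:
  assumes f: "f \<in> smooth_functions N" and g: "g \<in> smooth_functions N" and h: "h \<in> smooth_functions N"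
  shows "brN f (brN g h) + brN g (brN h f) + brN h (brN f g) = 0"
proof
  fix q
  show "(brN f (brN g h) + brN g (brN h f) + brN h (brN f g)) q = 0 q"
  proof (cases "q \<in> S")
    case False
    then show ?thesis by (simp add: brN_outside)
  next
    case q: True
    obtain F K G where F: "F \<in> smooth_functions M" "K \<in> smooth_functions M" "openin (top_of N) G" "q \<in> G"
      "\<forall>x\<in>G. restrict0 S F x = f x" "\<forall>x\<in>G. restrict0 S K x = g x"
      using common_extension[OF q f g] .
    obtain H G' where H: "H \<in> smooth_functions M" "openin (top_of N) G'" "q \<in> G'"
      "\<forall>x\<in>G'. restrict0 S H x = h x" using extend_smooth[OF h q] .
    let ?G = "G \<inter> G'"
    have G: "openin (top_of N) ?G" "q \<in> ?G" using F(3,4) H(2,3) by auto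
    have ext: "\<forall>x\<in>?G. restrict0 S F x = f x" "\<forall>x\<in>?G. restrict0 S K x = g x" "\<forall>x\<in>?G. restrict0 S H x = h x"
      using F(5,6) H(4) by auto
    \<comment> \<open>The inner brackets agree on a whole neighbourhood, not only at
      \<open>q\<close>, so the inner bracket of extensions is again an extension and the outer one
      may be compared too.\<close>
    have nested: "brN a (brN b c) q = br A (br B C) q"
      if "a \<in> smooth_functions N" "b \<in> smooth_functions N" "c \<in> smooth_functions N"
        "A \<in> smooth_functions M" "B \<in> smooth_functions M" "C \<in> smooth_functions M"
        "\<forall>x\<in>?G. restrict0 S A x = a x" "\<forall>x\<in>?G. restrict0 S B x = b x" "\<forall>x\<in>?G. restrict0 S C x = c x"
      for a b c A B C
      by (rule brN_local[OF q that(1,4) brN_smooth[OF that(2,3)] br_smooth[OF that(5,6)] G that(7)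
            brN_extension[OF q that(2,3,5,6) G(1) that(8,9)]])
    show ?thesis
      using fun_cong[OF jacobi[OF F(1,2) H(1)], of q]
      by (simp add: nested[OF f g h F(1,2) H(1) ext] nested[OF g h f F(2) H(1) F(1) ext(2,3,1)]
          nested[OF h f g H(1) F(1,2) ext(3,1,2)])
  qed
qed

text \<open>\<open>N\<close> is viewed as a Poisson submanifold of itself. Its restricted algebroid
  is then the cotangent algebroid of \<open>N\<close>, and the identities for forms along a
  submanifold become identities for 1-forms on \<open>N\<close>.\<close>

lemma poisson_pair_self: "poisson_pair N N Q Q"
proof -
  interpret NN: pair N N by (rule N.pair_self)
  have pull: "pull N N q \<alpha> = \<alpha>" if "q \<in> S" "\<alpha> \<in> cotangent N q" for q \<alpha>
  proof (rule cotangent_eqI[OF NN.pull_cotangent[OF that(2,1)] that(2)])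
    fix w assume w: "w \<in> tangent N q"
    have "push N N w = w"
    proof
      show "push N N w f = w f" for f
        by (cases "f \<in> smooth_functions N")
          (simp_all add: push_def N.restrict_self tangent_supported[OF w])
    qed
    then show "pull N N q \<alpha> w = \<alpha> w" using NN.pull_apply[OF w] by simp
  qed
  show ?thesis
  proof
    fix q assume q: "q \<in> S"
    show "Q q = bivector_push N N q (Q q)"
    proof (intro ext)
      show "Q q \<alpha> \<beta> = bivector_push N N q (Q q) \<alpha> \<beta>" for \<alpha> \<beta>
        using bivector_supported[OF Q_bivector[OF q], of \<alpha> \<beta>] pull[OF q]
        by (auto simp: bivector_push_def)
    qed
  qed (simp_all add: Q_field Q_bivector Q_outside brN_jacobi)
qed

lemma N_bracket:
  "brN f g = - brN g f"
  "g \<in> smooth_functions N \<Longrightarrow> h \<in> smooth_functions N \<Longrightarrow> brN f (g + h) = brN f g + brN f h"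
  "g \<in> smooth_functions N \<Longrightarrow> brN f (c *\<^sub>R g) = c *\<^sub>R brN f g"
proof -
  interpret NN: poisson_pair N N Q Q by (rule poisson_pair_self)
  show "brN f g = - brN g f" by (rule NN.br_skew)
  show "g \<in> smooth_functions N \<Longrightarrow> h \<in> smooth_functions N \<Longrightarrow> brN f (g + h) = brN f g + brN f h"
    by (rule NN.br_add_right)
  show "g \<in> smooth_functions N \<Longrightarrow> brN f (c *\<^sub>R g) = c *\<^sub>R brN f g" by (rule NN.br_scaleR_right)
qed

lemma brN_mult_right:
  assumes "g \<in> smooth_functions N" "h \<in> smooth_functions N"
  shows "brN f (g * h) = g * brN f h + h * brN f g"
proof
  fix q
  show "brN f (g * h) q = (g * brN f h + h * brN f g) q"
  proof (cases "q \<in> S")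
    case True
    show ?thesis
      using tangent_mult[OF N.sharp_tangent[of Q, OF Q_bivector[OF True] True d0_cotangent[of N f q]] assms]
      by (simp add: sharp_def brN_apply)
  qed (simp add: brN_outside)
qed

section \<open>The bracket of 1-forms on the submanifold\<close>

abbreviation "sharpN \<alpha> \<equiv> (\<lambda>q. sharp N Q q (\<alpha> q))"

text \<open>In the self-pair restriction does nothing, so \<open>form_bracket N Q\<close> is its
  bracket \<open>form_br\<close> and the anchor is the contraction with \<open>Q\<close>.\<close>

lemma one_form_bracket:
  assumes "\<alpha> \<in> one_forms N" "\<beta> \<in> one_forms N"
  shows form_bracket_one_form: "form_bracket N Q \<alpha> \<beta> \<in> one_forms N"
    and form_bracket_skew: "form_bracket N Q \<beta> \<alpha> = - form_bracket N Q \<alpha> \<beta>"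
    and form_bracket_add: "\<gamma> \<in> one_forms N \<Longrightarrow>
      form_bracket N Q \<alpha> (\<beta> + \<gamma>) = form_bracket N Q \<alpha> \<beta> + form_bracket N Q \<alpha> \<gamma>"
    and form_bracket_mult: "f \<in> smooth_functions N \<Longrightarrow>
      form_bracket N Q \<alpha> (f \<bullet>\<^sub>s \<beta>) = f \<bullet>\<^sub>s form_bracket N Q \<alpha> \<beta> + (\<lambda>q. sharp N Q q (\<alpha> q) f) \<bullet>\<^sub>s \<beta>"
proof -
  interpret NN: poisson_pair N N Q Q by (rule poisson_pair_self)
  have supp: "restrict0 S \<alpha> = \<alpha>" if "\<alpha> \<in> one_forms N" for \<alpha>
    using that by (intro restrict0_supported) (simp add: one_forms_def)
  have eq: "form_bracket N Q \<alpha> \<beta> = NN.form_br \<alpha> \<beta>" if "\<alpha> \<in> one_forms N" "\<beta> \<in> one_forms N" for \<alpha> \<beta>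
  proof -
    have "supported_on S (form_bracket N Q \<alpha> \<beta>)"
      by (simp add: supported_on_def form_bracket_def d1_def d0_def fun_eq_iff)
    then show ?thesis
      using NN.form_bracket_restrict[OF that] restrict0_supported[of S "form_bracket N Q \<alpha> \<beta>"]
      by (simp add: supp that)
  qed
  have anchor: "NN.anchor_field \<alpha> = sharpN \<alpha>"
  proof
    fix q
    show "NN.anchor_field \<alpha> q = sharp N Q q (\<alpha> q)"
    proof (cases "q \<in> S")
      case True
      have cot: "\<alpha> q \<in> cotangent N q" using assms(1) True by (simp add: one_forms_def)
      show ?thesis
      proof
        fix f
        show "NN.anchor_field \<alpha> q f = sharp N Q q (\<alpha> q) f"
        proof (cases "f \<in> smooth_functions N")
          case f: True
          show ?thesis
            using NN.anchor_restrict[OF True cot f]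
            by (simp add: N.restrict_self[OF f] NN.anchor_field_def sharp_def)
        next
          case False
          then show ?thesis
            using tangent_supported[OF NN.anchor_tangent[OF True cot] False]
            by (simp add: NN.anchor_field_def sharp_def d0_nonsmooth bivector_zero_right[OF Q_bivector[OF True] cot])
        qed
      qed
    qed (simp add: NN.anchor_field_outside sharp_def Q_outside zero_fun_def)
  qed
  note a = assms[folded forms_along_self]
  show "form_bracket N Q \<alpha> \<beta> \<in> one_forms N"
    unfolding eq[OF assms] using NN.form_br_form[OF a] by (simp add: forms_along_self)
  show "form_bracket N Q \<beta> \<alpha> = - form_bracket N Q \<alpha> \<beta>"
    unfolding eq[OF assms] eq[OF assms(2,1)] by (rule NN.form_br_skew[OF a])
  show "form_bracket N Q \<alpha> (\<beta> + \<gamma>) = form_bracket N Q \<alpha> \<beta> + form_bracket N Q \<alpha> \<gamma>"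
    if "\<gamma> \<in> one_forms N"
    unfolding eq[OF assms] eq[OF assms(1) that]
      eq[OF assms(1) NN.form_add[unfolded forms_along_self, OF assms(2) that]]
    by (rule NN.form_br_add_right[OF a that[folded forms_along_self]])
  show "form_bracket N Q \<alpha> (f \<bullet>\<^sub>s \<beta>) = f \<bullet>\<^sub>s form_bracket N Q \<alpha> \<beta> + (\<lambda>q. sharp N Q q (\<alpha> q) f) \<bullet>\<^sub>s \<beta>"
    if "f \<in> smooth_functions N"
    unfolding eq[OF assms] eq[OF assms(1) NN.form_mult[unfolded forms_along_self, OF that assms(2)]]
      NN.form_br_mult_right[OF that a] anchor ..
qed

lemma one_forms_closed:
  "\<alpha> \<in> one_forms N \<Longrightarrow> \<beta> \<in> one_forms N \<Longrightarrow> \<alpha> + \<beta> \<in> one_forms N"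
  "f \<in> smooth_functions N \<Longrightarrow> \<alpha> \<in> one_forms N \<Longrightarrow> f \<bullet>\<^sub>s \<alpha> \<in> one_forms N"
  "\<alpha> \<in> one_forms N \<Longrightarrow> - \<alpha> \<in> one_forms N"
proof -
  interpret NN: pair N N by (rule N.pair_self)
  show "\<alpha> \<in> one_forms N \<Longrightarrow> \<beta> \<in> one_forms N \<Longrightarrow> \<alpha> + \<beta> \<in> one_forms N"
    "f \<in> smooth_functions N \<Longrightarrow> \<alpha> \<in> one_forms N \<Longrightarrow> f \<bullet>\<^sub>s \<alpha> \<in> one_forms N"
    "\<alpha> \<in> one_forms N \<Longrightarrow> - \<alpha> \<in> one_forms N"
    using NN.form_add NN.form_mult NN.form_minus unfolding forms_along_self by blast+
qed

lemma form_bracket_exact: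
  assumes f: "f \<in> smooth_functions N" and g: "g \<in> smooth_functions N"
  shows "form_bracket N Q (d0 N f) (d0 N g) = d0 N (brN f g)"
proof -
  interpret NN: poisson_pair N N Q Q by (rule poisson_pair_self)
  have exact: "NN.exact h = d0 N h" for h
    unfolding NN.exact_def by (rule restrict0_supported) (simp add: supported_on_def d0_outside)
  have "supported_on S (form_bracket N Q (d0 N f) (d0 N g))"
    by (simp add: supported_on_def form_bracket_def d1_def d0_def fun_eq_iff)
  then show ?thesis
    using NN.form_bracket_restrict[OF N.d0_one_form[OF f] N.d0_one_form[OF g]] NN.form_br_exact[OF f g]
      restrict0_supported[of S "form_bracket N Q (d0 N f) (d0 N g)"]
    by (simp add: exact flip: NN.exact_def)
qed

lemma one_form_tensor_vanishes:
  fixes L :: "('p \<Rightarrow> 'p covec) \<Rightarrow> 'b::real_vector"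
  assumes q: "q \<in> S" and \<alpha>: "\<alpha> \<in> one_forms N"
    and add: "\<And>\<alpha> \<beta>. \<alpha> \<in> one_forms N \<Longrightarrow> \<beta> \<in> one_forms N \<Longrightarrow> L (\<alpha> + \<beta>) = L \<alpha> + L \<beta>"
    and mult: "\<And>a \<alpha>. a \<in> smooth_functions N \<Longrightarrow> \<alpha> \<in> one_forms N \<Longrightarrow> L (a \<bullet>\<^sub>s \<alpha>) = a q *\<^sub>R L \<alpha>"
    and exact: "\<And>x. x \<in> smooth_functions N \<Longrightarrow> L (d0 N x) = 0"
  shows "L \<alpha> = 0"
proof -
  interpret NN: pair N N by (rule N.pair_self)
  have ex: "NN.exact h = d0 N h" for h
    unfolding NN.exact_def by (rule restrict0_supported) (simp add: supported_on_def d0_outside)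
  show ?thesis
    by (rule NN.tensor_vanishes[where L = L, unfolded forms_along_self ex, OF q \<alpha> add mult exact])
qed

section \<open>The conormal bundle\<close>

abbreviation "sections \<equiv> conormal_sections M N"
abbreviation "dual \<equiv> nu_dual M N"

lemma push_zero: "push M N 0 = 0"
  by (simp add: push_def fun_eq_iff)

lemma nu_eq_iff:
  assumes q: "q \<in> S"
  shows "nu M N q v = nu M N q v' \<longleftrightarrow> (\<exists>w\<in>tangent N q. v = v' + push M N w)"
proof
  assume "nu M N q v = nu M N q v'"
  moreover have "v \<in> nu M N q v"
    unfolding nu_def using subspace_0[OF subspace_tangent, of N q] push_zero by force
  ultimately have "v \<in> nu M N q v'" by simp
  then show "\<exists>w\<in>tangent N q. v = v' + push M N w" unfolding nu_def by blast
next
  assume "\<exists>w\<in>tangent N q. v = v' + push M N w"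
  then obtain w where w: "w \<in> tangent N q" "v = v' + push M N w" by blast
  have "nu M N q v \<subseteq> nu M N q v'"
  proof
    fix u assume "u \<in> nu M N q v"
    then obtain w' where w': "w' \<in> tangent N q" "u = v + push M N w'" unfolding nu_def by blast
    have "u = v' + push M N (w + w')" using w w' push_add[OF w(1) w'(1)] by (simp add: add.assoc)
    then show "u \<in> nu M N q v'"
      unfolding nu_def using subspace_add[OF subspace_tangent w(1) w'(1)] by blast
  qed
  moreover have "nu M N q v' \<subseteq> nu M N q v"
  proof
    fix u assume "u \<in> nu M N q v'"
    then obtain w' where w': "w' \<in> tangent N q" "u = v' + push M N w'" unfolding nu_def by blast
    have neg: "- w \<in> tangent N q" using subspace_neg[OF subspace_tangent w(1)] .
    have "push M N (- w) = - push M N w" using push_scaleR[of "-1" w] by simp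
    then have "u = v + push M N (- w + w')"
      using w(2) w'(2) push_add[OF neg w'(1)] by (simp add: algebra_simps)
    then show "u \<in> nu M N q v"
      unfolding nu_def using subspace_add[OF subspace_tangent neg w'(1)] by blast
  qed
  ultimately show "nu M N q v = nu M N q v'" by blast
qed

lemma section_outside: "\<eta> \<in> sections \<Longrightarrow> q \<notin> S \<Longrightarrow> \<eta> q = 0"
  and section_conormal: "\<eta> \<in> sections \<Longrightarrow> q \<in> S \<Longrightarrow> \<eta> q \<in> conormal M N q"
  and section_smooth: "\<eta> \<in> sections \<Longrightarrow> V \<in> vfields \<Longrightarrow> (\<lambda>q. \<eta> q (nu M N q (V q))) \<in> smooth_functions N"
  by (auto simp: conormal_sections_def supported_on_def)

lemma sectionI:
  assumes "\<And>q. q \<notin> S \<Longrightarrow> \<eta> q = 0" "\<And>q. q \<in> S \<Longrightarrow> \<eta> q \<in> conormal M N q"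
    "\<And>V. V \<in> vfields \<Longrightarrow> (\<lambda>q. \<eta> q (nu M N q (V q))) \<in> smooth_functions N"
  shows "\<eta> \<in> sections"
  using assms by (simp add: conormal_sections_def supported_on_def)

lemma subspace_conormal: "subspace (conormal M N q)"
  by (auto simp: subspace_def conormal_def supported_on_def linear_over_def algebra_simps)

lemma section_zero: "0 \<in> sections"
proof (rule sectionI)
  show "(\<lambda>q. (0 :: 'p consec) q (nu M N q (V q))) \<in> smooth_functions N" for V
    using N.zero_smooth by (simp add: zero_fun_def)
qed (simp_all add: subspace_0[OF subspace_conormal])

lemma section_add: "\<eta> \<in> sections \<Longrightarrow> \<zeta> \<in> sections \<Longrightarrow> \<eta> + \<zeta> \<in> sections"
proof (rule sectionI)
  assume s: "\<eta> \<in> sections" "\<zeta> \<in> sections"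
  show "(\<lambda>q. (\<eta> + \<zeta>) q (nu M N q (V q))) \<in> smooth_functions N" if "V \<in> vfields" for V
    using N.add_smooth[OF section_smooth[OF s(1) that] section_smooth[OF s(2) that]]
    by (simp add: plus_fun_def)
qed (auto simp: section_outside section_conormal subspace_add[OF subspace_conormal])

lemma section_mult: "a \<in> smooth_functions N \<Longrightarrow> \<eta> \<in> sections \<Longrightarrow> a \<bullet>\<^sub>s \<eta> \<in> sections"
proof (rule sectionI)
  assume s: "a \<in> smooth_functions N" "\<eta> \<in> sections"
  show "(\<lambda>q. (a \<bullet>\<^sub>s \<eta>) q (nu M N q (V q))) \<in> smooth_functions N" if "V \<in> vfields" for V
    using N.mult_smooth[OF s(1) section_smooth[OF s(2) that]] by (simp add: times_fun_def)
qed (auto simp: section_outside section_conormal subspace_scale[OF subspace_conormal])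

lemma section_scaleR: "\<eta> \<in> sections \<Longrightarrow> c *\<^sub>R \<eta> \<in> sections"
  by (subst scaleR_eq_module_mult) (auto simp: section_outside intro!: section_mult)

lemma section_minus: "\<eta> \<in> sections \<Longrightarrow> - \<eta> \<in> sections"
  using section_scaleR[of \<eta> "-1"] by simp

lemma section_diff: "\<eta> \<in> sections \<Longrightarrow> \<zeta> \<in> sections \<Longrightarrow> \<eta> - \<zeta> \<in> sections"
  using section_add[of \<eta> "- \<zeta>"] section_minus by simp

lemma section_supported: "\<eta> \<in> sections \<Longrightarrow> c \<notin> nu M N q ` tangent M q \<Longrightarrow> \<eta> q c = 0"
  by (cases "q \<in> S") (use section_conormal in \<open>auto simp: section_outside conormal_def supported_on_def\<close>)

lemma section_nu_add:
  "\<eta> \<in> sections \<Longrightarrow> v \<in> tangent M q \<Longrightarrow> w \<in> tangent M q \<Longrightarrow>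
    \<eta> q (nu M N q (v + w)) = \<eta> q (nu M N q v) + \<eta> q (nu M N q w)"
  by (cases "q \<in> S") (use section_conormal in \<open>auto simp: section_outside conormal_def linear_over_def\<close>)

lemma section_nu_scaleR:
  "\<eta> \<in> sections \<Longrightarrow> v \<in> tangent M q \<Longrightarrow> \<eta> q (nu M N q (c *\<^sub>R v)) = c * \<eta> q (nu M N q v)"
  by (cases "q \<in> S") (use section_conormal in \<open>auto simp: section_outside conormal_def linear_over_def\<close>)

lemma dual_apply: "v \<in> tangent M q \<Longrightarrow> dual \<eta> q v = \<eta> q (nu M N q v)"
  by (simp add: nu_dual_def)

lemma dual_add: "dual (\<eta> + \<zeta>) = dual \<eta> + dual \<zeta>"
  and dual_mult: "dual (a \<bullet>\<^sub>s \<eta>) = a \<bullet>\<^sub>s dual \<eta>"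
  and dual_minus: "dual (- \<eta>) = - dual \<eta>"
  by (auto simp: nu_dual_def fun_eq_iff)

lemma dual_form:
  assumes \<eta>: "\<eta> \<in> sections"
  shows "dual \<eta> \<in> forms"
proof (rule formI)
  show "dual \<eta> q = 0" if "q \<notin> S" for q using section_outside[OF \<eta> that] by (simp add: nu_dual_def fun_eq_iff)
  show "dual \<eta> q \<in> cotangent M q" if "q \<in> S" for q
    by (auto simp: cotangent_def dual_of_def supported_on_def linear_over_def nu_dual_def
        section_nu_add[OF \<eta>] section_nu_scaleR[OF \<eta>] subspace_add[OF subspace_tangent]
        subspace_scale[OF subspace_tangent])
  show "contract (dual \<eta>) V \<in> smooth_functions N" if V: "V \<in> vfields" for V
  proof -
    have "contract (dual \<eta>) V = (\<lambda>q. \<eta> q (nu M N q (V q)))"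
    proof
      show "contract (dual \<eta>) V q = \<eta> q (nu M N q (V q))" for q
        using field_tangent[OF V, of q]
        by (cases "q \<in> S") (simp_all add: contract_def nu_dual_def section_outside[OF \<eta>])
    qed
    then show ?thesis using section_smooth[OF \<eta> V] by simp
  qed
qed

lemma dual_annihilates:
  assumes \<eta>: "\<eta> \<in> sections" and q: "q \<in> S" and w: "w \<in> tangent N q"
  shows "dual \<eta> q (push M N w) = 0"
proof -
  have "nu M N q (push M N w) = nu M N q 0" unfolding nu_eq_iff[OF q] using w by auto
  moreover have "\<eta> q (nu M N q 0) = 0"
    using section_nu_scaleR[OF \<eta> subspace_0[OF subspace_tangent], of q 0] by simp
  ultimately show ?thesis using push_tangent[OF w q] by (simp add: nu_dual_def)
qed

lemma dual_inject:
  assumes "\<eta> \<in> sections" "\<zeta> \<in> sections" "dual \<eta> = dual \<zeta>"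
  shows "\<eta> = \<zeta>"
proof (intro ext)
  fix q c
  show "\<eta> q c = \<zeta> q c"
  proof (cases "c \<in> nu M N q ` tangent M q")
    case True
    then obtain v where "v \<in> tangent M q" "c = nu M N q v" by blast
    then show ?thesis using dual_apply[of v q \<eta>] dual_apply[of v q \<zeta>] assms(3) by simp
  qed (simp add: section_supported assms(1,2))
qed

text \<open>Vanishing on the tangent spaces of \<open>S\<close> makes the value of
  \<open>\<sigma>\<close> independent of the representative chosen in a coset, so
  \<open>\<sigma>\<close> descends to the normal bundle.\<close>

lemma dual_surjective:
  assumes \<sigma>: "\<sigma> \<in> forms" and ann: "\<And>q w. q \<in> S \<Longrightarrow> w \<in> tangent N q \<Longrightarrow> \<sigma> q (push M N w) = 0"
  obtains \<eta> where "\<eta> \<in> sections" "dual \<eta> = \<sigma>"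
proof -
  define \<eta> where "\<eta> q c = (if q \<in> S \<and> c \<in> nu M N q ` tangent M q
      then \<sigma> q (SOME v. v \<in> tangent M q \<and> nu M N q v = c) else 0)" for q c
  have \<eta>_nu: "\<eta> q (nu M N q v) = \<sigma> q v" if q: "q \<in> S" and v: "v \<in> tangent M q" for q v
  proof -
    let ?v = "SOME u. u \<in> tangent M q \<and> nu M N q u = nu M N q v"
    have u: "?v \<in> tangent M q \<and> nu M N q ?v = nu M N q v" by (rule someI[of _ v]) (simp add: v)
    then obtain w where w: "w \<in> tangent N q" "?v = v + push M N w" using nu_eq_iff[OF q] by blast
    then have "\<sigma> q ?v = \<sigma> q v"
      using cotangent_add[OF form_cotangent[OF \<sigma> q] v push_tangent[OF w(1) q]] ann[OF q w(1)] by simp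
    then show ?thesis using q v by (simp add: \<eta>_def)
  qed
  have sec: "\<eta> \<in> sections"
  proof (rule sectionI)
    show "\<eta> q = 0" if "q \<notin> S" for q using that by (simp add: \<eta>_def fun_eq_iff)
    show "\<eta> q \<in> conormal M N q" if q: "q \<in> S" for q
      using q cotangent_add[OF form_cotangent[OF \<sigma> q]] cotangent_scaleR[OF form_cotangent[OF \<sigma> q]]
      by (auto simp: conormal_def supported_on_def linear_over_def \<eta>_nu subspace_add[OF subspace_tangent]
          subspace_scale[OF subspace_tangent]) (simp add: \<eta>_def)
    show "(\<lambda>q. \<eta> q (nu M N q (V q))) \<in> smooth_functions N" if V: "V \<in> vfields" for V
    proof -
      have "(\<lambda>q. \<eta> q (nu M N q (V q))) = contract \<sigma> V"
      proof
        show "\<eta> q (nu M N q (V q)) = contract \<sigma> V q" for q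
          using \<eta>_nu[OF _ field_tangent[OF V], of q]
          by (cases "q \<in> S") (simp_all add: contract_def form_outside[OF \<sigma>], simp add: \<eta>_def)
      qed
      then show ?thesis using contract_smooth[OF \<sigma> V] by simp
    qed
  qed
  moreover have "dual \<eta> = \<sigma>"
  proof (intro ext)
    fix q v
    show "dual \<eta> q v = \<sigma> q v"
      using \<eta>_nu[of q v] form_outside[OF \<sigma>, of q] cotangent_supported[OF form_cotangent[OF \<sigma>], of q v]
        section_outside[OF sec, of q]
      by (cases "q \<in> S"; cases "v \<in> tangent M q") (simp_all add: nu_dual_def)
  qed
  ultimately show thesis using that by blast
qed

text \<open>A covector that annihilates the tangent space of \<open>S\<close> pulls back to 0 on
  \<open>S\<close>.\<close>

lemma anchor_field_dual:
  assumes \<eta>: "\<eta> \<in> sections"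
  shows "anchor_field (dual \<eta>) = 0"
proof
  fix q
  show "anchor_field (dual \<eta>) q = 0 q"
  proof (cases "q \<in> S")
    case True
    have "pull M N q (dual \<eta> q) = 0"
      using dual_annihilates[OF \<eta> True] by (simp add: pull_def fun_eq_iff)
    then show ?thesis
      using bivector_zero_left[OF Q_bivector[OF True] d0_cotangent]
      by (simp add: anchor_field_def anchor_eq[OF True form_cotangent[OF dual_form[OF \<eta>] True]] sharp_def zero_fun_def)
  qed (simp add: anchor_field_outside)
qed

text \<open>The anchors of both forms are 0, so only \<open>w {f, g}\<close> remains in the Koszul
  formula. On \<open>S\<close> the bracket \<open>{f, g}\<close> is the pairing of the differential
  of \<open>?g\<close> with the Hamiltonian field of \<open>?f\<close>; both are 0 at
  \<open>q\<close>, so the derivative of the pairing is 0. The conormal sections are thus closed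
  under the bracket.\<close>

lemma form_br_dual:
  assumes \<eta>: "\<eta> \<in> sections" and \<zeta>: "\<zeta> \<in> sections" and q: "q \<in> S" and w: "w \<in> tangent N q"
  shows "form_br (dual \<eta>) (dual \<zeta>) q (push M N w) = 0"
proof -
  interpret NN: poisson_pair N N Q Q by (rule poisson_pair_self)
  note s = dual_form[OF \<eta>] dual_form[OF \<zeta>]
  obtain V where V: "V \<in> vfields" "V q = push M N w" using ex_field_through[OF q push_tangent[OF w q]] .
  obtain f where f: "f \<in> smooth_functions M" "d0 M f q = dual \<eta> q" using form_primitive[OF s(1) q] .
  obtain g where g: "g \<in> smooth_functions M" "d0 M g q = dual \<zeta> q" using form_primitive[OF s(2) q] .
  let ?f = "restrict0 S f" and ?g = "restrict0 S g"
  have "pull M N q (dual \<eta> q) = 0" "pull M N q (dual \<zeta> q) = 0"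
    using dual_annihilates[OF \<eta> q] dual_annihilates[OF \<zeta> q] by (simp_all add: pull_def fun_eq_iff)
  then have zero: "d0 N ?f q = 0" "d0 N ?g q = 0"
    using pull_d0[OF f(1) q] pull_d0[OF g(1) q] f(2) g(2) by simp_all
  have br: "restrict0 S (br f g) = contract (d0 N ?g) (NN.sharp_field (d0 N ?f))"
  proof
    fix x
    show "restrict0 S (br f g) x = contract (d0 N ?g) (NN.sharp_field (d0 N ?f)) x"
    proof (cases "x \<in> S")
      case True
      have "contract (d0 N ?g) (NN.sharp_field (d0 N ?f)) x = brN ?f ?g x"
        unfolding contract_def NN.sharp_field_def brN_apply
        by (rule N.cotangent_sharp[of Q, OF Q_bivector[OF True] True d0_cotangent d0_cotangent])
      also have "\<dots> = br f g x"
        by (rule brN_local[OF True restrict_smooth[OF f(1)] f(1) restrict_smooth[OF g(1)] g(1) openin_topspace True])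
          simp_all
      finally show ?thesis using True by simp
    qed (simp add: restrict0_def contract_def d0_outside)
  qed
  have sf: "NN.sharp_field (d0 N ?f) q = 0"
    using bivector_zero_left[OF Q_bivector[OF q] d0_cotangent]
    by (simp add: NN.sharp_field_def zero sharp_def zero_fun_def)
  have "push M N w (br f g) = w (restrict0 S (br f g))" by (rule push_apply[OF br_smooth[OF f(1) g(1)]])
  also have "\<dots> = 0"
    unfolding br
    by (rule N.vanishing_contraction[OF q N.d0_one_form[OF restrict_smooth[OF g(1)]] zero(2)
          NN.sharp_field[OF N.d0_one_form[OF restrict_smooth[OF f(1)]]] sf w])
  finally show ?thesis
    using form_br_eq[OF q s f g V(1)] V(2)
    by (simp add: koszul_def anchor_field_dual[OF \<eta>] anchor_field_dual[OF \<zeta>])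
qed

section \<open>The fiberwise Lie bracket on the conormal bundle\<close>

abbreviation "lie \<equiv> conormal_bracket M P N"

text \<open>\<open>form_br_dual\<close> gives a preimage under the dual of \<open>nu\<close>, and
  \<open>dual_inject\<close> its uniqueness, so the description in \<open>conormal_bracket\<close>
  is met. Identities for \<open>lie\<close> are from now on read off from
  \<open>form_br\<close>.\<close>

lemma lie_dual:
  assumes \<eta>: "\<eta> \<in> sections" and \<zeta>: "\<zeta> \<in> sections"
  shows lie_section: "lie \<eta> \<zeta> \<in> sections" and dual_lie: "dual (lie \<eta> \<zeta>) = form_br (dual \<eta>) (dual \<zeta>)"
proof -
  obtain \<xi> where \<xi>: "\<xi> \<in> sections" "dual \<xi> = form_br (dual \<eta>) (dual \<zeta>)"
    using dual_surjective[OF form_br_form[OF dual_form[OF \<eta>] dual_form[OF \<zeta>]] form_br_dual[OF \<eta> \<zeta>]] by blast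
  have "(THE \<xi>. \<xi> \<in> sections \<and> dual \<xi> = form_br (dual \<eta>) (dual \<zeta>)) = \<xi>"
    by (rule the_equality) (use \<xi> dual_inject in auto)
  then have "lie \<eta> \<zeta> = \<xi>" using \<eta> \<zeta> by (simp add: conormal_bracket_def restricted_bracket_eq)
  then show "lie \<eta> \<zeta> \<in> sections" "dual (lie \<eta> \<zeta>) = form_br (dual \<eta>) (dual \<zeta>)" using \<xi> by simp_all
qed

lemma lie_add_right:
  assumes s: "\<eta> \<in> sections" "\<zeta> \<in> sections" "\<xi> \<in> sections"
  shows "lie \<eta> (\<zeta> + \<xi>) = lie \<eta> \<zeta> + lie \<eta> \<xi>"
proof (rule dual_inject[OF lie_section[OF s(1) section_add[OF s(2,3)]]
      section_add[OF lie_section[OF s(1,2)] lie_section[OF s(1,3)]]])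
  show "dual (lie \<eta> (\<zeta> + \<xi>)) = dual (lie \<eta> \<zeta> + lie \<eta> \<xi>)"
    unfolding dual_add dual_lie[OF s(1) section_add[OF s(2,3)]] dual_lie[OF s(1,2)] dual_lie[OF s(1,3)]
    by (rule form_br_add_right[OF s[THEN dual_form]])
qed

lemma lie_skew:
  assumes s: "\<eta> \<in> sections" "\<zeta> \<in> sections"
  shows "lie \<zeta> \<eta> = - lie \<eta> \<zeta>"
proof (rule dual_inject[OF lie_section[OF s(2,1)] section_minus[OF lie_section[OF s]]])
  show "dual (lie \<zeta> \<eta>) = dual (- lie \<eta> \<zeta>)"
    unfolding dual_minus dual_lie[OF s] dual_lie[OF s(2,1)] by (rule form_br_skew[OF s[THEN dual_form]])
qed

text \<open>The anchor of a conormal form is 0, so the Leibniz rule has no derivative term; this is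
  why the bracket acts fiberwise.\<close>

lemma lie_mult_right:
  assumes a: "a \<in> smooth_functions N" and s: "\<eta> \<in> sections" "\<zeta> \<in> sections"
  shows "lie \<eta> (a \<bullet>\<^sub>s \<zeta>) = a \<bullet>\<^sub>s lie \<eta> \<zeta>"
proof (rule dual_inject[OF lie_section[OF s(1) section_mult[OF a s(2)]] section_mult[OF a lie_section[OF s]]])
  have "(\<lambda>q. anchor_field (dual \<eta>) q a) \<bullet>\<^sub>s dual \<zeta> = 0"
    unfolding anchor_field_dual[OF s(1)] by (simp add: fun_eq_iff)
  then show "dual (lie \<eta> (a \<bullet>\<^sub>s \<zeta>)) = dual (a \<bullet>\<^sub>s lie \<eta> \<zeta>)"
    unfolding dual_mult dual_lie[OF s(1) section_mult[OF a s(2)]] dual_lie[OF s]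
      form_br_mult_right[OF a s[THEN dual_form]] by simp
qed

lemma lie_add_left:
  assumes s: "\<eta> \<in> sections" "\<zeta> \<in> sections" "\<xi> \<in> sections"
  shows "lie (\<eta> + \<zeta>) \<xi> = lie \<eta> \<xi> + lie \<zeta> \<xi>"
  unfolding lie_skew[OF s(3) section_add[OF s(1,2)]] lie_skew[OF s(3,1)] lie_skew[OF s(3,2)]
    lie_add_right[OF s(3,1,2)] by simp

lemma lie_mult_left:
  assumes a: "a \<in> smooth_functions N" and s: "\<eta> \<in> sections" "\<zeta> \<in> sections"
  shows "lie (a \<bullet>\<^sub>s \<eta>) \<zeta> = a \<bullet>\<^sub>s lie \<eta> \<zeta>"
  unfolding lie_skew[OF s(2) section_mult[OF a s(1)]] lie_mult_right[OF a s(2,1)] lie_skew[OF s(2,1)]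
  by (simp add: fun_eq_iff)

lemma lie_jacobi:
  assumes s: "\<eta> \<in> sections" "\<zeta> \<in> sections" "\<xi> \<in> sections"
  shows "lie \<eta> (lie \<zeta> \<xi>) + lie \<zeta> (lie \<xi> \<eta>) + lie \<xi> (lie \<eta> \<zeta>) = 0"
proof (rule dual_inject[OF _ section_zero])
  show "lie \<eta> (lie \<zeta> \<xi>) + lie \<zeta> (lie \<xi> \<eta>) + lie \<xi> (lie \<eta> \<zeta>) \<in> sections"
    by (intro section_add lie_section s)
  have "dual (lie \<eta> (lie \<zeta> \<xi>) + lie \<zeta> (lie \<xi> \<eta>) + lie \<xi> (lie \<eta> \<zeta>))
      = jacobiator (dual \<eta>) (dual \<zeta>) (dual \<xi>)"
    unfolding jacobiator_def dual_add dual_lie[OF s(1) lie_section[OF s(2,3)]] dual_lie[OF s(2,3)]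
      dual_lie[OF s(2) lie_section[OF s(3,1)]] dual_lie[OF s(3,1)]
      dual_lie[OF s(3) lie_section[OF s(1,2)]] dual_lie[OF s(1,2)] ..
  also have "\<dots> = 0" by (rule form_br_jacobi[OF s[THEN dual_form]])
  finally show "dual (lie \<eta> (lie \<zeta> \<xi>) + lie \<zeta> (lie \<xi> \<eta>) + lie \<xi> (lie \<eta> \<zeta>)) = dual 0"
    by (simp add: nu_dual_def fun_eq_iff)
qed

end

section \<open>Infinitesimal Poisson algebras and Poisson triples\<close>

text \<open>\<open>D f\<close> stands for \<open>\<D>\<^bsub>df\<^esub>\<close>, and \<open>K f g\<close> for \<open>\<K>(df, dg)\<close>.\<close>

locale function_triple = poisson_pair M N P Q
  for M N :: "('p, 'e::euclidean_space) smooth_structure" and P Q +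
  fixes D :: "('p \<Rightarrow> real) \<Rightarrow> 'p consec \<Rightarrow> 'p consec"
    and K :: "('p \<Rightarrow> real) \<Rightarrow> ('p \<Rightarrow> real) \<Rightarrow> 'p consec"
  assumes D_section: "f \<in> smooth_functions N \<Longrightarrow> \<eta> \<in> sections \<Longrightarrow> D f \<eta> \<in> sections"
    and D_add_left: "f \<in> smooth_functions N \<Longrightarrow> g \<in> smooth_functions N \<Longrightarrow> \<eta> \<in> sections \<Longrightarrow>
      D (f + g) \<eta> = D f \<eta> + D g \<eta>"
    and D_scaleR_left: "f \<in> smooth_functions N \<Longrightarrow> \<eta> \<in> sections \<Longrightarrow> D (c *\<^sub>R f) \<eta> = c *\<^sub>R D f \<eta>"
    and D_mult_left: "f \<in> smooth_functions N \<Longrightarrow> g \<in> smooth_functions N \<Longrightarrow> \<eta> \<in> sections \<Longrightarrow>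
      D (f * g) \<eta> = f \<bullet>\<^sub>s D g \<eta> + g \<bullet>\<^sub>s D f \<eta>"
    and D_add_right: "f \<in> smooth_functions N \<Longrightarrow> \<eta> \<in> sections \<Longrightarrow> \<zeta> \<in> sections \<Longrightarrow>
      D f (\<eta> + \<zeta>) = D f \<eta> + D f \<zeta>"
    and D_scaleR_right: "f \<in> smooth_functions N \<Longrightarrow> \<eta> \<in> sections \<Longrightarrow> D f (c *\<^sub>R \<eta>) = c *\<^sub>R D f \<eta>"
    and D_mult_right: "f \<in> smooth_functions N \<Longrightarrow> g \<in> smooth_functions N \<Longrightarrow> \<eta> \<in> sections \<Longrightarrow>
      D f (g \<bullet>\<^sub>s \<eta>) = g \<bullet>\<^sub>s D f \<eta> + brN f g \<bullet>\<^sub>s \<eta>"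
    and K_section: "f \<in> smooth_functions N \<Longrightarrow> g \<in> smooth_functions N \<Longrightarrow> K f g \<in> sections"
    and K_skew: "f \<in> smooth_functions N \<Longrightarrow> g \<in> smooth_functions N \<Longrightarrow> K g f = - K f g"
    and K_add_right: "f \<in> smooth_functions N \<Longrightarrow> g \<in> smooth_functions N \<Longrightarrow> h \<in> smooth_functions N \<Longrightarrow>
      K f (g + h) = K f g + K f h"
    and K_scaleR_right: "f \<in> smooth_functions N \<Longrightarrow> g \<in> smooth_functions N \<Longrightarrow> K f (c *\<^sub>R g) = c *\<^sub>R K f g"
    and K_mult_right: "f \<in> smooth_functions N \<Longrightarrow> g \<in> smooth_functions N \<Longrightarrow> h \<in> smooth_functions N \<Longrightarrow>
      K f (g * h) = g \<bullet>\<^sub>s K f h + h \<bullet>\<^sub>s K f g"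
    and D_lie: "f \<in> smooth_functions N \<Longrightarrow> \<eta> \<in> sections \<Longrightarrow> \<zeta> \<in> sections \<Longrightarrow>
      D f (lie \<eta> \<zeta>) = lie \<eta> (D f \<zeta>) + lie (D f \<eta>) \<zeta>"
    and D_curvature: "f \<in> smooth_functions N \<Longrightarrow> g \<in> smooth_functions N \<Longrightarrow> \<eta> \<in> sections \<Longrightarrow>
      D f (D g \<eta>) - D g (D f \<eta>) - D (brN f g) \<eta> = lie (K f g) \<eta>"
    and K_bianchi: "f \<in> smooth_functions N \<Longrightarrow> g \<in> smooth_functions N \<Longrightarrow> h \<in> smooth_functions N \<Longrightarrow>
      (D f (K g h) + K f (brN g h)) + (D g (K h f) + K g (brN h f)) + (D h (K f g) + K h (brN f g)) = 0"

lemma affine_mult_eq: "affine_mult (f, \<eta>) (g, \<zeta>) = (f * g, f \<bullet>\<^sub>s \<zeta> + g \<bullet>\<^sub>s \<eta>)"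
  by (simp add: affine_mult_def)

lemma affine_mult_comm: "affine_mult x y = affine_mult y x"
  by (cases x; cases y) (simp add: affine_mult_eq mult.commute add.commute)

lemma affine_mult_assoc: "affine_mult (affine_mult x y) z = affine_mult x (affine_mult y z)"
  by (cases x; cases y; cases z) (simp add: affine_mult_eq fun_eq_iff algebra_simps)

lemma affine_mult_add_right: "affine_mult x (y + z) = affine_mult x y + affine_mult x z"
  by (cases x; cases y; cases z) (simp add: affine_mult_eq fun_eq_iff algebra_simps)

lemma affine_mult_scaleR_right: "affine_mult x (c *\<^sub>R y) = c *\<^sub>R affine_mult x y"
  by (cases x; cases y) (simp add: affine_mult_eq fun_eq_iff algebra_simps)

context poisson_pair
begin

abbreviation "affs \<equiv> affine_functions M N"

definition affine_bracket ::
  "(('p \<Rightarrow> real) \<Rightarrow> 'p consec \<Rightarrow> 'p consec) \<Rightarrow> (('p \<Rightarrow> real) \<Rightarrow> ('p \<Rightarrow> real) \<Rightarrow> 'p consec) \<Rightarrow>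
   ('p \<Rightarrow> real) \<times> 'p consec \<Rightarrow> ('p \<Rightarrow> real) \<times> 'p consec \<Rightarrow> ('p \<Rightarrow> real) \<times> 'p consec"
where
  "affine_bracket D K x y = (if x \<in> affs \<and> y \<in> affs then
     (brN (fst x) (fst y),
      D (fst x) (snd y) - D (fst y) (snd x) + lie (snd x) (snd y) + K (fst x) (fst y)) else 0)"

lemma triple_bracket_eq:
  "triple_bracket M P N (L, D, K) x y = (if x \<in> affs \<and> y \<in> affs then
     (brN (fst x) (fst y),
      D (d0 N (fst x)) (snd y) - D (d0 N (fst y)) (snd x) + L (snd x) (snd y)
        + K (d0 N (fst x)) (d0 N (fst y))) else 0)"
  by (cases x; cases y) (simp add: triple_bracket_def restricted_bivector_eq)

lemma affine_iff: "(f, \<eta>) \<in> affs \<longleftrightarrow> f \<in> smooth_functions N \<and> \<eta> \<in> sections"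
  by (simp add: affine_functions_def)

lemma section_scaleR_eq: "\<eta> \<in> sections \<Longrightarrow> c *\<^sub>R \<eta> = const_on S c \<bullet>\<^sub>s \<eta>"
  by (rule scaleR_eq_module_mult) (rule section_outside)

lemma lie_scaleR_right:
  assumes "\<eta> \<in> sections" "\<zeta> \<in> sections"
  shows "lie \<eta> (c *\<^sub>R \<zeta>) = c *\<^sub>R lie \<eta> \<zeta>"
  unfolding section_scaleR_eq[OF assms(2)] section_scaleR_eq[OF lie_section[OF assms]]
  by (rule lie_mult_right[OF N.const_smooth assms])

lemma lie_minus_right: "\<eta> \<in> sections \<Longrightarrow> \<zeta> \<in> sections \<Longrightarrow> lie \<eta> (- \<zeta>) = - lie \<eta> \<zeta>"
  using lie_scaleR_right[of \<eta> \<zeta> "-1"] by simp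

lemma lie_diff_right:
  "\<eta> \<in> sections \<Longrightarrow> \<zeta> \<in> sections \<Longrightarrow> \<xi> \<in> sections \<Longrightarrow> lie \<eta> (\<zeta> - \<xi>) = lie \<eta> \<zeta> - lie \<eta> \<xi>"
  using lie_add_right[of \<eta> \<zeta> "- \<xi>"] by (simp add: lie_minus_right section_minus)

lemma brN_zero: "brN f 0 = 0" "brN 0 f = 0"
  using N_bracket(3)[OF N.zero_smooth, of f 0] N_bracket(1)[of 0 f] by simp_all

lemma subspace_affine: "subspace affs"
  by (auto simp: subspace_def affine_functions_def zero_prod_def section_zero section_add section_scaleR)

lemma affine_mult_closed: "x \<in> affs \<Longrightarrow> y \<in> affs \<Longrightarrow> affine_mult x y \<in> affs"
  by (cases x; cases y) (simp add: affine_mult_eq affine_iff section_add section_mult)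

end

section \<open>From operators on functions to an infinitesimal Poisson algebra\<close>

context function_triple
begin

lemma D_zero_right: "f \<in> smooth_functions N \<Longrightarrow> D f 0 = 0"
  using D_scaleR_right[OF _ section_zero, of f 0] by simp

lemma D_zero_left: "\<eta> \<in> sections \<Longrightarrow> D 0 \<eta> = 0"
  using D_scaleR_left[OF N.zero_smooth, of \<eta> 0] by simp

lemma K_zero_right: "f \<in> smooth_functions N \<Longrightarrow> K f 0 = 0"
  using K_scaleR_right[OF _ N.zero_smooth, of f 0] by simp

lemma D_minus_right: "f \<in> smooth_functions N \<Longrightarrow> \<eta> \<in> sections \<Longrightarrow> D f (- \<eta>) = - D f \<eta>"
  using D_scaleR_right[of f \<eta> "-1"] by simp

lemma D_diff_right:
  "f \<in> smooth_functions N \<Longrightarrow> \<eta> \<in> sections \<Longrightarrow> \<zeta> \<in> sections \<Longrightarrow> D f (\<eta> - \<zeta>) = D f \<eta> - D f \<zeta>"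
  using D_add_right[of f \<eta> "- \<zeta>"] by (simp add: D_minus_right section_minus)

abbreviation "B \<equiv> affine_bracket D K"

text \<open>The section component without the support condition of \<open>affine_bracket\<close>, so
  that membership has to be checked only where an axiom is applied.\<close>

definition B2 :: "('p \<Rightarrow> real) \<Rightarrow> 'p consec \<Rightarrow> ('p \<Rightarrow> real) \<Rightarrow> 'p consec \<Rightarrow> 'p consec" where
  "B2 f \<eta> g \<zeta> = D f \<zeta> - D g \<eta> + lie \<eta> \<zeta> + K f g"

lemma B_eq:
  assumes "f \<in> smooth_functions N" "\<eta> \<in> sections" "g \<in> smooth_functions N" "\<zeta> \<in> sections"
  shows "B (f, \<eta>) (g, \<zeta>) = (brN f g, B2 f \<eta> g \<zeta>)"
  using assms by (simp add: affine_bracket_def affine_iff B2_def)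

lemma B2_section:
  assumes "f \<in> smooth_functions N" "\<eta> \<in> sections" "g \<in> smooth_functions N" "\<zeta> \<in> sections"
  shows "B2 f \<eta> g \<zeta> \<in> sections"
  unfolding B2_def by (intro section_add section_diff D_section lie_section K_section assms)

lemma B2_skew:
  assumes "f \<in> smooth_functions N" "\<eta> \<in> sections" "g \<in> smooth_functions N" "\<zeta> \<in> sections"
  shows "B2 g \<zeta> f \<eta> = - B2 f \<eta> g \<zeta>"
  unfolding B2_def lie_skew[OF assms(2,4)] K_skew[OF assms(1,3)] by simp

lemma B2_add_right:
  assumes "f \<in> smooth_functions N" "\<eta> \<in> sections" "g \<in> smooth_functions N" "\<zeta> \<in> sections"
    "h \<in> smooth_functions N" "\<xi> \<in> sections"
  shows "B2 f \<eta> (g + h) (\<zeta> + \<xi>) = B2 f \<eta> g \<zeta> + B2 f \<eta> h \<xi>"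
  unfolding B2_def D_add_right[OF assms(1,4,6)] D_add_left[OF assms(3,5,2)] lie_add_right[OF assms(2,4,6)]
    K_add_right[OF assms(1,3,5)] by simp

lemma B2_scaleR_right:
  assumes "f \<in> smooth_functions N" "\<eta> \<in> sections" "g \<in> smooth_functions N" "\<zeta> \<in> sections"
  shows "B2 f \<eta> (c *\<^sub>R g) (c *\<^sub>R \<zeta>) = c *\<^sub>R B2 f \<eta> g \<zeta>"
  unfolding B2_def D_scaleR_right[OF assms(1,4)] D_scaleR_left[OF assms(3,2)] lie_scaleR_right[OF assms(2,4)]
    K_scaleR_right[OF assms(1,3)] by (simp only: scaleR_add_right scaleR_diff_right)

lemma B2_leibniz:
  assumes "f \<in> smooth_functions N" "\<eta> \<in> sections" "g \<in> smooth_functions N" "\<zeta> \<in> sections"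
    "h \<in> smooth_functions N" "\<xi> \<in> sections"
  shows "B2 f \<eta> (g * h) (g \<bullet>\<^sub>s \<xi> + h \<bullet>\<^sub>s \<zeta>)
    = (brN f g \<bullet>\<^sub>s \<xi> + h \<bullet>\<^sub>s B2 f \<eta> g \<zeta>) + (g \<bullet>\<^sub>s B2 f \<eta> h \<xi> + brN f h \<bullet>\<^sub>s \<zeta>)"
proof (intro ext)
  fix q c
  show "B2 f \<eta> (g * h) (g \<bullet>\<^sub>s \<xi> + h \<bullet>\<^sub>s \<zeta>) q c
    = ((brN f g \<bullet>\<^sub>s \<xi> + h \<bullet>\<^sub>s B2 f \<eta> g \<zeta>) + (g \<bullet>\<^sub>s B2 f \<eta> h \<xi> + brN f h \<bullet>\<^sub>s \<zeta>)) q c"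
    unfolding B2_def D_add_right[OF assms(1) section_mult[OF assms(3,6)] section_mult[OF assms(5,4)]]
      D_mult_right[OF assms(1,3,6)] D_mult_right[OF assms(1,5,4)] D_mult_left[OF assms(3,5,2)]
      lie_add_right[OF assms(2) section_mult[OF assms(3,6)] section_mult[OF assms(5,4)]]
      lie_mult_right[OF assms(3,2,6)] lie_mult_right[OF assms(5,2,4)] K_mult_right[OF assms(1,3,5)]
      plus_fun_apply minus_apply module_mult_apply scaleR_fun_apply real_scaleR_def
    by (simp add: algebra_simps)
qed

text \<open>\<open>D_lie\<close> resolves \<open>D f\<close> of a Lie bracket; after that every term
  either belongs to an axiom or occurs with the opposite sign in the cyclic sum.\<close>

lemma B2_nested:
  assumes "f \<in> smooth_functions N" "\<eta> \<in> sections" "g \<in> smooth_functions N" "\<zeta> \<in> sections"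
    "h \<in> smooth_functions N" "\<xi> \<in> sections"
  shows "B2 f \<eta> (brN g h) (B2 g \<zeta> h \<xi>)
    = (D f (D g \<xi>) - D f (D h \<zeta>) + (lie \<zeta> (D f \<xi>) - lie \<xi> (D f \<zeta>)) + D f (K g h)) - D (brN g h) \<eta>
      + (lie \<eta> (D g \<xi>) - lie \<eta> (D h \<zeta>) + lie \<eta> (lie \<zeta> \<xi>) + lie \<eta> (K g h)) + K f (brN g h)"
proof -
  note s = D_section[OF assms(3,6)] D_section[OF assms(5,4)] lie_section[OF assms(4,6)] K_section[OF assms(3,5)]
  show ?thesis
    unfolding B2_def
      D_add_right[OF assms(1) section_add[OF section_diff[OF s(1,2)] s(3)] s(4)]
      D_add_right[OF assms(1) section_diff[OF s(1,2)] s(3)] D_diff_right[OF assms(1) s(1,2)]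
      lie_add_right[OF assms(2) section_add[OF section_diff[OF s(1,2)] s(3)] s(4)]
      lie_add_right[OF assms(2) section_diff[OF s(1,2)] s(3)] lie_diff_right[OF assms(2) s(1,2)]
      D_lie[OF assms(1,4,6)] lie_skew[OF assms(6) D_section[OF assms(1,4)]]
    by simp
qed

text \<open>In the cyclic sum the terms of the kind \<open>lie \<eta> (D g \<xi>)\<close> cancel in
  pairs. The rest falls into three curvature identities, the Jacobi identity of \<open>lie\<close>
  and \<open>K_bianchi\<close>.\<close>

lemma B2_jacobi:
  assumes "f \<in> smooth_functions N" "\<eta> \<in> sections" "g \<in> smooth_functions N" "\<zeta> \<in> sections"
    "h \<in> smooth_functions N" "\<xi> \<in> sections"
  shows "B2 f \<eta> (brN g h) (B2 g \<zeta> h \<xi>) + B2 g \<zeta> (brN h f) (B2 h \<xi> f \<eta>)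
    + B2 h \<xi> (brN f g) (B2 f \<eta> g \<zeta>) = 0"
proof (intro ext)
  fix q c
  have 1: "D f (D g \<xi>) q c - D g (D f \<xi>) q c - D (brN f g) \<xi> q c = - lie \<xi> (K f g) q c"
    "D g (D h \<eta>) q c - D h (D g \<eta>) q c - D (brN g h) \<eta> q c = - lie \<eta> (K g h) q c"
    "D h (D f \<zeta>) q c - D f (D h \<zeta>) q c - D (brN h f) \<zeta> q c = - lie \<zeta> (K h f) q c"
    using fun_cong[OF fun_cong[OF D_curvature[OF assms(1,3,6)], of q], of c]
      fun_cong[OF fun_cong[OF D_curvature[OF assms(3,5,2)], of q], of c]
      fun_cong[OF fun_cong[OF D_curvature[OF assms(5,1,4)], of q], of c]
    unfolding lie_skew[OF assms(6) K_section[OF assms(1,3)]] lie_skew[OF assms(2) K_section[OF assms(3,5)]]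
      lie_skew[OF assms(4) K_section[OF assms(5,1)]]
    by simp_all
  have 2: "lie \<eta> (lie \<zeta> \<xi>) q c + lie \<zeta> (lie \<xi> \<eta>) q c + lie \<xi> (lie \<eta> \<zeta>) q c = 0"
    using fun_cong[OF fun_cong[OF lie_jacobi[OF assms(2,4,6)], of q], of c] by simp
  have 3: "(D f (K g h) q c + K f (brN g h) q c) + (D g (K h f) q c + K g (brN h f) q c)
      + (D h (K f g) q c + K h (brN f g) q c) = 0"
    using fun_cong[OF fun_cong[OF K_bianchi[OF assms(1,3,5)], of q], of c] by simp
  show "(B2 f \<eta> (brN g h) (B2 g \<zeta> h \<xi>) + B2 g \<zeta> (brN h f) (B2 h \<xi> f \<eta>)
    + B2 h \<xi> (brN f g) (B2 f \<eta> g \<zeta>)) q c = 0 q c"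
    unfolding B2_nested[OF assms] B2_nested[OF assms(3-6,1,2)] B2_nested[OF assms(5,6,1-4)]
      plus_fun_apply minus_apply zero_fun_apply
    using 1 2 3 by linarith
qed

lemma B_closed: "x \<in> affs \<Longrightarrow> y \<in> affs \<Longrightarrow> B x y \<in> affs"
  by (cases x; cases y) (simp add: affine_iff B_eq B2_section brN_smooth)

lemma B_skew: "x \<in> affs \<Longrightarrow> y \<in> affs \<Longrightarrow> B x y = - B y x"
proof (cases x; cases y)
  fix f \<eta> g \<zeta> assume "x \<in> affs" "y \<in> affs" "x = (f, \<eta>)" "y = (g, \<zeta>)"
  then show "B x y = - B y x"
    using N_bracket(1)[of f g] B2_skew[of g \<zeta> f \<eta>] by (simp add: affine_iff B_eq)
qed

lemma B_add_right:
  "x \<in> affs \<Longrightarrow> y \<in> affs \<Longrightarrow> z \<in> affs \<Longrightarrow> B x (y + z) = B x y + B x z"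
  by (cases x; cases y; cases z)
    (simp add: affine_iff B_eq section_add B2_add_right N_bracket(2))

lemma B_scaleR_right: "x \<in> affs \<Longrightarrow> y \<in> affs \<Longrightarrow> B x (c *\<^sub>R y) = c *\<^sub>R B x y"
  by (cases x; cases y) (simp add: affine_iff B_eq section_scaleR B2_scaleR_right N_bracket(3))

lemma B_leibniz:
  "x \<in> affs \<Longrightarrow> y \<in> affs \<Longrightarrow> z \<in> affs \<Longrightarrow>
    B x (affine_mult y z) = affine_mult (B x y) z + affine_mult y (B x z)"
proof (cases x; cases y; cases z)
  fix f \<eta> g \<zeta> h \<xi>
  assume "x \<in> affs" "y \<in> affs" "z \<in> affs" "x = (f, \<eta>)" "y = (g, \<zeta>)" "z = (h, \<xi>)"
  then show "B x (affine_mult y z) = affine_mult (B x y) z + affine_mult y (B x z)"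
    using B2_leibniz[of f \<eta> g \<zeta> h \<xi>] brN_mult_right[of g h f]
    by (simp add: affine_iff B_eq affine_mult_eq section_add section_mult mult.commute)
qed

lemma B_jacobi:
  "x \<in> affs \<Longrightarrow> y \<in> affs \<Longrightarrow> z \<in> affs \<Longrightarrow> B x (B y z) + B y (B z x) + B z (B x y) = 0"
proof (cases x; cases y; cases z)
  fix f \<eta> g \<zeta> h \<xi>
  assume "x \<in> affs" "y \<in> affs" "z \<in> affs" "x = (f, \<eta>)" "y = (g, \<zeta>)" "z = (h, \<xi>)"
  then show "B x (B y z) + B y (B z x) + B z (B x y) = 0"
    using B2_jacobi[of f \<eta> g \<zeta> h \<xi>] brN_jacobi[of f g h]
    by (simp add: affine_iff B_eq B2_section brN_smooth zero_prod_def)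
qed

lemma poisson_algebra: "poisson_algebra_on affs affine_mult B"
  unfolding poisson_algebra_on_def lie_bracket_on_def bilinear_over_def linear_over_def
proof (intro conjI ballI allI)
  fix x y z assume x: "x \<in> affs" and y: "y \<in> affs"
  show "B x y = - B y x" by (rule B_skew[OF x y])
  show "affine_mult x y = affine_mult y x" by (rule affine_mult_comm)
  show "affine_mult (c *\<^sub>R x) y = c *\<^sub>R affine_mult x y" for c
    unfolding affine_mult_comm[of _ y] by (rule affine_mult_scaleR_right)
  show "B (c *\<^sub>R x) y = c *\<^sub>R B x y" for c
    unfolding B_skew[OF subspace_scale[OF subspace_affine x] y] B_scaleR_right[OF y x] B_skew[OF x y]
    by simp
  assume z: "z \<in> affs"
  show "affine_mult (x + y) z = affine_mult x z + affine_mult y z"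
    unfolding affine_mult_comm[of _ z] by (rule affine_mult_add_right)
  show "B (x + y) z = B x z + B y z"
    unfolding B_skew[OF subspace_add[OF subspace_affine x y] z] B_add_right[OF z x y]
      B_skew[OF x z] B_skew[OF y z] by simp
  show "B (affine_mult x y) z = affine_mult (B x z) y + affine_mult x (B y z)"
  proof -
    have minus: "affine_mult u (- v) = - affine_mult u v" for u v
      using affine_mult_scaleR_right[of u "-1" v] by simp
    show ?thesis
      unfolding B_skew[OF affine_mult_closed[OF x y] z] B_leibniz[OF z x y] B_skew[OF x z] B_skew[OF y z]
        minus affine_mult_comm[of "- B z x" y] affine_mult_comm[of "B z x" y]
      by simp
  qed
qed (simp_all add: subspace_affine affine_mult_closed affine_mult_assoc affine_mult_add_right
    affine_mult_scaleR_right B_closed B_add_right B_scaleR_right B_jacobi B_leibniz)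

lemma infinitesimal_poisson_algebra: "B \<in> infinitesimal_poisson_algebras M P N"
  unfolding infinitesimal_poisson_algebras_def mem_Collect_eq restricted_bivector_eq
proof (intro conjI ballI)
  show "supported_on2 affs affs B" by (auto simp: supported_on2_def affine_bracket_def)
  show "poisson_algebra_on affs affine_mult B" by (rule poisson_algebra)
  show "poisson_hom_onto affs affine_mult B (smooth_functions N) (*) brN fst"
    unfolding poisson_hom_onto_def linear_over_def
  proof (intro conjI ballI allI)
    show "fst ` affs = smooth_functions N"
      using section_zero by (force simp: affine_functions_def image_iff)
    fix x y assume "x \<in> affs" "y \<in> affs"
    then show "fst (B x y) = brN (fst x) (fst y)" by (simp add: affine_bracket_def)
    show "fst (affine_mult x y) = fst x * fst y" by (cases x; cases y) (simp add: affine_mult_eq)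
  qed simp_all
  fix \<eta> \<zeta> assume s: "\<eta> \<in> sections" "\<zeta> \<in> sections"
  show "B (0, \<eta>) (0, \<zeta>) = (0, lie \<eta> \<zeta>)"
    using s by (simp add: B_eq B2_def D_zero_left K_zero_right brN_zero)
qed

end

section \<open>From an infinitesimal Poisson algebra to operators on functions\<close>

context poisson_pair
begin

text \<open>Compatibility with the projection fixes the function component of every bracket, and
  \<open>brN f 0 = 0\<close>. Hence brackets with an argument \<open>(0, \<eta>)\<close> are purely
  linear, and \<open>D\<close> and \<open>K\<close> lose no information.\<close>

lemma algebra_components:
  assumes A: "A \<in> infinitesimal_poisson_algebras M P N"
  defines "D \<equiv> \<lambda>f \<eta>. snd (A (f, 0) (0, \<eta>))" and "K \<equiv> \<lambda>f g. snd (A (f, 0) (g, 0))"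
  shows algebra_function_triple: "function_triple M N P Q D K" and algebra_eq: "A = affine_bracket D K"
proof -
  have supp: "supported_on2 affs affs A" and alg: "poisson_algebra_on affs affine_mult A"
    and hom: "poisson_hom_onto affs affine_mult A (smooth_functions N) (*) brN fst"
    and lie: "A (0, \<eta>) (0, \<zeta>) = (0, lie \<eta> \<zeta>)" if "\<eta> \<in> sections" "\<zeta> \<in> sections" for \<eta> \<zeta>
    using A that section_zero unfolding infinitesimal_poisson_algebras_def restricted_bivector_eq by blast+
  \<comment> \<open>These facts were stated jointly with the fourth and carry its premises; the zero
    section discharges them.\<close>
  note supp = supp[OF section_zero section_zero] and alg = alg[OF section_zero section_zero]
    and hom = hom[OF section_zero section_zero]
  have fst_A: "fst (A x y) = brN (fst x) (fst y)" if "x \<in> affs" "y \<in> affs" for x y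
    using hom that unfolding poisson_hom_onto_def by blast
  have lie_alg: "lie_bracket_on affs A"
    and leib_right: "\<And>x y z. x \<in> affs \<Longrightarrow> y \<in> affs \<Longrightarrow> z \<in> affs \<Longrightarrow>
      A x (affine_mult y z) = affine_mult (A x y) z + affine_mult y (A x z)"
    and leib_left: "\<And>x y z. x \<in> affs \<Longrightarrow> y \<in> affs \<Longrightarrow> z \<in> affs \<Longrightarrow>
      A (affine_mult x y) z = affine_mult (A x z) y + affine_mult x (A y z)"
    using alg unfolding poisson_algebra_on_def by blast+
  have closed: "A x y \<in> affs" if "x \<in> affs" "y \<in> affs" for x y
    using lie_alg that unfolding lie_bracket_on_def by blast
  have skew: "A y x = - A x y" if "x \<in> affs" "y \<in> affs" for x y
    using lie_alg that unfolding lie_bracket_on_def by blast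
  have jac: "A x (A y z) + A y (A z x) + A z (A x y) = 0" if "x \<in> affs" "y \<in> affs" "z \<in> affs" for x y z
    using lie_alg that unfolding lie_bracket_on_def by blast
  have add_right: "A x (y + z) = A x y + A x z" and add_left: "A (y + z) x = A y x + A z x"
    if "x \<in> affs" "y \<in> affs" "z \<in> affs" for x y z
    using lie_alg that unfolding lie_bracket_on_def bilinear_over_def linear_over_def by blast+
  have scale_right: "A x (c *\<^sub>R y) = c *\<^sub>R A x y" and scale_left: "A (c *\<^sub>R y) x = c *\<^sub>R A y x"
    if "x \<in> affs" "y \<in> affs" for x y c
    using lie_alg that unfolding lie_bracket_on_def bilinear_over_def linear_over_def by blast+
  have fA: "(f, 0) \<in> affs" if "f \<in> smooth_functions N" for f using that by (simp add: affine_iff section_zero)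
  have sA: "(0, \<eta>) \<in> affs" if "\<eta> \<in> sections" for \<eta> using that by (simp add: affine_iff)
  have AD: "A (f, 0) (0, \<eta>) = (0, D f \<eta>)" if "f \<in> smooth_functions N" "\<eta> \<in> sections" for f \<eta>
    using fst_A[OF fA[OF that(1)] sA[OF that(2)]] by (simp add: prod_eq_iff D_def brN_zero)
  have AK: "A (f, 0) (g, 0) = (brN f g, K f g)" if "f \<in> smooth_functions N" "g \<in> smooth_functions N" for f g
    using fst_A[OF fA[OF that(1)] fA[OF that(2)]] by (simp add: prod_eq_iff K_def)
  have AD': "A (0, \<eta>) (f, 0) = (0, - D f \<eta>)" if "f \<in> smooth_functions N" "\<eta> \<in> sections" for f \<eta>
    using skew[OF fA[OF that(1)] sA[OF that(2)]] AD[OF that] by simp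
  have Ds: "D f \<eta> \<in> sections" if "f \<in> smooth_functions N" "\<eta> \<in> sections" for f \<eta>
    using closed[OF fA[OF that(1)] sA[OF that(2)]] AD[OF that] by (simp add: affine_iff)
  have Ks: "K f g \<in> sections" if "f \<in> smooth_functions N" "g \<in> smooth_functions N" for f g
    using closed[OF fA[OF that(1)] fA[OF that(2)]] AK[OF that] by (simp add: affine_iff)
  have split: "(f, \<eta>) = (f, 0) + (0, \<eta>)" for f :: "'p \<Rightarrow> real" and \<eta> :: "'p consec" by simp
  have zero_mult: "f \<bullet>\<^sub>s (0 :: 'p consec) = 0" "(0 :: 'p \<Rightarrow> real) \<bullet>\<^sub>s \<eta> = 0" "f * (0 :: 'p \<Rightarrow> real) = 0"
    for f and \<eta> :: "'p consec"
    by (auto simp: fun_eq_iff)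
  have AfK: "A (f, 0) (g, \<eta>) = (brN f g, K f g + D f \<eta>)"
    if "f \<in> smooth_functions N" "g \<in> smooth_functions N" "\<eta> \<in> sections" for f g \<eta>
    unfolding split[of g \<eta>] add_right[OF fA[OF that(1)] fA[OF that(2)] sA[OF that(3)]]
      AK[OF that(1,2)] AD[OF that(1,3)] by simp
  show "function_triple M N P Q D K"
  proof
    fix f g \<eta> assume f: "f \<in> smooth_functions N" and g: "g \<in> smooth_functions N" and \<eta>: "\<eta> \<in> sections"
    show "D (f + g) \<eta> = D f \<eta> + D g \<eta>"
      using add_left[OF sA[OF \<eta>] fA[OF f] fA[OF g]] by (simp add: D_def)
    show "D (f * g) \<eta> = f \<bullet>\<^sub>s D g \<eta> + g \<bullet>\<^sub>s D f \<eta>"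
      using leib_left[OF fA[OF f] fA[OF g] sA[OF \<eta>]] AD[OF N.mult_smooth[OF f g] \<eta>]
      by (simp add: affine_mult_eq AD[OF f \<eta>] AD[OF g \<eta>] zero_mult add.commute)
    \<comment> \<open>The Leibniz rule on \<open>(g, 0)\<close> times \<open>(0, \<eta>)\<close>:
      the coefficient \<open>brN f g\<close> is the function component of
      \<open>A (f, 0) (g, 0)\<close>.\<close>
    show "D f (g \<bullet>\<^sub>s \<eta>) = g \<bullet>\<^sub>s D f \<eta> + brN f g \<bullet>\<^sub>s \<eta>"
      using leib_right[OF fA[OF f] fA[OF g] sA[OF \<eta>]] AD[OF f section_mult[OF g \<eta>]]
      by (simp add: affine_mult_eq AD[OF f \<eta>] AK[OF f g] zero_mult add.commute)
    \<comment> \<open>The Jacobi identity for two functions and a section becomes the curvature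
      identity.\<close>
    have "A (f, 0) (0, D g \<eta>) + A (g, 0) (0, - D f \<eta>) + A (0, \<eta>) (brN f g, K f g) = 0"
      using jac[OF fA[OF f] fA[OF g] sA[OF \<eta>]] by (simp add: AD[OF g \<eta>] AD'[OF f \<eta>] AK[OF f g])
    moreover have "A (0, \<eta>) (brN f g, K f g) = (0, - D (brN f g) \<eta> + lie \<eta> (K f g))"
      unfolding split[of "brN f g" "K f g"]
        add_right[OF sA[OF \<eta>] fA[OF brN_smooth[OF f g]] sA[OF Ks[OF f g]]]
        AD'[OF brN_smooth[OF f g] \<eta>] lie[OF \<eta> Ks[OF f g]] by simp
    moreover have "D g (- D f \<eta>) = - D g (D f \<eta>)"
      using scale_right[OF fA[OF g] sA[OF Ds[OF f \<eta>]], of "-1"] by (simp add: D_def)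
    ultimately have "D f (D g \<eta>) - D g (D f \<eta>) + (- D (brN f g) \<eta> + lie \<eta> (K f g)) = 0"
      by (simp add: AD[OF f Ds[OF g \<eta>]] AD[OF g section_minus[OF Ds[OF f \<eta>]]] zero_prod_def)
    then show "D f (D g \<eta>) - D g (D f \<eta>) - D (brN f g) \<eta> = lie (K f g) \<eta>"
      unfolding lie_skew[OF \<eta> Ks[OF f g]] by (simp add: eq_neg_iff_add_eq_0 algebra_simps)
  next
    fix f \<eta> \<zeta> assume f: "f \<in> smooth_functions N" and \<eta>: "\<eta> \<in> sections" and \<zeta>: "\<zeta> \<in> sections"
    show "D f (\<eta> + \<zeta>) = D f \<eta> + D f \<zeta>"
      using add_right[OF fA[OF f] sA[OF \<eta>] sA[OF \<zeta>]] by (simp add: D_def)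
    \<comment> \<open>The Jacobi identity for a function and two sections makes \<open>D f\<close> a
      derivation of \<open>lie\<close>.\<close>
    have "A (f, 0) (0, lie \<eta> \<zeta>) + A (0, \<eta>) (0, - D f \<zeta>) + A (0, \<zeta>) (0, D f \<eta>) = 0"
      using jac[OF fA[OF f] sA[OF \<eta>] sA[OF \<zeta>]] by (simp add: lie[OF \<eta> \<zeta>] AD'[OF f \<zeta>] AD[OF f \<eta>])
    then have "D f (lie \<eta> \<zeta>) - lie \<eta> (D f \<zeta>) + lie \<zeta> (D f \<eta>) = 0"
      by (simp add: AD[OF f lie_section[OF \<eta> \<zeta>]] lie[OF \<eta> section_minus[OF Ds[OF f \<zeta>]]]
          lie[OF \<zeta> Ds[OF f \<eta>]] lie_minus_right[OF \<eta> Ds[OF f \<zeta>]] zero_prod_def)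
    then show "D f (lie \<eta> \<zeta>) = lie \<eta> (D f \<zeta>) + lie (D f \<eta>) \<zeta>"
      unfolding lie_skew[OF \<zeta> Ds[OF f \<eta>]] by (simp add: algebra_simps)
  next
    fix f \<eta> and c :: real assume f: "f \<in> smooth_functions N" and \<eta>: "\<eta> \<in> sections"
    show "D (c *\<^sub>R f) \<eta> = c *\<^sub>R D f \<eta>" using scale_left[OF sA[OF \<eta>] fA[OF f], of c] by (simp add: D_def)
    show "D f (c *\<^sub>R \<eta>) = c *\<^sub>R D f \<eta>" using scale_right[OF fA[OF f] sA[OF \<eta>], of c] by (simp add: D_def)
  next
    fix f g and c :: real assume f: "f \<in> smooth_functions N" and g: "g \<in> smooth_functions N"
    show "K g f = - K f g" using skew[OF fA[OF f] fA[OF g]] by (simp add: K_def)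
    show "K f (c *\<^sub>R g) = c *\<^sub>R K f g" using scale_right[OF fA[OF f] fA[OF g], of c] by (simp add: K_def)
  next
    fix f g h assume f: "f \<in> smooth_functions N" and g: "g \<in> smooth_functions N" and h: "h \<in> smooth_functions N"
    show "K f (g + h) = K f g + K f h"
      using add_right[OF fA[OF f] fA[OF g] fA[OF h]] by (simp add: K_def)
    show "K f (g * h) = g \<bullet>\<^sub>s K f h + h \<bullet>\<^sub>s K f g"
      using leib_right[OF fA[OF f] fA[OF g] fA[OF h]] AK[OF f N.mult_smooth[OF g h]]
      by (simp add: affine_mult_eq AK[OF f g] AK[OF f h] zero_mult add.commute)
    \<comment> \<open>The section component of the Jacobi identity for three functions.\<close>
    show "(D f (K g h) + K f (brN g h)) + (D g (K h f) + K g (brN h f)) + (D h (K f g) + K h (brN f g)) = 0"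
      using jac[OF fA[OF f] fA[OF g] fA[OF h]]
      by (simp add: AK[OF g h] AK[OF h f] AK[OF f g] AfK[OF f brN_smooth[OF g h] Ks[OF g h]]
          AfK[OF g brN_smooth[OF h f] Ks[OF h f]] AfK[OF h brN_smooth[OF f g] Ks[OF f g]]
          zero_prod_def add.commute add.left_commute)
  qed (simp_all add: Ds Ks)
  show "A = affine_bracket D K"
  proof (intro ext)
    fix x y
    show "A x y = affine_bracket D K x y"
    proof (cases "x \<in> affs \<and> y \<in> affs")
      case False
      have "A x y = 0" using supp False unfolding supported_on2_def by blast
      moreover have "affine_bracket D K x y = 0" using False by (simp only: affine_bracket_def if_False)
      ultimately show ?thesis by simp
    next
      case True
      obtain f \<eta> where x: "x = (f, \<eta>)" by (cases x)
      obtain g \<zeta> where y: "y = (g, \<zeta>)" by (cases y)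
      have s: "f \<in> smooth_functions N" "\<eta> \<in> sections" "g \<in> smooth_functions N" "\<zeta> \<in> sections"
        using True by (simp_all add: x y affine_iff)
      have "A x y = A (f, 0) (g, \<zeta>) + A (0, \<eta>) (g, \<zeta>)"
        using add_left[of y "(f, 0)" "(0, \<eta>)"] True s by (simp add: x y fA sA)
      also have "A (0, \<eta>) (g, \<zeta>) = (0, - D g \<eta> + lie \<eta> \<zeta>)"
        unfolding split[of g \<zeta>] add_right[OF sA[OF s(2)] fA[OF s(3)] sA[OF s(4)]] AD'[OF s(3,2)]
          lie[OF s(2,4)] by simp
      finally have "A x y = (brN f g, D f \<zeta> - D g \<eta> + lie \<eta> \<zeta> + K f g)"
        unfolding AfK[OF s(1,3,4)] by simp
      then show ?thesis using True by (simp add: affine_bracket_def x y)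
    qed
  qed
qed

text \<open>A derivation \<open>\<delta>\<close> of \<open>C\<^sup>\<infinity>(S)\<close> with values in \<open>\<Gamma>E\<^sup>*\<close> is, at each point, a tangent vector in its argument,
  so that a 1-form can be evaluated on it.\<close>

definition section_derivation :: "(('p \<Rightarrow> real) \<Rightarrow> 'p consec) \<Rightarrow> bool" where
  "section_derivation \<delta> \<longleftrightarrow> (\<forall>f\<in>smooth_functions N. \<delta> f \<in> sections \<and> (\<forall>c. \<delta> (c *\<^sub>R f) = c *\<^sub>R \<delta> f) \<and>
     (\<forall>g\<in>smooth_functions N. \<delta> (f + g) = \<delta> f + \<delta> g \<and> \<delta> (f * g) = f \<bullet>\<^sub>s \<delta> g + g \<bullet>\<^sub>s \<delta> f))"

definition value_at :: "(('p \<Rightarrow> real) \<Rightarrow> 'p consec) \<Rightarrow> 'p \<Rightarrow> 'p tvec set \<Rightarrow> 'p tvec" where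
  "value_at \<delta> q c = (\<lambda>f. if f \<in> smooth_functions N then \<delta> f q c else 0)"

definition extend :: "(('p \<Rightarrow> real) \<Rightarrow> 'p consec) \<Rightarrow> ('p \<Rightarrow> 'p covec) \<Rightarrow> 'p consec" where
  "extend \<delta> \<alpha> = (\<lambda>q c. \<alpha> q (value_at \<delta> q c))"

lemma value_at_tangent: "section_derivation \<delta> \<Longrightarrow> value_at \<delta> q c \<in> tangent N q"
  by (auto simp: tangent_def supported_on_def linear_over_def value_at_def section_derivation_def)

lemma one_form_cotangent: "\<alpha> \<in> one_forms N \<Longrightarrow> q \<in> S \<Longrightarrow> \<alpha> q \<in> cotangent N q"
  and one_form_outside: "\<alpha> \<in> one_forms N \<Longrightarrow> q \<notin> S \<Longrightarrow> \<alpha> q = 0"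
  by (simp_all add: one_forms_def supported_on_def)

text \<open>For fixed \<open>V\<close> the vectors
  \<open>value_at \<delta> q (nu M N q (V q))\<close> form a vector field on \<open>N\<close>,
  smooth because each \<open>\<delta> f\<close> is a smooth section; its contraction with
  \<open>\<alpha>\<close> is then smooth.\<close>

lemma extend_section:
  assumes \<delta>: "section_derivation \<delta>" and \<alpha>: "\<alpha> \<in> one_forms N"
  shows "extend \<delta> \<alpha> \<in> sections"
proof (rule sectionI)
  have sec: "\<delta> f \<in> sections" if "f \<in> smooth_functions N" for f
    using \<delta> that unfolding section_derivation_def by blast
  show "extend \<delta> \<alpha> q = 0" if "q \<notin> S" for q
    using one_form_outside[OF \<alpha> that] by (simp add: extend_def fun_eq_iff)
  show "extend \<delta> \<alpha> q \<in> conormal M N q" if q: "q \<in> S" for q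
    unfolding conormal_def supported_on_def linear_over_def mem_Collect_eq
  proof (intro conjI ballI allI impI)
    note cot = one_form_cotangent[OF \<alpha> q] and tan = value_at_tangent[OF \<delta>]
    show "extend \<delta> \<alpha> q c = 0" if "c \<notin> nu M N q ` tangent M q" for c
    proof -
      have "value_at \<delta> q c = 0"
        using section_supported[OF sec that] by (auto simp: value_at_def fun_eq_iff)
      then show ?thesis by (simp add: extend_def cotangent_zero[OF cot])
    qed
    fix v assume v: "v \<in> tangent M q"
    show "extend \<delta> \<alpha> q (nu M N q (c *\<^sub>R v)) = c *\<^sub>R extend \<delta> \<alpha> q (nu M N q v)" for c
    proof -
      have "value_at \<delta> q (nu M N q (c *\<^sub>R v)) = c *\<^sub>R value_at \<delta> q (nu M N q v)"
        using section_nu_scaleR[OF sec v] by (auto simp: value_at_def fun_eq_iff)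
      then show ?thesis by (simp add: extend_def cotangent_scaleR[OF cot tan])
    qed
    fix w assume w: "w \<in> tangent M q"
    have "value_at \<delta> q (nu M N q (v + w)) = value_at \<delta> q (nu M N q v) + value_at \<delta> q (nu M N q w)"
      using section_nu_add[OF sec v w] by (auto simp: value_at_def fun_eq_iff)
    then show "extend \<delta> \<alpha> q (nu M N q (v + w)) = extend \<delta> \<alpha> q (nu M N q v) + extend \<delta> \<alpha> q (nu M N q w)"
      by (simp add: extend_def cotangent_add[OF cot tan tan])
  qed
  fix V assume V: "V \<in> vfields"
  have "(\<lambda>q. value_at \<delta> q (nu M N q (V q))) \<in> vector_fields N"
    unfolding vector_fields_def mem_Collect_eq supported_on_def
  proof (intro conjI ballI allI impI)
    show "value_at \<delta> q (nu M N q (V q)) = 0" if "q \<notin> S" for q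
      using section_outside[OF sec that] by (auto simp: value_at_def fun_eq_iff)
    show "(\<lambda>q. value_at \<delta> q (nu M N q (V q)) f) \<in> smooth_functions N" if "f \<in> smooth_functions N" for f
      using section_smooth[OF sec[OF that] V] that by (simp add: value_at_def)
  qed (rule value_at_tangent[OF \<delta>])
  then show "(\<lambda>q. extend \<delta> \<alpha> q (nu M N q (V q))) \<in> smooth_functions N"
    using \<alpha> by (simp add: one_forms_def extend_def)
qed

lemma extend_exact:
  assumes \<delta>: "section_derivation \<delta>" and f: "f \<in> smooth_functions N"
  shows "extend \<delta> (d0 N f) = \<delta> f"
proof (intro ext)
  have sec: "\<delta> f \<in> sections" using \<delta> f unfolding section_derivation_def by blast
  show "extend \<delta> (d0 N f) q c = \<delta> f q c" for q c
    using value_at_tangent[OF \<delta>, of q c] f section_outside[OF sec, of q]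
    by (cases "q \<in> S") (simp_all add: extend_def d0_apply d0_outside, simp add: value_at_def)
qed

lemma extend_add_form: "extend \<delta> (\<alpha> + \<beta>) = extend \<delta> \<alpha> + extend \<delta> \<beta>"
  and extend_mult_form: "extend \<delta> (a \<bullet>\<^sub>s \<alpha>) = a \<bullet>\<^sub>s extend \<delta> \<alpha>"
  by (simp_all add: extend_def fun_eq_iff)

text \<open>At each point of \<open>S\<close> the vector of \<open>\<delta>''\<close> is a
  combination of those of \<open>\<delta>\<close> and \<open>\<delta>'\<close>. As \<open>a\<close>
  and \<open>b\<close> are arbitrary functions, constants that do not vanish off \<open>S\<close>
  may be inserted.\<close>

lemma extend_combination:
  assumes \<delta>: "section_derivation \<delta>" "section_derivation \<delta>'" and \<alpha>: "\<alpha> \<in> one_forms N"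
    and eq: "\<And>f. f \<in> smooth_functions N \<Longrightarrow> \<delta>'' f = a \<bullet>\<^sub>s \<delta> f + b \<bullet>\<^sub>s \<delta>' f"
  shows "extend \<delta>'' \<alpha> = a \<bullet>\<^sub>s extend \<delta> \<alpha> + b \<bullet>\<^sub>s extend \<delta>' \<alpha>"
proof (intro ext)
  fix q c
  show "extend \<delta>'' \<alpha> q c = (a \<bullet>\<^sub>s extend \<delta> \<alpha> + b \<bullet>\<^sub>s extend \<delta>' \<alpha>) q c"
  proof (cases "q \<in> S")
    case True
    note cot = one_form_cotangent[OF \<alpha> True]
      and tan = value_at_tangent[OF \<delta>(1), of q c] value_at_tangent[OF \<delta>(2), of q c]
    have "value_at \<delta>'' q c = a q *\<^sub>R value_at \<delta> q c + b q *\<^sub>R value_at \<delta>' q c"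
      by (auto simp: value_at_def eq fun_eq_iff)
    then show ?thesis
      by (simp add: extend_def cotangent_add[OF cot] cotangent_scaleR[OF cot] tan
          subspace_scale[OF subspace_tangent])
  qed (simp add: extend_def one_form_outside[OF \<alpha>])
qed

lemma module_mult_one: "(\<lambda>_. 1) \<bullet>\<^sub>s s = s" and module_mult_const: "(\<lambda>_. c) \<bullet>\<^sub>s s = c *\<^sub>R s"
  and module_mult_zero: "(\<lambda>_. 0) \<bullet>\<^sub>s s = 0"
  by (simp_all add: fun_eq_iff)

lemma extend_add:
  assumes "section_derivation \<delta>" "section_derivation \<delta>'" "\<alpha> \<in> one_forms N"
    and "\<And>f. f \<in> smooth_functions N \<Longrightarrow> \<delta>'' f = \<delta> f + \<delta>' f"
  shows "extend \<delta>'' \<alpha> = extend \<delta> \<alpha> + extend \<delta>' \<alpha>"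
  using extend_combination[OF assms(1-3), of \<delta>'' "\<lambda>_. 1" "\<lambda>_. 1"] assms(4)
  by (simp add: module_mult_one)

lemma extend_scaleR:
  assumes "section_derivation \<delta>" "\<alpha> \<in> one_forms N"
    and "\<And>f. f \<in> smooth_functions N \<Longrightarrow> \<delta>'' f = c *\<^sub>R \<delta> f"
  shows "extend \<delta>'' \<alpha> = c *\<^sub>R extend \<delta> \<alpha>"
  using extend_combination[OF assms(1,1,2), of \<delta>'' "\<lambda>_. c" "\<lambda>_. 0"] assms(3)
  by (simp add: module_mult_const module_mult_zero)

section \<open>Restriction of a triple to exact forms\<close>

lemma sharp_exact: "(\<lambda>q. sharp N Q q (d0 N f q) g) = brN f g"
  by (simp add: sharp_def poisson_bracket_def)

lemma d0_const_scaleR: "f \<in> smooth_functions N \<Longrightarrow> d0 N (c *\<^sub>R f) = const_on S c \<bullet>\<^sub>s d0 N f"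
  unfolding d0_scaleR by (rule scaleR_eq_module_mult) (rule d0_outside)

text \<open>Linearity over functions in a 1-form becomes the derivation property in
  \<open>f\<close>, as \<open>d(f g) = f dg + g df\<close>. The bracket of exact forms is
  \<open>d{f, g}\<close>, which turns the remaining axioms into identities for functions.\<close>

lemma triple_function_triple:
  assumes T: "(L, D, K) \<in> poisson_triples M P N"
  shows "L = lie" "function_triple M N P Q (\<lambda>f. D (d0 N f)) (\<lambda>f g. K (d0 N f) (d0 N g))"
proof -
  have L: "L = lie" and D: "contravariant_derivative M P N D" and K: "skew_form_valued M N K"
    using T unfolding poisson_triples_def by blast+
  have ad: "D \<alpha> (lie \<eta> \<zeta>) - lie \<eta> (D \<alpha> \<zeta>) = lie (D \<alpha> \<eta>) \<zeta>"
    if "\<alpha> \<in> one_forms N" "\<eta> \<in> sections" "\<zeta> \<in> sections" for \<alpha> \<eta> \<zeta>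
    using T that unfolding poisson_triples_def by blast
  have curv: "curvature M P N D \<alpha> \<beta> \<zeta> = lie (K \<alpha> \<beta>) \<zeta>"
    if "\<alpha> \<in> one_forms N" "\<beta> \<in> one_forms N" "\<zeta> \<in> sections" for \<alpha> \<beta> \<zeta>
    using T that unfolding poisson_triples_def by blast
  have bianchi: "(D \<alpha> (K \<beta> \<gamma>) + K \<alpha> (form_bracket N Q \<beta> \<gamma>)) +
      (D \<beta> (K \<gamma> \<alpha>) + K \<beta> (form_bracket N Q \<gamma> \<alpha>)) +
      (D \<gamma> (K \<alpha> \<beta>) + K \<gamma> (form_bracket N Q \<alpha> \<beta>)) = 0"
    if "\<alpha> \<in> one_forms N" "\<beta> \<in> one_forms N" "\<gamma> \<in> one_forms N" for \<alpha> \<beta> \<gamma>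
    using T that unfolding poisson_triples_def Let_def restricted_bivector_eq by blast
  have D_sec: "D \<alpha> \<eta> \<in> sections" if "\<alpha> \<in> one_forms N" "\<eta> \<in> sections" for \<alpha> \<eta>
    using D that unfolding contravariant_derivative_def by blast
  have D_lin: "linear_over sections (D \<alpha>)" if "\<alpha> \<in> one_forms N" for \<alpha>
    using D that unfolding contravariant_derivative_def by blast
  have D_add: "D (\<alpha> + \<beta>) \<eta> = D \<alpha> \<eta> + D \<beta> \<eta>" if "\<alpha> \<in> one_forms N" "\<beta> \<in> one_forms N" "\<eta> \<in> sections" for \<alpha> \<beta> \<eta>
    using D that unfolding contravariant_derivative_def by blast
  have D_mult: "D (f \<bullet>\<^sub>s \<alpha>) \<eta> = f \<bullet>\<^sub>s D \<alpha> \<eta>" if "f \<in> smooth_functions N" "\<alpha> \<in> one_forms N" "\<eta> \<in> sections" for f \<alpha> \<eta>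
    using D that unfolding contravariant_derivative_def by blast
  have D_leib: "D \<alpha> (f \<bullet>\<^sub>s \<eta>) = f \<bullet>\<^sub>s D \<alpha> \<eta> + (\<lambda>q. sharp N Q q (\<alpha> q) f) \<bullet>\<^sub>s \<eta>"
    if "f \<in> smooth_functions N" "\<alpha> \<in> one_forms N" "\<eta> \<in> sections" for f \<alpha> \<eta>
    using D that unfolding contravariant_derivative_def restricted_bivector_eq by blast
  have K_sec: "K \<alpha> \<beta> \<in> sections" and K_skew: "K \<alpha> \<beta> = - K \<beta> \<alpha>"
    if "\<alpha> \<in> one_forms N" "\<beta> \<in> one_forms N" for \<alpha> \<beta>
    using K that unfolding skew_form_valued_def by blast+
  have K_add: "K \<gamma> (\<alpha> + \<beta>) = K \<gamma> \<alpha> + K \<gamma> \<beta>" if "\<alpha> \<in> one_forms N" "\<beta> \<in> one_forms N" "\<gamma> \<in> one_forms N" for \<alpha> \<beta> \<gamma>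
    using K that unfolding skew_form_valued_def by blast
  have K_mult: "K \<alpha> (f \<bullet>\<^sub>s \<beta>) = f \<bullet>\<^sub>s K \<alpha> \<beta>" if "f \<in> smooth_functions N" "\<alpha> \<in> one_forms N" "\<beta> \<in> one_forms N" for f \<alpha> \<beta>
    using K that unfolding skew_form_valued_def by blast
  note d = N.d0_one_form
  show "L = lie" by (rule L)
  show "function_triple M N P Q (\<lambda>f. D (d0 N f)) (\<lambda>f g. K (d0 N f) (d0 N g))"
  proof
    fix f g \<eta> assume f: "f \<in> smooth_functions N" and g: "g \<in> smooth_functions N" and \<eta>: "\<eta> \<in> sections"
    show "D (d0 N (f + g)) \<eta> = D (d0 N f) \<eta> + D (d0 N g) \<eta>"
      unfolding d0_add[OF f g] by (rule D_add[OF d[OF f] d[OF g] \<eta>])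
    show "D (d0 N (f * g)) \<eta> = f \<bullet>\<^sub>s D (d0 N g) \<eta> + g \<bullet>\<^sub>s D (d0 N f) \<eta>"
      unfolding d0_mult[OF f g] D_add[OF one_forms_closed(2)[OF f d[OF g]] one_forms_closed(2)[OF g d[OF f]] \<eta>]
        D_mult[OF f d[OF g] \<eta>] D_mult[OF g d[OF f] \<eta>] ..
    show "D (d0 N f) (g \<bullet>\<^sub>s \<eta>) = g \<bullet>\<^sub>s D (d0 N f) \<eta> + brN f g \<bullet>\<^sub>s \<eta>"
      unfolding D_leib[OF g d[OF f] \<eta>] sharp_exact ..
    show "D (d0 N f) (D (d0 N g) \<eta>) - D (d0 N g) (D (d0 N f) \<eta>) - D (d0 N (brN f g)) \<eta>
        = lie (K (d0 N f) (d0 N g)) \<eta>"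
      using curv[OF d[OF f] d[OF g] \<eta>]
      unfolding curvature_def restricted_bivector_eq form_bracket_exact[OF f g] .
  next
    fix f \<eta> \<zeta> assume f: "f \<in> smooth_functions N" and \<eta>: "\<eta> \<in> sections" and \<zeta>: "\<zeta> \<in> sections"
    show "D (d0 N f) (\<eta> + \<zeta>) = D (d0 N f) \<eta> + D (d0 N f) \<zeta>"
      using D_lin[OF d[OF f]] \<eta> \<zeta> unfolding linear_over_def by blast
    show "D (d0 N f) (lie \<eta> \<zeta>) = lie \<eta> (D (d0 N f) \<zeta>) + lie (D (d0 N f) \<eta>) \<zeta>"
      using ad[OF d[OF f] \<eta> \<zeta>] by (simp only: diff_eq_eq add.commute)
  next
    fix f \<eta> and c :: real assume f: "f \<in> smooth_functions N" and \<eta>: "\<eta> \<in> sections"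
    show "D (d0 N (c *\<^sub>R f)) \<eta> = c *\<^sub>R D (d0 N f) \<eta>"
      unfolding d0_const_scaleR[OF f] D_mult[OF N.const_smooth d[OF f] \<eta>]
        section_scaleR_eq[OF D_sec[OF d[OF f] \<eta>]] ..
    show "D (d0 N f) (c *\<^sub>R \<eta>) = c *\<^sub>R D (d0 N f) \<eta>"
      using D_lin[OF d[OF f]] \<eta> unfolding linear_over_def by blast
  next
    fix f g and c :: real assume f: "f \<in> smooth_functions N" and g: "g \<in> smooth_functions N"
    show "K (d0 N g) (d0 N f) = - K (d0 N f) (d0 N g)" by (rule K_skew[OF d[OF g] d[OF f]])
    show "K (d0 N f) (d0 N (c *\<^sub>R g)) = c *\<^sub>R K (d0 N f) (d0 N g)"
      unfolding d0_const_scaleR[OF g] K_mult[OF N.const_smooth d[OF f] d[OF g]]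
        section_scaleR_eq[OF K_sec[OF d[OF f] d[OF g]]] ..
  next
    fix f g h assume f: "f \<in> smooth_functions N" and g: "g \<in> smooth_functions N" and h: "h \<in> smooth_functions N"
    show "K (d0 N f) (d0 N (g + h)) = K (d0 N f) (d0 N g) + K (d0 N f) (d0 N h)"
      unfolding d0_add[OF g h] by (rule K_add[OF d[OF g] d[OF h] d[OF f]])
    show "K (d0 N f) (d0 N (g * h)) = g \<bullet>\<^sub>s K (d0 N f) (d0 N h) + h \<bullet>\<^sub>s K (d0 N f) (d0 N g)"
      unfolding d0_mult[OF g h] K_add[OF one_forms_closed(2)[OF g d[OF h]] one_forms_closed(2)[OF h d[OF g]] d[OF f]]
        K_mult[OF g d[OF f] d[OF h]] K_mult[OF h d[OF f] d[OF g]] ..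
    show "(D (d0 N f) (K (d0 N g) (d0 N h)) + K (d0 N f) (d0 N (brN g h))) +
        (D (d0 N g) (K (d0 N h) (d0 N f)) + K (d0 N g) (d0 N (brN h f))) +
        (D (d0 N h) (K (d0 N f) (d0 N g)) + K (d0 N h) (d0 N (brN f g))) = 0"
      using bianchi[OF d[OF f] d[OF g] d[OF h]]
      unfolding form_bracket_exact[OF g h] form_bracket_exact[OF h f] form_bracket_exact[OF f g] .
  qed (simp_all add: D_sec K_sec d)
qed

lemma triple_bracket_affine:
  "triple_bracket M P N (lie, D, K) = affine_bracket (\<lambda>f. D (d0 N f)) (\<lambda>f g. K (d0 N f) (d0 N g))"
  by (intro ext) (simp add: triple_bracket_eq affine_bracket_def)

end

section \<open>Extension of operators on functions to a Poisson triple\<close>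

context function_triple
begin

lemma D_derivation: "\<eta> \<in> sections \<Longrightarrow> section_derivation (\<lambda>f. D f \<eta>)"
  by (simp add: section_derivation_def D_section D_scaleR_left D_add_left D_mult_left)

lemma K_derivation: "f \<in> smooth_functions N \<Longrightarrow> section_derivation (K f)"
  by (simp add: section_derivation_def K_section K_scaleR_right K_add_right K_mult_right)

lemma K_add_left:
  "f \<in> smooth_functions N \<Longrightarrow> g \<in> smooth_functions N \<Longrightarrow> h \<in> smooth_functions N \<Longrightarrow>
    K (f + g) h = K f h + K g h"
  using K_skew[of h "f + g"] K_skew[of h f] K_skew[of h g] K_add_right[of h f g] by simp

lemma K_scaleR_left:
  "f \<in> smooth_functions N \<Longrightarrow> h \<in> smooth_functions N \<Longrightarrow> K (c *\<^sub>R f) h = c *\<^sub>R K f h"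
  using K_skew[of h "c *\<^sub>R f"] K_skew[of h f] K_scaleR_right[of h f c] by simp

lemma K_mult_left:
  assumes "f \<in> smooth_functions N" "g \<in> smooth_functions N" "h \<in> smooth_functions N"
  shows "K (f * g) h = f \<bullet>\<^sub>s K g h + g \<bullet>\<^sub>s K f h"
  unfolding K_skew[OF assms(3) N.mult_smooth[OF assms(1,2)]] K_mult_right[OF assms(3,1,2)]
    K_skew[OF assms(3,1)] K_skew[OF assms(3,2)]
  by (simp add: fun_eq_iff)

text \<open>\<open>K\<close> is extended in its second slot first; the result has to stay a
  derivation in the first slot, so that the extension can be repeated there.\<close>

lemma extend_K_derivation:
  assumes \<beta>: "\<beta> \<in> one_forms N"
  shows "section_derivation (\<lambda>f. extend (K f) \<beta>)"
  unfolding section_derivation_def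
proof (intro ballI conjI allI)
  fix f assume f: "f \<in> smooth_functions N"
  show "extend (K f) \<beta> \<in> sections" by (rule extend_section[OF K_derivation[OF f] \<beta>])
  show "extend (K (c *\<^sub>R f)) \<beta> = c *\<^sub>R extend (K f) \<beta>" for c
    by (rule extend_scaleR[OF K_derivation[OF f] \<beta> K_scaleR_left[OF f]])
  fix g assume g: "g \<in> smooth_functions N"
  show "extend (K (f + g)) \<beta> = extend (K f) \<beta> + extend (K g) \<beta>"
    by (rule extend_add[OF K_derivation[OF f] K_derivation[OF g] \<beta> K_add_left[OF f g]])
  show "extend (K (f * g)) \<beta> = f \<bullet>\<^sub>s extend (K g) \<beta> + g \<bullet>\<^sub>s extend (K f) \<beta>"
    by (rule extend_combination[OF K_derivation[OF g] K_derivation[OF f] \<beta> K_mult_left[OF f g]])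
qed

definition DD :: "('p \<Rightarrow> 'p covec) \<Rightarrow> 'p consec \<Rightarrow> 'p consec" where
  "DD \<alpha> \<eta> = (if \<alpha> \<in> one_forms N \<and> \<eta> \<in> sections then extend (\<lambda>f. D f \<eta>) \<alpha> else 0)"

definition KK :: "('p \<Rightarrow> 'p covec) \<Rightarrow> ('p \<Rightarrow> 'p covec) \<Rightarrow> 'p consec" where
  "KK \<alpha> \<beta> = (if \<alpha> \<in> one_forms N \<and> \<beta> \<in> one_forms N then extend (\<lambda>f. extend (K f) \<beta>) \<alpha> else 0)"

lemma DD_section: "\<alpha> \<in> one_forms N \<Longrightarrow> \<eta> \<in> sections \<Longrightarrow> DD \<alpha> \<eta> \<in> sections"
  by (simp add: DD_def extend_section D_derivation)

lemma DD_exact: "f \<in> smooth_functions N \<Longrightarrow> \<eta> \<in> sections \<Longrightarrow> DD (d0 N f) \<eta> = D f \<eta>"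
  by (simp add: DD_def N.d0_one_form extend_exact[OF D_derivation])

lemma DD_add_right:
  "\<alpha> \<in> one_forms N \<Longrightarrow> \<eta> \<in> sections \<Longrightarrow> \<zeta> \<in> sections \<Longrightarrow> DD \<alpha> (\<eta> + \<zeta>) = DD \<alpha> \<eta> + DD \<alpha> \<zeta>"
  using extend_add[OF D_derivation D_derivation, of \<eta> \<zeta> \<alpha> "\<lambda>f. D f (\<eta> + \<zeta>)"]
  by (simp add: DD_def section_add D_add_right)

lemma DD_scaleR_right: "\<alpha> \<in> one_forms N \<Longrightarrow> \<eta> \<in> sections \<Longrightarrow> DD \<alpha> (c *\<^sub>R \<eta>) = c *\<^sub>R DD \<alpha> \<eta>"
  using extend_scaleR[OF D_derivation, of \<eta> \<alpha> "\<lambda>f. D f (c *\<^sub>R \<eta>)" c]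
  by (simp add: DD_def section_scaleR D_scaleR_right)

lemma DD_add_left:
  "\<alpha> \<in> one_forms N \<Longrightarrow> \<beta> \<in> one_forms N \<Longrightarrow> \<eta> \<in> sections \<Longrightarrow> DD (\<alpha> + \<beta>) \<eta> = DD \<alpha> \<eta> + DD \<beta> \<eta>"
  by (simp add: DD_def one_forms_closed extend_add_form)

lemma DD_mult_left:
  "f \<in> smooth_functions N \<Longrightarrow> \<alpha> \<in> one_forms N \<Longrightarrow> \<eta> \<in> sections \<Longrightarrow> DD (f \<bullet>\<^sub>s \<alpha>) \<eta> = f \<bullet>\<^sub>s DD \<alpha> \<eta>"
  by (simp add: DD_def one_forms_closed extend_mult_form)

lemma DD_minus_left:
  assumes "\<alpha> \<in> one_forms N" "\<eta> \<in> sections"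
  shows "DD (- \<alpha>) \<eta> = - DD \<alpha> \<eta>"
  using assms by (simp add: DD_def one_forms_closed extend_def fun_eq_iff)

text \<open>As a tangent vector in \<open>g\<close>, \<open>D g\<close> of \<open>f\<close> times
  \<open>\<eta>\<close> is \<open>f\<close> times the vector of \<open>D g \<eta>\<close> minus
  \<open>\<eta>\<close> times the Hamiltonian vector of \<open>f\<close>, because
  \<open>brN g f = - brN f g\<close>. On that Hamiltonian vector \<open>\<alpha>\<close> takes the
  value \<open>- sharp N Q q (\<alpha> q) f\<close>, so the two signs cancel.\<close>

lemma DD_leibniz:
  assumes f: "f \<in> smooth_functions N" and \<alpha>: "\<alpha> \<in> one_forms N" and \<eta>: "\<eta> \<in> sections"
  shows "DD \<alpha> (f \<bullet>\<^sub>s \<eta>) = f \<bullet>\<^sub>s DD \<alpha> \<eta> + (\<lambda>q. sharp N Q q (\<alpha> q) f) \<bullet>\<^sub>s \<eta>"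
proof (intro ext)
  fix q c
  have f\<eta>: "f \<bullet>\<^sub>s \<eta> \<in> sections" by (rule section_mult[OF f \<eta>])
  show "DD \<alpha> (f \<bullet>\<^sub>s \<eta>) q c = (f \<bullet>\<^sub>s DD \<alpha> \<eta> + (\<lambda>q. sharp N Q q (\<alpha> q) f) \<bullet>\<^sub>s \<eta>) q c"
  proof (cases "q \<in> S")
    case False
    then show ?thesis
      using section_outside[OF DD_section[OF \<alpha> f\<eta>]] section_outside[OF DD_section[OF \<alpha> \<eta>]]
        section_outside[OF \<eta>] by simp
  next
    case True
    note cot = one_form_cotangent[OF \<alpha> True] and B = Q_bivector[OF True]
    let ?X = "sharp N Q q (d0 N f q)"
    have X: "?X \<in> tangent N q" by (rule N.sharp_tangent[of Q, OF B True d0_cotangent])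
    have tan: "value_at (\<lambda>g. D g \<eta>) q c \<in> tangent N q" by (rule value_at_tangent[OF D_derivation[OF \<eta>]])
    have "value_at (\<lambda>g. D g (f \<bullet>\<^sub>s \<eta>)) q c = f q *\<^sub>R value_at (\<lambda>g. D g \<eta>) q c + (- \<eta> q c) *\<^sub>R ?X"
    proof
      fix g
      show "value_at (\<lambda>g. D g (f \<bullet>\<^sub>s \<eta>)) q c g = (f q *\<^sub>R value_at (\<lambda>g. D g \<eta>) q c + (- \<eta> q c) *\<^sub>R ?X) g"
      proof (cases "g \<in> smooth_functions N")
        case g: True
        have "?X g = brN f g q" by (simp add: sharp_def brN_apply)
        then have "?X g = - brN g f q" using fun_cong[OF N_bracket(1)[of f g], of q] by simp
        then show ?thesis using g by (simp add: value_at_def D_mult_right[OF g f \<eta>])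
      next
        case False
        then show ?thesis using tangent_supported[OF X False] by (simp add: value_at_def)
      qed
    qed
    then have "DD \<alpha> (f \<bullet>\<^sub>s \<eta>) q c = f q * DD \<alpha> \<eta> q c - \<eta> q c * \<alpha> q ?X"
      using \<alpha> \<eta> f\<eta>
      by (simp add: DD_def extend_def cotangent_add[OF cot] cotangent_diff[OF cot] cotangent_minus[OF cot]
          cotangent_scaleR[OF cot] tan X subspace_scale[OF subspace_tangent])
    also have "\<alpha> q ?X = Q q (d0 N f q) (\<alpha> q)" by (rule N.cotangent_sharp[of Q, OF B True d0_cotangent cot])
    also have "\<dots> = - sharp N Q q (\<alpha> q) f"
      unfolding sharp_def by (rule bivector_skew[OF B d0_cotangent cot])
    finally have e: "DD \<alpha> (f \<bullet>\<^sub>s \<eta>) q c = f q * DD \<alpha> \<eta> q c + \<eta> q c * sharp N Q q (\<alpha> q) f"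
      by (simp only: mult_minus_right diff_minus_eq_add)
    show ?thesis unfolding e by (simp add: mult.commute)
  qed
qed

lemma KK_section: "\<alpha> \<in> one_forms N \<Longrightarrow> \<beta> \<in> one_forms N \<Longrightarrow> KK \<alpha> \<beta> \<in> sections"
  by (simp add: KK_def extend_section extend_K_derivation)

lemma KK_exact: "f \<in> smooth_functions N \<Longrightarrow> g \<in> smooth_functions N \<Longrightarrow> KK (d0 N f) (d0 N g) = K f g"
  by (simp add: KK_def N.d0_one_form extend_exact[OF extend_K_derivation] extend_exact[OF K_derivation])

lemma KK_add_left:
  "\<alpha> \<in> one_forms N \<Longrightarrow> \<beta> \<in> one_forms N \<Longrightarrow> \<gamma> \<in> one_forms N \<Longrightarrow> KK (\<alpha> + \<beta>) \<gamma> = KK \<alpha> \<gamma> + KK \<beta> \<gamma>"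
  by (simp add: KK_def one_forms_closed extend_add_form)

lemma KK_mult_left:
  "f \<in> smooth_functions N \<Longrightarrow> \<alpha> \<in> one_forms N \<Longrightarrow> \<beta> \<in> one_forms N \<Longrightarrow> KK (f \<bullet>\<^sub>s \<alpha>) \<beta> = f \<bullet>\<^sub>s KK \<alpha> \<beta>"
  by (simp add: KK_def one_forms_closed extend_mult_form)

lemma KK_add_right:
  assumes "\<alpha> \<in> one_forms N" "\<beta> \<in> one_forms N" "\<gamma> \<in> one_forms N"
  shows "KK \<gamma> (\<alpha> + \<beta>) = KK \<gamma> \<alpha> + KK \<gamma> \<beta>"
  using extend_add[OF extend_K_derivation[OF assms(1)] extend_K_derivation[OF assms(2)] assms(3),
      of "\<lambda>f. extend (K f) (\<alpha> + \<beta>)"] assms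
  by (simp add: KK_def one_forms_closed extend_add_form)

lemma KK_mult_right:
  assumes "f \<in> smooth_functions N" "\<alpha> \<in> one_forms N" "\<beta> \<in> one_forms N"
  shows "KK \<alpha> (f \<bullet>\<^sub>s \<beta>) = f \<bullet>\<^sub>s KK \<alpha> \<beta>"
  using extend_combination[OF extend_K_derivation[OF assms(3)] extend_K_derivation[OF assms(3)] assms(2),
      of "\<lambda>g. extend (K g) (f \<bullet>\<^sub>s \<beta>)" f "\<lambda>_. 0"] assms
  by (simp add: KK_def one_forms_closed extend_mult_form module_mult_zero)

text \<open>The two slots are extended one after the other, so the definition is not visibly skew.
  The sum \<open>KK \<mu> \<nu> + KK \<nu> \<mu>\<close> is tensorial in each slot and vanishes on
  exact forms by \<open>K_skew\<close>.\<close>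

lemma KK_skew:
  assumes \<alpha>: "\<alpha> \<in> one_forms N" and \<beta>: "\<beta> \<in> one_forms N"
  shows "KK \<alpha> \<beta> = - KK \<beta> \<alpha>"
proof
  fix q
  show "KK \<alpha> \<beta> q = (- KK \<beta> \<alpha>) q"
  proof (cases "q \<in> S")
    case False
    then show ?thesis
      using section_outside[OF KK_section[OF \<alpha> \<beta>]] section_outside[OF KK_section[OF \<beta> \<alpha>]] by simp
  next
    case q: True
    have red: "KK \<mu> \<nu> q + KK \<nu> \<mu> q = 0"
      if \<mu>: "\<mu> \<in> one_forms N" and \<nu>: "\<nu> \<in> one_forms N"
        and ex: "\<And>x. x \<in> smooth_functions N \<Longrightarrow> KK \<mu> (d0 N x) q + KK (d0 N x) \<mu> q = 0" for \<mu> \<nu>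
      by (rule one_form_tensor_vanishes[OF q \<nu>, of "\<lambda>\<nu>. KK \<mu> \<nu> q + KK \<nu> \<mu> q"])
        (simp_all add: KK_add_left KK_add_right KK_mult_left KK_mult_right \<mu> ex scaleR_add_right)
    have "KK \<alpha> \<beta> q + KK \<beta> \<alpha> q = 0"
    proof (rule red[OF \<alpha> \<beta>])
      fix x assume x: "x \<in> smooth_functions N"
      have "KK (d0 N x) \<alpha> q + KK \<alpha> (d0 N x) q = 0"
        by (rule red[OF N.d0_one_form[OF x] \<alpha>]) (simp add: KK_exact x K_skew[OF x])
      then show "KK \<alpha> (d0 N x) q + KK (d0 N x) \<alpha> q = 0" by (simp add: add.commute)
    qed
    then show ?thesis by (simp add: eq_neg_iff_add_eq_0)
  qed
qed

lemma KK_minus_right: "\<alpha> \<in> one_forms N \<Longrightarrow> \<beta> \<in> one_forms N \<Longrightarrow> KK \<alpha> (- \<beta>) = - KK \<alpha> \<beta>"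
  using KK_skew[of \<alpha> "- \<beta>"] KK_skew[of \<alpha> \<beta>]
  by (simp add: one_forms_closed KK_def extend_def fun_eq_iff)

abbreviation "fb \<equiv> form_bracket N Q"

lemma sharpN_smooth:
  assumes "\<alpha> \<in> one_forms N" "f \<in> smooth_functions N"
  shows "(\<lambda>q. sharp N Q q (\<alpha> q) f) \<in> smooth_functions N"
  using Q_field assms(1) N.d0_one_form[OF assms(2)] by (simp add: bivector_fields_def sharp_def)

text \<open>The defect is tensorial in \<open>\<alpha>\<close>, since \<open>lie\<close> is bilinear
  over functions, and 0 on exact forms by \<open>D_lie\<close>.\<close>

lemma DD_lie:
  assumes \<alpha>: "\<alpha> \<in> one_forms N" and \<eta>: "\<eta> \<in> sections" and \<zeta>: "\<zeta> \<in> sections"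
  shows "DD \<alpha> (lie \<eta> \<zeta>) - lie \<eta> (DD \<alpha> \<zeta>) = lie (DD \<alpha> \<eta>) \<zeta>"
proof
  fix q
  let ?T = "\<lambda>\<alpha>. DD \<alpha> (lie \<eta> \<zeta>) - lie \<eta> (DD \<alpha> \<zeta>) - lie (DD \<alpha> \<eta>) \<zeta>"
  have l: "lie \<eta> \<zeta> \<in> sections" by (rule lie_section[OF \<eta> \<zeta>])
  show "(DD \<alpha> (lie \<eta> \<zeta>) - lie \<eta> (DD \<alpha> \<zeta>)) q = lie (DD \<alpha> \<eta>) \<zeta> q"
  proof (cases "q \<in> S")
    case False
    have "?T \<alpha> \<in> sections" by (intro section_diff DD_section lie_section \<alpha> \<eta> \<zeta>)
    then show ?thesis using section_outside[OF _ False] by force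
  next
    case q: True
    have "?T \<alpha> q = 0"
    proof (rule one_form_tensor_vanishes[OF q \<alpha>, of "\<lambda>\<alpha>. ?T \<alpha> q"])
      fix \<alpha> \<beta> assume a: "\<alpha> \<in> one_forms N" "\<beta> \<in> one_forms N"
      show "?T (\<alpha> + \<beta>) q = ?T \<alpha> q + ?T \<beta> q"
        unfolding DD_add_left[OF a l] DD_add_left[OF a \<zeta>] DD_add_left[OF a \<eta>]
          lie_add_right[OF \<eta> DD_section[OF a(1) \<zeta>] DD_section[OF a(2) \<zeta>]]
          lie_add_left[OF DD_section[OF a(1) \<eta>] DD_section[OF a(2) \<eta>] \<zeta>]
        by simp
    next
      fix f \<alpha> assume a: "f \<in> smooth_functions N" "\<alpha> \<in> one_forms N"
      show "?T (f \<bullet>\<^sub>s \<alpha>) q = f q *\<^sub>R ?T \<alpha> q"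
        unfolding DD_mult_left[OF a l] DD_mult_left[OF a \<zeta>] DD_mult_left[OF a \<eta>]
          lie_mult_right[OF a(1) \<eta> DD_section[OF a(2) \<zeta>]] lie_mult_left[OF a(1) DD_section[OF a(2) \<eta>] \<zeta>]
        by (simp only: minus_apply module_mult_apply scaleR_diff_right)
    qed (simp add: DD_exact l \<eta> \<zeta> D_lie)
    then show ?thesis by simp
  qed
qed

section \<open>The curvature identity\<close>

definition curv :: "('p \<Rightarrow> 'p covec) \<Rightarrow> ('p \<Rightarrow> 'p covec) \<Rightarrow> 'p consec \<Rightarrow> 'p consec" where
  "curv \<alpha> \<beta> \<zeta> = DD \<alpha> (DD \<beta> \<zeta>) - DD \<beta> (DD \<alpha> \<zeta>) - DD (fb \<alpha> \<beta>) \<zeta> - lie (KK \<alpha> \<beta>) \<zeta>"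

lemma curv_skew:
  assumes a: "\<alpha> \<in> one_forms N" "\<beta> \<in> one_forms N" and \<zeta>: "\<zeta> \<in> sections"
  shows "curv \<beta> \<alpha> \<zeta> = - curv \<alpha> \<beta> \<zeta>"
proof -
  have "lie (- KK \<alpha> \<beta>) \<zeta> = - lie (KK \<alpha> \<beta>) \<zeta>"
    using lie_skew[OF \<zeta> section_minus[OF KK_section[OF a]]] lie_skew[OF \<zeta> KK_section[OF a]]
      lie_minus_right[OF \<zeta> KK_section[OF a]] by simp
  then show ?thesis
    unfolding curv_def form_bracket_skew[OF a] DD_minus_left[OF form_bracket_one_form[OF a] \<zeta>]
      KK_skew[OF a(2,1)] by simp
qed

lemma curv_add:
  assumes a: "\<alpha> \<in> one_forms N" "\<beta> \<in> one_forms N" "\<gamma> \<in> one_forms N" and \<zeta>: "\<zeta> \<in> sections"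
  shows "curv \<alpha> (\<beta> + \<gamma>) \<zeta> = curv \<alpha> \<beta> \<zeta> + curv \<alpha> \<gamma> \<zeta>"
  unfolding curv_def DD_add_left[OF a(2,3) \<zeta>] DD_add_right[OF a(1) DD_section[OF a(2) \<zeta>] DD_section[OF a(3) \<zeta>]]
    DD_add_left[OF a(2,3) DD_section[OF a(1) \<zeta>]] form_bracket_add[OF a]
    DD_add_left[OF form_bracket_one_form[OF a(1,2)] form_bracket_one_form[OF a(1,3)] \<zeta>]
    KK_add_right[OF a(2,3,1)] lie_add_left[OF KK_section[OF a(1,2)] KK_section[OF a(1,3)] \<zeta>]
  by simp

text \<open>The derivative of \<open>f\<close> from the Leibniz rule of \<open>DD \<alpha>\<close>
  cancels against the one from the bracket of \<open>\<alpha>\<close> with \<open>f\<close> times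
  \<open>\<beta>\<close>.\<close>

lemma curv_mult:
  assumes f: "f \<in> smooth_functions N" and a: "\<alpha> \<in> one_forms N" "\<beta> \<in> one_forms N" and \<zeta>: "\<zeta> \<in> sections"
  shows "curv \<alpha> (f \<bullet>\<^sub>s \<beta>) \<zeta> = f \<bullet>\<^sub>s curv \<alpha> \<beta> \<zeta>"
  unfolding curv_def DD_mult_left[OF f a(2) \<zeta>] DD_leibniz[OF f a(1) DD_section[OF a(2) \<zeta>]]
    DD_mult_left[OF f a(2) DD_section[OF a(1) \<zeta>]] form_bracket_mult[OF a f]
    DD_add_left[OF one_forms_closed(2)[OF f form_bracket_one_form[OF a]]
      one_forms_closed(2)[OF sharpN_smooth[OF a(1) f] a(2)] \<zeta>]
    DD_mult_left[OF f form_bracket_one_form[OF a] \<zeta>] DD_mult_left[OF sharpN_smooth[OF a(1) f] a(2) \<zeta>]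
    KK_mult_right[OF f a] lie_mult_left[OF f KK_section[OF a] \<zeta>]
  by (simp add: fun_eq_iff algebra_simps)

text \<open>Tensoriality reduces the second slot to exact forms, and skew-symmetry exchanges the
  slots to treat the first in the same way.\<close>

lemma curv_zero:
  assumes a: "\<alpha> \<in> one_forms N" "\<beta> \<in> one_forms N" and \<zeta>: "\<zeta> \<in> sections"
  shows "curv \<alpha> \<beta> \<zeta> = 0"
proof
  fix q
  show "curv \<alpha> \<beta> \<zeta> q = 0 q"
  proof (cases "q \<in> S")
    case False
    have "curv \<alpha> \<beta> \<zeta> \<in> sections"
      unfolding curv_def
      by (intro section_diff DD_section lie_section form_bracket_one_form KK_section a \<zeta>)
    from section_outside[OF this False] show ?thesis unfolding zero_fun_apply .
  next
    case q: True
    have red: "curv \<mu> \<nu> \<zeta> q = 0"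
      if \<mu>: "\<mu> \<in> one_forms N" and \<nu>: "\<nu> \<in> one_forms N"
        and ex: "\<And>x. x \<in> smooth_functions N \<Longrightarrow> curv \<mu> (d0 N x) \<zeta> q = 0" for \<mu> \<nu>
      by (rule one_form_tensor_vanishes[OF q \<nu>, of "\<lambda>\<nu>. curv \<mu> \<nu> \<zeta> q"])
        (simp_all only: curv_add[OF \<mu> _ _ \<zeta>] curv_mult[OF _ \<mu> _ \<zeta>] ex plus_fun_apply module_mult_apply)
    have "curv \<alpha> \<beta> \<zeta> q = 0"
    proof (rule red[OF a])
      fix x assume x: "x \<in> smooth_functions N"
      have "curv (d0 N x) \<alpha> \<zeta> q = 0"
      proof (rule red[OF N.d0_one_form[OF x] a(1)])
        fix y assume y: "y \<in> smooth_functions N"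
        show "curv (d0 N x) (d0 N y) \<zeta> q = 0"
          using D_curvature[OF x y \<zeta>]
          by (simp add: curv_def DD_exact x y \<zeta> D_section form_bracket_exact brN_smooth KK_exact)
      qed
      then show "curv \<alpha> (d0 N x) \<zeta> q = 0"
        unfolding curv_skew[OF N.d0_one_form[OF x] a(1) \<zeta>] by simp
    qed
    then show ?thesis by simp
  qed
qed

section \<open>The Bianchi identity\<close>

definition bianchi :: "('p \<Rightarrow> 'p covec) \<Rightarrow> ('p \<Rightarrow> 'p covec) \<Rightarrow> ('p \<Rightarrow> 'p covec) \<Rightarrow> 'p consec" where
  "bianchi \<alpha> \<beta> \<gamma> = (DD \<alpha> (KK \<beta> \<gamma>) + KK \<alpha> (fb \<beta> \<gamma>)) + (DD \<beta> (KK \<gamma> \<alpha>) + KK \<beta> (fb \<gamma> \<alpha>))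
    + (DD \<gamma> (KK \<alpha> \<beta>) + KK \<gamma> (fb \<alpha> \<beta>))"

lemma bianchi_cyclic: "bianchi \<beta> \<gamma> \<alpha> = bianchi \<alpha> \<beta> \<gamma>"
  by (simp add: bianchi_def add.commute add.left_commute)

lemma form_bracket_add_left:
  assumes "\<alpha> \<in> one_forms N" "\<beta> \<in> one_forms N" "\<gamma> \<in> one_forms N"
  shows "fb (\<alpha> + \<beta>) \<gamma> = fb \<alpha> \<gamma> + fb \<beta> \<gamma>"
  unfolding form_bracket_skew[OF assms(3) one_forms_closed(1)[OF assms(1,2)]]
    form_bracket_add[OF assms(3,1,2)] form_bracket_skew[OF assms(3,1)] form_bracket_skew[OF assms(3,2)]
  by simp

lemma bianchi_add:
  assumes a: "\<alpha> \<in> one_forms N" "\<beta> \<in> one_forms N" "\<gamma> \<in> one_forms N" "\<gamma>' \<in> one_forms N"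
  shows "bianchi \<alpha> \<beta> (\<gamma> + \<gamma>') = bianchi \<alpha> \<beta> \<gamma> + bianchi \<alpha> \<beta> \<gamma>'"
  unfolding bianchi_def KK_add_right[OF a(3,4,2)] KK_add_left[OF a(3,4,1)]
    DD_add_right[OF a(1) KK_section[OF a(2,3)] KK_section[OF a(2,4)]]
    DD_add_right[OF a(2) KK_section[OF a(3,1)] KK_section[OF a(4,1)]]
    form_bracket_add[OF a(2-4)] form_bracket_add_left[OF a(3,4,1)]
    KK_add_right[OF form_bracket_one_form[OF a(2,3)] form_bracket_one_form[OF a(2,4)] a(1)]
    KK_add_right[OF form_bracket_one_form[OF a(3,1)] form_bracket_one_form[OF a(4,1)] a(2)]
    DD_add_left[OF a(3,4) KK_section[OF a(1,2)]] KK_add_left[OF a(3,4) form_bracket_one_form[OF a(1,2)]]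
  by (simp only: add_ac)

text \<open>Derivatives of \<open>f\<close> arise along \<open>\<alpha>\<close> and along
  \<open>\<beta>\<close>, each time once from \<open>DD\<close> and once from a form bracket inside
  \<open>KK\<close>. The two along \<open>\<alpha>\<close> cancel directly, those along
  \<open>\<beta>\<close> by skew-symmetry of \<open>KK\<close>.\<close>

lemma bianchi_mult:
  assumes f: "f \<in> smooth_functions N" and a: "\<alpha> \<in> one_forms N" "\<beta> \<in> one_forms N" "\<gamma> \<in> one_forms N"
  shows "bianchi \<alpha> \<beta> (f \<bullet>\<^sub>s \<gamma>) = f \<bullet>\<^sub>s bianchi \<alpha> \<beta> \<gamma>"
proof -
  note f\<gamma> = one_forms_closed(2)[OF f a(3)]
  note sh = sharpN_smooth[OF a(1) f] sharpN_smooth[OF a(2) f]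
  have skew: "fb (f \<bullet>\<^sub>s \<gamma>) \<alpha> = f \<bullet>\<^sub>s fb \<gamma> \<alpha> + (\<lambda>q. sharp N Q q (\<alpha> q) f) \<bullet>\<^sub>s (- \<gamma>)"
    unfolding form_bracket_skew[OF a(1) f\<gamma>] form_bracket_mult[OF a(1,3) f] form_bracket_skew[OF a(1,3)]
    by (simp add: fun_eq_iff)
  have K1: "KK \<alpha> (fb \<beta> (f \<bullet>\<^sub>s \<gamma>)) = f \<bullet>\<^sub>s KK \<alpha> (fb \<beta> \<gamma>) + (\<lambda>q. sharp N Q q (\<beta> q) f) \<bullet>\<^sub>s KK \<alpha> \<gamma>"
    unfolding form_bracket_mult[OF a(2,3) f]
      KK_add_right[OF one_forms_closed(2)[OF f form_bracket_one_form[OF a(2,3)]]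
        one_forms_closed(2)[OF sh(2) a(3)] a(1)]
      KK_mult_right[OF f a(1) form_bracket_one_form[OF a(2,3)]] KK_mult_right[OF sh(2) a(1,3)] ..
  have K2: "KK \<beta> (fb (f \<bullet>\<^sub>s \<gamma>) \<alpha>) = f \<bullet>\<^sub>s KK \<beta> (fb \<gamma> \<alpha>) + (\<lambda>q. sharp N Q q (\<alpha> q) f) \<bullet>\<^sub>s (- KK \<beta> \<gamma>)"
    unfolding skew KK_add_right[OF one_forms_closed(2)[OF f form_bracket_one_form[OF a(3,1)]]
        one_forms_closed(2)[OF sh(1) one_forms_closed(3)[OF a(3)]] a(2)]
      KK_mult_right[OF f a(2) form_bracket_one_form[OF a(3,1)]]
      KK_mult_right[OF sh(1) a(2) one_forms_closed(3)[OF a(3)]] KK_minus_right[OF a(2,3)] ..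
  \<comment> \<open>A fixed order of the arguments lets the two terms with the derivative along
    \<open>\<beta>\<close> cancel in the final normalisation.\<close>
  have skew': "KK \<alpha> \<gamma> q c = - KK \<gamma> \<alpha> q c" for q c
    using fun_cong[OF fun_cong[OF KK_skew[OF a(1,3)], of q], of c] by simp
  show ?thesis
  proof (intro ext)
    fix q c
    show "bianchi \<alpha> \<beta> (f \<bullet>\<^sub>s \<gamma>) q c = (f \<bullet>\<^sub>s bianchi \<alpha> \<beta> \<gamma>) q c"
      unfolding bianchi_def K1 K2 KK_mult_right[OF f a(2,3)] KK_mult_left[OF f a(3,1)]
        DD_leibniz[OF f a(1) KK_section[OF a(2,3)]] DD_leibniz[OF f a(2) KK_section[OF a(3,1)]]
        DD_mult_left[OF f a(3) KK_section[OF a(1,2)]] KK_mult_left[OF f a(3) form_bracket_one_form[OF a(1,2)]]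
        plus_fun_apply module_mult_apply scaleR_fun_apply uminus_apply real_scaleR_def skew'
      by (simp add: algebra_simps)
  qed
qed

text \<open>Cyclic invariance moves each argument to the last slot, where tensoriality reduces it to
  an exact form.\<close>

lemma bianchi_zero:
  assumes a: "\<alpha> \<in> one_forms N" "\<beta> \<in> one_forms N" "\<gamma> \<in> one_forms N"
  shows "bianchi \<alpha> \<beta> \<gamma> = 0"
proof
  fix q
  show "bianchi \<alpha> \<beta> \<gamma> q = 0 q"
  proof (cases "q \<in> S")
    case False
    have "bianchi \<alpha> \<beta> \<gamma> \<in> sections"
      unfolding bianchi_def by (intro section_add DD_section form_bracket_one_form KK_section a)
    from section_outside[OF this False] show ?thesis unfolding zero_fun_apply .
  next
    case q: True
    have red: "bianchi \<mu> \<nu> \<omega> q = 0"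
      if \<mu>: "\<mu> \<in> one_forms N" and \<nu>: "\<nu> \<in> one_forms N" and \<omega>: "\<omega> \<in> one_forms N"
        and ex: "\<And>x. x \<in> smooth_functions N \<Longrightarrow> bianchi \<mu> \<nu> (d0 N x) q = 0" for \<mu> \<nu> \<omega>
      by (rule one_form_tensor_vanishes[OF q \<omega>, of "\<lambda>\<omega>. bianchi \<mu> \<nu> \<omega> q"])
        (simp_all only: bianchi_add[OF \<mu> \<nu>] bianchi_mult[OF _ \<mu> \<nu>] ex plus_fun_apply module_mult_apply)
    have "bianchi \<alpha> \<beta> \<gamma> q = 0"
    proof (rule red[OF a])
      fix x assume x: "x \<in> smooth_functions N"
      note dx = N.d0_one_form[OF x]
      have "bianchi (d0 N x) \<alpha> \<beta> q = 0"
      proof (rule red[OF dx a(1,2)])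
        fix y assume y: "y \<in> smooth_functions N"
        note dy = N.d0_one_form[OF y]
        have "bianchi (d0 N y) (d0 N x) \<alpha> q = 0"
        proof (rule red[OF dy dx a(1)])
          fix z assume z: "z \<in> smooth_functions N"
          show "bianchi (d0 N y) (d0 N x) (d0 N z) q = 0"
            using K_bianchi[OF y x z]
            by (simp add: bianchi_def KK_exact DD_exact x y z K_section form_bracket_exact brN_smooth)
        qed
        then show "bianchi (d0 N x) \<alpha> (d0 N y) q = 0" unfolding bianchi_cyclic[of "d0 N x" \<alpha> "d0 N y"] .
      qed
      then show "bianchi \<alpha> \<beta> (d0 N x) q = 0" unfolding bianchi_cyclic[of \<alpha> \<beta> "d0 N x"] .
    qed
    then show ?thesis by simp
  qed
qed

lemma poisson_triple: "(lie, DD, KK) \<in> poisson_triples M P N"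
  unfolding poisson_triples_def mem_Collect_eq prod.case restricted_bivector_eq Let_def
proof (intro conjI ballI)
  show "contravariant_derivative M P N DD"
    unfolding contravariant_derivative_def restricted_bivector_eq linear_over_def
  proof (intro conjI ballI allI)
    show "supported_on2 (one_forms N) sections DD" by (auto simp: supported_on2_def DD_def)
  qed (simp_all add: DD_section DD_add_right DD_scaleR_right DD_add_left DD_mult_left DD_leibniz)
  show "skew_form_valued M N KK"
    unfolding skew_form_valued_def
  proof (intro conjI ballI)
    show "supported_on2 (one_forms N) (one_forms N) KK" by (auto simp: supported_on2_def KK_def)
    show "KK \<alpha> \<beta> = - KK \<beta> \<alpha>" if "\<alpha> \<in> one_forms N" "\<beta> \<in> one_forms N" for \<alpha> \<beta> by (rule KK_skew[OF that])
  qed (simp_all add: KK_section KK_add_left KK_add_right KK_mult_left KK_mult_right)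
  show "curvature M P N DD \<alpha> \<beta> \<zeta> = lie (KK \<alpha> \<beta>) \<zeta>"
    if "\<alpha> \<in> one_forms N" "\<beta> \<in> one_forms N" "\<zeta> \<in> sections" for \<alpha> \<beta> \<zeta>
    using curv_zero[OF that] by (simp add: curvature_def restricted_bivector_eq curv_def)
  show "DD \<alpha> (KK \<beta> \<gamma>) + KK \<alpha> (fb \<beta> \<gamma>) + (DD \<beta> (KK \<gamma> \<alpha>) + KK \<beta> (fb \<gamma> \<alpha>)) +
      (DD \<gamma> (KK \<alpha> \<beta>) + KK \<gamma> (fb \<alpha> \<beta>)) = 0"
    if "\<alpha> \<in> one_forms N" "\<beta> \<in> one_forms N" "\<gamma> \<in> one_forms N" for \<alpha> \<beta> \<gamma>
    using bianchi_zero[OF that] unfolding bianchi_def .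
qed (simp_all add: DD_lie)

lemma triple_bracket_extension: "triple_bracket M P N (lie, DD, KK) = affine_bracket D K"
proof (intro ext)
  fix x y
  show "triple_bracket M P N (lie, DD, KK) x y = affine_bracket D K x y"
    by (cases x; cases y) (simp add: triple_bracket_eq affine_bracket_def affine_iff DD_exact KK_exact)
qed

end

section \<open>Bijectivity of the correspondence\<close>

context poisson_pair
begin

text \<open>Brackets of \<open>(f, 0)\<close> with \<open>(0, \<eta>)\<close> and with
  \<open>(g, 0)\<close> recover the operators on exact forms. The differences of \<open>D\<close>,
  \<open>D'\<close> and of \<open>K\<close>, \<open>K'\<close> are tensorial in their forms, hence
  vanish everywhere.\<close>

lemma triple_bracket_inject:
  assumes T: "(L, D, K) \<in> poisson_triples M P N" and T': "(L', D', K') \<in> poisson_triples M P N"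
    and eq: "triple_bracket M P N (L, D, K) = triple_bracket M P N (L', D', K')"
  shows "(L, D, K) = (L', D', K')"
proof -
  note L = triple_function_triple(1)[OF T] triple_function_triple(1)[OF T']
  interpret A: function_triple M N P Q "\<lambda>f. D (d0 N f)" "\<lambda>f g. K (d0 N f) (d0 N g)"
    by (rule triple_function_triple(2)[OF T])
  interpret B: function_triple M N P Q "\<lambda>f. D' (d0 N f)" "\<lambda>f g. K' (d0 N f) (d0 N g)"
    by (rule triple_function_triple(2)[OF T'])
  have D: "contravariant_derivative M P N D" "contravariant_derivative M P N D'"
    and K: "skew_form_valued M N K" "skew_form_valued M N K'"
    using T T' unfolding poisson_triples_def by blast+
  have e: "A.B = B.B" using eq unfolding L triple_bracket_affine .
  have D_exact: "D (d0 N f) \<eta> = D' (d0 N f) \<eta>" if f: "f \<in> smooth_functions N" and \<eta>: "\<eta> \<in> sections" for f \<eta>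
  proof -
    have "A.B (f, 0) (0, \<eta>) = B.B (f, 0) (0, \<eta>)" unfolding e ..
    then show ?thesis
      unfolding A.B_eq[OF f section_zero N.zero_smooth \<eta>] B.B_eq[OF f section_zero N.zero_smooth \<eta>]
        A.B2_def B.B2_def A.D_zero_left[OF section_zero] B.D_zero_left[OF section_zero]
        A.K_zero_right[OF f] B.K_zero_right[OF f] by simp
  qed
  have K_exact: "K (d0 N f) (d0 N g) = K' (d0 N f) (d0 N g)"
    if f: "f \<in> smooth_functions N" and g: "g \<in> smooth_functions N" for f g
  proof -
    have "A.B (f, 0) (g, 0) = B.B (f, 0) (g, 0)" unfolding e ..
    then show ?thesis
      unfolding A.B_eq[OF f section_zero g section_zero] B.B_eq[OF f section_zero g section_zero]
        A.B2_def B.B2_def A.D_zero_right[OF f] B.D_zero_right[OF f] A.D_zero_right[OF g] B.D_zero_right[OF g]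
      by simp
  qed
  have "D = D'"
  proof (intro ext)
    fix \<alpha> \<eta> q c
    show "D \<alpha> \<eta> q c = D' \<alpha> \<eta> q c"
    proof (cases "\<alpha> \<in> one_forms N \<and> \<eta> \<in> sections")
      case False
      have "supported_on2 (one_forms N) sections D" "supported_on2 (one_forms N) sections D'"
        using D unfolding contravariant_derivative_def by blast+
      then have "D \<alpha> \<eta> = 0" "D' \<alpha> \<eta> = 0"
        using False unfolding supported_on2_def by blast+
      then show ?thesis by simp
    next
      case True
      note D_sec = D[unfolded contravariant_derivative_def, THEN conjunct2, THEN conjunct1]
      have s: "D \<alpha> \<eta> \<in> sections" "D' \<alpha> \<eta> \<in> sections"
        using D_sec True by blast+
      show ?thesis
      proof (cases "q \<in> S")
        case False
        then show ?thesis using s section_outside by metis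
      next
        case q: True
        have "D \<alpha> \<eta> q - D' \<alpha> \<eta> q = 0"
        proof (rule one_form_tensor_vanishes[OF q conjunct1[OF True], of "\<lambda>\<alpha>. D \<alpha> \<eta> q - D' \<alpha> \<eta> q"])
          fix \<alpha> \<beta> assume a: "\<alpha> \<in> one_forms N" "\<beta> \<in> one_forms N"
          have "D (\<alpha> + \<beta>) \<eta> = D \<alpha> \<eta> + D \<beta> \<eta>" "D' (\<alpha> + \<beta>) \<eta> = D' \<alpha> \<eta> + D' \<beta> \<eta>"
            using D[unfolded contravariant_derivative_def, THEN conjunct2, THEN conjunct2, THEN conjunct2,
                THEN conjunct1] True a by blast+
          then show "D (\<alpha> + \<beta>) \<eta> q - D' (\<alpha> + \<beta>) \<eta> q = D \<alpha> \<eta> q - D' \<alpha> \<eta> q + (D \<beta> \<eta> q - D' \<beta> \<eta> q)"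
            by simp
        next
          fix f \<alpha> assume a: "f \<in> smooth_functions N" "\<alpha> \<in> one_forms N"
          have "D (f \<bullet>\<^sub>s \<alpha>) \<eta> = f \<bullet>\<^sub>s D \<alpha> \<eta>" "D' (f \<bullet>\<^sub>s \<alpha>) \<eta> = f \<bullet>\<^sub>s D' \<alpha> \<eta>"
            using D[unfolded contravariant_derivative_def, THEN conjunct2, THEN conjunct2, THEN conjunct2,
                THEN conjunct2, THEN conjunct1] True a by blast+
          then show "D (f \<bullet>\<^sub>s \<alpha>) \<eta> q - D' (f \<bullet>\<^sub>s \<alpha>) \<eta> q = f q *\<^sub>R (D \<alpha> \<eta> q - D' \<alpha> \<eta> q)"
            by (simp only: module_mult_apply scaleR_diff_right)
        qed (simp add: D_exact True)
        then show ?thesis by simp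
      qed
    qed
  qed
  moreover have "K = K'"
  proof (intro ext)
    fix \<alpha> \<beta> q c
    show "K \<alpha> \<beta> q c = K' \<alpha> \<beta> q c"
    proof (cases "\<alpha> \<in> one_forms N \<and> \<beta> \<in> one_forms N")
      case False
      then have "K \<alpha> \<beta> = 0" "K' \<alpha> \<beta> = 0"
        using K unfolding skew_form_valued_def supported_on2_def by blast+
      then show ?thesis by simp
    next
      case True
      then have s: "K \<alpha> \<beta> \<in> sections" "K' \<alpha> \<beta> \<in> sections" using K unfolding skew_form_valued_def by blast+
      show ?thesis
      proof (cases "q \<in> S")
        case False
        then show ?thesis using s section_outside by metis
      next
        case q: True
        have red: "K \<mu> \<nu> q - K' \<mu> \<nu> q = 0"
          if \<mu>: "\<mu> \<in> one_forms N" and \<nu>: "\<nu> \<in> one_forms N"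
            and ex: "\<And>x. x \<in> smooth_functions N \<Longrightarrow> K \<mu> (d0 N x) q - K' \<mu> (d0 N x) q = 0" for \<mu> \<nu>
        proof (rule one_form_tensor_vanishes[OF q \<nu>, of "\<lambda>\<nu>. K \<mu> \<nu> q - K' \<mu> \<nu> q"])
          fix \<alpha> \<beta> assume a: "\<alpha> \<in> one_forms N" "\<beta> \<in> one_forms N"
          have "K \<mu> (\<alpha> + \<beta>) = K \<mu> \<alpha> + K \<mu> \<beta>" "K' \<mu> (\<alpha> + \<beta>) = K' \<mu> \<alpha> + K' \<mu> \<beta>"
            using K \<mu> a unfolding skew_form_valued_def by blast+
          then show "K \<mu> (\<alpha> + \<beta>) q - K' \<mu> (\<alpha> + \<beta>) q = K \<mu> \<alpha> q - K' \<mu> \<alpha> q + (K \<mu> \<beta> q - K' \<mu> \<beta> q)"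
            by simp
        next
          fix f \<alpha> assume a: "f \<in> smooth_functions N" "\<alpha> \<in> one_forms N"
          have "K \<mu> (f \<bullet>\<^sub>s \<alpha>) = f \<bullet>\<^sub>s K \<mu> \<alpha>" "K' \<mu> (f \<bullet>\<^sub>s \<alpha>) = f \<bullet>\<^sub>s K' \<mu> \<alpha>"
            using K \<mu> a unfolding skew_form_valued_def by blast+
          then show "K \<mu> (f \<bullet>\<^sub>s \<alpha>) q - K' \<mu> (f \<bullet>\<^sub>s \<alpha>) q = f q *\<^sub>R (K \<mu> \<alpha> q - K' \<mu> \<alpha> q)"
            by (simp only: module_mult_apply scaleR_diff_right)
        qed (rule ex)
        have "K \<alpha> \<beta> q - K' \<alpha> \<beta> q = 0"
        proof (rule red)
          fix x assume x: "x \<in> smooth_functions N"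
          note dx = N.d0_one_form[OF x]
          have "K (d0 N x) \<alpha> q - K' (d0 N x) \<alpha> q = 0"
            by (rule red[OF dx]) (simp_all add: True K_exact x)
          moreover have "K \<alpha> (d0 N x) = - K (d0 N x) \<alpha>" "K' \<alpha> (d0 N x) = - K' (d0 N x) \<alpha>"
            using K True dx unfolding skew_form_valued_def by blast+
          ultimately show "K \<alpha> (d0 N x) q - K' \<alpha> (d0 N x) q = 0" by simp
        qed (use True in auto)
        then show ?thesis by simp
      qed
    qed
  qed
  ultimately show ?thesis using L by simp
qed

lemma bij_betw_triple_bracket:
  "bij_betw (triple_bracket M P N) (poisson_triples M P N) (infinitesimal_poisson_algebras M P N)"
  unfolding bij_betw_def
proof (intro conjI subset_antisym)
  show "inj_on (triple_bracket M P N) (poisson_triples M P N)"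
  proof (rule inj_onI)
    fix x y assume xy: "x \<in> poisson_triples M P N" "y \<in> poisson_triples M P N"
      and eq: "triple_bracket M P N x = triple_bracket M P N y"
    obtain L D K where x: "x = (L, D, K)" by (cases x)
    obtain L' D' K' where y: "y = (L', D', K')" by (cases y)
    show "x = y" unfolding x y by (rule triple_bracket_inject[OF xy[unfolded x y] eq[unfolded x y]])
  qed
  show "triple_bracket M P N ` poisson_triples M P N \<subseteq> infinitesimal_poisson_algebras M P N"
  proof (rule image_subsetI)
    fix x assume T: "x \<in> poisson_triples M P N"
    obtain L D K where x: "x = (L, D, K)" by (cases x)
    note T = T[unfolded x]
    interpret function_triple M N P Q "\<lambda>f. D (d0 N f)" "\<lambda>f g. K (d0 N f) (d0 N g)"
      by (rule triple_function_triple(2)[OF T])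
    show "triple_bracket M P N x \<in> infinitesimal_poisson_algebras M P N"
      unfolding x triple_function_triple(1)[OF T] triple_bracket_affine by (rule infinitesimal_poisson_algebra)
  qed
  show "infinitesimal_poisson_algebras M P N \<subseteq> triple_bracket M P N ` poisson_triples M P N"
  proof
    fix A assume A: "A \<in> infinitesimal_poisson_algebras M P N"
    interpret function_triple M N P Q "\<lambda>f \<eta>. snd (A (f, 0) (0, \<eta>))" "\<lambda>f g. snd (A (f, 0) (g, 0))"
      by (rule algebra_function_triple[OF A])
    have "A = triple_bracket M P N (lie, DD, KK)"
      unfolding triple_bracket_extension by (rule algebra_eq[OF A])
    then show "A \<in> triple_bracket M P N ` poisson_triples M P N" using poisson_triple by (rule image_eqI)
  qed
qed

end

theorem corollary4p4:
  fixes M N :: "('p, 'e::euclidean_space) smooth_structure"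
    and P :: "'p \<Rightarrow> 'p bivec" and S :: "'p set" and W :: "'e set"
  assumes "poisson_manifold M P"
    and "poisson_submanifold M P S W"
    and "N = submanifold M S W"
  shows "bij_betw (triple_bracket M P N) (poisson_triples M P N) (infinitesimal_poisson_algebras M P N)"
proof -
  interpret E: embedded M S W
    using assms(1,2)
    by unfold_locales (simp_all add: poisson_manifold_def poisson_submanifold_def)
  have S: "points N = S" unfolding assms(3) by (rule E.points_N)
  \<comment> \<open>This comes before any bivector on \<open>N\<close>, because uniqueness of the
    restricted bivector, \<open>bivector_push_inject\<close>, is a fact about pairs.\<close>
  interpret pair M N
  proof
    fix G assume "openin (top_of M) G"
    then show "openin (top_of N) (G \<inter> points N)"
      unfolding S by (auto simp: assms(3) E.top_N openin_subtopology)
  next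
    fix p assume "p \<in> points N"
    then show "\<exists>(E :: 'e set) x d G. finite E \<and> openin (top_of N) G \<and> p \<in> G \<and>
        (\<forall>b\<in>E. x b \<in> smooth_functions N \<and> d b \<in> vector_fields N) \<and>
        (\<forall>q\<in>G. \<forall>v\<in>tangent N q. v = (\<Sum>b\<in>E. v (x b) *\<^sub>R d b q))"
      unfolding assms(3) by (rule E.N.ex_frame)
  next
    fix g q assume "g \<in> smooth_functions N" "q \<in> points N"
    then show "\<exists>F\<in>smooth_functions M. \<exists>G. openin (top_of N) G \<and> q \<in> G \<and> (\<forall>x\<in>G. F x = g x)"
      unfolding S using E.local_extension[of g q] by (simp add: assms(3))
  qed (use E.S_subset E.restrict_smooth E.N.function_space_axioms in
      \<open>auto simp: S assms(3) function_space_def\<close>)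
  have push: "P q \<in> bivector_push M N q ` bivectors N q" if "q \<in> points N" for q
    using assms(2) that by (simp add: poisson_submanifold_def assms(3))
  let ?Q = "restricted_bivector M P N"
  \<comment> \<open>Existence is the tangency of \<open>P\<close> to \<open>S\<close> in the
    hypothesis, uniqueness the injectivity of \<open>bivector_push\<close>; together they make the
    description in \<open>restricted_bivector\<close> meaningful.\<close>
  have Q: "?Q q \<in> bivectors N q \<and> P q = bivector_push M N q (?Q q)" if q: "q \<in> points N" for q
  proof -
    obtain B where B: "B \<in> bivectors N q" "P q = bivector_push M N q B" using push[OF q] by blast
    have "?Q q = (THE B. B \<in> bivectors N q \<and> P q = bivector_push M N q B)"
      using q by (simp add: restricted_bivector_def)
    also have "\<dots> = B"
      by (rule the_equality) (use B bivector_push_inject[OF q] in auto)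
    finally show ?thesis using B by simp
  qed
  interpret poisson_pair M N P ?Q
    by unfold_locales (use assms(1) Q in \<open>auto simp: poisson_manifold_def restricted_bivector_def\<close>)
  show ?thesis by (rule bij_betw_triple_bracket)
qed

end
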